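(* Let $\{W(x);x\in\mathbb R\}$ be a two-sided one-dimensional Brownian motion, and let $V=\dot W$ be the white noise on $\mathbb R$, i.e. the generalized Gaussian field $\langle V,\varphi\rangle=\int_{-\infty}^\infty\varphi(x)W(dx)$, $\varphi\in\mathcal S(\mathbb R)$. Let $\{B_s;s\ge0\}$ be a one-dimensional Brownian motion independent of $W$. Then for any $\theta>0$ and $x\in\mathbb R$, $$\lim_{t\to\infty}t^{-1}(\log t)^{-2/3}\log\mathbb E_x\exp\Big\{\theta\int_0^t\dot W(B_s)\,ds\Big\}=\frac12\Big(\frac32\Big)^{2/3}\theta^{4/3}\qquad\text{a.s.}$$
   Context: $\mathcal S(\mathbb R)$ is the Schwartz space. $\mathbb P,\mathbb E$ refer to $W$; $\mathbb P_x,\mathbb E_x$ refer to the Brownian motion started at $B_0=x$, independent of $W$; "a.s." is with respect to $\mathbb P$. Let $l\in\mathcal S(\mathbb R)$ be a symmetric probability density supported on $[-1,1]$ with nonnegative Fourier transform, $l_\varepsilon(x)=\varepsilon^{-1}l(\varepsilon^{-1}x)$, and $V_\varepsilon(x)=\langle V,l_\varepsilon(\cdot-x)\rangle$. The integral $\int_0^t\dot W(B_s)\,ds=\int_0^tV(B_s)\,ds$ is defined as the limit of $\int_0^tV_\varepsilon(B_s)\,ds$ in $L^2(\mathbb P\otimes\mathbb P_x)$ as $\varepsilon\to0^+$ (which exists), taken in a version continuous in $t$. $\mathbb E_x\exp\{\cdot\}$ is the expectation over the Brownian motion only (conditionally on $W$). *)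

theory Defs
  imports "HOL-Probability.Probability"
begin

section \<open>Brownian motion\<close>

text \<open>
  With T = \<open>{0..}\<close> this is the one-dimensional Brownian motion started at x; with T = \<open>UNIV\<close>
  and x = 0 it is the two-sided Brownian motion on the line.
\<close>

definition brownian_motion_on ::
  "'a measure \<Rightarrow> real set \<Rightarrow> real \<Rightarrow> (real \<Rightarrow> 'a \<Rightarrow> real) \<Rightarrow> bool" where
  "brownian_motion_on M T x B \<longleftrightarrow>
     (\<forall>t\<in>T. B t \<in> borel_measurable M) \<and>
     (AE \<omega> in M. B 0 \<omega> = x) \<and>
     (\<forall>s\<in>T. \<forall>t\<in>T. s < t \<longrightarrow>
        distributed M lborel (\<lambda>\<omega>. B t \<omega> - B s \<omega>) (normal_density 0 (sqrt (t - s)))) \<and>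
     (\<forall>(n::nat) (t::nat \<Rightarrow> real). (\<forall>i\<le>n. t i \<in> T) \<and> (\<forall>i<n. t i < t (Suc i)) \<longrightarrow>
        prob_space.indep_vars M (\<lambda>_. borel) (\<lambda>i \<omega>. B (t (Suc i)) \<omega> - B (t i) \<omega>) {..<n}) \<and>
     (AE \<omega> in M. continuous_on T (\<lambda>t. B t \<omega>))"

abbreviation brownian_motion :: "'a measure \<Rightarrow> real \<Rightarrow> (real \<Rightarrow> 'a \<Rightarrow> real) \<Rightarrow> bool" where
  "brownian_motion M x B \<equiv> brownian_motion_on M {0..} x B"

abbreviation two_sided_brownian_motion :: "'a measure \<Rightarrow> (real \<Rightarrow> 'a \<Rightarrow> real) \<Rightarrow> bool" where
  "two_sided_brownian_motion M W \<equiv> brownian_motion_on M UNIV 0 W"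

section \<open>The Wiener integral\<close>

definition L2_tendsto ::
  "'a measure \<Rightarrow> ('i \<Rightarrow> 'a \<Rightarrow> real) \<Rightarrow> ('a \<Rightarrow> real) \<Rightarrow> 'i filter \<Rightarrow> bool" where
  "L2_tendsto M f g F \<longleftrightarrow>
     ((\<lambda>i. \<integral>\<^sup>+ \<omega>. ennreal ((f i \<omega> - g \<omega>)\<^sup>2) \<partial>M) \<longlongrightarrow> 0) F"

text \<open>A list of triples (c, a, b) represents the step function with value c on each (a, b].\<close>

definition step_fun :: "(real \<times> real \<times> real) list \<Rightarrow> real \<Rightarrow> real" where
  "step_fun S x = (\<Sum>(c, a, b)\<leftarrow>S. c * indicator {a<..b} x)"

definition step_integral ::
  "(real \<Rightarrow> 'a \<Rightarrow> real) \<Rightarrow> (real \<times> real \<times> real) list \<Rightarrow> 'a \<Rightarrow> real" where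
  "step_integral W S \<omega> = (\<Sum>(c, a, b)\<leftarrow>S. c * (W b \<omega> - W a \<omega>))"

text \<open>
  The random variable X is a version of the stochastic integral of \<open>\<phi>\<close> against W.
  By the Ito isometry the choice of the approximating sequence is immaterial, and X is
  determined up to a null set.
\<close>

definition is_wiener_integral ::
  "'a measure \<Rightarrow> (real \<Rightarrow> 'a \<Rightarrow> real) \<Rightarrow> (real \<Rightarrow> real) \<Rightarrow> ('a \<Rightarrow> real) \<Rightarrow> bool" where
  "is_wiener_integral M W \<phi> X \<longleftrightarrow>
     X \<in> borel_measurable M \<and>
     (\<exists>S. (\<forall>n. \<forall>(c, a, b)\<in>set (S n). a \<le> b) \<and>
          L2_tendsto lborel (\<lambda>n. step_fun (S n)) \<phi> sequentially \<and>
          L2_tendsto M (\<lambda>n. step_integral W (S n)) X sequentially)"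

section \<open>White noise as a generalized random field\<close>

definition schwartz :: "(real \<Rightarrow> real) set" where
  "schwartz = {\<phi>. (\<forall>m x. (deriv ^^ m) \<phi> field_differentiable at x) \<and>
                  (\<forall>k m. bounded (range (\<lambda>x. x ^ k * (deriv ^^ m) \<phi> x)))}"

definition schwartz_seminorm :: "nat \<Rightarrow> nat \<Rightarrow> (real \<Rightarrow> real) \<Rightarrow> real" where
  "schwartz_seminorm k m \<phi> = (SUP x. \<bar>x ^ k * (deriv ^^ m) \<phi> x\<bar>)"

definition tempered_distribution :: "((real \<Rightarrow> real) \<Rightarrow> real) \<Rightarrow> bool" where
  "tempered_distribution T \<longleftrightarrow>
     (\<forall>\<phi>\<in>schwartz. \<forall>\<psi>\<in>schwartz. \<forall>a b. T (\<lambda>x. a * \<phi> x + b * \<psi> x) = a * T \<phi> + b * T \<psi>) \<and>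
     (\<exists>C n. \<forall>\<phi>\<in>schwartz. \<bar>T \<phi>\<bar> \<le> C * (\<Sum>k\<le>n. \<Sum>m\<le>n. schwartz_seminorm k m \<phi>))"

text \<open>
  The pairing of the noise with \<open>\<phi>\<close> is the Wiener integral of \<open>\<phi>\<close>, which fixes it only up to a
  null set depending on \<open>\<phi>\<close>. As a generalized random field the noise is almost surely a tempered
  distribution; this makes the mollified noise below continuous in the space variable, so that
  it can be integrated along Brownian paths.
\<close>

definition is_white_noise_of ::
  "'a measure \<Rightarrow> (real \<Rightarrow> 'a \<Rightarrow> real) \<Rightarrow> ((real \<Rightarrow> real) \<Rightarrow> 'a \<Rightarrow> real) \<Rightarrow> bool" where
  "is_white_noise_of M W V \<longleftrightarrow>
     (\<forall>\<phi>\<in>schwartz. is_wiener_integral M W \<phi> (V \<phi>)) \<and>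
     (AE \<omega> in M. tempered_distribution (\<lambda>\<phi>. V \<phi> \<omega>))"

section \<open>The noise integrated along a Brownian path\<close>

definition fourier_transform :: "(real \<Rightarrow> real) \<Rightarrow> real \<Rightarrow> complex" where
  "fourier_transform f \<xi> = (LINT x|lborel. complex_of_real (f x) * exp (- \<i> * \<xi> * x))"

definition mollifier :: "(real \<Rightarrow> real) \<Rightarrow> bool" where
  "mollifier l \<longleftrightarrow>
     l \<in> schwartz \<and>
     (\<forall>x. l (- x) = l x) \<and>
     (\<forall>x. 0 \<le> l x) \<and> has_bochner_integral lborel l 1 \<and>
     closure {x. l x \<noteq> 0} \<subseteq> {-1..1} \<and>
     (\<forall>\<xi>. fourier_transform l \<xi> \<in> \<real>\<^sub>\<ge>\<^sub>0)"

definition rescale :: "(real \<Rightarrow> real) \<Rightarrow> real \<Rightarrow> real \<Rightarrow> real" where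
  "rescale l \<epsilon> x = inverse \<epsilon> * l (inverse \<epsilon> * x)"

definition smooth_noise ::
  "((real \<Rightarrow> real) \<Rightarrow> 'a \<Rightarrow> real) \<Rightarrow> (real \<Rightarrow> real) \<Rightarrow> real \<Rightarrow> real \<Rightarrow> 'a \<Rightarrow> real" where
  "smooth_noise V l \<epsilon> x \<omega> = V (\<lambda>y. rescale l \<epsilon> (y - x)) \<omega>"

text \<open>
  W lives on M and B on N; the two are independent by working on the product space.
  J t is a version of the integral of the noise along B up to time t.

  The expectation over B alone is the integral over N with the first component of the argument
  of J fixed. Almost sure continuity of J in t is what makes this expectation, for almost every
  outcome in M, independent of the version simultaneously for all t. If an exponential moment is
  infinite, its Bochner integral is 0 and \<open>ln 0 = 0\<close>; hence a positive limit for the normalized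
  logarithms entails finiteness of the moments for all large t.
\<close>

definition is_noise_path_integral ::
  "'a measure \<Rightarrow> 'b measure \<Rightarrow> ((real \<Rightarrow> real) \<Rightarrow> 'a \<Rightarrow> real) \<Rightarrow> (real \<Rightarrow> real) \<Rightarrow>
   (real \<Rightarrow> 'b \<Rightarrow> real) \<Rightarrow> (real \<Rightarrow> 'a \<times> 'b \<Rightarrow> real) \<Rightarrow> bool" where
  "is_noise_path_integral M N V l B J \<longleftrightarrow>
     (\<forall>t\<ge>0. J t \<in> borel_measurable (M \<Otimes>\<^sub>M N) \<and>
        L2_tendsto (M \<Otimes>\<^sub>M N)
          (\<lambda>\<epsilon> (\<omega>, \<omega>'). LINT s:{0..t}|lborel. smooth_noise V l \<epsilon> (B s \<omega>') \<omega>) (J t) (at_right 0)) \<and>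
     (AE p in M \<Otimes>\<^sub>M N. continuous_on {0..} (\<lambda>t. J t p))"

end

theory Submission
  imports Defs "HOL-Real_Asymp.Real_Asymp"
begin

text \<open>
  Heuristically the logarithm of the moment is t times the top eigenvalue of half the second
  derivative plus \<open>\<theta>\<close> times the noise on an interval of length about t, and the lemmas follow the two
  variational descriptions of this eigenvalue.

  Upper bound: a function p with derivative at most \<open>2 * \<lambda> - p^2\<close> minus \<open>2 * \<theta>\<close> times the noise is the
  logarithmic derivative of a supersolution. Along a mesh, p is a Markov chain with the drift of a
  Riccati equation; a Kramers estimate shows that it almost surely never explodes before
  distance t once \<open>2 * \<lambda>\<close> exceeds the square of the cube root of \<open>3/2 * \<theta>^2 * log t\<close>.

  Lower bound: among the order of t independent blocks one carries an increment of W close to a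
  multiple of tanh, whose derivative is the optimal potential; sech is then nearly an
  eigenfunction. The cost of reaching the block is controlled by the Cauchy-Schwarz inequality and
  a crude upper bound.

  The smoothed noise is almost surely the derivative of a mollification of W, so that both bounds
  apply to it pathwise, uniformly in the mollification, and carry over to J by Fatou's lemma and
  uniform integrability.
\<close>

text \<open>The two bounds meet because two costs agree. The drift \<open>m^2 - p^2\<close> with
  noise \<open>2*thh*w\<close> has a potential barrier of height \<open>4*m^3/3\<close>, which
  Kramers' law turns into an explosion rate of exponential order
  \<open>exp (- 2*m^3/(3*thh^2))\<close>. A path with derivative \<open>m^2*sech^2(m*y)/thh\<close>
  has the energy \<open>2*m^3/(3*thh^2)\<close> as well, because sech^4 has integral 4/3. Both costs
  equal \<open>j\<close> when \<open>m^3 = 3/2*thh^2*j\<close>, and the eigenvalue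
  \<open>m^2/2\<close> then gives the constant of the theorem. The obstacle is that w has no
  derivative. Differential inequalities are therefore imposed on primitives:
  \<open>p + 2*thh*w\<close> is compared with an antiderivative, and in the lower bound the
  deviation of the noise from its target is removed by an exponential factor which sees only the
  deviation of the primitives. Stochastic calculus is replaced by chains with Gaussian increments,
  whose one-step errors of order \<open>h^(3/2)\<close> vanish under refinement of the mesh. Time
  enters through integer scales \<open>t <= exp j\<close>, so that Borel-Cantelli meets countably
  many events only.\<close>

section \<open>Gaussian integrals and one-step moment bounds\<close>

definition gauss :: "real => real measure" where
 "gauss h = density lborel (%x. ennreal (normal_density 0 (sqrt h) x))"

lemma sets_gauss [simp, measurable_cong]: "sets (gauss h) = sets borel"
 by (simp add: gauss_def)

lemma space_gauss [simp]: "space (gauss h) = UNIV"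
 by (simp add: gauss_def)

lemma prob_space_gauss: "h > 0 ==> prob_space (gauss h)"
 unfolding gauss_def by (rule prob_space_normal_density) simp

lemma nn_integral_gauss:
 "g \<in> borel_measurable borel ==> (\<integral>\<^sup>+z. g z \<partial>gauss h) = (\<integral>\<^sup>+z. ennreal (normal_density 0 (sqrt h) z)*g z \<partial>lborel)"
 unfolding gauss_def by (subst nn_integral_density) auto

text \<open>Completing the square turns the integrand into a multiple of the normal density with
  mean \<open>a*h/d\<close> and variance \<open>h/d\<close>, where \<open>d = 1 - 2*c*h\<close>. The
  quadratic term is needed because the second-order bound on the Kramers potential puts a square of
  the increment into the exponent.\<close>

lemma nn_integral_gauss_exp_quadratic:
 assumes h: "h > 0" and c: "2 * c*h < 1"
 shows "(\<integral>\<^sup>+z. ennreal (exp (a*z + c*z\<^sup>2)) \<partial>gauss h)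
 = ennreal (exp (a\<^sup>2*h/(2*(1 - 2 * c*h)))/sqrt (1 - 2 * c*h))"
proof -
 define d where "d = 1 - 2 * c*h"
 have d: "d > 0" using c by (simp add: d_def)
 define s where "s = sqrt (h/d)"
 define mu where "mu = a*h/d"
 have s: "s > 0" "s\<^sup>2 = h/d" using d h by (auto simp: s_def)
 have eq: "normal_density 0 (sqrt h) z*exp (a*z + c*z\<^sup>2)
  = exp (a\<^sup>2*h/(2*d))/sqrt d*normal_density mu s z" for z
 proof -
 have 1: "- (z - 0)\<^sup>2/(2*(sqrt h)\<^sup>2) + (a*z + c*z\<^sup>2) = a\<^sup>2*h/(2*d) + - (z - mu)\<^sup>2/(2 * s\<^sup>2)"
 proof -
  \<comment> \<open>Eliminating \<open>c\<close> in favour of \<open>d\<close> leaves a rational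
    identity in \<open>d\<close> and \<open>h\<close>.\<close>
  have c': "c = (1 - d)/(2*h)" using h by (simp add: d_def)
  show ?thesis unfolding s(2) mu_def c' using d h
  by (simp add: divide_simps) (simp add: algebra_simps power2_eq_square)
 qed
 have 2: "sqrt (2*pi*(sqrt h)\<^sup>2) = sqrt d * sqrt (2*pi * s\<^sup>2)"
  using d h by (simp add: s(2) real_sqrt_mult[symmetric])
 show ?thesis unfolding normal_density_def 2
  using 1 d by (simp add: exp_add[symmetric])
 qed
 have "(\<integral>\<^sup>+z. ennreal (exp (a*z + c*z\<^sup>2)) \<partial>gauss h)
 = (\<integral>\<^sup>+z. ennreal (exp (a\<^sup>2*h/(2*d))/sqrt d)*ennreal (normal_density mu s z) \<partial>lborel)"
 using d by (subst nn_integral_gauss) (auto simp: ennreal_mult'[symmetric] eq intro!: nn_integral_cong)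
 also have "... = ennreal (exp (a\<^sup>2*h/(2*d))/sqrt d)*(\<integral>\<^sup>+z. ennreal (normal_density mu s z) \<partial>lborel)"
 by (rule nn_integral_cmult) auto
 also have "(\<integral>\<^sup>+z. ennreal (normal_density mu s z) \<partial>lborel) = 1"
 using prob_space.emeasure_space_1[OF prob_space_normal_density[OF s(1), of mu]]
 by (simp add: emeasure_density)
 finally show ?thesis by (simp add: d_def)
qed

lemma nn_integral_gauss_exp:
 "h > 0 ==> (\<integral>\<^sup>+z. ennreal (exp (a*z)) \<partial>gauss h) = ennreal (exp (a\<^sup>2*h/2))"
 using nn_integral_gauss_exp_quadratic[of h 0 a] by simp

lemma exp_abs_le: "exp (K * \<bar>z\<bar>) <= exp (K*z) + exp (- K*z)" for K z :: real
 by (cases "z >= 0") (auto simp: abs_if add_increasing add_increasing2)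

lemma nn_integral_gauss_exp_abs:
 assumes h: "h > 0"
 shows "(\<integral>\<^sup>+z. ennreal (exp (K * \<bar>z\<bar>)) \<partial>gauss h) <= ennreal (2*exp (K\<^sup>2*h/2))"
proof -
 have "(\<integral>\<^sup>+z. ennreal (exp (K * \<bar>z\<bar>)) \<partial>gauss h) <= (\<integral>\<^sup>+z. ennreal (exp (K*z)) + ennreal (exp (- K*z)) \<partial>gauss h)"
 by (intro nn_integral_mono) (simp only: ennreal_plus[symmetric] exp_ge_zero ennreal_leI exp_abs_le)
 also have "... = ennreal (exp (K\<^sup>2*h/2)) + ennreal (exp (K\<^sup>2*h/2))"
 by (subst nn_integral_add) (simp_all only: nn_integral_gauss_exp[OF h] power2_minus, measurable)
 also have "... = ennreal (2*exp (K\<^sup>2*h/2))"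
 by (simp add: ennreal_plus[symmetric] del: ennreal_plus)
 finally show ?thesis .
qed

text \<open>The inequality \<open>u^3 <= 6*exp u\<close> at \<open>u = |z|/sqrt h\<close> trades the
  cube for the factor \<open>h^(3/2)\<close> and raises the exponential rate to
  \<open>K + 1/sqrt h\<close>. At that rate the Gaussian moment stays bounded, as
  \<open>(K + 1/sqrt h)^2*h <= (K + 1)^2\<close> for \<open>h <= 1\<close>. An error of this order
  vanishes after summation over \<open>t/h\<close> steps.\<close>

lemma gauss_cube_bound:
 fixes C K :: real
 assumes h: "0 < h" "h <= 1" and K: "K >= 0"
 shows "integrable (gauss h) (%z. \<bar>z\<bar>^3*exp (K * \<bar>z\<bar>))"
 and "(\<integral>z. \<bar>z\<bar>^3*exp (K * \<bar>z\<bar>) \<partial>gauss h) <= 12*exp ((K + 1)\<^sup>2/2)*(h * sqrt h)"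
proof -
 let ?L = "K + 1/sqrt h"
 have cube: "u ^ 3 <= 6*exp u" if "u >= 0" for u :: real
 proof -
 have "u ^ 3 /\<^sub>R fact 3 <= exp u"
  unfolding exp_def using summable_exp_generic[of u] that
  by (intro order.trans[OF _ sum_le_suminf[of _ "{3}"]]) auto
 then show ?thesis by (simp add: fact_numeral)
 qed
 have le: "\<bar>z\<bar>^3*exp (K * \<bar>z\<bar>) <= 6*(h * sqrt h)*exp (?L * \<bar>z\<bar>)" for z
 proof -
 have "(\<bar>z\<bar>/sqrt h) ^ 3 <= 6*exp (\<bar>z\<bar>/sqrt h)" using h by (intro cube) auto
 then have "\<bar>z\<bar>^3 <= 6*(h * sqrt h)*exp (\<bar>z\<bar>/sqrt h)"
  using h by (simp add: power_divide divide_simps power3_eq_cube mult.commute mult.left_commute)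
 then have "\<bar>z\<bar>^3*exp (K * \<bar>z\<bar>) <= 6*(h * sqrt h)*exp (\<bar>z\<bar>/sqrt h)*exp (K * \<bar>z\<bar>)"
  by (intro mult_right_mono) auto
 also have "... = 6*(h * sqrt h)*exp (?L * \<bar>z\<bar>)"
  by (simp add: exp_add[symmetric] algebra_simps)
 finally show ?thesis .
 qed
 have "?L\<^sup>2*h = (K * sqrt h + 1)\<^sup>2"
 proof -
 have "?L * sqrt h = K * sqrt h + 1" using h by (simp add: distrib_right)
 then have "(?L * sqrt h)\<^sup>2 = (K * sqrt h + 1)\<^sup>2" by simp
 then show ?thesis using h by (simp add: power_mult_distrib)
 qed
 moreover have "(K * sqrt h + 1)\<^sup>2 <= (K + 1)\<^sup>2"
 using h K by (intro power_mono) (auto intro!: mult_left_le)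
 ultimately have L: "?L\<^sup>2*h <= (K + 1)\<^sup>2" by simp
 have "(\<integral>\<^sup>+z. ennreal (\<bar>z\<bar>^3*exp (K * \<bar>z\<bar>)) \<partial>gauss h)
  <= (\<integral>\<^sup>+z. ennreal (6*(h * sqrt h))*ennreal (exp (?L * \<bar>z\<bar>)) \<partial>gauss h)"
 using h le by (intro nn_integral_mono) (simp add: ennreal_mult'[symmetric] ennreal_leI)
 also have "... = ennreal (6*(h * sqrt h))*(\<integral>\<^sup>+z. ennreal (exp (?L * \<bar>z\<bar>)) \<partial>gauss h)"
 by (rule nn_integral_cmult) measurable
 also have "... <= ennreal (6*(h * sqrt h))*ennreal (2*exp (?L\<^sup>2*h/2))"
 by (intro mult_left_mono nn_integral_gauss_exp_abs h) auto
 also have "... <= ennreal (6*(h * sqrt h))*ennreal (2*exp ((K + 1)\<^sup>2/2))"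
 using L by (intro mult_left_mono ennreal_leI) auto
 also have "... = ennreal (12*exp ((K + 1)\<^sup>2/2)*(h * sqrt h))"
 using h by (simp add: ennreal_mult'[symmetric] algebra_simps)
 finally have *: "(\<integral>\<^sup>+z. ennreal (\<bar>z\<bar>^3*exp (K * \<bar>z\<bar>)) \<partial>gauss h) <= ennreal (12*exp ((K + 1)\<^sup>2/2)*(h * sqrt h))" .
 show I: "integrable (gauss h) (%z. \<bar>z\<bar>^3*exp (K * \<bar>z\<bar>))"
 using * by (intro integrableI_nonneg) (auto simp: le_less_trans[OF _ ennreal_less_top])
 show "(\<integral>z. \<bar>z\<bar>^3*exp (K * \<bar>z\<bar>) \<partial>gauss h) <= 12*exp ((K + 1)\<^sup>2/2)*(h * sqrt h)"
 using * h by (subst (asm) nn_integral_eq_integral[OF I]) auto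
qed

lemma gauss_moments:
 assumes h: "h > 0"
 shows "integrable (gauss h) (%z. z)" "(\<integral>z. z \<partial>gauss h) = 0"
 "integrable (gauss h) (%z. z\<^sup>2)" "(\<integral>z. z\<^sup>2 \<partial>gauss h) = h"
proof -
 have s: "sqrt h > 0" using h by simp
 have 1: "integrable lborel (%x. normal_density 0 (sqrt h) x*x)" "(LBINT x. normal_density 0 (sqrt h) x*x) = 0"
 using integrable_normal_moment_nz_1[OF s, of 0] integral_normal_moment_nz_1[OF s, of 0] by auto
 have 2: "integrable lborel (%x. normal_density 0 (sqrt h) x*x\<^sup>2)" "(LBINT x. normal_density 0 (sqrt h) x*x\<^sup>2) = h"
 using integrable_normal_moment[OF s, of 0 2] integral_normal_moment_even[OF s, of 0 1] h
 by (auto simp: fact_numeral)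
 show "integrable (gauss h) (%z. z)" "(\<integral>z. z \<partial>gauss h) = 0"
 "integrable (gauss h) (%z. z\<^sup>2)" "(\<integral>z. z\<^sup>2 \<partial>gauss h) = h"
 using 1 2 unfolding gauss_def
 by (simp_all add: integrable_density integral_density)
qed

text \<open>A one-step substitute for Ito's formula: under a centred increment of variance
  \<open>h\<close> the linear term integrates to 0, the quadratic one to \<open>b*h\<close>, and the
  remainder is of order \<open>h^(3/2)\<close>.\<close>

lemma gauss_step_upper:
 assumes h: "0 < h" "h <= 1" and K: "K >= 0" and C: "C >= 0"
 and [measurable]: "g \<in> borel_measurable borel"
 and le: "\<And>z. g z <= A + a*z + b*z\<^sup>2 + C*(\<bar>z\<bar>^3*exp (K * \<bar>z\<bar>))" and pos: "\<And>z. g z >= 0"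
 shows "(\<integral>\<^sup>+z. ennreal (g z) \<partial>gauss h) <= ennreal (A + b*h + C*(12*exp ((K + 1)\<^sup>2/2))*(h * sqrt h))"
proof -
 interpret prob_space "gauss h" by (rule prob_space_gauss) fact
 note m = gauss_moments[OF h(1)] gauss_cube_bound[OF h K]
 let ?G = "%z. A + a*z + b*z\<^sup>2 + C*(\<bar>z\<bar>^3*exp (K * \<bar>z\<bar>))"
 have I: "integrable (gauss h) ?G" using m by (intro Bochner_Integration.integrable_add integrable_mult_right) auto
 have "(\<integral>\<^sup>+z. ennreal (g z) \<partial>gauss h) <= (\<integral>\<^sup>+z. ennreal (?G z) \<partial>gauss h)"
 by (intro nn_integral_mono ennreal_leI le)
 also have "... = ennreal (\<integral>z. ?G z \<partial>gauss h)"
 using order.trans[OF pos le] by (intro nn_integral_eq_integral I) auto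
 also have "(\<integral>z. ?G z \<partial>gauss h) = A + b*h + C*(\<integral>z. \<bar>z\<bar>^3*exp (K * \<bar>z\<bar>) \<partial>gauss h)"
 using m prob_space by simp
 also have "ennreal ... <= ennreal (A + b*h + C*(12*exp ((K + 1)\<^sup>2/2))*(h * sqrt h))"
 using mult_left_mono[OF m(6) C] by (intro ennreal_leI) (simp add: algebra_simps)
 finally show ?thesis .
qed

lemma gauss_step_lower:
 assumes h: "0 < h" "h <= 1" and C: "C >= 0"
 and [measurable]: "g \<in> borel_measurable borel"
 and le: "\<And>z. g z >= A + a*z + b*z\<^sup>2 - C * \<bar>z\<bar>^3" and pos: "\<And>z. g z >= 0"
 shows "(\<integral>\<^sup>+z. ennreal (g z) \<partial>gauss h) >= ennreal (A + b*h - C*(12*exp (1/2))*(h * sqrt h))"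
proof -
 interpret prob_space "gauss h" by (rule prob_space_gauss) fact
 note m = gauss_moments[OF h(1)] gauss_cube_bound[OF h, of 0, simplified]
 let ?G = "%z. A + a*z + b*z\<^sup>2 - C * \<bar>z\<bar>^3"
 have I: "integrable (gauss h) ?G" using m
 by (intro Bochner_Integration.integrable_add Bochner_Integration.integrable_diff integrable_mult_right) auto
 have "ennreal (A + b*h - C*(12*exp (1/2))*(h * sqrt h)) <= ennreal (A + b*h - C*(\<integral>z. \<bar>z\<bar>^3 \<partial>gauss h))"
 using mult_left_mono[OF m(6) C] by (intro ennreal_leI) (simp add: algebra_simps)
 also have "A + b*h - C*(\<integral>z. \<bar>z\<bar>^3 \<partial>gauss h) = (\<integral>z. ?G z \<partial>gauss h)"
 using m prob_space by simp
 \<comment> \<open>The polynomial may be negative while \<open>g\<close> is not; its positive part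
   lies between the two and can be integrated in \<open>ennreal\<close>.\<close>
 also have "ennreal ... <= ennreal (\<integral>z. max 0 (?G z) \<partial>gauss h)"
 using I by (intro ennreal_leI integral_mono integrable_max) auto
 also have "... = (\<integral>\<^sup>+z. ennreal (max 0 (?G z)) \<partial>gauss h)"
 using I by (intro nn_integral_eq_integral[symmetric] integrable_max) auto
 also have "... <= (\<integral>\<^sup>+z. ennreal (g z) \<partial>gauss h)"
 using le pos by (intro nn_integral_mono ennreal_leI) auto
 finally show ?thesis .
qed

subsection \<open>Chains driven by independent Gaussian increments\<close>

text \<open>The update may depend on the step and the state space is arbitrary, so that one
  recursion serves for the stopped random walk, for the Riccati chain and, with pairs as states, for
  the Feynman-Kac weight.\<close>

primrec chain :: "(nat => 's => real => 's) => 's => nat => (nat => real) => 's" where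
 "chain F s 0 x = s"
| "chain F s (Suc k) x = F k (chain F s k x) (x k)"

lemma chain_cong: "(\<And>i. i < k ==> x i = y i) ==> chain F s k x = chain F s k y"
 by (induction k) auto

lemma measurable_chain:
 assumes F: "\<And>k. (%(s, z). F k s z) \<in> S \<Otimes>\<^sub>M borel \<rightarrow>\<^sub>M S" and s: "s \<in> space S"
 and X: "\<And>i. i < k ==> X i \<in> borel_measurable M"
 shows "(%om. chain F s k (%i. X i om)) \<in> M \<rightarrow>\<^sub>M S"
 using X
proof (induction k)
 case (Suc k)
 have "(%om. (%(s, z). F k s z) (chain F s k (%i. X i om), X k om)) \<in> M \<rightarrow>\<^sub>M S"
 using Suc by (intro measurable_compose[OF measurable_Pair F]) auto
 then show ?case by simp
qed (use s in simp)

definition gaussian_incs :: "'a measure => real => nat => (nat => 'a => real) => bool" where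
 "gaussian_incs M h n xi \<longleftrightarrow> prob_space M & h > 0 & prob_space.indep_vars M (%_. borel) xi {..<n} &
 (\<forall>i<n. distributed M lborel (xi i) (normal_density 0 (sqrt h)))"

lemma gaussian_incs_measurable: "gaussian_incs M h n xi ==> i < n ==> xi i \<in> borel_measurable M"
 unfolding gaussian_incs_def distributed_def by auto

lemma gaussian_incs_distr: "gaussian_incs M h n xi ==> i < n ==> distr M borel (xi i) = gauss h"
 unfolding gaussian_incs_def distributed_def gauss_def
 by (metis distr_cong sets_lborel)

lemma brownian_gaussian_incs:
 assumes M: "prob_space M" and B: "brownian_motion_on M T x B" and h: "h > 0"
 and T: "\<And>i. i <= n ==> a + real i*h \<in> T"
 shows "gaussian_incs M h n (%i om. B (a + real (Suc i)*h) om - B (a + real i*h) om)"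
proof -
 have "prob_space.indep_vars M (%_. borel) (%i om. B (a + real (Suc i)*h) om - B (a + real i*h) om) {..<n}"
 using B T h unfolding brownian_motion_on_def
 by (elim conjE allE[of _ n] allE[of _ "%i. a + real i*h"]) auto
 moreover have "distributed M lborel (%om. B (a + real (Suc i)*h) om - B (a + real i*h) om)
 (normal_density 0 (sqrt h))" if "i < n" for i
 proof -
 have "a + real (Suc i)*h - (a + real i*h) = h" by (simp add: algebra_simps)
 moreover have "a + real i*h < a + real (Suc i)*h" using h by simp
 ultimately show ?thesis
  using B T[of i] T[of "Suc i"] that unfolding brownian_motion_on_def
  by (metis Suc_leI less_or_eq_imp_le)
 qed
 ultimately show ?thesis using M h by (simp add: gaussian_incs_def)
qed

text \<open>The Markov property. The state after \<open>k\<close> steps is a function of the first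
  \<open>k\<close> increments, which are jointly independent of the next one; the joint law is a
  product and Fubini's theorem applies.\<close>

lemma chain_nn_integral_step:
 fixes u :: "'s => ennreal"
 assumes F: "\<And>k. (%(s, z). F k s z) \<in> S \<Otimes>\<^sub>M borel \<rightarrow>\<^sub>M S" and s: "s \<in> space S"
 and xi: "gaussian_incs M h n xi" and k: "k < n" and u [measurable]: "u \<in> borel_measurable S"
 shows "(\<integral>\<^sup>+om. u (chain F s (Suc k) (%i. xi i om)) \<partial>M)
 = (\<integral>\<^sup>+om. (\<integral>\<^sup>+z. u (F k (chain F s k (%i. xi i om)) z) \<partial>gauss h) \<partial>M)"
proof -
 interpret prob_space M using xi by (simp add: gaussian_incs_def)
 interpret G: prob_space "gauss h" using xi by (intro prob_space_gauss) (simp add: gaussian_incs_def)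
 have ind: "indep_vars (%_. borel) xi {..<n}" using xi by (simp add: gaussian_incs_def)
 define R where "R = (%A om. restrict (%i. xi i om) A)"
 define C where "C = (%x. chain F s k (%i. x i))"
 have Cm: "C \<in> PiM {..<k} (%_. borel) \<rightarrow>\<^sub>M S"
 unfolding C_def by (rule measurable_chain[OF F s]) auto
 have RC: "chain F s k (%i. xi i om) = C (R {..<k} om)" for om
 unfolding C_def R_def by (rule chain_cong) auto
 have "indep_var (PiM {..<k} (%_. borel)) (R {..<k}) (PiM {k} (%_. borel)) (R {k})"
 unfolding R_def using k by (intro indep_var_restrict[OF ind]) auto
 note D = this[unfolded indep_var_distribution_eq]
 have [measurable]: "R {..<k} \<in> M \<rightarrow>\<^sub>M PiM {..<k} (%_. borel)" "R {k} \<in> M \<rightarrow>\<^sub>M PiM {k} (%_. borel)"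
 "xi k \<in> borel_measurable M" using D gaussian_incs_measurable[OF xi k] by auto
 note [measurable] = F Cm
 interpret P: prob_space "distr M (PiM {k} (%_. borel)) (R {k})"
 by (rule prob_space_distr) measurable
 have dk: "distr (distr M (PiM {k} (%_. borel)) (R {k})) borel (%x. x k) = gauss h"
 proof -
 have "distr (distr M (PiM {k} (%_. borel)) (R {k})) borel (%x. x k) = distr M borel (%om. R {k} om k)"
  by (subst distr_distr) (auto simp: comp_def)
 then show ?thesis using gaussian_incs_distr[OF xi k] by (simp add: R_def)
 qed
 have [measurable]: "(%x. F k (C (fst x)) (snd x k)) \<in> PiM {..<k} (%_. borel) \<Otimes>\<^sub>M PiM {k} (%_. borel) \<rightarrow>\<^sub>M S"
 using measurable_compose[OF _ F[of k], of "%x. (C (fst x), snd x k)"] by simp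
 have [measurable]: "(%z. F k (C x) z) \<in> borel \<rightarrow>\<^sub>M S" if "x \<in> space (PiM {..<k} (%_. borel))" for x
 using measurable_compose[OF _ F[of k], of "%z. (C x, z)" borel] measurable_space[OF Cm that] by simp
 have "(\<integral>\<^sup>+om. u (chain F s (Suc k) (%i. xi i om)) \<partial>M)
 = (\<integral>\<^sup>+om. u (F k (C (fst (R {..<k} om, R {k} om))) (snd (R {..<k} om, R {k} om) k)) \<partial>M)"
 by (simp add: RC) (simp add: R_def)
 also have "... = (\<integral>\<^sup>+p. u (F k (C (fst p)) (snd p k)) \<partial>distr M (PiM {..<k} (%_. borel) \<Otimes>\<^sub>M PiM {k} (%_. borel))
  (%om. (R {..<k} om, R {k} om)))"
 by (subst nn_integral_distr) auto
 also have "distr M (PiM {..<k} (%_. borel) \<Otimes>\<^sub>M PiM {k} (%_. borel)) (%om. (R {..<k} om, R {k} om))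
 = distr M (PiM {..<k} (%_. borel)) (R {..<k}) \<Otimes>\<^sub>M distr M (PiM {k} (%_. borel)) (R {k})"
 using D by simp
 also have "(\<integral>\<^sup>+p. u (F k (C (fst p)) (snd p k)) \<partial>...)
 = (\<integral>\<^sup>+x. \<integral>\<^sup>+y. u (F k (C x) (y k)) \<partial>distr M (PiM {k} (%_. borel)) (R {k}) \<partial>distr M (PiM {..<k} (%_. borel)) (R {..<k}))"
 by (subst P.nn_integral_fst[symmetric]) auto
 also have "... = (\<integral>\<^sup>+x. \<integral>\<^sup>+z. u (F k (C x) z) \<partial>gauss h \<partial>distr M (PiM {..<k} (%_. borel)) (R {..<k}))"
 unfolding dk[symmetric] by (intro nn_integral_cong) (subst nn_integral_distr, auto)
 also have "... = (\<integral>\<^sup>+om. (\<integral>\<^sup>+z. u (F k (chain F s k (%i. xi i om)) z) \<partial>gauss h) \<partial>M)"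
 unfolding RC by (subst nn_integral_distr) auto
 finally show ?thesis .
qed

text \<open>Drift conditions are iterated in this form: \<open>c\<close> is a growth or contraction
  factor and \<open>d\<close> a source term. Allowing \<open>u\<close> and \<open>u'\<close> to
  differ admits functions that change from step to step.\<close>

lemma chain_nn_integral_le:
 fixes u u' :: "'s => ennreal"
 assumes F: "\<And>k. (%(s, z). F k s z) \<in> S \<Otimes>\<^sub>M borel \<rightarrow>\<^sub>M S" and s: "s \<in> space S"
 and xi: "gaussian_incs M h n xi" and k: "k < n"
 and u [measurable]: "u \<in> borel_measurable S" and u' [measurable]: "u' \<in> borel_measurable S"
 and le: "\<And>s. s \<in> space S ==> (\<integral>\<^sup>+z. u' (F k s z) \<partial>gauss h) <= c*u s + d"
 shows "(\<integral>\<^sup>+om. u' (chain F s (Suc k) (%i. xi i om)) \<partial>M) <= c*(\<integral>\<^sup>+om. u (chain F s k (%i. xi i om)) \<partial>M) + d"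
proof -
 interpret prob_space M using xi by (simp add: gaussian_incs_def)
 have C[measurable]: "(%om. chain F s k (%i. xi i om)) \<in> M \<rightarrow>\<^sub>M S"
 using gaussian_incs_measurable[OF xi] k by (intro measurable_chain[OF F s]) auto
 have "(\<integral>\<^sup>+om. u' (chain F s (Suc k) (%i. xi i om)) \<partial>M)
 <= (\<integral>\<^sup>+om. c*u (chain F s k (%i. xi i om)) + d \<partial>M)"
 unfolding chain_nn_integral_step[OF F s xi k u']
 by (intro nn_integral_mono le measurable_space[OF C])
 also have "... = c*(\<integral>\<^sup>+om. u (chain F s k (%i. xi i om)) \<partial>M) + d"
 by (simp add: nn_integral_add nn_integral_cmult emeasure_space_1)
 finally show ?thesis .
qed

subsection \<open>The maximal inequality\<close>

text \<open>Stopping the signed walk at level \<open>u\<close> turns the event that its running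
  maximum reaches \<open>u\<close> into an event about the final state, which exponential moments
  can control.\<close>

definition freeze :: "real => real => nat => real => real => real" where
 "freeze si u k s z = (if s >= u then s else s + si*z)"

lemma freeze_chain:
 "chain (freeze si u) 0 n x < u ==> j <= n ==> chain (freeze si u) 0 j x = si*(\<Sum>i<j. x i) & chain (freeze si u) 0 j x < u"
proof (induction n arbitrary: j)
 case (Suc n)
 have *: "chain (freeze si u) 0 n x < u" using Suc.prems(1) by (auto simp: freeze_def[of _ _ n] split: if_splits)
 show ?case
 proof (cases "j = Suc n")
 case True
 then show ?thesis using Suc.IH[OF *, of n]*Suc.prems(1) by (auto simp: freeze_def[of _ _ n] algebra_simps)
 next
 case False
 then show ?thesis using Suc.IH[OF *, of j] Suc.prems by auto
 qed
qed auto

lemma measurable_freeze: "(%(s, z). freeze si u k s z) \<in> borel \<Otimes>\<^sub>M borel \<rightarrow>\<^sub>M borel"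
 unfolding freeze_def by measurable

lemma maximal_inequality_one_sided:
 assumes xi: "gaussian_incs M h n xi" and u: "u > 0" and n: "n > 0" and si: "si\<^sup>2 = 1"
 shows "emeasure M {om \<in> space M. \<exists>j\<le>n. u <= si*(\<Sum>i<j. xi i om)} <= ennreal (exp (- u\<^sup>2/(2*(n*h))))"
proof -
 have h: "h > 0" using xi by (simp add: gaussian_incs_def)
 interpret prob_space M using xi by (simp add: gaussian_incs_def)
 \<comment> \<open>This value minimises \<open>- L*u + n*L^2*h/2\<close>.\<close>
 define L where "L = u/(n*h)"
 let ?c = "%k om. chain (freeze si u) 0 k (%i. xi i om)"
 have cm: "?c k \<in> borel_measurable M" if "k <= n" for k
 using gaussian_incs_measurable[OF xi] that by (intro measurable_chain measurable_freeze) auto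
 have b: "(\<integral>\<^sup>+om. ennreal (exp (L * ?c k om)) \<partial>M) <= ennreal (exp (L\<^sup>2*h/2)) ^ k" if "k <= n" for k
 using that
 proof (induction k)
 case (Suc k)
 have "(\<integral>\<^sup>+z. ennreal (exp (L*freeze si u k s z)) \<partial>gauss h) <= ennreal (exp (L\<^sup>2*h/2))*ennreal (exp (L * s)) + 0" for s
 proof (cases "s >= u")
  case True
  have "(\<integral>\<^sup>+z. ennreal (exp (L*freeze si u k s z)) \<partial>gauss h) = ennreal (exp (L * s))"
  using prob_space.emeasure_space_1[OF prob_space_gauss[OF h]] True by (simp add: freeze_def)
  also have "... <= ennreal (exp (L\<^sup>2*h/2))*ennreal (exp (L * s))"
  using h by (simp add: ennreal_mult'[symmetric] ennreal_leI)
  finally show ?thesis by simp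
 next
  case False
  have "(\<integral>\<^sup>+z. ennreal (exp (L*freeze si u k s z)) \<partial>gauss h)
  = (\<integral>\<^sup>+z. ennreal (exp (L * s))*ennreal (exp ((L * si)*z)) \<partial>gauss h)"
  using False by (intro nn_integral_cong)
  (auto simp: freeze_def exp_add[symmetric] ennreal_mult'[symmetric] algebra_simps)
  also have "... = ennreal (exp (L * s))*ennreal (exp ((L * si)\<^sup>2*h/2))"
  by (subst nn_integral_cmult) (auto simp: nn_integral_gauss_exp[OF h])
  finally show ?thesis by (simp add: power_mult_distrib si mult.commute)
 qed
 then have "(\<integral>\<^sup>+om. ennreal (exp (L * ?c (Suc k) om)) \<partial>M) <= ennreal (exp (L\<^sup>2*h/2))*(\<integral>\<^sup>+om. ennreal (exp (L * ?c k om)) \<partial>M) + 0"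
  using Suc.prems by (intro chain_nn_integral_le[where S = borel, OF _ _ xi] measurable_freeze) auto
 also have "... <= ennreal (exp (L\<^sup>2*h/2))*ennreal (exp (L\<^sup>2*h/2)) ^ k + 0"
  using Suc by (intro add_mono mult_left_mono) auto
 finally show ?case by simp
 qed (simp add: emeasure_space_1)
 have "{om \<in> space M. \<exists>j\<le>n. u <= si*(\<Sum>i<j. xi i om)} \<subseteq> {om \<in> space M. 1 <= ennreal (exp (- L*u))*ennreal (exp (L * ?c n om))}"
 proof safe
 fix om j assume "j <= n" "u <= si*(\<Sum>i<j. xi i om)"
 then have "\<not> ?c n om < u" using freeze_chain[of si u n "%i. xi i om" j] by auto
 then have "1 <= exp (- L*u)*exp (L * ?c n om)"
  using u h unfolding exp_add[symmetric] by (simp add: L_def divide_simps)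
 then show "1 <= ennreal (exp (- L*u))*ennreal (exp (L * ?c n om))"
  by (simp add: ennreal_mult'[symmetric])
 qed
 then have "emeasure M {om \<in> space M. \<exists>j\<le>n. u <= si*(\<Sum>i<j. xi i om)}
 <= emeasure M {om \<in> space M. 1 <= ennreal (exp (- L*u))*ennreal (exp (L * ?c n om))}"
 using cm[of n] by (intro emeasure_mono) auto
 also have "... <= ennreal (exp (- L*u))*(\<integral>\<^sup>+om. ennreal (exp (L * ?c n om))*indicator (space M) om \<partial>M)"
 using cm[of n] nn_integral_Markov_inequality[where u = "%om. ennreal (exp (L * ?c n om))" and M = M and A = "space M" and c = "ennreal (exp (- L*u))"] by auto
 also have "... <= ennreal (exp (- L*u))*ennreal (exp (L\<^sup>2*h/2)) ^ n"
 using b[of n] by (intro mult_left_mono) (auto simp: mult_indicator_cong[symmetric] cong: nn_integral_cong)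
 also have "... = ennreal (exp (- u\<^sup>2/(2*(n*h))))"
 proof -
 have "- L*u + real n*(L\<^sup>2*h/2) = - u\<^sup>2/(2*(n*h))"
  using h n by (simp add: L_def divide_simps power2_eq_square)
 then show ?thesis
  by (simp add: ennreal_power exp_of_nat_mult[symmetric] ennreal_mult'[symmetric] exp_add[symmetric])
 qed
 finally show ?thesis .
qed

lemma maximal_inequality:
 assumes xi: "gaussian_incs M h n xi" and u: "u > 0" and n: "n > 0"
 shows "emeasure M {om \<in> space M. \<exists>j\<le>n. u <= \<bar>\<Sum>i<j. xi i om\<bar>} <= ennreal (2*exp (- u\<^sup>2/(2*(n*h))))"
proof -
 let ?A = "%si. {om \<in> space M. \<exists>j\<le>n. u <= si*(\<Sum>i<j. xi i om)}"
 note [measurable] = gaussian_incs_measurable[OF xi]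
 have S [measurable]: "(%om. \<Sum>i<j. xi i om) \<in> borel_measurable M" if "j <= n" for j
 using that by (intro borel_measurable_sum gaussian_incs_measurable[OF xi]) auto
 have A: "?A si \<in> sets M" for si :: real
 proof -
 have "?A si = (\<Union>j\<in>{..n}. {om \<in> space M. u <= si*(\<Sum>i<j. xi i om)})" by auto
 also have "... \<in> sets M" by (intro sets.finite_UN) auto
 finally show ?thesis .
 qed
 have "{om \<in> space M. \<exists>j\<le>n. u <= \<bar>\<Sum>i<j. xi i om\<bar>} \<subseteq> ?A 1 \<union> ?A (-1)"
 by (auto simp: abs_if split: if_splits)
 then have "emeasure M {om \<in> space M. \<exists>j\<le>n. u <= \<bar>\<Sum>i<j. xi i om\<bar>} <= emeasure M (?A 1 \<union> ?A (-1))"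
 using A by (intro emeasure_mono sets.Un) auto
 also have "... <= emeasure M (?A 1) + emeasure M (?A (-1))" using A by (intro emeasure_subadditive) auto
 also have "... <= ennreal (exp (- u\<^sup>2/(2*(n*h)))) + ennreal (exp (- u\<^sup>2/(2*(n*h))))"
 using assms by (intro add_mono maximal_inequality_one_sided) auto
 also have "... = ennreal (2*exp (- u\<^sup>2/(2*(n*h))))"
 by (simp add: ennreal_plus[symmetric] del: ennreal_plus)
 finally show ?thesis .
qed

lemma dyadic_approx:
 fixes a b y :: real
 assumes b: "b > 0" and y: "y \<in> {a..a + b}"
 defines "z \<equiv> (%n. a + real (nat \<lfloor>(y - a)/b*2 ^ n\<rfloor>)*(b/2 ^ n))"
 shows "z \<longlonglongrightarrow> y" "\<And>n. z n \<in> {a..a + b}" "\<And>n. nat \<lfloor>(y - a)/b*2 ^ n\<rfloor> <= 2 ^ n"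
proof -
 define r where "r = (y - a)/b"
 have r: "0 <= r" "r <= 1" using y b by (auto simp: r_def divide_simps)
 have yr: "y = a + r*b" using b by (simp add: r_def)
 have fl: "real (nat \<lfloor>r*2 ^ n\<rfloor>) = of_int \<lfloor>r*2 ^ n\<rfloor>" for n using r by (simp add: of_nat_nat)
 have le: "real (nat \<lfloor>r*2 ^ n\<rfloor>) <= r*2 ^ n" "r*2 ^ n - 1 <= real (nat \<lfloor>r*2 ^ n\<rfloor>)" for n
 unfolding fl by linarith+
 have up: "z n <= y" for n
 proof -
 have "real (nat \<lfloor>r*2 ^ n\<rfloor>)*(b/2 ^ n) <= r*2 ^ n*(b/2 ^ n)"
  using b le(1) by (intro mult_right_mono) auto
 then show ?thesis unfolding z_def r_def[symmetric] yr by simp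
 qed
 have lo: "y - b/2 ^ n <= z n" for n
 proof -
 have "(r*2 ^ n - 1)*(b/2 ^ n) <= real (nat \<lfloor>r*2 ^ n\<rfloor>)*(b/2 ^ n)"
  using b le(2) by (intro mult_right_mono) auto
 then show ?thesis unfolding z_def r_def[symmetric] yr by (simp add: algebra_simps)
 qed
 show "z \<longlonglongrightarrow> y"
 proof (rule tendsto_sandwich[of "%n. y - b/2 ^ n" _ _ "%_. y"])
 have "(%n. y - b*(1/2) ^ n) \<longlonglongrightarrow> y - b*0"
  by (intro tendsto_intros LIMSEQ_realpow_zero) auto
 moreover have "b*(1/2) ^ n = b/2 ^ n" for n by (simp add: power_one_over)
 ultimately show "(%n. y - b/2 ^ n) \<longlonglongrightarrow> y" by simp
 qed (use up lo in auto)
 show "z n \<in> {a..a + b}" for n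
 using up[of n] y b by (auto simp: z_def)
 show "nat \<lfloor>(y - a)/b*2 ^ n\<rfloor> <= 2 ^ n" for n
 proof -
 have "real (nat \<lfloor>r*2 ^ n\<rfloor>) <= 1*2 ^ n" using r le(1)[of n] by (meson mult_right_mono order.trans zero_le_numeral zero_le_power)
 then have "real (nat \<lfloor>r*2 ^ n\<rfloor>) <= real (2 ^ n)" by simp
 then show ?thesis unfolding r_def[symmetric] of_nat_le_iff .
 qed
qed

text \<open>The exceptional set is the union over dyadic levels. Each level has the same total
  variance \<open>b\<close> and hence the same bound from \<open>maximal_inequality\<close>, and the
  events increase because the points of one level recur at the next; so nothing is lost in the
  union. Continuity is a hypothesis on the single path, since the set of paths where it fails is
  only contained in a null set.\<close>

lemma brownian_oscillation:
 assumes M: "prob_space M" and B: "brownian_motion_on M T x B" and b: "b > 0" and T: "{a..a + b} \<subseteq> T" and u: "u > 0"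
 obtains A where "A \<in> sets M" "emeasure M A <= ennreal (2*exp (- u\<^sup>2/(2*b)))"
 "\<And>om. om \<in> space M - A ==> continuous_on T (%t. B t om) ==> (\<forall>y\<in>{a..a + b}. \<bar>B y om - B a om\<bar> <= u)"
proof -
 define A where "A = (%n::nat. {om \<in> space M. \<exists>j\<le>2 ^ n. u <= \<bar>B (a + real j*(b/2 ^ n)) om - B a om\<bar>})"
 have inT: "a + real j*(b/2 ^ n) \<in> T" if "j <= 2 ^ n" for j n :: nat
 proof -
 have "real j*(b/2 ^ n) <= 2 ^ n*(b/2 ^ n)"
  using that b by (intro mult_right_mono) (auto simp flip: of_nat_le_iff)
 then show ?thesis using T b by auto
 qed
 have Bm: "B t \<in> borel_measurable M" if "t \<in> T" for t using B that by (auto simp: brownian_motion_on_def)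
 have aT: "a \<in> T" using T b by auto
 have Am: "A n \<in> sets M" for n
 proof -
 have "A n = (\<Union>j\<in>{..2 ^ n}. {om \<in> space M. u <= \<bar>B (a + real j*(b/2 ^ n)) om - B a om\<bar>})" by (auto simp: A_def)
 also have "... \<in> sets M" using Bm inT aT by (intro sets.finite_UN) auto
 finally show ?thesis .
 qed
 have An: "emeasure M (A n) <= ennreal (2*exp (- u\<^sup>2/(2*b)))" for n
 proof -
 let ?h = "b/2 ^ n"
 have "gaussian_incs M ?h (2 ^ n) (%i om. B (a + real (Suc i) * ?h) om - B (a + real i * ?h) om)"
  using M B b inT by (intro brownian_gaussian_incs) auto
 from maximal_inequality[OF this u]
 have "emeasure M {om \<in> space M. \<exists>j\<le>2 ^ n. u <= \<bar>\<Sum>i<j. B (a + real (Suc i) * ?h) om - B (a + real i * ?h) om\<bar>}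
  <= ennreal (2*exp (- u\<^sup>2/(2*b)))" by simp
 moreover have "(\<Sum>i<j. B (a + real (Suc i) * ?h) om - B (a + real i * ?h) om) = B (a + real j * ?h) om - B a om" for j om
  using sum_lessThan_telescope[of "%i. B (a + real i * ?h) om" j] by simp
 ultimately show ?thesis unfolding A_def by simp
 qed
 have "incseq A"
 proof (rule incseq_SucI, safe)
 fix n om assume "om \<in> A n"
 then obtain j where j: "om \<in> space M" "j <= 2 ^ n" "u <= \<bar>B (a + real j*(b/2 ^ n)) om - B a om\<bar>" by (auto simp: A_def)
 have "real (2*j)*(b/2 ^ Suc n) = real j*(b/2 ^ n)" by simp
 with j show "om \<in> A (Suc n)" unfolding A_def by (intro CollectI conjI exI[of _ "2*j"]) (simp_all add: mult.commute)
 qed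
 then have "emeasure M (\<Union>n. A n) = (SUP n. emeasure M (A n))"
 using Am by (intro SUP_emeasure_incseq[symmetric]) auto
 also have "... <= ennreal (2*exp (- u\<^sup>2/(2*b)))" using An by (intro SUP_least) auto
 finally have 1: "emeasure M (\<Union>n. A n) <= ennreal (2*exp (- u\<^sup>2/(2*b)))" .
 show ?thesis
 proof (rule that[of "\<Union>n. A n"])
 fix om assume om: "om \<in> space M - (\<Union>n. A n)" and c: "continuous_on T (%t. B t om)"
 show "\<forall>y\<in>{a..a + b}. \<bar>B y om - B a om\<bar> <= u"
 proof
  fix y assume y: "y \<in> {a..a + b}"
  note d = dyadic_approx[OF b y]
  let ?z = "%n. a + real (nat \<lfloor>(y - a)/b*2 ^ n\<rfloor>)*(b/2 ^ n)"
  have "(%n. B (?z n) om) \<longlonglongrightarrow> B y om"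
  using d(1) T y by (intro continuous_on_tendsto_compose[OF c] always_eventually allI subsetD[OF T d(2)]) auto
  then have "(%n. \<bar>B (?z n) om - B a om\<bar>) \<longlonglongrightarrow> \<bar>B y om - B a om\<bar>" by (intro tendsto_intros)
  moreover have "\<bar>B (?z n) om - B a om\<bar> <= u" for n
  proof -
  have "\<not> u <= \<bar>B (?z n) om - B a om\<bar>" using om d(3)[of n] unfolding A_def by blast
  then show ?thesis by linarith
  qed
  ultimately show "\<bar>B y om - B a om\<bar> <= u" by (intro LIMSEQ_le_const2) auto
 qed
 qed (use 1 Am in auto)
qed

subsection \<open>The Kramers estimate\<close>

text \<open>Minus an antiderivative of the rescaled Riccati drift \<open>1 - rh^2\<close>,
  normalised to 0 at the stable point 1 and continued by constants. The barrier at the unstable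
  point -1 has height 4/3.\<close>

definition pot :: "real => real" where
 "pot rh = (if rh >= 1 then 0 else if rh <= - 1 then 4/3 else 2/3 - rh + rh ^ 3/3)"

lemma measurable_pot [measurable]: "pot \<in> borel_measurable borel"
 unfolding pot_def by measurable

lemma pot_min: "pot (min 1 rh) = pot rh"
 by (auto simp: pot_def min_def)

lemma pot_near_1: "0 <= e ==> e <= 2 ==> pot (1 - e) = e\<^sup>2 - e ^ 3/3"
 by (auto simp: pot_def power2_eq_square power3_eq_cube field_simps)

lemma pot_near_m1: "0 <= f ==> f <= 2 ==> pot (- 1 + f) = 4/3 - (f\<^sup>2 - f ^ 3/3)"
 by (auto simp: pot_def power2_eq_square power3_eq_cube field_simps)

lemma pot_antimono:
 assumes "x <= y" shows "pot y <= pot x"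
proof -
 have *: "2/3 - y + y ^ 3/3 <= 2/3 - x + x ^ 3/3" if "x <= y" "-1 <= x" "y <= 1" for x y :: real
 proof -
 have "(y - x)*(3 - (y\<^sup>2 + x*y + x\<^sup>2)) >= 0"
 proof (intro mult_nonneg_nonneg)
  have "x\<^sup>2 <= 1" "y\<^sup>2 <= 1" using that by (auto simp: abs_square_le_1)
  moreover have "x*y <= (x\<^sup>2 + y\<^sup>2)/2" using sum_squares_ge_zero[of "x - y" 0] by (simp add: power2_eq_square algebra_simps)
  ultimately show "3 - (y\<^sup>2 + x*y + x\<^sup>2) >= 0" by simp
 qed (use that in auto)
 then show ?thesis by (simp add: power2_eq_square power3_eq_cube algebra_simps)
 qed
 have 0: "2/3 - x + x ^ 3/3 >= 0" "2/3 - x + x ^ 3/3 <= 4/3" if "-1 <= x" "x <= 1" for x :: real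
 using *[of x 1] *[of "-1" x] that by auto
 show ?thesis
 using assms *[of x y] 0[of x] 0[of y] by (auto simp: pot_def)
qed

text \<open>Between the end points this is Taylor's formula, the second derivative
  \<open>2*rh\<close> being at most 2. The two outer cases check that the constant continuation
  stays below the parabola when \<open>d\<close> leaves the interval, as an unbounded Gaussian
  increment may.\<close>

lemma pot_quadratic:
 assumes "-1 <= rh" "rh <= 1"
 shows "pot (rh + d) <= pot rh - (1 - rh\<^sup>2)*d + d\<^sup>2"
proof -
 consider "rh + d >= 1" | "rh + d <= -1" | "-1 < rh + d" "rh + d < 1" by linarith
 then show ?thesis
 proof cases
 case 1
 define e where "e = 1 - rh"
 have e: "0 <= e" "e <= 2" "d >= e" "rh = 1 - e" using assms 1 by (auto simp: e_def)
 have "d + e - e*(2 - e) = (d - e) + e*e" by (simp add: algebra_simps)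
 then have "0 <= d + e - e*(2 - e)" using e zero_le_square[of e] by linarith
 then have "0 <= (d - e)*(d + e - e*(2 - e))" using e by (intro mult_nonneg_nonneg) auto
 moreover have "0 <= e ^ 3" using e by simp
 ultimately have "0 <= e\<^sup>2 - e ^ 3/3 - e*(2 - e)*d + d\<^sup>2"
  by (simp add: power2_eq_square power3_eq_cube algebra_simps)
 moreover have "1 - rh\<^sup>2 = e*(2 - e)" unfolding e(4) by (simp add: power2_eq_square algebra_simps)
 moreover have "pot (rh + d) = 0" using 1 by (simp add: pot_def)
 ultimately show ?thesis using pot_near_1[OF e(1,2)] e(4) by simp
 next
 case 2
 define f where "f = 1 + rh"
 have f: "0 <= f" "f <= 2" "- d >= f" "rh = -1 + f" using assms 2 by (auto simp: f_def)
 have "f*(2 - f)*f <= f*(2 - f)*(- d)" using f by (intro mult_left_mono mult_nonneg_nonneg) auto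
 moreover have "f\<^sup>2 <= (- d)\<^sup>2" using f by (intro power_mono) auto
 moreover have "f\<^sup>2*(2/3*f) <= f\<^sup>2*2" using f by (intro mult_left_mono) auto
 ultimately have "0 <= - (f\<^sup>2 - f ^ 3/3) - f*(2 - f)*d + d\<^sup>2"
  by (simp add: power2_eq_square power3_eq_cube algebra_simps)
 moreover have "1 - rh\<^sup>2 = f*(2 - f)" unfolding f(4) by (simp add: power2_eq_square algebra_simps)
 moreover have "pot (rh + d) = 4/3" using 2 by (simp add: pot_def)
 ultimately show ?thesis using pot_near_m1[OF f(1,2)] f(4) by simp
 next
 case 3
 have "pot rh = 2/3 - rh + rh ^ 3/3" using assms by (auto simp: pot_def)
 moreover have "pot (rh + d) = 2/3 - (rh + d) + (rh + d) ^ 3/3" using 3 by (auto simp: pot_def)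
 moreover have "d\<^sup>2*(rh + d/3) <= d\<^sup>2*1" using 3 assms by (intro mult_left_mono) auto
 ultimately show ?thesis by (simp add: power2_eq_square power3_eq_cube algebra_simps add_divide_distrib)
 qed
qed

text \<open>An Euler step of size \<open>et\<close> for the Riccati equation in the unit
  \<open>rh = p/m\<close>. Capping at 1 only lowers the increment, the permitted direction for a
  supersolution. A state near the unstable point -1 counts as lost and is frozen, so that survival
  can be read off at the last step.\<close>

definition kstep :: "real => real => nat => real => real => real" where
 "kstep et ga k rh z = (if - 1 + ga < rh & rh <= 1 then min 1 (rh + et*(1 - rh\<^sup>2) - z) else rh)"

lemma measurable_kstep: "(%(rh, z). kstep et ga k rh z) \<in> borel \<Otimes>\<^sub>M borel \<rightarrow>\<^sub>M borel"
 unfolding kstep_def by measurable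

text \<open>The parameter \<open>s\<close> is an inverse temperature. A chain with drift
  \<open>et*(1 - rh^2)\<close> and variance \<open>v\<close> has the approximate stationary density
  \<open>exp (- (2*et/v)*pot rh)\<close>, so \<open>sv\<close> puts \<open>s\<close> below the
  critical value \<open>2*et/v\<close> by the factor \<open>1 - de/4\<close>. This slack makes
  \<open>exp (s*pot rh)\<close> a Lyapunov function, and \<open>large\<close> lets its contraction
  beat the constant lost in each step.\<close>

locale kramers =
 fixes de et ga s v :: real
 assumes de: "0 < de" "de <= 1" and et: "0 < et" "et <= de/64" and ga: "0 < ga" "ga <= 1/2" "32*et <= de*ga\<^sup>2"
 and s: "s > 0" and v: "v > 0" and sv: "s * v = 2*(1 - de/4)*et"
 and large: "2*exp (- 2 * s*et\<^sup>2) <= 1/2"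
begin

text \<open>Bounds the Lyapunov function after a step from near the stable point 1, where the drift
  is too weak to contract but the potential is at most \<open>ga^2\<close>.\<close>

definition "C1 = 2*exp (s*(ga\<^sup>2 + 2*et\<^sup>2))"

text \<open>In the exponent the drift contributes \<open>- s*et*g^2\<close> and the noise about
  \<open>s^2*v*g^2/2 = (1 - de/4)*s*et*g^2\<close>, so the net effect is negative of order
  \<open>de*g^2\<close>. It yields a contraction wherever \<open>g\<close> is not small.\<close>

lemma step:
 assumes rh: "- 1 + ga < rh" "rh <= 1"
 shows "(\<integral>\<^sup>+z. ennreal (exp (s*pot (kstep et ga k rh z))) \<partial>gauss v) <= ennreal (exp (s*pot rh)/2) + ennreal C1"
proof -
 define g where "g = 1 - rh\<^sup>2"
 define ka where "ka = 1 - de/4"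
 have ka: "0 < ka" "ka < 1" using de by (auto simp: ka_def)
 have "rh\<^sup>2 <= 1" using rh ga by (simp add: abs_square_le_1)
 then have g: "0 <= g" "g <= 1" by (auto simp: g_def)
 \<comment> \<open>The normalising quantity \<open>d\<close> of the Gaussian integral: the quadratic
   coefficient is \<open>2*s\<close>, and \<open>2*(2*s)*v = 8*ka*et\<close>.\<close>
 define q where "q = 1 - 8 * ka*et"
 have q: "q >= 1 - de/8" "q >= 1/2" "q <= 1"
 proof -
 have "8 * ka*et <= 8*et" using ka et by auto
 moreover have "8 * ka*et >= 0" using ka et by simp
 ultimately show "q >= 1 - de/8" "q >= 1/2" "q <= 1" using et de unfolding q_def by linarith+
 qed
 have kq: "ka/q <= 1 - de/8"
 proof -
 have "(1 - de/8)*(1 - de/8) <= (1 - de/8)*q" using q de by (intro mult_left_mono) auto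
 moreover have "ka <= (1 - de/8)*(1 - de/8)" by (simp add: ka_def algebra_simps)
 ultimately show ?thesis using q by (simp add: divide_le_eq)
 qed
 have svk: "s * v = 2 * ka*et" using sv by (simp add: ka_def)
 have pw: "exp (s*pot (kstep et ga k rh z)) <= exp (s*(pot rh - et*g\<^sup>2 + 2*et\<^sup>2))*exp (s*g*z + 2 * s*z\<^sup>2)" for z
 proof -
 have "kstep et ga k rh z = min 1 (rh + (et*g - z))" using rh by (simp add: kstep_def g_def algebra_simps)
 then have "pot (kstep et ga k rh z) <= pot rh - g*(et*g - z) + (et*g - z)\<^sup>2"
  using pot_quadratic[of rh "et*g - z"] rh ga by (simp add: pot_min g_def)
 also have "(et*g - z)\<^sup>2 <= 2*(et*g)\<^sup>2 + 2*z\<^sup>2"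
  using sum_squares_ge_zero[of "et*g + z" 0] by (simp add: power2_eq_square algebra_simps)
 also have "(et*g)\<^sup>2 <= (et*1)\<^sup>2" using g et by (intro power_mono mult_left_mono) auto
 finally have "pot (kstep et ga k rh z) <= (pot rh - et*g\<^sup>2 + 2*et\<^sup>2) + (g*z + 2*z\<^sup>2)"
  by (simp add: power2_eq_square algebra_simps)
 then have "s*pot (kstep et ga k rh z) <= s*((pot rh - et*g\<^sup>2 + 2*et\<^sup>2) + (g*z + 2*z\<^sup>2))"
  using s by (intro mult_left_mono) auto
 then show ?thesis by (simp add: exp_add[symmetric] algebra_simps)
 qed
 have "(\<integral>\<^sup>+z. ennreal (exp (s*pot (kstep et ga k rh z))) \<partial>gauss v)
 <= (\<integral>\<^sup>+z. ennreal (exp (s*(pot rh - et*g\<^sup>2 + 2*et\<^sup>2)))*ennreal (exp (s*g*z + 2 * s*z\<^sup>2)) \<partial>gauss v)"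
 using pw by (intro nn_integral_mono) (simp add: ennreal_mult'[symmetric] ennreal_leI)
 also have "... = ennreal (exp (s*(pot rh - et*g\<^sup>2 + 2*et\<^sup>2)))*ennreal (exp ((s*g)\<^sup>2 * v/(2*q))/sqrt q)"
 proof -
 have eq: "1 - 2*(2 * s) * v = q" using svk by (simp add: q_def algebra_simps)
 have "2*(2 * s) * v < 1" using eq q by linarith
 from nn_integral_gauss_exp_quadratic[OF v this, of "s*g", unfolded eq]
 show ?thesis by (subst nn_integral_cmult) auto
 qed
 also have "... <= ennreal (exp (s*(pot rh - et*g\<^sup>2 + 2*et\<^sup>2)))*ennreal (2*exp (s*et*(1 - de/8)*g\<^sup>2))"
 proof (intro mult_left_mono ennreal_leI)
 have "(s*g)\<^sup>2 * v/(2*q) = s*g\<^sup>2*(s * v)/(2*q)" by (simp add: power2_eq_square)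
 also have "... = s*et*g\<^sup>2*(ka/q)" unfolding svk by simp
 also have "... <= s*et*g\<^sup>2*(1 - de/8)" using s et by (intro mult_left_mono kq) auto
 finally have *: "(s*g)\<^sup>2 * v/(2*q) <= s*et*(1 - de/8)*g\<^sup>2" by (simp add: mult_ac)
 have "1/2 <= sqrt q" using q by (intro real_le_rsqrt) (auto simp: power2_eq_square)
 then have "exp ((s*g)\<^sup>2 * v/(2*q))/sqrt q <= exp ((s*g)\<^sup>2 * v/(2*q))/(1/2)"
  using q by (intro divide_left_mono) auto
 also have "... <= 2*exp (s*et*(1 - de/8)*g\<^sup>2)" using * by simp
 finally show "exp ((s*g)\<^sup>2 * v/(2*q))/sqrt q <= 2*exp (s*et*(1 - de/8)*g\<^sup>2)" .
 qed simp
 also have "... = ennreal (2*exp (s*pot rh + s*et*(2*et - de/8*g\<^sup>2)))"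
 by (simp add: ennreal_mult'[symmetric] exp_add[symmetric] power2_eq_square algebra_simps)
 also have "... <= ennreal (exp (s*pot rh)/2 + C1)"
 proof (rule ennreal_leI)
 show "2*exp (s*pot rh + s*et*(2*et - de/8*g\<^sup>2)) <= exp (s*pot rh)/2 + C1"
 proof (cases "ga\<^sup>2 <= g\<^sup>2")
  \<comment> \<open>Here the gain \<open>de/8*g^2\<close> is at least twice the discretisation error
    \<open>2*et\<close>. What remains is \<open>- 2*s*et^2\<close>, and \<open>large\<close> makes
    it absorb the factor 2 and leave 1/2.\<close>
  case True
  then have "de*ga\<^sup>2 <= de*g\<^sup>2" using de by (intro mult_left_mono) auto
  then have "2*et - de/8*g\<^sup>2 <= - 2*et" using ga(3) by linarith
  then have "s*et*(2*et - de/8*g\<^sup>2) <= s*et*(- 2*et)" using s et by (intro mult_left_mono) auto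
  then have "2*exp (s*pot rh + s*et*(2*et - de/8*g\<^sup>2)) <= 2*exp (s*pot rh + - 2 * s*et\<^sup>2)"
  by (simp add: power2_eq_square mult_ac)
  also have "... = exp (s*pot rh)*(2*exp (- 2 * s*et\<^sup>2))" by (subst exp_add) simp
  also have "... <= exp (s*pot rh)*(1/2)" by (intro mult_left_mono large) auto
  finally show ?thesis by (simp add: C1_def add_increasing2)
 next
  case False
  then have lt: "g < ga" using power_mono[of ga g 2] ga by linarith
  have "rh > 0"
  proof (rule ccontr)
  assume n: "\<not> rh > 0"
  then have "ga*1 <= (1 + rh)*(1 - rh)" using rh ga by (intro mult_mono) auto
  with lt show False by (simp add: g_def power2_eq_square algebra_simps)
  qed
  then have "(1 - rh)*1 <= (1 - rh)*(1 + rh)" using rh by (intro mult_left_mono) auto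
  then have e: "1 - rh <= g" by (simp add: g_def power2_eq_square algebra_simps)
  have "pot rh = (1 - rh)\<^sup>2 - (1 - rh) ^ 3/3" using pot_near_1[of "1 - rh"] rh \<open>rh > 0\<close> by simp
  also have "... <= (1 - rh)\<^sup>2" using rh by simp
  also have "... <= g\<^sup>2" using e rh by (intro power_mono) auto
  also have "... <= ga\<^sup>2" using lt g by (intro power_mono) auto
  finally have "s*pot rh <= s*ga\<^sup>2" using s by (intro mult_left_mono) auto
  moreover have "s*et*(2*et - de/8*g\<^sup>2) <= s*et*(2*et)" using s et de by (intro mult_left_mono) auto
  ultimately have "s*pot rh + s*et*(2*et - de/8*g\<^sup>2) <= s*(ga\<^sup>2 + 2*et\<^sup>2)"
  by (simp add: power2_eq_square algebra_simps)
  then show ?thesis by (simp add: C1_def add_increasing)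
 qed
 qed
 also have "... = ennreal (exp (s*pot rh)/2) + ennreal C1" by (subst ennreal_plus) (auto simp: C1_def)
 finally show ?thesis .
qed

definition u1 :: "real => ennreal" where
 "u1 rh = (if - 1 + ga < rh & rh <= 1 then ennreal (exp (s*pot rh)) else 0)"

definition u2 :: "real => ennreal" where
 "u2 rh = indicator {.. - 1 + ga} rh"

lemma measurable_u [measurable]: "u1 \<in> borel_measurable borel" "u2 \<in> borel_measurable borel"
 unfolding u1_def u2_def by measurable

lemma half_mult: "ennreal (x/2) = ennreal (1/2)*ennreal x" if "x >= 0"
proof -
 have "ennreal (1/2*x) = ennreal (1/2)*ennreal x" by (rule ennreal_mult') simp
 then show ?thesis by (simp only: times_divide_eq_left mult_1)
qed

lemma u1_step: "(\<integral>\<^sup>+z. u1 (kstep et ga k rh z) \<partial>gauss v) <= ennreal (1/2)*u1 rh + ennreal C1"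
proof (cases "- 1 + ga < rh & rh <= 1")
 case True
 have "(\<integral>\<^sup>+z. u1 (kstep et ga k rh z) \<partial>gauss v) <= (\<integral>\<^sup>+z. ennreal (exp (s*pot (kstep et ga k rh z))) \<partial>gauss v)"
 by (intro nn_integral_mono) (auto simp: u1_def)
 also have "... <= ennreal (exp (s*pot rh)/2) + ennreal C1" using True by (intro step) auto
 finally show ?thesis using True by (simp add: u1_def half_mult)
qed (auto simp: kstep_def u1_def)

definition "esc = exp (- s*(4/3 - ga\<^sup>2))"

lemma u2_step: "(\<integral>\<^sup>+z. u2 (kstep et ga k rh z) \<partial>gauss v) <= 1*(u2 rh + ennreal esc*(ennreal (1/2)*u1 rh)) + ennreal (esc*C1)"
proof (cases "- 1 + ga < rh & rh <= 1")
 case True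
 have "u2 rh' <= ennreal esc*ennreal (exp (s*pot rh'))" for rh'
 proof (cases "rh' <= - 1 + ga")
 case True
 have "4/3 - ga\<^sup>2 <= pot (- 1 + ga)" using ga by (subst pot_near_m1) auto
 also have "... <= pot rh'" using True by (intro pot_antimono)
 finally have "s*(4/3 - ga\<^sup>2) <= s*pot rh'" using s by (intro mult_left_mono) auto
 then show ?thesis using True by (simp add: u2_def esc_def ennreal_mult'[symmetric] exp_add[symmetric])
 qed (simp add: u2_def)
 then have "(\<integral>\<^sup>+z. u2 (kstep et ga k rh z) \<partial>gauss v) <= (\<integral>\<^sup>+z. ennreal esc*ennreal (exp (s*pot (kstep et ga k rh z))) \<partial>gauss v)"
 by (intro nn_integral_mono) auto
 also have "... = ennreal esc*(\<integral>\<^sup>+z. ennreal (exp (s*pot (kstep et ga k rh z))) \<partial>gauss v)"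
 unfolding kstep_def by (intro nn_integral_cmult) measurable
 also have "... <= ennreal esc*(ennreal (exp (s*pot rh)/2) + ennreal C1)" using True by (intro mult_left_mono step) auto
 also have "... = ennreal esc*(ennreal (1/2)*u1 rh) + ennreal (esc*C1)"
 using True by (simp add: u1_def half_mult distrib_left ennreal_mult' esc_def)
 also have "... <= 1*(u2 rh + ennreal esc*(ennreal (1/2)*u1 rh)) + ennreal (esc*C1)"
 by (intro add_right_mono) simp
 finally show ?thesis .
next
 case False
 then have "kstep et ga k rh z = rh" for z by (auto simp: kstep_def)
 then have "(\<integral>\<^sup>+z. u2 (kstep et ga k rh z) \<partial>gauss v) = u2 rh"
 using prob_space.emeasure_space_1[OF prob_space_gauss[OF v]] by simp
 then show ?thesis by (simp add: add_increasing2)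
qed

context
 fixes M :: "'a measure" and n :: nat and xi :: "nat => 'a => real"
 assumes xi: "gaussian_incs M v n xi"
begin

abbreviation "kc k om \<equiv> chain (kstep et ga) 0 k (%i. xi i om)"

lemma kc_measurable: "k <= n ==> kc k \<in> borel_measurable M"
 using gaussian_incs_measurable[OF xi] by (intro measurable_chain measurable_kstep) auto

lemma u1_bound: "k <= n ==> (\<integral>\<^sup>+om. u1 (kc k om) \<partial>M) <= ennreal ((1/2) ^ k*exp (2 * s/3) + 2*C1)"
proof (induction k)
 case 0
 interpret prob_space M using xi by (simp add: gaussian_incs_def)
 have "(\<integral>\<^sup>+om. u1 (kc 0 om) \<partial>M) = u1 0" by (simp add: emeasure_space_1)
 also have "... <= ennreal (exp (2 * s/3))" by (auto simp: u1_def pot_def mult.commute)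
 finally show ?case by (rule order.trans) (auto intro!: ennreal_leI simp: C1_def)
next
 case (Suc k)
 have "(\<integral>\<^sup>+om. u1 (kc (Suc k) om) \<partial>M) <= ennreal (1/2)*(\<integral>\<^sup>+om. u1 (kc k om) \<partial>M) + ennreal C1"
 using Suc.prems by (intro chain_nn_integral_le[where S = borel, OF _ _ xi] measurable_kstep u1_step) auto
 also have "... <= ennreal (1/2)*ennreal ((1/2) ^ k*exp (2 * s/3) + 2*C1) + ennreal C1"
 using Suc by (intro add_right_mono mult_left_mono) auto
 also have "... = ennreal ((1/2) ^ Suc k*exp (2 * s/3) + 2*C1)"
 unfolding ennreal_mult'[OF order.refl[of "0::real", THEN order.trans], symmetric]
 by (subst ennreal_mult'[symmetric], simp, subst ennreal_plus[symmetric]) (auto simp: C1_def field_simps)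
 finally show ?case .
qed

lemma u2_bound: "k <= n ==> (\<integral>\<^sup>+om. u2 (kc k om) \<partial>M) <= ennreal (esc*(exp (2 * s/3)*(1 - (1/2) ^ k) + 2 * real k*C1))"
proof (induction k)
 case 0
 have "u2 0 = 0" using ga by (auto simp: u2_def indicator_def)
 then show ?case by simp
next
 case (Suc k)
 have [measurable]: "kc k \<in> borel_measurable M" using kc_measurable Suc.prems by auto
 let ?E = "exp (2 * s/3)"
 have pos: "esc > 0" "C1 > 0" by (auto simp: esc_def C1_def)
 have "(\<integral>\<^sup>+om. u2 (kc (Suc k) om) \<partial>M) <= 1*(\<integral>\<^sup>+om. u2 (kc k om) + ennreal esc*(ennreal (1/2)*u1 (kc k om)) \<partial>M) + ennreal (esc*C1)"
 using Suc.prems by (intro chain_nn_integral_le[where S = borel and u = "%rh. u2 rh + ennreal esc*(ennreal (1/2)*u1 rh)", OF _ _ xi] measurable_kstep u2_step) auto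
 also have "... = (\<integral>\<^sup>+om. u2 (kc k om) \<partial>M) + ennreal esc*(ennreal (1/2)*(\<integral>\<^sup>+om. u1 (kc k om) \<partial>M)) + ennreal (esc*C1)"
 by (simp add: nn_integral_add nn_integral_cmult)
 also have "... <= ennreal (esc*(?E*(1 - (1/2) ^ k) + 2 * real k*C1))
  + ennreal esc*(ennreal (1/2)*ennreal ((1/2) ^ k * ?E + 2*C1)) + ennreal (esc*C1)"
 using Suc by (intro add_mono mult_left_mono u1_bound order.refl) auto
 also have "... = ennreal (esc*(?E*(1 - (1/2) ^ k) + 2 * real k*C1) + esc*(1/2*((1/2) ^ k * ?E + 2*C1)) + esc*C1)"
 proof -
 have "0 <= ?E*(1 - (1/2) ^ k)" by (simp add: power_le_one)
 moreover have "0 <= (1/2) ^ k * ?E" by simp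
 ultimately have nn: "0 <= esc*(?E*(1 - (1/2) ^ k) + 2 * real k*C1)" "0 <= 1/2*((1/2) ^ k * ?E + 2*C1)"
  "0 <= esc*(1/2*((1/2) ^ k * ?E + 2*C1))" "0 <= esc*C1" "0 <= (1/2) ^ k * ?E + 2*C1"
  using pos by (auto intro!: mult_nonneg_nonneg add_nonneg_nonneg)
 show ?thesis
  using nn pos by (subst ennreal_mult'[symmetric], simp, subst ennreal_mult'[symmetric], simp,
  subst ennreal_plus[symmetric], simp, simp, subst ennreal_plus[symmetric], simp_all)
 qed
 also have "esc*(?E*(1 - (1/2) ^ k) + 2 * real k*C1) + esc*(1/2*((1/2) ^ k * ?E + 2*C1)) + esc*C1
 = esc*(?E*(1 - (1/2) ^ Suc k) + 2 * real (Suc k)*C1)"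
 by (simp add: field_simps)
 finally show ?case .
qed

lemma frozen_prob:
 "emeasure M {om\<in>space M. kc n om <= - 1 + ga} <= ennreal (esc*(exp (2 * s/3) + 2 * real n*C1))"
proof -
 have [measurable]: "kc n \<in> borel_measurable M" using kc_measurable by auto
 have "emeasure M {om\<in>space M. kc n om <= - 1 + ga} = (\<integral>\<^sup>+om. indicator {om\<in>space M. kc n om <= - 1 + ga} om \<partial>M)"
 by (subst nn_integral_indicator) auto
 also have "... = (\<integral>\<^sup>+om. u2 (kc n om) \<partial>M)" by (intro nn_integral_cong) (auto simp: u2_def indicator_def)
 also have "... <= ennreal (esc*(exp (2 * s/3)*(1 - (1/2) ^ n) + 2 * real n*C1))" by (rule u2_bound) simp
 also have "... <= ennreal (esc*(exp (2 * s/3) + 2 * real n*C1))"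
 by (intro ennreal_leI mult_left_mono add_right_mono) (auto simp: esc_def mult_left_le)
 finally show ?thesis .
qed

text \<open>Below 1/2 the Lyapunov function is at least \<open>exp (5*s/24)\<close>, so the expected
  number of such visits is much smaller than the number of steps, and Markov's inequality applies.
  The visits matter because p can be negative only near them, and negative p lowers its primitive in
  the upper bound.\<close>

lemma low_prob:
 assumes L: "L > 0"
 shows "emeasure M {om\<in>space M. L <= real (card {k. k < n & - 1 + ga < kc k om & kc k om < 1/2})}
 <= ennreal (exp (- 5 * s/24)*(2*exp (2 * s/3) + 2 * real n*C1)/L)"
proof -
 let ?P = "%k om. - 1 + ga < kc k om & kc k om < 1/2"
 let ?N = "%om. \<Sum>k<n. indicator {om\<in>space M. ?P k om} om :: ennreal"
 have km [measurable]: "{om\<in>space M. ?P k om} \<in> sets M" if "k < n" for k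
 using kc_measurable[of k] that by auto
 have Nm [measurable]: "?N \<in> borel_measurable M" using km by (intro borel_measurable_sum) auto
 have le: "indicator {om\<in>space M. ?P k om} om <= ennreal (exp (- 5 * s/24))*u1 (kc k om)" for k om
 proof (cases "?P k om")
 case True
 have "5/24 = pot (1/2)" by (simp add: pot_def power3_eq_cube)
 also have "... <= pot (kc k om)" using True by (intro pot_antimono) auto
 finally have "s*(5/24) <= s*pot (kc k om)" using s by (intro mult_left_mono) auto
 then show ?thesis using True by (auto simp: u1_def indicator_def ennreal_mult'[symmetric] exp_add[symmetric])
 qed auto
 have "(\<integral>\<^sup>+om. ?N om \<partial>M) = (\<Sum>k<n. \<integral>\<^sup>+om. indicator {om\<in>space M. ?P k om} om \<partial>M)"
 using km by (intro nn_integral_sum) auto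
 also have "... <= (\<Sum>k<n. ennreal (exp (- 5 * s/24)*((1/2) ^ k*exp (2 * s/3) + 2*C1)))"
 proof (intro sum_mono)
 fix k assume k: "k \<in> {..<n}"
 have [measurable]: "kc k \<in> borel_measurable M" using kc_measurable k by auto
 have "(\<integral>\<^sup>+om. indicator {om\<in>space M. ?P k om} om \<partial>M) <= (\<integral>\<^sup>+om. ennreal (exp (- 5 * s/24))*u1 (kc k om) \<partial>M)"
  by (intro nn_integral_mono le)
 also have "... = ennreal (exp (- 5 * s/24))*(\<integral>\<^sup>+om. u1 (kc k om) \<partial>M)" by (intro nn_integral_cmult) measurable
 also have "... <= ennreal (exp (- 5 * s/24))*ennreal ((1/2) ^ k*exp (2 * s/3) + 2*C1)"
  using k by (intro mult_left_mono u1_bound) auto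
 finally show "(\<integral>\<^sup>+om. indicator {om\<in>space M. ?P k om} om \<partial>M) <= ennreal (exp (- 5 * s/24)*((1/2) ^ k*exp (2 * s/3) + 2*C1))"
  by (simp add: ennreal_mult')
 qed
 also have "... = ennreal (\<Sum>k<n. exp (- 5 * s/24)*((1/2) ^ k*exp (2 * s/3) + 2*C1))"
 by (intro sum_ennreal) (auto simp: C1_def)
 also have "... <= ennreal (exp (- 5 * s/24)*(2*exp (2 * s/3) + 2 * real n*C1))"
 proof (rule ennreal_leI)
 have "(\<Sum>k<n. (1/2 :: real) ^ k) <= 2" by (simp add: geometric_sum)
 then have *: "(\<Sum>k<n. (1/2 :: real) ^ k)*exp (2 * s/3) <= 2*exp (2 * s/3)" by (rule mult_right_mono) simp
 have e: "(\<Sum>k<n. exp (- 5 * s/24)*((1/2) ^ k*exp (2 * s/3) + 2*C1))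
  = exp (- 5 * s/24)*((\<Sum>k<n. (1/2 :: real) ^ k)*exp (2 * s/3) + 2 * real n*C1)"
  unfolding sum_distrib_left[symmetric] sum.distrib unfolding sum_distrib_right[symmetric] by simp
 show "(\<Sum>k<n. exp (- 5 * s/24)*((1/2) ^ k*exp (2 * s/3) + 2*C1)) <= exp (- 5 * s/24)*(2*exp (2 * s/3) + 2 * real n*C1)"
  unfolding e by (rule mult_left_mono[OF add_right_mono[OF *]]) simp
 qed
 finally have EN: "(\<integral>\<^sup>+om. ?N om \<partial>M) <= ennreal (exp (- 5 * s/24)*(2*exp (2 * s/3) + 2 * real n*C1))" .
 have cardN: "ennreal (real (card {k. k < n & ?P k om})) = ?N om" if "om \<in> space M" for om
 proof -
 have "?N om = (\<Sum>k<n. if ?P k om then 1 else 0)" using that by (intro sum.cong) (auto simp: indicator_def)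
 also have "... = (\<Sum>k\<in>{..<n} \<inter> {k. ?P k om}. 1)" by (simp add: sum.If_cases)
 also have "... = ennreal (real (card ({..<n} \<inter> {k. ?P k om})))" by (simp only: sum_constant mult_1_right ennreal_of_nat_eq_real_of_nat)
 also have "{..<n} \<inter> {k. ?P k om} = {k. k < n & ?P k om}" by auto
 finally show ?thesis by simp
 qed
 define N where "N = ?N"
 have Nm' [measurable]: "N \<in> borel_measurable M" unfolding N_def by (rule Nm)
 have EN': "(\<integral>\<^sup>+om. N om \<partial>M) <= ennreal (exp (- 5 * s/24)*(2*exp (2 * s/3) + 2 * real n*C1))"
 unfolding N_def by (rule EN)
 have "{om\<in>space M. L <= real (card {k. k < n & ?P k om})} \<subseteq> {om\<in>space M. 1 <= ennreal (1/L)*N om}"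
 proof (rule subsetI)
 fix om assume "om \<in> {om\<in>space M. L <= real (card {k. k < n & ?P k om})}"
 then have om: "om \<in> space M" "L <= real (card {k. k < n & ?P k om})" by simp_all
 have "1 <= ennreal (1/L * real (card {k. k < n & ?P k om}))" using L om by (simp add: le_divide_eq)
 also have "... = ennreal (1/L)*ennreal (real (card {k. k < n & ?P k om}))" using L by (intro ennreal_mult') auto
 also have "... = ennreal (1/L)*N om" unfolding N_def by (simp only: cardN[OF om(1)])
 finally show "om \<in> {om\<in>space M. 1 <= ennreal (1/L)*N om}" using om(1) by simp
 qed
 then have "emeasure M {om\<in>space M. L <= real (card {k. k < n & ?P k om})} <= emeasure M {om\<in>space M. 1 <= ennreal (1/L)*N om}"
 by (rule emeasure_mono) measurable
 also have "... <= ennreal (1/L)*(\<integral>\<^sup>+om. N om*indicator (space M) om \<partial>M)"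
 by (rule nn_integral_Markov_inequality) measurable
 also have "(\<integral>\<^sup>+om. N om*indicator (space M) om \<partial>M) = (\<integral>\<^sup>+om. N om \<partial>M)" by (intro nn_integral_cong) auto
 also have "ennreal (1/L) * ... <= ennreal (1/L)*ennreal (exp (- 5 * s/24)*(2*exp (2 * s/3) + 2 * real n*C1))"
 by (rule mult_left_mono[OF EN']) simp
 also have "... = ennreal (exp (- 5 * s/24)*(2*exp (2 * s/3) + 2 * real n*C1)/L)"
 using L by (simp add: ennreal_mult'[symmetric])
 finally show ?thesis .
qed

end

end

subsection \<open>The almost sure behaviour of the noise\<close>

lemma gaussian_incs_scale:
 assumes "gaussian_incs M h n xi" "c ~= 0"
 shows "gaussian_incs M (c\<^sup>2*h) n (%i om. c*xi i om)"
proof -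
 interpret prob_space M using assms by (simp add: gaussian_incs_def)
 have h: "h > 0" using assms by (simp add: gaussian_incs_def)
 have "distributed M lborel (%om. c*xi i om) (normal_density 0 (sqrt (c\<^sup>2*h)))" if "i < n" for i
 proof -
 have "distributed M lborel (xi i) (normal_density 0 (sqrt h))" using assms that by (simp add: gaussian_incs_def)
 from normal_density_affine[OF this _ assms(2), of 0] h
 have "distributed M lborel (%om. 0 + c*xi i om) (normal_density (0 + c*0) (\<bar>c\<bar> * sqrt h))" by simp
 moreover have "sqrt (c\<^sup>2*h) = \<bar>c\<bar> * sqrt h" by (simp add: real_sqrt_mult)
 ultimately show ?thesis by simp
 qed
 moreover have "indep_vars (%_. borel) (%i om. c*xi i om) {..<n}"
 proof -
 have "indep_vars (%_. borel) xi {..<n}" using assms by (simp add: gaussian_incs_def)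
 then show ?thesis by (rule indep_vars_compose2) simp
 qed
 ultimately show ?thesis using assms h prob_space_axioms by (simp add: gaussian_incs_def)
qed

definition osc_ok :: "(real => real) => real => (nat => real) => bool" where
 "osc_ok w b u \<longleftrightarrow> (\<forall>k::nat. \<forall>y\<in>{real k*b..real k*b + b}. \<bar>w y - w (real k*b)\<bar> <= u k)"

lemma inverse_one_minus_exp: "(x::real) > 0 ==> 1/(1 - exp (- x)) <= 1 + 1/x"
proof -
 assume x: "x > 0"
 have "x/(1 + x) <= 1 - exp (- x)"
 proof -
 have "exp (- x) = 1/exp x" by (simp add: exp_minus divide_inverse)
 also have "... <= 1/(1 + x)" using x exp_ge_add_one_self[of x] by (intro divide_left_mono mult_pos_pos) auto
 finally show ?thesis using x by (simp add: field_simps)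
 qed
 then have "1/(1 - exp (- x)) <= 1/(x/(1 + x))" using x by (intro divide_left_mono mult_pos_pos) auto
 also have "... = 1 + 1/x" using x by (simp add: field_simps)
 finally show ?thesis .
qed

text \<open>A union bound over all cells of the half-line: the thresholds grow with distance, so
  that the failure probabilities are dominated by a geometric series.\<close>

lemma oscillation_event:
 assumes M: "prob_space M" and B: "brownian_motion_on M {0..} x B" and b: "b > 0"
 and u: "\<And>k. u k > 0" "\<And>k. (u k)\<^sup>2/(2*b) >= \<alpha> + be * real k" and be: "be > 0"
 obtains A where "A \<in> sets M" "emeasure M A <= ennreal (2*exp (- \<alpha>)*(1 + 1/be))"
 "\<And>om. om \<in> space M - A ==> continuous_on {0..} (%t. B t om) ==> osc_ok (%t. B t om) b u"
proof -
 have "\<exists>A. A \<in> sets M & emeasure M A <= ennreal (2*exp (- (u k)\<^sup>2/(2*b))) &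
 (\<forall>om. om \<in> space M - A --> continuous_on {0..} (%t. B t om) -->
  (\<forall>y\<in>{real k*b..real k*b + b}. \<bar>B y om - B (real k*b) om\<bar> <= u k))" for k
 proof -
 have "{real k*b..real k*b + b} \<subseteq> {0..}" using b by (auto intro: order.trans[of 0 "real k*b"])
 from brownian_oscillation[OF M B b this u(1)[of k]] show ?thesis by metis
 qed
 then obtain A where A: "\<And>k. A k \<in> sets M" "\<And>k. emeasure M (A k) <= ennreal (2*exp (- (u k)\<^sup>2/(2*b)))"
 "\<And>k om. om \<in> space M - A k ==> continuous_on {0..} (%t. B t om) ==>
  (\<forall>y\<in>{real k*b..real k*b + b}. \<bar>B y om - B (real k*b) om\<bar> <= u k)"
 by metis
 have le: "2*exp (- (u k)\<^sup>2/(2*b)) <= 2*exp (- \<alpha>)*exp (- be) ^ k" for k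
 using u(2)[of k] by (simp add: exp_add[symmetric] exp_of_nat_mult[symmetric] mult.commute)
 have sm: "(%k. 2*exp (- \<alpha>)*exp (- be) ^ k) sums (2*exp (- \<alpha>)*(1/(1 - exp (- be))))"
 using be by (intro sums_mult geometric_sums) auto
 show ?thesis
 proof (rule that[of "\<Union>k. A k"])
 have "emeasure M (\<Union>k. A k) <= (\<Sum>k. emeasure M (A k))"
  using A(1) by (intro emeasure_subadditive_countably) auto
 also have "... <= (\<Sum>k. ennreal (2*exp (- \<alpha>)*exp (- be) ^ k))"
  using A(2) le by (intro suminf_le order.trans[OF A(2)] ennreal_leI) auto
 also have "... = ennreal (2*exp (- \<alpha>)*(1/(1 - exp (- be))))"
  using sm by (intro suminf_ennreal_eq) auto
 also have "... <= ennreal (2*exp (- \<alpha>)*(1 + 1/be))"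
  using be by (intro ennreal_leI mult_left_mono inverse_one_minus_exp) auto
 finally show "emeasure M (\<Union>k. A k) <= ennreal (2*exp (- \<alpha>)*(1 + 1/be))" .
 qed (use A in \<open>auto simp: osc_ok_def\<close>)
qed

text \<open>For \<open>si = 0\<close> this is the solution \<open>m\<close> of
  \<open>2*m^3/(3*thh^2) = j\<close>, at which both the Kramers cost and the energy of the tanh
  profile equal \<open>j\<close>. Positive \<open>si\<close> makes explosions too rare to occur,
  negative \<open>si\<close> makes the profile likely to occur.\<close>

definition mm :: "real => real => real => real" where
 "mm thh si j = root 3 (3/2*thh\<^sup>2*(1 + si)*j)"

lemma mm_cube: "mm thh si j ^ 3 = 3/2*thh\<^sup>2*(1 + si)*j"
 by (simp add: mm_def odd_real_root_pow)

lemma mm_pos: "thh > 0 ==> si > -1 ==> j > 0 ==> mm thh si j > 0"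
 by (simp add: mm_def)

definition rho :: "(real => real) => real => real => real => real => real => nat => real" where
 "rho w thh m b et ga k = chain (kstep et ga) 0 k (%i. 2*thh/m*(w (real (Suc i)*b) - w (real i*b)))"

definition kr_ok :: "(real => real) => real => real => real => real => real => nat => real => bool" where
 "kr_ok w thh m b et ga n L \<longleftrightarrow> - 1 + ga < rho w thh m b et ga n &
 real (card {k. k < n & - 1 + ga < rho w thh m b et ga k & rho w thh m b et ga k < 1/2}) < L"

text \<open>The barrier 4/3 yields the escape factor \<open>exp (- (1 + de/2 - de/32)*j)\<close>,
  which outweighs the at most \<open>exp ((1 + de/16)*j)\<close> steps. For the visits below 1/2, an
  expected number of order \<open>exp (29/32*j)\<close> is compared with the level
  \<open>exp (31/32*j)\<close>, which is still negligible against \<open>exp j\<close>.\<close>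

lemma kramers_event:
 assumes M: "prob_space M" and B: "brownian_motion_on M {0..} x B" and thh: "thh > 0"
 and de: "0 < de" "de <= 1/2" and ga: "0 < ga" "ga <= 1/2" "ga\<^sup>2 <= de/64"
 and et: "0 < et" "32*et <= de*ga\<^sup>2"
 and j: "j > 0" and N: "real n <= exp ((1 + de/16)*j)" and large: "2*exp (- j*et\<^sup>2) <= 1/2"
 defines "m \<equiv> mm thh de j" and "b \<equiv> et/mm thh de j"
 shows "{om\<in>space M. \<not> kr_ok (%t. B t om) thh m b et ga n (exp (31/32*j))} \<in> sets M"
 "emeasure M {om\<in>space M. \<not> kr_ok (%t. B t om) thh m b et ga n (exp (31/32*j))} <= ennreal (11*exp (- de*j/8))"
proof -
 have m: "m > 0" using thh de j by (simp add: m_def mm_pos)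
 have b: "b > 0" using m et by (simp add: b_def m_def)
 define v where "v = (2*thh/m)\<^sup>2*b"
 \<comment> \<open>With \<open>v\<close> the variance of the rescaled increments and
   \<open>m^3 = 3/2*thh^2*(1 + de)*j\<close>, this is the value for which
   \<open>s*v = 2*(1 - de/4)*et\<close>.\<close>
 define s where "s = (1 - de/4)*(3/4)*(1 + de)*j"
 have v: "v > 0" using b m thh by (simp add: v_def)
 have m3: "m ^ 3 = 3/2*thh\<^sup>2*(1 + de)*j" by (simp add: m_def mm_cube)
 have "v * m ^ 3 = 4*thh\<^sup>2*et"
 using m by (simp add: v_def b_def m_def[symmetric] power2_eq_square power3_eq_cube)
 then have "v * (3/2*thh\<^sup>2*(1 + de)*j) = 4*thh\<^sup>2*et" unfolding m3 .
 then have "v * ((1 + de)*j)*thh\<^sup>2 = (8/3*et)*thh\<^sup>2" by (simp add: algebra_simps)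
 then have vj: "v * ((1 + de)*j) = 8/3*et" using thh by simp
 have "s * v = (1 - de/4)*(3/4)*(v * ((1 + de)*j))" by (simp add: s_def mult_ac)
 then have "s * v = (1 - de/4)*(3/4*(8/3*et))" unfolding vj by (simp only: mult.assoc)
 also have "... = 2*(1 - de/4)*et" by (simp add: algebra_simps)
 finally have sv: "s * v = 2*(1 - de/4)*et" .
 have dd: "de*de <= de*(1/2)" using de by (intro mult_left_mono) auto
 have f: "1 + de/2 <= (1 - de/4)*(1 + de)" "(1 - de/4)*(1 + de) <= 7/4"
 proof -
 have "(1 - de/4)*(1 + de) = 1 + 3/4*de - de*de/4" by (simp add: field_simps)
 then show "1 + de/2 <= (1 - de/4)*(1 + de)" "(1 - de/4)*(1 + de) <= 7/4"
  using de dd zero_le_square[of de] by linarith+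
 qed
 have s1: "s >= 3/4*(1 + de/2)*j" "s <= 21/16*j"
 using mult_right_mono[OF f(1), of "3/4*j"] mult_right_mono[OF f(2), of "3/4*j"] j by (auto simp: s_def mult_ac)
 have dj: "0 <= de*j" using de j by simp
 have s2: "s >= 3/4*j"
 proof -
 have "3/4*(1 + de/2)*j = 3/4*j + 3/8*(de*j)" by (simp add: field_simps)
 then show ?thesis using s1(1) dj by linarith
 qed
 have s0: "s > 0" using s2 j by linarith
 have g2: "ga\<^sup>2 <= 1/4" using ga power_mono[of ga "1/2" 2] by (simp add: power2_eq_square)
 have et2: "et <= de/64" using et ga de mult_left_mono[OF g2, of de] by linarith
 have et3: "2*et\<^sup>2 <= de/64"
 proof -
 have "et*et <= et*(1/2)" using et2 et de by (intro mult_left_mono) auto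
 then show ?thesis using et2 by (simp add: power2_eq_square)
 qed
 interpret K: kramers de et ga s v
 proof
 have "- 2 * s*et\<^sup>2 <= - j*et\<^sup>2" using s2 j by (simp add: mult_right_mono)
 then have "exp (- 2 * s*et\<^sup>2) <= exp (- j*et\<^sup>2)" by simp
 then show "2*exp (- 2 * s*et\<^sup>2) <= 1/2" using large by linarith
 qed (use de et ga et2 s0 v sv in auto)
 have inc: "gaussian_incs M b n (%i om. B (0 + real (Suc i)*b) om - B (0 + real i*b) om)"
 using b by (intro brownian_gaussian_incs[OF M B]) auto
 from gaussian_incs_scale[OF this, of "2*thh/m"] thh m
 have X: "gaussian_incs M v n (%i om. 2*thh/m*(B (real (Suc i)*b) om - B (real i*b) om))"
 by (simp add: v_def)
 let ?L = "exp (31/32*j)"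
 let ?r = "%k om. rho (%t. B t om) thh m b et ga k"
 let ?A1 = "{om\<in>space M. ?r n om <= - 1 + ga}"
 let ?A2 = "{om\<in>space M. ?L <= real (card {k. k < n & - 1 + ga < ?r k om & ?r k om < 1/2})}"
 have eq: "{om\<in>space M. \<not> kr_ok (%t. B t om) thh m b et ga n ?L} = ?A1 \<union> ?A2"
 by (auto simp: kr_ok_def not_le not_less)
 have rm [measurable]: "?r k \<in> borel_measurable M" if "k <= n" for k
 unfolding rho_def using K.kc_measurable[OF X that] by simp
 have A1: "?A1 \<in> sets M" by measurable
 have A2: "?A2 \<in> sets M"
 proof -
 have "real (card {k. k < n & - 1 + ga < ?r k om & ?r k om < 1/2})
  = (\<Sum>k<n. if - 1 + ga < ?r k om & ?r k om < 1/2 then 1 else 0)" for om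
 proof -
  have "(\<Sum>k<n. if - 1 + ga < ?r k om & ?r k om < 1/2 then 1 else 0 :: real)
  = (\<Sum>k\<in>{..<n} \<inter> {k. - 1 + ga < ?r k om & ?r k om < 1/2}. 1)" by (simp add: sum.If_cases)
  also have "{..<n} \<inter> {k. - 1 + ga < ?r k om & ?r k om < 1/2} = {k. k < n & - 1 + ga < ?r k om & ?r k om < 1/2}" by auto
  finally show ?thesis by simp
 qed
 moreover have "(%om. \<Sum>k<n. if - 1 + ga < ?r k om & ?r k om < 1/2 then 1 else 0 :: real) \<in> borel_measurable M"
  using rm by (intro borel_measurable_sum) (auto intro!: measurable_If)
 ultimately show ?thesis by simp
 qed
 have C1: "K.C1 <= 2*exp (de*j/16)"
 proof -
 have "s*(ga\<^sup>2 + 2*et\<^sup>2) <= (21/16*j)*(de/32)"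
  using s1 s0 ga(3) et3 de j by (intro mult_mono) auto
 also have "... <= de*j/16" using j de by simp
 finally show ?thesis by (simp add: K.C1_def)
 qed
 have NC: "2 * real n*K.C1 <= 4*exp ((1 + de/8)*j)"
 proof -
 have "real n*K.C1 <= exp ((1 + de/16)*j)*(2*exp (de*j/16))"
  using N C1 by (intro mult_mono) (auto simp: K.C1_def)
 also have "... = 2*exp ((1 + de/8)*j)" by (simp add: exp_add[symmetric] algebra_simps)
 finally show ?thesis by simp
 qed
 have esc: "K.esc <= exp (- (1 + de/2 - de/32)*j)"
 proof -
 have "s*ga\<^sup>2 <= (21/16*j)*(de/64)" using s1 s0 ga(3) j by (intro mult_mono) auto
 also have "... <= de/32*j" using j de by simp
 finally have "s*ga\<^sup>2 <= de/32*j" .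
 moreover have "s*(4/3) >= (1 + de/2)*j" using s1(1) by (simp add: algebra_simps)
 ultimately have "- s*(4/3 - ga\<^sup>2) <= - (1 + de/2 - de/32)*j" by (simp add: algebra_simps)
 then show ?thesis by (simp add: K.esc_def)
 qed
 have e78: "exp (2 * s/3) <= exp ((1 + de/8)*j)"
 proof -
 have "(1 + de/8)*j = j + de*j/8" by (simp add: field_simps)
 then show ?thesis using s1(2) dj j by (simp only: exp_le_cancel_iff)
 qed
 have "emeasure M ?A1 <= ennreal (K.esc*(exp (2 * s/3) + 2 * real n*K.C1))"
 using K.frozen_prob[OF X] by (simp add: rho_def)
 also have "... <= ennreal (5*exp (- de*j/8))"
 proof (rule ennreal_leI)
 have "K.esc*(exp (2 * s/3) + 2 * real n*K.C1) <= exp (- (1 + de/2 - de/32)*j)*(5*exp ((1 + de/8)*j))"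
 proof (rule mult_mono[OF esc])
  show "exp (2 * s/3) + 2 * real n*K.C1 <= 5*exp ((1 + de/8)*j)" using e78 NC by linarith
 qed (auto simp: K.C1_def)
 also have "... = 5*exp (- (11/32)*de*j)" by (simp add: exp_add[symmetric] algebra_simps)
 also have "... <= 5*exp (- de*j/8)" using de j by simp
 finally show "K.esc*(exp (2 * s/3) + 2 * real n*K.C1) <= 5*exp (- de*j/8)" .
 qed
 finally have P1: "emeasure M ?A1 <= ennreal (5*exp (- de*j/8))" .
 have "emeasure M ?A2 <= ennreal (exp (- 5 * s/24)*(2*exp (2 * s/3) + 2 * real n*K.C1) / ?L)"
 using K.low_prob[OF X, of ?L] by (simp add: rho_def)
 also have "... <= ennreal (6*exp (- de*j/8))"
 proof (rule ennreal_leI)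
 have "exp (- 5 * s/24)*exp (2 * s/3) <= exp (29/32*j)"
  unfolding exp_add[symmetric] using s1(2) j by simp
 moreover have "exp (- 5 * s/24)*(2 * real n*K.C1) <= 4*exp (29/32*j)"
 proof -
  have "exp (- 5 * s/24)*(2 * real n*K.C1) <= exp (- 5/32*j)*(4*exp ((1 + de/8)*j))"
  proof (rule mult_mono[OF _ NC])
  show "exp (- 5 * s/24) <= exp (- 5/32*j)" using s2 by simp
  qed (auto simp: K.C1_def)
  also have "... = 4*exp ((27/32 + de/8)*j)" by (simp add: exp_add[symmetric] algebra_simps)
  also have "... <= 4*exp (29/32*j)" using de j by simp
  finally show ?thesis .
 qed
 ultimately have "exp (- 5 * s/24)*(2*exp (2 * s/3) + 2 * real n*K.C1) <= 6*exp (29/32*j)"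
 proof -
  assume a: "exp (- 5 * s/24)*exp (2 * s/3) <= exp (29/32*j)"
  and b: "exp (- 5 * s/24)*(2 * real n*K.C1) <= 4*exp (29/32*j)"
  have "exp (- 5 * s/24)*(2*exp (2 * s/3) + 2 * real n*K.C1)
  = 2*(exp (- 5 * s/24)*exp (2 * s/3)) + exp (- 5 * s/24)*(2 * real n*K.C1)"
  by (simp only: distrib_left mult.left_commute[of 2])
  with a b show ?thesis by linarith
 qed
 then have "exp (- 5 * s/24)*(2*exp (2 * s/3) + 2 * real n*K.C1) / ?L <= 6*exp (29/32*j) / ?L"
  by (intro divide_right_mono) auto
 also have "... = 6*exp (- j/16)"
 proof -
  have "exp (29/32*j) = exp (- j/16)*exp (31/32*j)" unfolding exp_add[symmetric] by simp
  then show ?thesis by simp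
 qed
 also have "... <= 6*exp (- de*j/8)" using de j by simp
 finally show "exp (- 5 * s/24)*(2*exp (2 * s/3) + 2 * real n*K.C1) / ?L <= 6*exp (- de*j/8)" .
 qed
 finally have P2: "emeasure M ?A2 <= ennreal (6*exp (- de*j/8))" .
 show "{om\<in>space M. \<not> kr_ok (%t. B t om) thh m b et ga n ?L} \<in> sets M" unfolding eq using A1 A2 by auto
 have "emeasure M (?A1 \<union> ?A2) <= emeasure M ?A1 + emeasure M ?A2" using A1 A2 by (intro emeasure_subadditive) auto
 also have "... <= ennreal (5*exp (- de*j/8)) + ennreal (6*exp (- de*j/8))" by (intro add_mono P1 P2)
 also have "... = ennreal (11*exp (- de*j/8))" by (subst ennreal_plus[symmetric]) auto
 finally show "emeasure M {om\<in>space M. \<not> kr_ok (%t. B t om) thh m b et ga n ?L} <= ennreal (11*exp (- de*j/8))"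
 unfolding eq .
qed

text \<open>As \<open>b = et/m\<close> and \<open>m^3\<close> is of order \<open>thh^2*j\<close>,
  the factor in front of the last root is of order \<open>sqrt (b*j)\<close>, a size exceeded on one
  cell with probability exponentially small in \<open>j\<close>. The last root makes the exponent
  grow linearly in \<open>k\<close>, so that all cells can be summed.\<close>

definition ou :: "real => real => real => real => real => nat => real" where
 "ou thh et m b R k = 3 * sqrt et*m/thh * sqrt (1 + real k*b/R)"

text \<open>The radius is a multiple of \<open>m*exp j\<close> and not of \<open>exp j\<close>: the
  process weighted by the exponential has a drift of order \<open>m\<close> and may travel that far
  by time \<open>exp j\<close>. Only one half-line is constrained; the reflected path gives the
  other.\<close>

definition up_ok :: "real => real => real => real => real => nat => (real => real) => bool" where
 "up_ok thh de et ga K j w \<longleftrightarrow>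
 (let m = mm thh de j; b = et/m; R = K*exp j*m in
  osc_ok w b (ou thh et m b R) & kr_ok w thh m b et ga (nat \<lceil>R/b\<rceil>) (exp (31/32*j)))"

text \<open>The property \<open>P\<close> may fail to be measurable: it is required only outside
  measurable sets of summable measure, and only on outcomes with the almost sure property
  \<open>Q\<close>, such as continuity of the path.\<close>

lemma borel_cantelli_exp:
 assumes M: "prob_space M" and c: "c > 0"
 and A: "\<And>j. j >= J ==> \<exists>A\<in>sets M. emeasure M A <= ennreal (C*exp (- c * real j)) & (\<forall>om\<in>space M - A. Q om --> P j om)"
 and Q: "AE om in M. Q om"
 shows "AE om in M. \<forall>\<^sub>F j in sequentially. P j om"
proof -
 interpret prob_space M by fact
 obtain A where A': "\<And>j. j >= J ==> A j \<in> sets M" "\<And>j. j >= J ==> emeasure M (A j) <= ennreal (C*exp (- c * real j))"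
 "\<And>j om. j >= J ==> om \<in> space M - A j ==> Q om ==> P j om" using A by metis
 define D where "D j = A (J + j)" for j
 have D: "D j \<in> sets M" for j using A' by (simp add: D_def)
 have *: "measure M (D j) <= max C 0*exp (- c) ^ j" for j
 proof -
 have "ennreal (measure M (D j)) <= ennreal (C*exp (- c * real (J + j)))"
  unfolding D_def emeasure_eq_measure[symmetric] by (rule A'(2)) simp
 also have "... <= ennreal (max C 0*exp (- c) ^ j)"
 proof (rule ennreal_leI)
  have "exp (- c * real (J + j)) <= exp (- c * real j)" using c by simp
  also have "... = exp (- c) ^ j" by (simp add: exp_of_nat_mult[symmetric] mult.commute)
  finally show "C*exp (- c * real (J + j)) <= max C 0*exp (- c) ^ j" by (intro mult_mono) auto
 qed
 finally show ?thesis by (subst (asm) ennreal_le_iff) auto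
 qed
 have "summable (%j. max C 0*exp (- c) ^ j)" using c by (intro summable_mult summable_geometric) auto
 then have "summable (%j. measure M (D j))"
 by (rule summable_comparison_test') (use*in auto)
 from borel_cantelli_AE1[OF D _ this]
 have "AE om in M. \<forall>\<^sub>F j in sequentially. om \<in> space M - D j" by (auto simp: emeasure_eq_measure)
 with Q show ?thesis
 proof eventually_elim
 case (elim om)
 have "\<forall>\<^sub>F j in sequentially. P (J + j) om"
  using elim(2) by (rule eventually_mono) (use A'(3) elim(1) in \<open>auto simp: D_def\<close>)
 then show ?case using eventually_sequentially_seg[of "%j. P j om" J] by (simp add: add.commute)
 qed
qed

lemma up_ok_AE:
 assumes M: "prob_space M" and B: "brownian_motion_on M {0..} x B" and thh: "thh > 0"
 and de: "0 < de" "de <= 1/2" and ga: "0 < ga" "ga <= 1/2" "ga\<^sup>2 <= de/64"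
 and et: "0 < et" "32*et <= de*ga\<^sup>2" and K: "K > 0"
 shows "AE om in M. \<forall>\<^sub>F j in sequentially. up_ok thh de et ga K j (%t. B t om)"
proof -
 define c where "c = 3/2*thh\<^sup>2*(1 + de)"
 have c: "c > 0" using thh de by (simp add: c_def)
 \<comment> \<open>The number \<open>R/b\<close> of cells is \<open>exp j\<close> times a polynomial
   in \<open>j\<close>, and for large \<open>j\<close> the factor \<open>exp (de/16*j)\<close>
   absorbs the polynomial.\<close>
 have "\<forall>\<^sub>F j :: real in at_top. K*(c*j + 1)/et + 1 <= exp (de/16*j)"
 using c K et de by real_asymp
 moreover have "\<forall>\<^sub>F j :: real in at_top. 2*exp (- j*et\<^sup>2) <= 1/2"
 using et by real_asymp
 ultimately have "\<forall>\<^sub>F j :: real in at_top. j >= 1 & K*(c*j + 1)/et + 1 <= exp (de/16*j) & 2*exp (- j*et\<^sup>2) <= 1/2"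
 using eventually_ge_at_top[of 1] by eventually_elim auto
 then have "\<forall>\<^sub>F j in sequentially. real j >= 1 & K*(c * real j + 1)/et + 1 <= exp (de/16 * real j) & 2*exp (- real j*et\<^sup>2) <= 1/2"
 by (rule eventually_compose_filterlim[OF _ filterlim_real_sequentially])
 then obtain J where J: "\<And>j. j >= J ==> real j >= 1 & K*(c * real j + 1)/et + 1 <= exp (de/16 * real j) & 2*exp (- real j*et\<^sup>2) <= 1/2"
 unfolding eventually_sequentially by blast
 have Q: "AE om in M. continuous_on {0..} (%t. B t om)" using B by (simp add: brownian_motion_on_def)
 show ?thesis
 proof (rule borel_cantelli_exp[OF M _ _ Q, of "de/8" J 15])
 fix j assume "j >= J"
 note Jj = J[OF this]
 define m where "m = mm thh de j"
 define b where "b = et/m"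
 define R where "R = K*exp (real j)*m"
 have m: "m > 0" using thh de Jj by (simp add: m_def mm_pos)
 have b: "b > 0" using m et by (simp add: b_def)
 have R: "R > 0" using m K by (simp add: R_def)
 have m3: "m ^ 3 = c*j" by (simp add: m_def mm_cube c_def)
 have m2: "m\<^sup>2 <= c*j + 1"
 proof (cases "m <= 1")
  case True
  then have "m\<^sup>2 <= 1" using m by (simp add: power_le_one)
  then show ?thesis using c by (simp add: add_increasing)
 next
  case False
  then have "m\<^sup>2*1 <= m\<^sup>2*m" by (intro mult_left_mono) auto
  then show ?thesis using m3 by (simp add: power2_eq_square power3_eq_cube)
 qed
 have Rb: "R/b = exp (real j)*(K*m\<^sup>2/et)" using m et by (simp add: R_def b_def power2_eq_square)
 have "K*m\<^sup>2/et + 1 <= exp (de/16*j)"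
  using m2 K et Jj by (intro order.trans[OF _ conjunct1[OF conjunct2[OF Jj]]] add_right_mono divide_right_mono mult_left_mono) auto
 then have "exp (real j)*(K*m\<^sup>2/et + 1) <= exp (real j)*exp (de/16*j)" by (intro mult_left_mono) auto
 moreover have "exp (real j)*(K*m\<^sup>2/et) + 1 <= exp (real j)*(K*m\<^sup>2/et + 1)"
  by (simp add: distrib_left)
 moreover have "exp (real j)*exp (de/16*j) = exp ((1 + de/16)*j)"
  by (simp add: exp_add[symmetric] algebra_simps)
 ultimately have Rb1: "R/b + 1 <= exp ((1 + de/16)*j)"
  unfolding Rb by linarith
 define n where "n = nat \<lceil>R/b\<rceil>"
 have n: "real n <= R/b + 1" using R b by (simp add: n_def)
 let ?A = "{om\<in>space M. \<not> kr_ok (%t. B t om) thh m b et ga n (exp (31/32*j))}"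
 have kr: "?A \<in> sets M" "emeasure M ?A <= ennreal (11*exp (- de*j/8))"
 proof -
  have j0: "real j > 0" and N: "real n <= exp ((1 + de/16) * real j)"
  and l: "2*exp (- real j*et\<^sup>2) <= 1/2" using Jj n Rb1 by auto
  note k = kramers_event[OF M B thh de ga et j0 N l, folded m_def, folded b_def]
  show "?A \<in> sets M" "emeasure M ?A <= ennreal (11*exp (- de*j/8))" using k by auto
 qed
 \<comment> \<open>The reciprocal of this rate is the number \<open>R/b\<close> of cells divided by
   \<open>6*j\<close>, so the union over all cells of the half-line costs no more than order
   \<open>R/b\<close> cells, which the factor \<open>exp (- 6*j)\<close> outweighs.\<close>
 let ?be = "6 * real j*b/R"
 have be: "?be > 0" using b R Jj by simp
 have u: "ou thh et m b R k > 0" for k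
  using m et thh b R by (auto simp: ou_def intro!: mult_pos_pos divide_pos_pos add_pos_nonneg)
 have uu: "(ou thh et m b R k)\<^sup>2/(2*b) >= 6 * real j + ?be * real k" for k
 proof -
  have "(ou thh et m b R k)\<^sup>2 = 9*et*m\<^sup>2/thh\<^sup>2*(1 + real k*b/R)"
  using et b R by (simp add: ou_def power_mult_distrib power_divide)
  then have "(ou thh et m b R k)\<^sup>2/(2*b) = 9/2*(m ^ 3/thh\<^sup>2)*(1 + real k*b/R)"
  proof -
  have "9*et*m\<^sup>2/thh\<^sup>2*X/(2*(et/m)) = 9/2*(m ^ 3/thh\<^sup>2)*X" for X
  using et m by (simp add: power2_eq_square power3_eq_cube mult_ac)
  then show ?thesis unfolding \<open>(ou thh et m b R k)\<^sup>2 = _\<close> by (simp only: b_def)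
  qed
  also have "m ^ 3/thh\<^sup>2 = 3/2*(1 + de)*j" using thh by (simp add: m3 c_def)
  also have "9/2*(3/2*(1 + de)*j)*(1 + real k*b/R) >= 6 * real j*(1 + real k*b/R)"
  proof (rule mult_right_mono)
  have "9/2*(3/2*(1 + de) * real j) = 27/4 * real j + 27/4*(de * real j)" by (simp add: field_simps)
  moreover have "0 <= de * real j" using de by simp
  ultimately show "6 * real j <= 9/2*(3/2*(1 + de) * real j)" by linarith
  qed (use b R in auto)
  finally show ?thesis by (simp add: algebra_simps)
 qed
 obtain A where A: "A \<in> sets M" "emeasure M A <= ennreal (2*exp (- (6 * real j))*(1 + 1 / ?be))"
  "\<And>om. om \<in> space M - A ==> continuous_on {0..} (%t. B t om) ==> osc_ok (%t. B t om) b (ou thh et m b R)"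
  using oscillation_event[OF M B b u uu be] by blast
 have "2*exp (- (6 * real j))*(1 + 1 / ?be) <= 4*exp (- (de/8)*j)"
 proof -
  have "1 / ?be = R/b/(6*j)" using b R by simp
  also have "... <= R/b/1" using b R Jj by (intro divide_left_mono) auto
  also have "... <= exp ((1 + de/16)*j)" using Rb1 by simp
  finally have "1 / ?be <= exp ((1 + de/16)*j)" .
  moreover have "1 <= exp ((1 + de/16)*j)" using de by simp
  ultimately have "1 + 1 / ?be <= 2*exp ((1 + de/16)*j)" by linarith
  then have "2*exp (- (6 * real j))*(1 + 1 / ?be) <= 2*exp (- (6 * real j))*(2*exp ((1 + de/16)*j))"
  by (intro mult_left_mono) auto
  also have "... = 4*exp ((de/16 - 5)*j)" by (simp add: exp_add[symmetric] algebra_simps)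
  also have "... <= 4*exp (- (de/8)*j)"
  proof -
  have "(de/16 - 5) * real j <= - (de/8) * real j" using de by (intro mult_right_mono) auto
  then show ?thesis by simp
  qed
  finally show ?thesis .
 qed
 then have A2: "emeasure M A <= ennreal (4*exp (- (de/8)*j))" using A(2) by (meson ennreal_leI order.trans)
 show "\<exists>A\<in>sets M. emeasure M A <= ennreal (15*exp (- (de/8) * real j)) &
  (\<forall>om\<in>space M - A. continuous_on {0..} (%t. B t om) --> up_ok thh de et ga K j (%t. B t om))"
 proof (intro bexI[of _ "?A \<union> A"] conjI ballI impI)
  have "emeasure M (?A \<union> A) <= emeasure M ?A + emeasure M A" using kr A by (intro emeasure_subadditive) auto
  also have "... <= ennreal (11*exp (- (de/8)*j)) + ennreal (4*exp (- (de/8)*j))"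
  using kr A2 by (intro add_mono) auto
  also have "... = ennreal (15*exp (- (de/8)*j))" by (subst ennreal_plus[symmetric]) auto
  finally show "emeasure M (?A \<union> A) <= ennreal (15*exp (- (de/8) * real j))" .
 next
  fix om assume "om \<in> space M - (?A \<union> A)" "continuous_on {0..} (%t. B t om)"
  then show "up_ok thh de et ga K j (%t. B t om)"
  using A(3) by (auto simp: up_ok_def Let_def m_def b_def R_def n_def)
 qed (use kr A in auto)
 qed (use de in simp)
qed

subsection \<open>Mollification\<close>

lemma continuous_on_UNIV_comp:
 fixes g :: "real => real"
 assumes "continuous_on UNIV g" "continuous_on S f" shows "continuous_on S (%x. g (f x))"
 using continuous_on_compose2[OF assms] by simp

text \<open>Here \<open>D n\<close> is the n-th derivative of one mollifier. As
  \<open>ep < 1\<close>, integration over the fixed window from -1 to 1 serves every mollification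
  scale.\<close>

locale kernel =
 fixes D :: "nat => real => real" and ep :: real
 assumes eps: "0 < ep" "ep < 1"
 and deriv: "\<And>n x. (D n has_real_derivative D (Suc n) x) (at x)"
 and supp: "\<And>n x. \<bar>x\<bar> > ep ==> D n x = 0"
 and nonneg: "\<And>x. D 0 x >= 0"
 and total: "integral {-1..1} (D 0) = 1"
begin

lemma cont_D: "continuous_on S (D n)"
 using deriv by (meson DERIV_continuous continuous_at_imp_continuous_on)

text \<open>Since \<open>g\<close> is evaluated at \<open>y + z\<close>, each derivative in
  \<open>y\<close> brings a minus sign; \<open>- conv w 1\<close> is the mollified derivative of
  \<open>w\<close>.\<close>

definition conv :: "(real => real) => nat => real => real" where
 "conv g n y = integral {-1..1} (%z. g (y + z)*D n z)"

lemma conv_cont: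
 assumes g: "continuous_on UNIV g" shows "continuous_on S (%z. g (y + z)*D n z)"
 by (intro continuous_on_mult cont_D continuous_on_UNIV_comp[OF g] continuous_on_add continuous_on_const continuous_on_id)

lemma conv_integrable: "continuous_on UNIV g ==> (%z. g (y + z)*D n z) integrable_on {a..b}"
 by (intro integrable_continuous_interval conv_cont)

text \<open>The shift of variable moves all dependence on \<open>y\<close> into the kernel, so that
  differentiation under the integral asks no smoothness of \<open>g\<close>. The freedom in the
  window lets one interval serve a whole neighbourhood of \<open>y\<close>.\<close>

lemma conv_eq:
 assumes g: "continuous_on UNIV g" and ab: "a <= y - 1" "y + 1 <= b"
 shows "conv g n y = integral {a..b} (%u. g u*D n (u - y))"
proof -
 have c: "continuous_on S (%u. g u*D n (u - y))" for S
 by (intro continuous_on_mult continuous_on_UNIV_comp[OF cont_D] continuous_on_UNIV_comp[OF g] continuous_on_diff continuous_on_const continuous_on_id)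
 have i: "(%u. g u*D n (u - y)) integrable_on {a..b}" for a b
 by (intro integrable_continuous_interval c)
 have "conv g n y = integral {-1..1} ((%u. g u*D n (u - y)) \<circ> (+) y)"
 by (simp add: conv_def comp_def)
 also have "... = integral {y - 1..y + 1} (%u. g u*D n (u - y))"
 by (subst integral_shift_Icc_real) (simp add: add.commute)
 also have "... = integral {a..b} (%u. g u*D n (u - y))"
 proof -
 have z: "integral {a..y - 1} (%u. g u*D n (u - y)) = 0" "integral {y + 1..b} (%u. g u*D n (u - y)) = 0"
  using supp[of _ n] eps by (subst integral_cong[where g = "%_. 0"]; simp)+
 have "integral {a..b} (%u. g u*D n (u - y)) = integral {a..y - 1} (%u. g u*D n (u - y)) + integral {y - 1..b} (%u. g u*D n (u - y))"
  using ab by (intro Henstock_Kurzweil_Integration.integral_combine[symmetric] i) auto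
 also have "integral {y - 1..b} (%u. g u*D n (u - y)) = integral {y - 1..y + 1} (%u. g u*D n (u - y)) + integral {y + 1..b} (%u. g u*D n (u - y))"
  using ab by (intro Henstock_Kurzweil_Integration.integral_combine[symmetric] i) auto
 finally show ?thesis using z by simp
 qed
 finally show ?thesis .
qed

lemma conv_deriv:
 assumes g: "continuous_on UNIV g"
 shows "(conv g n has_real_derivative - conv g (Suc n) y) (at y)"
proof -
 let ?f = "%x u. g u*D n (u - x)" and ?fx = "%x u. g u * - D (Suc n) (u - x)"
 have 1: "((%x. ?f x t) has_real_derivative ?fx x t) (at x within ball y 1)" for x t
 proof -
 have "((%x. t - x) has_real_derivative (-1)) (at x within ball y 1)"
  by (auto intro!: derivative_eq_intros)
 from DERIV_cmult[OF DERIV_chain2[OF deriv[of n "t - x"] this], of "g t"] show ?thesis by simp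
 qed
 have 2: "?f x integrable_on cbox (y - 3) (y + 3)" for x
 by (intro integrable_continuous continuous_on_mult continuous_on_UNIV_comp[OF cont_D] continuous_on_UNIV_comp[OF g] continuous_on_diff continuous_on_const continuous_on_id)
 have "continuous_on (ball y 1 \<times> cbox (y - 3) (y + 3)) (%p. g (snd p))"
 by (rule continuous_on_compose2[OF g continuous_on_snd[OF continuous_on_id]]) simp
 moreover have "continuous_on (ball y 1 \<times> cbox (y - 3) (y + 3)) (%p. D (Suc n) (snd p - fst p))"
 by (rule continuous_on_compose2[OF cont_D[of UNIV] continuous_on_diff[OF continuous_on_snd[OF continuous_on_id] continuous_on_fst[OF continuous_on_id]]]) simp
 ultimately have 3: "continuous_on (ball y 1 \<times> cbox (y - 3) (y + 3)) (%(x, u). ?fx x u)"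
 unfolding case_prod_unfold by (intro continuous_on_mult continuous_on_minus)
 have "((%x. integral (cbox (y - 3) (y + 3)) (?f x)) has_real_derivative
 integral (cbox (y - 3) (y + 3)) (?fx y)) (at y within ball y 1)"
 using leibniz_rule_field_derivative[where f = ?f and fx = ?fx and U = "ball y 1" and a = "y - 3" and b = "y + 3" and ?x0.0 = y, OF 1 2 3]
 by (simp add: convex_ball)
 then have "((%x. integral (cbox (y - 3) (y + 3)) (%u. g u*D n (u - x))) has_real_derivative
 integral (cbox (y - 3) (y + 3)) (%u. g u * - D (Suc n) (u - y))) (at y)"
 using at_within_open[of y "ball y 1"] by simp
 moreover have "integral (cbox (y - 3) (y + 3)) (%u. g u * - D (Suc n) (u - y)) = - conv g (Suc n) y"
 using conv_eq[OF g, of "y - 3" y "y + 3" "Suc n"] by simp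
 ultimately have "((%x. integral (cbox (y - 3) (y + 3)) (%u. g u*D n (u - x))) has_real_derivative - conv g (Suc n) y) (at y)"
 by simp
 then show ?thesis
 proof (rule has_field_derivative_transform_within_open[where S = "ball y 1"])
 fix x assume "x \<in> ball y 1"
 then have "y - 3 <= x - 1" "x + 1 <= y + 3" by (auto simp: dist_real_def)
 then show "integral (cbox (y - 3) (y + 3)) (%u. g u*D n (u - x)) = conv g n x"
  using conv_eq[OF g, of "y - 3" x "y + 3" n] by simp
 qed auto
qed

lemma conv_add: "continuous_on UNIV f ==> continuous_on UNIV g ==> conv (%x. f x + g x) n y = conv f n y + conv g n y"
 unfolding conv_def distrib_right by (intro integral_add conv_integrable)

lemma conv_diff: "continuous_on UNIV f ==> continuous_on UNIV g ==> conv (%x. f x - g x) n y = conv f n y - conv g n y"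
 unfolding conv_def left_diff_distrib by (intro integral_diff conv_integrable)

lemma conv_cmult: "conv (%x. c*f x) n y = c * conv f n y"
 unfolding conv_def mult.assoc by (rule integral_mult_right)

lemma conv_const: "conv (%x. c) 0 y = c"
 using total by (simp add: conv_def)

lemma conv_mono:
 assumes "continuous_on UNIV f" "continuous_on UNIV g" and le: "\<And>z. \<bar>z - y\<bar> <= ep ==> f z <= g z"
 shows "conv f 0 y <= conv g 0 y"
 unfolding conv_def
proof (rule integral_le)
 fix z :: real
 show "f (y + z)*D 0 z <= g (y + z)*D 0 z"
 using le[of "y + z"] supp[of z 0] nonneg[of z] by (cases "\<bar>z\<bar> <= ep") (auto intro: mult_right_mono)
qed (use assms in \<open>auto intro!: conv_integrable\<close>)

lemma conv_bounds:
 assumes g: "continuous_on UNIV g" and le: "\<And>z. \<bar>z - y\<bar> <= ep ==> \<bar>g z - c\<bar> <= r"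
 shows "\<bar>conv g 0 y - c\<bar> <= r"
proof -
 have "conv g 0 y <= conv (%_. c + r) 0 y" "conv (%_. c - r) 0 y <= conv g 0 y"
 using le by (intro conv_mono g continuous_intros; force simp: abs_le_iff)+
 then show ?thesis by (simp add: conv_const abs_le_iff)
qed

lemma conv_abs_bound:
 assumes "continuous_on UNIV g"
 obtains C where "\<And>y B. (\<And>z. \<bar>g z\<bar> <= B) ==> \<bar>conv g n y\<bar> <= C*B" "C >= 0"
proof (rule that[of "integral {-1..1} (%z. \<bar>D n z\<bar>)"])
 fix y B assume B: "\<And>z. \<bar>g z\<bar> <= B"
 have "norm (conv g n y) <= integral {-1..1} (%z. B * \<bar>D n z\<bar>)"
 unfolding conv_def
 proof (rule integral_norm_bound_integral)
 show "(%z. g (y + z)*D n z) integrable_on {-1..1}" by (rule conv_integrable[OF assms])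
 show "(%z. B * \<bar>D n z\<bar>) integrable_on {-1..1}"
  by (intro integrable_continuous_interval continuous_intros cont_D)
 show "norm (g (y + z)*D n z) <= B * \<bar>D n z\<bar>" for z
  using B[of "y + z"] by (simp add: abs_mult mult_right_mono)
 qed
 then show "\<bar>conv g n y\<bar> <= integral {-1..1} (%z. \<bar>D n z\<bar>)*B" by (simp add: mult.commute)
qed (auto intro!: integral_nonneg integrable_continuous_interval continuous_intros cont_D)

lemma conv_ibp:
 assumes g: "\<And>y. (g has_real_derivative g' y) (at y)" and g': "continuous_on UNIV g'"
 shows "conv g (Suc n) y = - conv g' n y"
proof -
 have gc: "continuous_on UNIV g" using g by (meson DERIV_continuous continuous_at_imp_continuous_on)
 have "((%z. g' (y + z)*D n z + g (y + z)*D (Suc n) z) has_integral g (y + 1)*D n 1 - g (y + -1)*D n (-1)) {-1..1}"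
 proof (rule fundamental_theorem_of_calculus)
 fix z :: real
 have "((%z. g (y + z)) has_real_derivative g' (y + z)*1) (at z within {-1..1})"
  by (rule DERIV_chain2[OF g]) (auto intro!: derivative_eq_intros)
 from DERIV_mult[OF this has_field_derivative_at_within[OF deriv[of n z]]]
 show "((%z. g (y + z)*D n z) has_vector_derivative g' (y + z)*D n z + g (y + z)*D (Suc n) z) (at z within {-1..1})"
  by (simp add: has_real_derivative_iff_has_vector_derivative algebra_simps)
 qed auto
 moreover have "D n 1 = 0" "D n (-1) = 0" using supp eps by auto
 ultimately have "integral {-1..1} (%z. g' (y + z)*D n z + g (y + z)*D (Suc n) z) = 0"
 by (simp add: integral_unique)
 then have "conv g' n y + conv g (Suc n) y = 0"
 unfolding conv_def by (subst (asm) integral_add) (auto intro!: conv_integrable g' gc)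
 then show ?thesis by simp
qed

lemma conv_deriv_C1:
 assumes g: "\<And>y. (g has_real_derivative g' y) (at y)" and g': "continuous_on UNIV g'"
 shows "(conv g n has_real_derivative conv g' n y) (at y)"
proof -
 have gc: "continuous_on UNIV g" using g by (meson DERIV_continuous continuous_at_imp_continuous_on)
 show ?thesis using conv_deriv[OF gc, of n y] conv_ibp[OF g g', of n y] by simp
qed

lemma conv_Jensen:
 assumes p: "continuous_on UNIV p"
 shows "(conv p 0 y)\<^sup>2 <= conv (%x. (p x)\<^sup>2) 0 y"
proof -
 define c where "c = conv p 0 y"
 have pc: "continuous_on UNIV (%x. (p x - c)\<^sup>2)" "continuous_on UNIV (%x. (p x)\<^sup>2)" "continuous_on UNIV (%x. 2 * c*p x)"
 by (intro continuous_on_power continuous_on_mult continuous_on_diff p continuous_on_const)+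
 have "conv (%_. 0) 0 y <= conv (%x. (p x - c)\<^sup>2) 0 y"
 by (rule conv_mono[OF continuous_on_const pc(1)]) simp
 then have "0 <= conv (%x. (p x - c)\<^sup>2) 0 y" by (simp add: conv_const)
 also have "(%x. (p x - c)\<^sup>2) = (%x. ((p x)\<^sup>2 - 2 * c*p x) + c\<^sup>2)"
 by (simp add: power2_eq_square algebra_simps)
 also have "conv ... 0 y = conv (%x. (p x)\<^sup>2) 0 y - 2 * c * conv p 0 y + c\<^sup>2"
 using conv_add[OF continuous_on_diff[OF pc(2,3)] continuous_on_const[of UNIV "c\<^sup>2"], of 0 y]
  conv_diff[OF pc(2,3), of 0 y] by (simp add: conv_cmult conv_const)
 finally show ?thesis by (simp add: c_def power2_eq_square)
qed

text \<open>Differentiability of \<open>g\<close> is not assumed: mollification preserves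
  monotonicity, and \<open>- conv g 1\<close> is the derivative of the decreasing function
  \<open>conv g 0\<close>. This turns the monotonicity in \<open>supersol\<close> into a pointwise
  inequality.\<close>

lemma conv_antimono:
 assumes g: "continuous_on UNIV g" and "antimono g" shows "conv g (Suc 0) y >= 0"
proof (rule ccontr)
 assume n: "\<not> conv g (Suc 0) y >= 0"
 have "conv g 0 b <= conv g 0 a" if "a <= b" for a b
 unfolding conv_def
 using \<open>antimono g\<close> that nonneg by (intro integral_le conv_integrable g mult_right_mono) (auto simp: antimono_def)
 moreover obtain d where "d > 0" "\<And>h. 0 < h ==> h < d ==> conv g 0 y < conv g 0 (y + h)"
 using DERIV_pos_inc_right[OF conv_deriv[OF g, of 0 y]] n by auto
 ultimately show False by (metis add_le_same_cancel1 dense less_add_same_cancel1 less_le_not_le order.strict_implies_order)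
qed

end

text \<open>The inequality \<open>p' + p^2 + 2*thh*w' <= 2*lam\<close> in integrated form, since
  \<open>p\<close> and \<open>w\<close> are rough: their irregular parts cancel in
  \<open>p + 2*thh*w\<close>, and \<open>G\<close> is the integral of the regular terms.\<close>

definition supersol :: "real => (real => real) => (real => real) => (real => real) => bool" where
 "supersol thh w lam p \<longleftrightarrow> (\<exists>G. (\<forall>y. (G has_real_derivative 2*lam y - (p y)\<^sup>2) (at y)) &
 antimono (%y. p y + 2*thh*w y - G y))"

context kernel
begin

text \<open>Mollification makes the weak inequality a classical one for \<open>conv p 0\<close>,
  whose derivative is \<open>- conv p 1\<close>. Jensen's inequality handles the square in the
  favourable direction, so nothing is lost and the scale of the mollifier does not enter.\<close>

lemma supersol_conv:
 assumes s: "supersol thh w lam p" and w: "continuous_on UNIV w" and p: "continuous_on UNIV p" and lam: "continuous_on UNIV lam"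
 shows "- conv p 1 y/2 + (conv p 0 y)\<^sup>2/2 + thh*(- conv w 1 y) <= conv lam 0 y"
proof -
 obtain G where G: "\<And>y. (G has_real_derivative 2*lam y - (p y)\<^sup>2) (at y)" "antimono (%y. p y + 2*thh*w y - G y)"
 using s unfolding supersol_def by blast
 have Gc: "continuous_on UNIV G" using G(1) by (meson DERIV_continuous continuous_at_imp_continuous_on)
 have wc: "continuous_on UNIV (%y. 2*thh*w y)" and lc: "continuous_on UNIV (%y. 2*lam y)" and pc: "continuous_on UNIV (%y. (p y)\<^sup>2)"
 by (intro continuous_on_power continuous_on_mult continuous_on_const p w lam)+
 have g': "continuous_on UNIV (%y. 2*lam y - (p y)\<^sup>2)" by (rule continuous_on_diff[OF lc pc])
 have "0 <= conv (%y. p y + 2*thh*w y - G y) (Suc 0) y"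
 by (intro conv_antimono G(2) continuous_on_add continuous_on_diff continuous_on_mult continuous_on_const p w Gc)
 also have "... = conv p 1 y + 2*thh * conv w 1 y - conv G 1 y"
 using conv_diff[OF continuous_on_add[OF p wc] Gc, of 1 y] conv_add[OF p wc, of 1 y] by (simp add: conv_cmult)
 also have "conv G 1 y = - conv (%y. 2*lam y - (p y)\<^sup>2) 0 y"
 using conv_ibp[OF G(1) g', of 0 y] by simp
 also have "conv (%y. 2*lam y - (p y)\<^sup>2) 0 y = 2 * conv lam 0 y - conv (%y. (p y)\<^sup>2) 0 y"
 using conv_diff[OF lc pc, of 0 y] by (simp add: conv_cmult)
 finally show ?thesis using conv_Jensen[OF p, of y] by simp
qed

end

lemma antideriv_exists:
 fixes f :: "real => real"
 assumes "continuous_on UNIV f"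
 obtains F where "\<And>y. (F has_real_derivative f y) (at y)"
proof -
 have "isCont f x" for x using assms by (simp add: continuous_on_eq_continuous_at)
 then obtain F where "\<forall>x::real. -\<infinity> < ereal x --> ereal x < \<infinity> --> (F has_vector_derivative f x) (at x)"
 using einterval_antiderivative[of "-\<infinity>" "\<infinity>" f] by auto
 then show ?thesis by (intro that[of F]) (auto simp: has_real_derivative_iff_has_vector_derivative)
qed

subsection \<open>Piecewise linear supersolutions\<close>

definition plin :: "real => (int => real) => real => real" where
 "plin b Q y = Q \<lfloor>y/b\<rfloor> + (y/b - of_int \<lfloor>y/b\<rfloor>)*(Q (\<lfloor>y/b\<rfloor> + 1) - Q \<lfloor>y/b\<rfloor>)"

lemma plin_cell:
 assumes b: "b > 0" and y: "of_int k*b <= y" "y <= of_int (k + 1)*b"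
 shows "plin b Q y = Q k + (y/b - of_int k)*(Q (k + 1) - Q k)"
proof -
 have "of_int k <= y/b" "y/b <= of_int k + 1" using b y by (auto simp: le_divide_eq divide_le_eq)
 then consider "\<lfloor>y/b\<rfloor> = k" | "y/b = of_int (k + 1)" by (fastforce simp: floor_eq_iff)
 then show ?thesis
 proof cases
 case 2
 then have "\<lfloor>y/b\<rfloor> = k + 1" by simp
 then show ?thesis using 2 by (simp add: plin_def)
 qed (simp add: plin_def)
qed

lemma cell_exists:
 assumes "b > 0" shows "of_int \<lfloor>y/b\<rfloor>*b <= y" "y < of_int (\<lfloor>y/b\<rfloor> + 1)*b"
proof -
 define F where "F = \<lfloor>y/b\<rfloor>"
 have "of_int F <= y/b" "y/b < of_int F + 1" unfolding F_def by linarith+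
 then have "of_int F*b <= y" "y < of_int (F + 1)*b" using assms by (simp_all add: pos_le_divide_eq pos_divide_less_eq)
 then show "of_int \<lfloor>y/b\<rfloor>*b <= y" "y < of_int (\<lfloor>y/b\<rfloor> + 1)*b" by (auto simp: F_def)
qed

lemma plin_cont:
 assumes b: "b > 0" shows "continuous_on UNIV (plin b Q)"
proof -
 have c: "continuous_on {of_int k*b..of_int (k + 1)*b} (plin b Q)" for k
 proof (rule continuous_on_eq)
 show "continuous_on {of_int k*b..of_int (k + 1)*b} (%y. Q k + (y/b - of_int k)*(Q (k + 1) - Q k))"
  using b by (intro continuous_intros) auto
 qed (use plin_cell[OF b] in auto)
 have "isCont (plin b Q) y" for y
 proof -
 define k where "k = \<lfloor>y/b\<rfloor>"
 have y: "of_int k*b <= y" "y < of_int (k + 1)*b" using cell_exists[OF b, of y] by (auto simp: k_def)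
 have "continuous_on ({of_int (k - 1)*b..of_int (k - 1 + 1)*b} \<union> {of_int k*b..of_int (k + 1)*b}) (plin b Q)"
  by (intro continuous_on_closed_Un c closed_atLeastAtMost)
 also have "{of_int (k - 1)*b..of_int (k - 1 + 1)*b} \<union> {of_int k*b..of_int (k + 1)*b} = {of_int (k - 1)*b..of_int (k + 1)*b}"
  using b by (auto simp: algebra_simps)
 finally have "continuous_on {of_int (k - 1)*b..of_int (k + 1)*b} (plin b Q)" .
 then show ?thesis
  by (rule continuous_on_interior) (use y b in \<open>auto simp: algebra_simps\<close>)
 qed
 then show ?thesis by (simp add: continuous_on_eq_continuous_at)
qed

lemma antimono_cells:
 fixes D :: "real => real"
 assumes b: "b > 0" and D: "\<And>k x y. of_int k*b <= x ==> x <= y ==> y <= of_int (k + 1)*b ==> D y <= D x"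
 shows "antimono D"
proof -
 have *: "D y <= D x" if "x <= y" "of_int k*b <= x" "x <= of_int (k + 1)*b" "y <= of_int (k + 1 + int n)*b" for n x y and k :: int
 using that
 proof (induction n arbitrary: y)
 case 0
 then show ?case using D[of k x y] by auto
 next
 case (Suc n)
 show ?case
 proof (cases "y <= of_int (k + 1 + int n)*b")
  case True
  then show ?thesis using Suc by auto
 next
  case False
  let ?m = "of_int (k + 1 + int n)*b"
  have m: "x <= ?m" using Suc.prems b by (auto simp: algebra_simps intro: order.trans)
  have "D ?m <= D x" using m Suc.prems by (intro Suc.IH) auto
  moreover have "D y <= D ?m" using False Suc.prems by (intro D[of "k + 1 + int n"]) (auto simp: algebra_simps)
  ultimately show ?thesis by simp
 qed
 qed
 show ?thesis
 proof (rule antimonoI)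
 fix x y :: real assume xy: "x <= y"
 define k where "k = \<lfloor>x/b\<rfloor>"
 have x: "of_int k*b <= x" "x < of_int (k + 1)*b" using cell_exists[OF b, of x] by (auto simp: k_def)
 define n where "n = nat (\<lfloor>y/b\<rfloor> + 1)"
 define n' where "n' = nat (\<bar>\<lfloor>y/b\<rfloor>\<bar> + \<bar>k\<bar>)"
 have "\<lfloor>y/b\<rfloor> + 1 <= k + 1 + int n'" by (simp add: n'_def)
 then have "real_of_int (\<lfloor>y/b\<rfloor> + 1) <= real_of_int (k + 1 + int n')" by (rule of_int_le_iff[THEN iffD2])
 then have "of_int (\<lfloor>y/b\<rfloor> + 1)*b <= of_int (k + 1 + int n')*b" using b by (intro mult_right_mono) auto
 then show "D y <= D x" using cell_exists(2)[OF b, of y] xy x by (intro *[of x y k n']) auto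
 qed
qed

text \<open>With p a piecewise linear function minus \<open>2*thh*w\<close>, the sum
  \<open>p + 2*thh*w\<close> is piecewise linear, and the weak inequality reduces to comparing one
  slope per cell with the right-hand side.\<close>

lemma plin_supersol:
 assumes b: "b > 0" and w: "continuous_on UNIV w" and lam: "continuous_on UNIV lam"
 and cell: "\<And>k y. of_int k*b <= y ==> y <= of_int (k + 1)*b ==>
  (Q (k + 1) - Q k)/b <= 2*lam y - (plin b Q y - 2*thh*w y)\<^sup>2"
 shows "supersol thh w lam (%y. plin b Q y - 2*thh*w y)" "continuous_on UNIV (%y. plin b Q y - 2*thh*w y)"
proof -
 let ?p = "%y. plin b Q y - 2*thh*w y"
 show p: "continuous_on UNIV ?p" using w plin_cont[OF b, of Q] by (intro continuous_on_diff continuous_on_mult continuous_on_const)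
 have "continuous_on UNIV (%y. 2*lam y - (?p y)\<^sup>2)"
 by (rule continuous_on_diff[OF continuous_on_mult[OF continuous_on_const lam] continuous_on_power[OF p]])
 then obtain G where G: "\<And>y. (G has_real_derivative 2*lam y - (?p y)\<^sup>2) (at y)" using antideriv_exists by blast
 have "antimono (%y. plin b Q y - G y)"
 proof (rule antimono_cells[OF b])
 fix k x y assume xy: "of_int k*b <= x" "x <= y" "y <= of_int (k + 1)*b"
 have "Q k + (y/b - of_int k)*(Q (k + 1) - Q k) - G y <= Q k + (x/b - of_int k)*(Q (k + 1) - Q k) - G x"
 proof (rule DERIV_nonpos_imp_nonincreasing[OF xy(2)])
  fix z assume z: "x <= z" "z <= y"
  have "((%y. Q k + (y/b - of_int k)*(Q (k + 1) - Q k) - G y) has_real_derivative (Q (k + 1) - Q k)/b - (2*lam z - (?p z)\<^sup>2)) (at z)"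
  using b by (auto intro!: derivative_eq_intros G)
  moreover have "(Q (k + 1) - Q k)/b - (2*lam z - (?p z)\<^sup>2) <= 0" using cell[of k z] z xy by simp
  ultimately show "\<exists>d. ((%y. Q k + (y/b - of_int k)*(Q (k + 1) - Q k) - G y) has_real_derivative d) (at z) & d <= 0" by blast
 qed
 then show "plin b Q y - G y <= plin b Q x - G x"
  using plin_cell[OF b, of k x Q] plin_cell[OF b, of k y Q] xy by simp
 qed
 then show "supersol thh w lam ?p" unfolding supersol_def using G by (intro exI[of _ G]) auto
qed

text \<open>The two half-lines are treated alike: the negative one is reflected, which turns w into
 the path -w(-y) and the logarithmic derivative p into -p(-y).\<close>

lemma build_supersol:
 assumes b: "b > 0" and thh: "thh > 0" and w: "continuous_on UNIV w"
 and osc: "osc_ok w b u" "osc_ok (%y. - w (- y)) b u"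
 and r0: "rp 0 = 0" "rm 0 = 0"
 and cp: "\<And>i. (rp (Suc i) - rp i + 2*thh*(w (real (Suc i)*b) - w (real i*b)))/b
  + (max \<bar>rp i\<bar> \<bar>rp (Suc i)\<bar> + 4*thh*u i)\<^sup>2 <= 2*L i"
 and cm: "\<And>i. (rm (Suc i) - rm i + 2*thh*(- w (- (real (Suc i)*b)) - - w (- (real i*b))))/b
  + (max \<bar>rm i\<bar> \<bar>rm (Suc i)\<bar> + 4*thh*u i)\<^sup>2 <= 2*L i"
 and lam: "continuous_on UNIV lam" and L: "\<And>i y. real i*b <= \<bar>y\<bar> ==> \<bar>y\<bar> <= real (Suc i)*b ==> L i <= lam y"
 obtains p where "continuous_on UNIV p" "supersol thh w lam p"
 "\<And>i y. real i*b <= y ==> y <= real (Suc i)*b ==> \<bar>p y\<bar> <= max \<bar>rp i\<bar> \<bar>rp (Suc i)\<bar> + 4*thh*u i & min (rp i) (rp (Suc i)) - 4*thh*u i <= p y"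
 "\<And>i y. real i*b <= y ==> y <= real (Suc i)*b ==> \<bar>p (- y)\<bar> <= max \<bar>rm i\<bar> \<bar>rm (Suc i)\<bar> + 4*thh*u i & min (rm i) (rm (Suc i)) - 4*thh*u i <= - p (- y)"
proof -
 define r where "r k = (if k >= 0 then rp (nat k) else - rm (nat (- k)))" for k :: int
 define Q where "Q k = r k + 2*thh*w (of_int k*b)" for k :: int
 define p where "p y = plin b Q y - 2*thh*w y" for y
 have r1: "r (int i) = rp i" "r (- int i) = - rm i" for i using r0 by (auto simp: r_def)
 \<comment> \<open>convex combinations and the deviation of the path from its chord\<close>
 have comb: "\<bar>(1 - t)*A + t*B\<bar> <= max \<bar>A\<bar> \<bar>B\<bar>" "min A B <= (1 - t)*A + t*B" if "0 <= t" "t <= 1" for t A B :: real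
 proof -
 have *: "(1 - t)*A + t*B <= max A B" for A B :: real
  using convex_bound_le[of A "max A B" B "1 - t" t] that by simp
 show "min A B <= (1 - t)*A + t*B" using *[of "- A" "- B"] by (auto simp: min_def max_def split: if_splits)
 show "\<bar>(1 - t)*A + t*B\<bar> <= max \<bar>A\<bar> \<bar>B\<bar>" using *[of "- A" "- B"] *[of A B] by (auto simp: abs_if max_def split: if_splits)
 qed
 have chord: "\<bar>x - t*d\<bar> <= 2 * c" if "0 <= t" "t <= 1" "\<bar>x\<bar> <= c" "\<bar>d\<bar> <= c" for x t d c :: real
 proof -
 have "t * \<bar>d\<bar> <= 1 * c" using that by (intro mult_mono) auto
 moreover have "\<bar>t*d\<bar> = t * \<bar>d\<bar>" using that by (simp add: abs_mult)
 ultimately show ?thesis using that by linarith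
 qed
 have P: "\<bar>p y\<bar> <= max \<bar>rp i\<bar> \<bar>rp (Suc i)\<bar> + 4*thh*u i & min (rp i) (rp (Suc i)) - 4*thh*u i <= p y"
 if y: "real i*b <= y" "y <= real (Suc i)*b" for i y
 proof -
 define t where "t = y/b - real i"
 have t: "0 <= t" "t <= 1" using y b by (auto simp: t_def field_simps)
 have "plin b Q y = Q (int i) + (y/b - of_int (int i))*(Q (int i + 1) - Q (int i))"
  using y by (intro plin_cell[OF b]) (auto simp: algebra_simps)
 then have "plin b Q y = Q (int i) + t*(Q (int (Suc i)) - Q (int i))" by (simp add: t_def add.commute)
 then have "p y = ((1 - t) * rp i + t * rp (Suc i)) - 2*thh*((w y - w (real i*b)) - t*(w (real (Suc i)*b) - w (real i*b)))"
  unfolding p_def Q_def r1 by (simp add: algebra_simps)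
 moreover have "\<bar>(w y - w (real i*b)) - t*(w (real (Suc i)*b) - w (real i*b))\<bar> <= 2*u i"
  using osc(1) y b unfolding osc_ok_def by (intro chord t) (auto simp: algebra_simps)
 then have "2*thh * \<bar>(w y - w (real i*b)) - t*(w (real (Suc i)*b) - w (real i*b))\<bar> <= 2*thh*(2*u i)"
  using thh by (intro mult_left_mono) auto
 then have "\<bar>2*thh*((w y - w (real i*b)) - t*(w (real (Suc i)*b) - w (real i*b)))\<bar> <= 4*thh*u i"
  using thh by (simp add: abs_mult)
 ultimately show ?thesis using comb[OF t, of "rp i" "rp (Suc i)"] by linarith
 qed
 have N: "\<bar>p (- y)\<bar> <= max \<bar>rm i\<bar> \<bar>rm (Suc i)\<bar> + 4*thh*u i & min (rm i) (rm (Suc i)) - 4*thh*u i <= - p (- y)"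
 if y: "real i*b <= y" "y <= real (Suc i)*b" for i y
 proof -
 define t where "t = y/b - real i"
 let ?v = "%y. - w (- y)"
 have t: "0 <= t" "t <= 1" using y b by (auto simp: t_def field_simps)
 have "plin b Q (- y) = Q (- int (Suc i)) + (- y/b - of_int (- int (Suc i)))*(Q (- int (Suc i) + 1) - Q (- int (Suc i)))"
  using y by (intro plin_cell[OF b]) (auto simp: algebra_simps)
 moreover have "- int (Suc i) + 1 = - int i" by simp
 moreover have "- y/b - of_int (- int (Suc i)) = 1 - t" by (simp add: t_def)
 ultimately have "plin b Q (- y) = Q (- int (Suc i)) + (1 - t)*(Q (- int i) - Q (- int (Suc i)))" by (simp only:)
 then have "- p (- y) = ((1 - t) * rm i + t * rm (Suc i)) - 2*thh*((?v y - ?v (real i*b)) - t*(?v (real (Suc i)*b) - ?v (real i*b)))"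
  unfolding p_def Q_def r1 by (simp add: algebra_simps)
 moreover have "\<bar>(?v y - ?v (real i*b)) - t*(?v (real (Suc i)*b) - ?v (real i*b))\<bar> <= 2*u i"
 proof -
  have o: "\<bar>?v z - ?v (real i*b)\<bar> <= u i" if "z \<in> {real i*b..real i*b + b}" for z
  using osc(2) that unfolding osc_ok_def by blast
  have "y \<in> {real i*b..real i*b + b}" "real (Suc i)*b \<in> {real i*b..real i*b + b}"
  using y b by (auto simp: algebra_simps)
  then show ?thesis by (intro chord t o)
 qed
 then have "2*thh * \<bar>(?v y - ?v (real i*b)) - t*(?v (real (Suc i)*b) - ?v (real i*b))\<bar> <= 2*thh*(2*u i)"
  using thh by (intro mult_left_mono) auto
 then have "\<bar>2*thh*((?v y - ?v (real i*b)) - t*(?v (real (Suc i)*b) - ?v (real i*b)))\<bar> <= 4*thh*u i"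
  using thh by (simp add: abs_mult)
 ultimately show ?thesis using comb[OF t, of "rm i" "rm (Suc i)"] by linarith
 qed
 have cell: "(Q (k + 1) - Q k)/b <= 2*lam y - (plin b Q y - 2*thh*w y)\<^sup>2"
 if y: "of_int k*b <= y" "y <= of_int (k + 1)*b" for k y
 proof (cases "k >= 0")
 case True
 define i where "i = nat k"
 have k: "k = int i" "k + 1 = int (Suc i)" using True by (auto simp: i_def)
 have yi: "real i*b <= y" "y <= real (Suc i)*b" using y unfolding k by (auto simp: add.commute)
 then have y0: "0 <= y" using b by (auto intro: order.trans[of 0 "real i*b"])
 have "(p y)\<^sup>2 <= (max \<bar>rp i\<bar> \<bar>rp (Suc i)\<bar> + 4*thh*u i)\<^sup>2" using P[OF yi] by (intro power2_le_iff_abs_le[THEN iffD2]) auto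
 moreover have "L i <= lam y" using L[of i y] yi y0 by simp
 moreover have "Q (k + 1) - Q k = rp (Suc i) - rp i + 2*thh*(w (real (Suc i)*b) - w (real i*b))"
 proof -
  have "Q (k + 1) = rp (Suc i) + 2*thh*w (real (Suc i)*b)" unfolding k(2) Q_def r1 by simp
  moreover have "Q k = rp i + 2*thh*w (real i*b)" unfolding k(1) Q_def r1 by simp
  ultimately show ?thesis by (simp only: right_diff_distrib)
 qed
 ultimately show ?thesis using cp[of i] unfolding p_def by simp
 next
 case False
 define i where "i = nat (- k - 1)"
 have k: "k = - int (Suc i)" "k + 1 = - int i" using False by (auto simp: i_def)
 have yi: "real i*b <= - y" "- y <= real (Suc i)*b" using y unfolding k by (auto simp: algebra_simps)
 then have y0: "y <= 0" using b mult_nonneg_nonneg[of "real i" b] by linarith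
 have "(p y)\<^sup>2 <= (max \<bar>rm i\<bar> \<bar>rm (Suc i)\<bar> + 4*thh*u i)\<^sup>2" using N[OF yi] by (intro power2_le_iff_abs_le[THEN iffD2]) auto
 moreover have "L i <= lam y" using L[of i y] yi y0 by simp
 moreover have "Q (k + 1) - Q k = rm (Suc i) - rm i + 2*thh*(- w (- (real (Suc i)*b)) - - w (- (real i*b)))"
 proof -
  have "Q (k + 1) = - rm i + 2*thh*w (- (real i*b))" unfolding k(2) Q_def r1 by simp
  moreover have "Q k = - rm (Suc i) + 2*thh*w (- (real (Suc i)*b))"
  by (simp only: k(1) Q_def r1 of_int_minus of_int_of_nat_eq mult_minus_left)
  ultimately show ?thesis by (simp only: right_diff_distrib mult_minus_right)
 qed
 ultimately show ?thesis using cm[of i] unfolding p_def by simp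
 qed
 show ?thesis
 proof (rule that[of p])
 show "continuous_on UNIV p" unfolding p_def[abs_def] by (rule plin_supersol(2)[OF b w lam cell])
 show "supersol thh w lam p" unfolding p_def[abs_def] by (rule plin_supersol(1)[OF b w lam cell])
 qed (fact P, fact N)
qed

subsection \<open>Feynman-Kac bounds\<close>

lemma riemann_sum_tendsto:
 fixes f :: "real => real"
 assumes t: "t >= 0" and f: "continuous_on {0..t} f"
 shows "(%n. \<Sum>i<Suc n. t/real (Suc n)*f (real i*(t/real (Suc n)))) \<longlonglongrightarrow> integral {0..t} f"
proof (rule LIMSEQ_I)
 fix e :: real assume e: "e > 0"
 define e' where "e' = e/(2*(t + 1))"
 have e': "e' > 0" using e t by (simp add: e'_def)
 have uc: "uniformly_continuous_on {0..t} f" using f by (intro compact_uniformly_continuous) auto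
 then obtain d where d: "d > 0" "\<And>x y. x \<in> {0..t} ==> y \<in> {0..t} ==> dist y x < d ==> dist (f y) (f x) < e'"
 using e' unfolding uniformly_continuous_on_def by metis
 obtain n0 :: nat where n0: "t/d < real n0" using reals_Archimedean2 by blast
 show "\<exists>no. \<forall>n\<ge>no. norm ((\<Sum>i<Suc n. t/real (Suc n)*f (real i*(t/real (Suc n)))) - integral {0..t} f) < e"
 proof (intro exI[of _ n0] allI impI)
 fix n assume n: "n >= n0"
 define h where "h = t/real (Suc n)"
 have h: "0 <= h" using t by (simp add: h_def)
 have "t/d < real (Suc n)" using n0 n by linarith
 then have hd: "h < d" using d t by (simp add: h_def divide_less_eq mult.commute)
 have kt: "real k*h <= t" if "k <= Suc n" for k
 proof -
  have "real k*h <= real (Suc n)*h" using that h by (intro mult_right_mono) auto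
  then show ?thesis by (simp add: h_def)
 qed
 have "\<bar>(\<Sum>i<k. h*f (real i*h)) - integral {0..real k*h} f\<bar> <= real k*h*e'" if "k <= Suc n" for k
  using that
 proof (induction k)
  case (Suc k)
  let ?a = "real k*h" and ?b = "real (Suc k)*h"
  have ab: "0 <= ?a" "?a <= ?b" "?b <= t" using h kt[of "Suc k"] Suc.prems by (simp_all add: mult_right_mono)
  have fi: "f integrable_on {a..b}" if "0 <= a" "b <= t" for a b
  using that by (intro integrable_continuous_interval continuous_on_subset[OF f]) auto
  have I: "integral {0..?b} f = integral {0..?a} f + integral {?a..?b} f"
  using ab by (intro Henstock_Kurzweil_Integration.integral_combine[symmetric] fi) auto
  have "h*f ?a = integral {?a..?b} (%_. f ?a)" using h by (simp add: algebra_simps)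
  then have "h*f ?a - integral {?a..?b} f = integral {?a..?b} (%x. f ?a - f x)"
  using ab by (subst integral_diff) (auto intro!: fi)
  also have "norm ... <= e'*(?b - ?a)"
  proof (rule integral_bound)
  fix x assume "x \<in> {?a..?b}"
  then have x: "?a <= x" "x <= ?b" by (simp_all only: atLeastAtMost_iff)
  then have x': "x \<in> {0..t}" "?a \<in> {0..t}" unfolding atLeastAtMost_iff using ab by linarith+
  have "?b = ?a + h" by (simp add: algebra_simps)
  then have "dist ?a x < d" unfolding dist_real_def using x hd by linarith
  then have "dist (f ?a) (f x) < e'" by (intro d(2) x')
  then show "norm (f ?a - f x) <= e'" by (simp add: dist_real_def)
  qed (use ab in \<open>auto intro!: continuous_intros continuous_on_subset[OF f]\<close>)
  finally have "\<bar>h*f ?a - integral {?a..?b} f\<bar> <= e'*h" by (simp add: algebra_simps)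
  then show ?case using Suc I by (simp add: algebra_simps)
 qed simp
 from this[of "Suc n"] have "\<bar>(\<Sum>i<Suc n. h*f (real i*h)) - integral {0..t} f\<bar> <= t*e'" by (simp add: h_def)
 also have "... < e"
 proof -
  have "0 < 2*(t + 1)" using t by simp
  then have c: "2*(t + 1) ~= 0" by (metis less_irrefl)
  have "e'*(2*(t + 1)) = e" unfolding e'_def by (rule nonzero_eq_divide_eq[OF c, THEN iffD1]) (rule refl)
  then show ?thesis using e e' by (simp add: algebra_simps)
 qed
 finally show "norm ((\<Sum>i<Suc n. t/real (Suc n)*f (real i*(t/real (Suc n)))) - integral {0..t} f) < e"
  by (simp add: h_def)
 qed
qed

text \<open>The state carries the position and the Riemann sum of \<open>v\<close> along the path,
  which makes the Feynman-Kac weight a function of the state.\<close>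

definition fkstep :: "(real => real) => real => nat => real \<times> real => real => real \<times> real" where
 "fkstep v h k s z = (fst s + z, snd s + h * v (fst s))"

lemma measurable_fkstep:
 assumes [measurable]: "v \<in> borel_measurable borel"
 shows "(%(s, z). fkstep v h k s z) \<in> borel \<Otimes>\<^sub>M borel \<rightarrow>\<^sub>M borel"
 unfolding fkstep_def borel_prod[symmetric] by measurable

lemma fkstep_chain:
 "chain (fkstep v h) (x, 0) k (%i. B (real (Suc i)*h) - B (real i*h))
 = (x + (B (real k*h) - B 0), \<Sum>i<k. h * v (x + (B (real i*h) - B 0)))"
 by (induction k) (auto simp: fkstep_def)

text \<open>The function \<open>exp (F ta y)\<close> is a supersolution in the remaining time
  \<open>ta\<close>, up to the rate \<open>c\<close>. On an equidistant mesh the weighted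
  expectation gains at most the factor \<open>exp (h*c + C'*h^(3/2))\<close> per step; the total
  error \<open>C'*t*sqrt h\<close> vanishes under refinement, and Fatou's lemma passes to the
  integral along the path. The conditions are stated for increments of \<open>F\<close> in time, so
  no time derivative appears.\<close>

lemma FK_upper:
 fixes F F1 F2 :: "real => real => real"
 assumes N: "prob_space N" and B: "brownian_motion N x B" and t: "t > 0"
 and v: "continuous_on UNIV v" and Fm: "\<And>ta. continuous_on UNIV (F ta)" and K: "K >= 0" and C: "C >= 0"
 and taylor: "\<And>ta y d. 0 <= ta ==> ta <= t ==> exp (F ta (y + d) - F ta y) \<le>
  1 + F1 ta y*d + (F2 ta y + (F1 ta y)\<^sup>2)/2*d\<^sup>2 + C*(\<bar>d\<bar> ^ 3*exp (K * \<bar>d\<bar>))"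
 and gen: "\<And>ta h y. 0 <= ta ==> 0 <= h ==> ta + h <= t ==>
  F ta y + h*((F2 ta y + (F1 ta y)\<^sup>2)/2 + v y - c) <= F (ta + h) y"
 shows "(\<integral>\<^sup>+om. ennreal (exp (integral {0..t} (%s. v (B s om)) + F 0 (B t om))) \<partial>N) <= ennreal (exp (F t x + c*t))"
proof -
 define C' where "C' = C*(12*exp ((K + 1)\<^sup>2/2))"
 have C': "C' >= 0" using C by (simp add: C'_def)
 have vm [measurable]: "v \<in> borel_measurable borel" using v by (rule borel_measurable_continuous_onI)
 have Fmm [measurable]: "F ta \<in> borel_measurable borel" for ta using Fm by (rule borel_measurable_continuous_onI)
 have Bm: "B s \<in> borel_measurable N" if "s >= 0" for s using B that by (auto simp: brownian_motion_on_def)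
 interpret prob_space N by fact
 define h where "h n = t/real (Suc n)" for n
 define Y where "Y n k om = chain (fkstep v (h n)) (x, 0) k (%i. B (real (Suc i)*h n) om - B (real i*h n) om)" for n k om
 have h0: "h n > 0" for n using t by (simp add: h_def)
 have inc: "gaussian_incs N (h n) (Suc n) (%i om. B (real (Suc i)*h n) om - B (real i*h n) om)" for n
 using brownian_gaussian_incs[OF N B h0[of n], of "Suc n" 0] h0[of n] by simp
 have Ym [measurable]: "Y n k \<in> borel_measurable N" if "k <= Suc n" for n k
 unfolding Y_def using that h0[of n]
 by (intro measurable_chain[OF measurable_fkstep] vm) (auto intro!: borel_measurable_diff Bm)
 define g where "g n om = ennreal (exp (snd (Y n (Suc n) om) + F 0 (fst (Y n (Suc n) om))))" for n om
 have gm [measurable]: "g n \<in> borel_measurable N" for n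
 using Ym[of "Suc n" n] unfolding g_def borel_prod[symmetric] by measurable
 have um: "(%s. ennreal (exp (snd s + F ta (fst s)))) \<in> borel_measurable (borel :: (real \<times> real) measure)" for ta
 unfolding borel_prod[symmetric] by measurable
 have bound: "(\<integral>\<^sup>+om. g n om \<partial>N) <= ennreal (exp (F t x + c*t + C'*t * sqrt (h n)))" if h1: "h n <= 1" for n
 proof -
 let ?h = "h n"
 let ?q = "exp (?h * c + C'*(?h * sqrt ?h))"
 have th: "t = real (Suc n) * ?h" by (simp add: h_def)
 have "(\<integral>\<^sup>+om. ennreal (exp (snd (Y n k om) + F (t - real k * ?h) (fst (Y n k om)))) \<partial>N) <= ennreal (?q ^ k*exp (F t x))"
  if "k <= Suc n" for k
  using that
 proof (induction k)
  case 0
  show ?case by (simp add: Y_def emeasure_space_1)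
 next
  case (Suc k)
  \<comment> \<open>The time left after step \<open>k + 1\<close>: the remaining time in
    \<open>F\<close> decreases while the chain advances.\<close>
  define ta where "ta = t - real (Suc k) * ?h"
  have "real (Suc k) * ?h <= real (Suc n) * ?h" using Suc.prems h0[of n] by (intro mult_right_mono) auto
  then have ta: "0 <= ta" "ta + ?h <= t" "ta <= t" "ta + ?h = t - real k * ?h"
  using th h0[of n] by (auto simp: ta_def algebra_simps)
  have st: "(\<integral>\<^sup>+z. ennreal (exp (snd (fkstep v ?h k s z) + F ta (fst (fkstep v ?h k s z)))) \<partial>gauss ?h)
  <= ennreal ?q*ennreal (exp (snd s + F (ta + ?h) (fst s))) + 0" for s
  proof -
  obtain y a where s: "s = (y, a)" by force
  have "(\<integral>\<^sup>+z. ennreal (exp (snd (fkstep v ?h k s z) + F ta (fst (fkstep v ?h k s z)))) \<partial>gauss ?h)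
  = (\<integral>\<^sup>+z. ennreal (exp (a + ?h * v y + F ta y))*ennreal (exp (F ta (y + z) - F ta y)) \<partial>gauss ?h)"
  by (intro nn_integral_cong) (simp add: s fkstep_def ennreal_mult'[symmetric] exp_add[symmetric])
  also have "... = ennreal (exp (a + ?h * v y + F ta y))*(\<integral>\<^sup>+z. ennreal (exp (F ta (y + z) - F ta y)) \<partial>gauss ?h)"
  by (rule nn_integral_cmult) measurable
  also have "... <= ennreal (exp (a + ?h * v y + F ta y)) *
   ennreal (1 + (F2 ta y + (F1 ta y)\<^sup>2)/2 * ?h + C*(12*exp ((K + 1)\<^sup>2/2))*(?h * sqrt ?h))"
  by (intro mult_left_mono gauss_step_upper[OF h0 h1 K C _ taylor] ta) (auto intro!: measurable)
  also have "... <= ennreal (exp (a + ?h * v y + F ta y)) *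
   ennreal (exp ((F2 ta y + (F1 ta y)\<^sup>2)/2 * ?h + C'*(?h * sqrt ?h)))"
  unfolding C'_def by (intro mult_left_mono ennreal_leI order.trans[OF _ exp_ge_add_one_self]) auto
  also have "... = ennreal (exp (a + C'*(?h * sqrt ?h) + (F ta y + ?h*((F2 ta y + (F1 ta y)\<^sup>2)/2 + v y - c)) + ?h * c))"
  by (simp add: ennreal_mult'[symmetric] exp_add[symmetric] algebra_simps)
  also have "... <= ennreal (exp (a + C'*(?h * sqrt ?h) + F (ta + ?h) y + ?h * c))"
  using gen[OF ta(1) less_imp_le[OF h0] ta(2), of y] by (intro ennreal_leI) simp
  also have "... = ennreal ?q*ennreal (exp (snd s + F (ta + ?h) (fst s)))"
  by (simp add: s ennreal_mult'[symmetric] exp_add[symmetric] algebra_simps)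
  finally show ?thesis by simp
  qed
  have "(\<integral>\<^sup>+om. ennreal (exp (snd (Y n (Suc k) om) + F ta (fst (Y n (Suc k) om)))) \<partial>N)
  <= ennreal ?q*(\<integral>\<^sup>+om. ennreal (exp (snd (Y n k om) + F (ta + ?h) (fst (Y n k om)))) \<partial>N) + 0"
  unfolding Y_def
  by (rule chain_nn_integral_le[where S = borel and u' = "%s. ennreal (exp (snd s + F ta (fst s)))"
   and u = "%s. ennreal (exp (snd s + F (ta + ?h) (fst s)))", OF measurable_fkstep[OF vm] _ inc])
  (use Suc.prems st um in auto)
  also have "... <= ennreal ?q*ennreal (?q ^ k*exp (F t x)) + 0"
  using Suc ta(4) by (intro add_right_mono mult_left_mono) auto
  also have "... = ennreal (?q ^ Suc k*exp (F t x))" by (simp add: ennreal_mult'[symmetric] mult.assoc)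
  finally show ?case unfolding ta_def .
 qed
 from this[of "Suc n"] have "(\<integral>\<^sup>+om. g n om \<partial>N) <= ennreal (?q ^ Suc n*exp (F t x))"
  using th by (simp add: g_def)
 also have "?q ^ Suc n*exp (F t x) = exp (F t x + c*t + C'*t * sqrt ?h)"
  unfolding exp_of_nat_mult[symmetric] exp_add[symmetric] using th by (simp add: algebra_simps)
 finally show ?thesis .
 qed
 have lim: "AE om in N. (%n. g n om) \<longlonglongrightarrow> ennreal (exp (integral {0..t} (%s. v (B s om)) + F 0 (B t om)))"
 proof -
 have "AE om in N. B 0 om = x" "AE om in N. continuous_on {0..} (%t. B t om)"
  using B by (auto simp: brownian_motion_on_def)
 then show ?thesis
 proof eventually_elim
  case (elim om)
  have Yeq: "Y n (Suc n) om = (B t om, \<Sum>i<Suc n. h n * v (B (real i*h n) om))" for n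
  unfolding Y_def using elim(1) by (subst fkstep_chain) (simp add: h_def)
  have "continuous_on {0..t} (%s. v (B s om))"
  by (rule continuous_on_UNIV_comp[OF v continuous_on_subset[OF elim(2)]]) auto
  from riemann_sum_tendsto[OF less_imp_le[OF t] this]
  have "(%n. snd (Y n (Suc n) om)) \<longlonglongrightarrow> integral {0..t} (%s. v (B s om))" unfolding Yeq snd_conv h_def .
  then show ?case unfolding g_def Yeq fst_conv snd_conv by (intro tendsto_ennrealI tendsto_exp tendsto_add tendsto_const)
 qed
 qed
 have "(\<integral>\<^sup>+om. ennreal (exp (integral {0..t} (%s. v (B s om)) + F 0 (B t om))) \<partial>N) = (\<integral>\<^sup>+om. liminf (%n. g n om) \<partial>N)"
 by (rule nn_integral_cong_AE) (use lim in eventually_elim, simp add: lim_imp_Liminf)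
 also have "... <= liminf (%n. \<integral>\<^sup>+om. g n om \<partial>N)" by (rule nn_integral_liminf) measurable
 also have "... <= liminf (%n. ennreal (exp (F t x + c*t + C'*t * sqrt (h n))))"
 proof (rule Liminf_mono)
 have "(%n. t/real (Suc n)) \<longlonglongrightarrow> 0" by real_asymp
 then have "\<forall>\<^sub>F n in sequentially. h n < 1" unfolding h_def by (rule order_tendstoD) simp
 then show "\<forall>\<^sub>F n in sequentially. (\<integral>\<^sup>+om. g n om \<partial>N) <= ennreal (exp (F t x + c*t + C'*t * sqrt (h n)))"
  by eventually_elim (rule bound, simp)
 qed
 also have "... = ennreal (exp (F t x + c*t))"
 proof (rule lim_imp_Liminf)
 have "(%n. t/real (Suc n)) \<longlonglongrightarrow> 0" by real_asymp
 then have "h \<longlonglongrightarrow> 0" by (simp add: h_def[abs_def])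
 then have "(%n. exp (F t x + c*t + C'*t * sqrt (h n))) \<longlonglongrightarrow> exp (F t x + c*t + C'*t * sqrt 0)"
  by (intro tendsto_intros)
 then show "(%n. ennreal (exp (F t x + c*t + C'*t * sqrt (h n)))) \<longlonglongrightarrow> ennreal (exp (F t x + c*t))"
  by (intro tendsto_ennrealI) simp
 qed simp
 finally show ?thesis .
qed

lemma exp_le_quadratic: "\<bar>x\<bar> <= 1 ==> exp x <= 1 + x + x\<^sup>2" for x :: real
proof (cases "x >= 0")
 case False
 assume x: "\<bar>x\<bar> <= 1"
 define y where "y = - x"
 have y: "0 < y" "y <= 1" using x False by (auto simp: y_def)
 have "exp (- y) = 1/exp y" by (simp add: exp_minus divide_inverse)
 also have "... <= 1/(1 + y)" using y exp_ge_add_one_self[of y] by (intro divide_left_mono mult_pos_pos) auto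
 also have "... <= 1 - y + y\<^sup>2"
 proof -
 have "1 <= (1 - y + y\<^sup>2)*(1 + y)" using y by (simp add: power2_eq_square algebra_simps)
 then show ?thesis using y by (simp add: divide_le_eq)
 qed
 finally show ?thesis by (simp add: y_def)
qed (use exp_bound in auto)

lemma ennreal_add_le: "q >= 0 ==> ennreal (p + q) <= ennreal p + ennreal q"
 by (cases "p >= 0") (auto simp: ennreal_neg intro!: ennreal_leI)

text \<open>The dual comparison, for a bounded subsolution. Since \<open>ph\<close> will be a
  positive part, the Taylor and generator conditions are asked only where it is positive; elsewhere
  the one-step inequality is trivial. The comparison starts at \<open>t/q\<close>, giving a path
  from \<open>x\<close> time to reach the support of \<open>ph\<close>. Boundedness of
  \<open>v\<close> and \<open>ph\<close> permits dominated convergence, Fatou's lemma giving the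
  wrong direction here.\<close>

lemma FK_lower:
 fixes ph D1 D2 :: "real => real" and q :: nat
 assumes N: "prob_space N" and B: "brownian_motion N x B" and t: "t > 0" and q: "q > 0"
 and v: "continuous_on UNIV v" "\<And>y. \<bar>v y\<bar> <= A"
 and ph: "continuous_on UNIV ph" "\<And>y. 0 <= ph y" "\<And>y. ph y <= P" and C: "C >= 0"
 and taylor: "\<And>y d. ph y > 0 ==> ph y + D1 y*d + D2 y/2*d\<^sup>2 - C * \<bar>d\<bar> ^ 3 <= ph (y + d)"
 and gen: "\<And>y. ph y > 0 ==> La*ph y <= D2 y/2 + v y*ph y"
 shows "ennreal (exp (La*(t - t/q)))*(\<integral>\<^sup>+om. ennreal (exp (integral {0..t/q} (%s. v (B s om)))*ph (B (t/q) om)) \<partial>N)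
 <= (\<integral>\<^sup>+om. ennreal (exp (integral {0..t} (%s. v (B s om)))*ph (B t om)) \<partial>N)"
proof -
 interpret prob_space N by fact
 have A: "A >= 0" using v(2)[of 0] by linarith
 have P: "P >= 0" using ph(2,3)[of 0] by linarith
 have vm [measurable]: "v \<in> borel_measurable borel" using v by (intro borel_measurable_continuous_onI)
 have phm [measurable]: "ph \<in> borel_measurable borel" using ph by (intro borel_measurable_continuous_onI)
 have Bm: "B s \<in> borel_measurable N" if "s >= 0" for s using B that by (auto simp: brownian_motion_on_def)
 define C' where "C' = C*(12*exp (1/2))"
 \<comment> \<open>Bounds the local rate \<open>La - v\<close>, so that \<open>h*G <= 1\<close>
   admits the quadratic estimate of the exponential.\<close>
 define G where "G = \<bar>La\<bar> + A"
 define C4 where "C4 = exp A*(P*G\<^sup>2 + C')"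
 have C': "C' >= 0" using C by (simp add: C'_def)
 have C4: "C4 >= 0" using C' P by (simp add: C4_def)
 define Y where "Y n k om = chain (fkstep v (t/real n)) (x, 0) k (%i. B (real (Suc i)*(t/real n)) om - B (real i*(t/real n)) om)" for n k om
 define E where "E n k = (LINT om|N. exp (snd (Y n k om))*ph (fst (Y n k om)))" for n k
 have Y_eq: "Y n k om = (x + (B (real k*(t/real n)) om - B 0 om), \<Sum>i<k. t/real n * v (x + (B (real i*(t/real n)) om - B 0 om)))" for n k om
 unfolding Y_def by (rule fkstep_chain)
 have Ym [measurable]: "Y n k \<in> borel_measurable N" if "n > 0" for n k
 unfolding Y_def using that t
 by (intro measurable_chain[OF measurable_fkstep] vm) (auto intro!: borel_measurable_diff Bm)
 have a_le: "exp (snd (Y n k om)) <= exp (A*t)" if "k <= n" "n > 0" for n k om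
 proof -
 have "snd (Y n k om) <= (\<Sum>i<k. t/real n*A)"
  unfolding Y_eq snd_conv using v(2) t by (intro sum_mono mult_left_mono) (auto simp: abs_le_iff)
 also have "... = A*t*(real k/real n)" by simp
 also have "... <= A*t*1" using that A t by (intro mult_left_mono) auto
 finally show ?thesis by simp
 qed
 have uY: "(%om. exp (snd (Y n k om))*ph (fst (Y n k om))) \<in> borel_measurable N" if "n > 0" for n k
 using Ym[OF that, of k] unfolding borel_prod[symmetric] by measurable
 have uB: "norm (exp (snd (Y n k om))*ph (fst (Y n k om))) <= exp (A*t)*P" if "k <= n" "n > 0" for n k om
 using a_le[OF that, of om] ph(2,3) by (auto simp: abs_mult intro!: mult_mono)
 have Ei: "integrable N (%om. exp (snd (Y n k om))*ph (fst (Y n k om)))" if "k <= n" "n > 0" for n k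
 by (rule integrable_const_bound[where B = "exp (A*t)*P"]) (use uY[OF that(2)] uB[OF that] in auto)
 have En: "(\<integral>\<^sup>+om. ennreal (exp (snd (Y n k om))*ph (fst (Y n k om))) \<partial>N) = ennreal (E n k)" if "k <= n" "n > 0" for n k
 unfolding E_def using ph(2) by (intro nn_integral_eq_integral Ei that) auto
 have E0: "0 <= E n k" for n k unfolding E_def using ph(2) by (intro integral_nonneg_AE) auto
 have step: "exp (t/real n*La)*E n k <= E n (Suc k) + C4*(t/real n * sqrt (t/real n))*exp (A*t)"
 if k: "k < n" and h: "t/real n <= 1" "t/real n*G <= 1" for n k
 proof -
 define h where "h = t/real n"
 have n: "n > 0" using k by simp
 have h0: "0 < h" "h <= 1" "h*G <= 1" using h t n by (auto simp: h_def)
 have inc: "gaussian_incs N h n (%i om. B (real (Suc i)*h) om - B (real i*h) om)"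
  using brownian_gaussian_incs[OF N B h0(1), of n 0] h0 by simp
 have pt: "ennreal (exp (h*La))*ennreal (exp a*ph y)
  <= (\<integral>\<^sup>+z. ennreal (exp (snd (fkstep v h k (y, a) z))*ph (fst (fkstep v h k (y, a) z))) \<partial>gauss h) + ennreal (C4*(h * sqrt h)*exp a)" for y a
 proof (cases "ph y > 0")
  case False
  then have "ph y = 0" using ph(2)[of y] by simp
  then show ?thesis by simp
 next
  case True
  define X where "X = ph y + D2 y/2*h - C'*(h * sqrt h)"
  define x' where "x' = h*(La - v y)"
  have "\<bar>La - v y\<bar> <= G" using v(2)[of y] by (simp add: G_def abs_le_iff) linarith
  then have "h * \<bar>La - v y\<bar> <= h*G" using h0 by (intro mult_left_mono) auto
  then have x1: "\<bar>x'\<bar> <= h*G" using h0 by (simp add: x'_def abs_mult)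
  then have x2: "\<bar>x'\<bar> <= 1" using h0 by simp
  have hh: "h\<^sup>2 <= h * sqrt h"
  proof -
  have "h*h <= h * sqrt h" using h0 real_sqrt_le_mono[of "h" 1] by (intro mult_left_mono real_le_rsqrt) (auto simp: power2_eq_square mult_left_le)
  then show ?thesis by (simp add: power2_eq_square)
  qed
  have "x'\<^sup>2 <= (h*G)\<^sup>2" using x1 power_mono[of "\<bar>x'\<bar>" "h*G" 2] by simp
  also have "... = G\<^sup>2*h\<^sup>2" by (simp add: power_mult_distrib)
  also have "... <= G\<^sup>2*(h * sqrt h)" using hh by (intro mult_left_mono) auto
  finally have xx: "x'\<^sup>2 <= G\<^sup>2*(h * sqrt h)" .
  have "ph y*(1 + x') <= ph y + D2 y/2*h"
  using gen[OF True] mult_left_mono[OF gen[OF True], of h] h0 by (simp add: x'_def algebra_simps)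
  moreover have "exp x' <= 1 + x' + G\<^sup>2*(h * sqrt h)" using exp_le_quadratic[OF x2] xx by linarith
  then have "ph y*exp x' <= ph y*(1 + x' + G\<^sup>2*(h * sqrt h))" using True by (intro mult_left_mono) auto
  moreover have "ph y*(G\<^sup>2*(h * sqrt h)) <= P*(G\<^sup>2*(h * sqrt h))" using ph(3)[of y] h0 by (intro mult_right_mono) auto
  ultimately have "ph y*exp x' <= X + (P*G\<^sup>2 + C')*(h * sqrt h)" by (simp add: X_def algebra_simps)
  then have "exp (h * v y)*(ph y*exp x') <= exp (h * v y)*(X + (P*G\<^sup>2 + C')*(h * sqrt h))" by (intro mult_left_mono) auto
  also have "... = exp (h * v y)*X + exp (h * v y)*((P*G\<^sup>2 + C')*(h * sqrt h))" by (simp add: distrib_left)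
  also have "exp (h * v y)*((P*G\<^sup>2 + C')*(h * sqrt h)) <= exp A*((P*G\<^sup>2 + C')*(h * sqrt h))"
  proof (intro mult_right_mono)
  have "h * v y <= 1*A" using h0 v(2)[of y] A by (intro order.trans[OF mult_left_mono[of "v y" A h] mult_right_mono]) (auto simp: abs_le_iff)
  then show "exp (h * v y) <= exp A" by simp
  qed (use P C' h0 in auto)
  finally have "ph y*exp (h*La) <= exp (h * v y)*X + C4*(h * sqrt h)"
  by (simp add: x'_def exp_add[symmetric] C4_def algebra_simps)
  then have "exp a*(ph y*exp (h*La)) <= exp a*(exp (h * v y)*X + C4*(h * sqrt h))" by (intro mult_left_mono) auto
  then have main: "exp (h*La)*(exp a*ph y) <= exp (a + h * v y)*X + C4*(h * sqrt h)*exp a"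
  by (simp add: exp_add algebra_simps)
  have "ennreal X <= (\<integral>\<^sup>+z. ennreal (ph (y + z)) \<partial>gauss h)"
  unfolding X_def C'_def using taylor[OF True] ph(2) C h0 by (intro gauss_step_lower[where a = "D1 y"]) auto
  then have "ennreal (exp (a + h * v y))*ennreal X <= ennreal (exp (a + h * v y))*(\<integral>\<^sup>+z. ennreal (ph (y + z)) \<partial>gauss h)"
  by (intro mult_left_mono) auto
  also have "... = (\<integral>\<^sup>+z. ennreal (exp (a + h * v y))*ennreal (ph (y + z)) \<partial>gauss h)"
  by (rule nn_integral_cmult[symmetric]) measurable
  also have "... = (\<integral>\<^sup>+z. ennreal (exp (snd (fkstep v h k (y, a) z))*ph (fst (fkstep v h k (y, a) z))) \<partial>gauss h)"
  by (intro nn_integral_cong) (simp add: fkstep_def ennreal_mult')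
  finally have I: "ennreal (exp (a + h * v y)*X) <= (\<integral>\<^sup>+z. ennreal (exp (snd (fkstep v h k (y, a) z))*ph (fst (fkstep v h k (y, a) z))) \<partial>gauss h)"
  by (simp add: ennreal_mult')
  have "ennreal (exp (h*La))*ennreal (exp a*ph y) = ennreal (exp (h*La)*(exp a*ph y))"
  by (rule ennreal_mult'[symmetric]) simp
  also have "... <= ennreal (exp (a + h * v y)*X + C4*(h * sqrt h)*exp a)" by (intro ennreal_leI main)
  also have "... <= ennreal (exp (a + h * v y)*X) + ennreal (C4*(h * sqrt h)*exp a)"
  using C4 h0 by (intro ennreal_add_le) auto
  also have "... <= (\<integral>\<^sup>+z. ennreal (exp (snd (fkstep v h k (y, a) z))*ph (fst (fkstep v h k (y, a) z))) \<partial>gauss h) + ennreal (C4*(h * sqrt h)*exp a)"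
  by (intro add_right_mono I)
  finally show ?thesis .
 qed
 have um: "(%s. ennreal (exp (snd s)*ph (fst s))) \<in> borel_measurable (borel :: (real \<times> real) measure)"
  unfolding borel_prod[symmetric] by measurable
 have "(\<integral>\<^sup>+om. ennreal (exp (snd (Y n (Suc k) om))*ph (fst (Y n (Suc k) om))) \<partial>N)
  = (\<integral>\<^sup>+om. (\<integral>\<^sup>+z. ennreal (exp (snd (fkstep v h k (Y n k om) z))*ph (fst (fkstep v h k (Y n k om) z))) \<partial>gauss h) \<partial>N)"
  unfolding Y_def h_def[symmetric]
  by (rule chain_nn_integral_step[where S = borel and u = "%s. ennreal (exp (snd s)*ph (fst s))", OF measurable_fkstep[OF vm] _ inc k um]) simp
 then have S: "ennreal (E n (Suc k)) = (\<integral>\<^sup>+om. (\<integral>\<^sup>+z. ennreal (exp (snd (fkstep v h k (Y n k om) z))*ph (fst (fkstep v h k (Y n k om) z))) \<partial>gauss h) \<partial>N)"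
  using En[of "Suc k" n] k n by simp
 have "ennreal (exp (h*La)*E n k) = ennreal (exp (h*La))*ennreal (E n k)" by (rule ennreal_mult') simp
 also have "... = (\<integral>\<^sup>+om. ennreal (exp (h*La))*ennreal (exp (snd (Y n k om))*ph (fst (Y n k om))) \<partial>N)"
  using En[of k n] k n uY[OF n, of k] by (subst nn_integral_cmult) auto
 also have "... <= (\<integral>\<^sup>+om. (\<integral>\<^sup>+z. ennreal (exp (snd (fkstep v h k (Y n k om) z))*ph (fst (fkstep v h k (Y n k om) z))) \<partial>gauss h)
  + ennreal (C4*(h * sqrt h)*exp (A*t)) \<partial>N)"
 proof (rule nn_integral_mono)
  fix om
  have "C4*(h * sqrt h)*exp (snd (Y n k om)) <= C4*(h * sqrt h)*exp (A*t)"
  using a_le[of k n om] k n C4 h0 by (intro mult_left_mono) auto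
  then show "ennreal (exp (h*La))*ennreal (exp (snd (Y n k om))*ph (fst (Y n k om)))
  <= (\<integral>\<^sup>+z. ennreal (exp (snd (fkstep v h k (Y n k om) z))*ph (fst (fkstep v h k (Y n k om) z))) \<partial>gauss h) + ennreal (C4*(h * sqrt h)*exp (A*t))"
  using pt[of "snd (Y n k om)" "fst (Y n k om)"] unfolding prod.collapse by (meson add_left_mono ennreal_leI order.trans)
 qed
 also have "... = ennreal (E n (Suc k)) + ennreal (C4*(h * sqrt h)*exp (A*t))"
 proof -
  interpret H: prob_space "gauss h" by (rule prob_space_gauss) fact
  note [measurable] = Ym[OF n, of k]
  have "(%(s, z). ennreal (exp (snd (fkstep v h k s z))*ph (fst (fkstep v h k s z)))) \<in> borel_measurable ((borel :: (real \<times> real) measure) \<Otimes>\<^sub>M gauss h)"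
  unfolding fkstep_def borel_prod[symmetric] by measurable
  then have "(%s. \<integral>\<^sup>+z. ennreal (exp (snd (fkstep v h k s z))*ph (fst (fkstep v h k s z))) \<partial>gauss h) \<in> borel_measurable (borel :: (real \<times> real) measure)"
  by (rule H.borel_measurable_nn_integral)
  then have "(%om. \<integral>\<^sup>+z. ennreal (exp (snd (fkstep v h k (Y n k om) z))*ph (fst (fkstep v h k (Y n k om) z))) \<partial>gauss h) \<in> borel_measurable N"
  by (rule measurable_compose[OF Ym[OF n]])
  then show ?thesis by (subst nn_integral_add) (auto simp: S emeasure_space_1)
 qed
 also have "... = ennreal (E n (Suc k) + C4*(h * sqrt h)*exp (A*t))"
  using E0 C4 h0 by (intro ennreal_plus[symmetric]) auto
 finally show ?thesis
  using E0[of n "Suc k"] C4 h0 unfolding h_def[symmetric] by (subst (asm) ennreal_le_iff) auto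
 qed
 have iter: "exp (- La*(t/real n) * real k)*E n k <= exp (- La*t)*E n n + t*(C4*exp ((A + \<bar>La\<bar>)*t)) * sqrt (t/real n)"
 if k: "k <= n" "n > 0" and h: "t/real n <= 1" "t/real n*G <= 1" for n k
 proof -
 define h where "h = t/real n"
 define Z where "Z = C4*exp ((A + \<bar>La\<bar>)*t)*(h * sqrt h)"
 have h0: "0 < h" using t k by (simp add: h_def)
 have Z: "Z >= 0" using C4 h0 by (simp add: Z_def)
 have "exp (- La*h * real (n - j))*E n (n - j) <= exp (- La*h * real n)*E n n + real j*Z" if "j <= n" for j
  using that
 proof (induction j)
  case (Suc j)
  define i where "i = n - Suc j"
  have i: "n - j = Suc i" "i < n" using Suc.prems by (auto simp: i_def)
  have "exp (- La*h * real i)*E n i = exp (- La*h * real (Suc i))*(exp (h*La)*E n i)"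
  by (simp add: exp_add[symmetric] algebra_simps)
  also have "... <= exp (- La*h * real (Suc i))*(E n (Suc i) + C4*(h * sqrt h)*exp (A*t))"
  using step[OF i(2) h] unfolding h_def by (intro mult_left_mono) auto
  also have "... = exp (- La*h * real (Suc i))*E n (Suc i) + C4*(h * sqrt h)*(exp (- La*h * real (Suc i))*exp (A*t))"
  by (simp add: algebra_simps)
  also have "C4*(h * sqrt h)*(exp (- La*h * real (Suc i))*exp (A*t)) <= Z"
  proof -
  have "h * real (Suc i) <= h * real n" using i h0 by (intro mult_left_mono) auto
  then have hi: "h * real (Suc i) <= t" using k by (simp add: h_def)
  have "- La*h * real (Suc i) <= \<bar>La\<bar>*(h * real (Suc i))" using h0 by (simp only: mult.assoc) (intro mult_right_mono, auto)
  also have "... <= \<bar>La\<bar>*t" using hi by (intro mult_left_mono) auto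
  finally have "exp (- La*h * real (Suc i))*exp (A*t) <= exp ((A + \<bar>La\<bar>)*t)"
  unfolding exp_add[symmetric] by (simp add: algebra_simps)
  then have "C4*(h * sqrt h)*(exp (- La*h * real (Suc i))*exp (A*t)) <= C4*(h * sqrt h)*exp ((A + \<bar>La\<bar>)*t)"
  using C4 h0 by (intro mult_left_mono) auto
  then show ?thesis by (simp add: Z_def mult_ac)
  qed
  finally have "exp (- La*h * real i)*E n i <= exp (- La*h * real (n - j))*E n (n - j) + Z" unfolding i(1) by simp
  also have "... <= exp (- La*h * real n)*E n n + real j*Z + Z" using Suc by simp
  finally show ?case unfolding i_def[symmetric] by (simp add: algebra_simps)
 qed simp
 from this[of "n - k"] k have "exp (- La*h * real k)*E n k <= exp (- La*h * real n)*E n n + real (n - k)*Z" by simp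
 also have "real (n - k)*Z <= real n*Z" using Z by (intro mult_right_mono) auto
 also have "real n*Z = t*(C4*exp ((A + \<bar>La\<bar>)*t)) * sqrt h" using k by (simp add: Z_def h_def)
 also have "- La*h * real n = - La*t" using k by (simp add: h_def)
 finally show ?thesis by (simp add: h_def)
 qed
 define I where "I r = (\<integral>\<^sup>+om. ennreal (exp (integral {0..r} (%s. v (B s om)))*ph (B r om)) \<partial>N)" for r
 have conv: "\<exists>L\<ge>0. (%i. E (nn i) (kk i)) \<longlonglongrightarrow> L & I r = ennreal L"
 if r: "r > 0" and nk: "\<And>i. kk i > 0" "\<And>i. kk i <= nn i" "\<And>i. real (kk i)*t = r * real (nn i)" and lim: "filterlim (%i. kk i - 1) at_top sequentially"
 for nn kk :: "nat => nat" and r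
 proof -
 have n0: "nn i > 0" for i using nk(1,2)[of i] by linarith
 have hr: "t/real (nn i) = r/real (kk i)" for i using nk(1,3)[of i] n0[of i] by (simp add: field_simps)
 let ?f = "%i om. exp (snd (Y (nn i) (kk i) om))*ph (fst (Y (nn i) (kk i) om))"
 let ?g = "%om. exp (integral {0..r} (%s. v (B s om)))*ph (B r om)"
 have fg: "AE om in N. (%i. ?f i om) \<longlonglongrightarrow> ?g om"
 proof -
  have "AE om in N. B 0 om = x" "AE om in N. continuous_on {0..} (%t. B t om)"
  using B by (auto simp: brownian_motion_on_def)
  then show ?thesis
  proof eventually_elim
  case (elim om)
  have Yk: "Y (nn i) (kk i) om = (B r om, \<Sum>l<kk i. r/real (kk i) * v (B (real l*(r/real (kk i))) om))" for i
  unfolding Y_eq using elim(1) nk(1)[of i] by (simp add: hr)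
  have "continuous_on {0..r} (%s. v (B s om))"
  by (rule continuous_on_UNIV_comp[OF v(1) continuous_on_subset[OF elim(2)]]) auto
  note R = riemann_sum_tendsto[OF less_imp_le[OF r] this]
  from filterlim_compose[OF R lim]
  have "(%i. snd (Y (nn i) (kk i) om)) \<longlonglongrightarrow> integral {0..r} (%s. v (B s om))"
  unfolding Yk snd_conv using nk(1) by simp
  then show ?case unfolding Yk fst_conv snd_conv by (intro tendsto_mult tendsto_exp tendsto_const)
  qed
 qed
 define g where "g om = lim (%i. ?f i om)" for om
 have fm: "?f i \<in> borel_measurable N" for i using uY[OF n0] by auto
 have gm: "g \<in> borel_measurable N" unfolding g_def by (rule borel_measurable_lim_metric[OF fm])
 have gg: "AE om in N. g om = ?g om" using fg by eventually_elim (simp add: g_def limI)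
 have fg': "AE om in N. (%i. ?f i om) \<longlonglongrightarrow> g om" using fg gg by eventually_elim simp
 have fb: "AE om in N. norm (?f i om) <= exp (A*t)*P" for i using uB[OF nk(2) n0] by (intro AE_I2)
 note dc = integrable_dominated_convergence[OF gm fm integrable_const fg' fb]
 note dc' = integral_dominated_convergence[OF gm fm integrable_const fg' fb]
 have g0: "AE om in N. 0 <= g om" using gg by eventually_elim (simp add: ph(2))
 have "I r = (\<integral>\<^sup>+om. ennreal (g om) \<partial>N)" unfolding I_def
  by (rule nn_integral_cong_AE) (use gg in eventually_elim, simp)
 also have "... = ennreal (integral\<^sup>L N g)" by (rule nn_integral_eq_integral[OF dc g0])
 finally have "I r = ennreal (integral\<^sup>L N g)" .
 moreover have "(%i. E (nn i) (kk i)) \<longlonglongrightarrow> integral\<^sup>L N g" unfolding E_def by (rule dc')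
 moreover have "0 <= integral\<^sup>L N g" by (rule integral_nonneg_AE[OF g0])
 ultimately show ?thesis by blast
 qed
 have f1: "filterlim (%i. Suc i - 1) at_top sequentially" by (simp add: filterlim_ident)
 have f2: "filterlim (%i. q*Suc i - 1) at_top sequentially"
 proof (rule filterlim_at_top_mono[OF filterlim_ident])
 show "\<forall>\<^sub>F i in sequentially. i <= q*Suc i - 1" using q by (intro always_eventually allI) (cases q, auto)
 qed
 have q1: "Suc i <= q*Suc i" for i using q by (cases q) auto
 \<comment> \<open>With \<open>q*(i + 1)\<close> steps, time \<open>t/q\<close> is the mesh point of
   index \<open>i + 1\<close>; both moments live on the same mesh.\<close>
 obtain L1 where L1: "L1 >= 0" "(%i. E (q*Suc i) (Suc i)) \<longlonglongrightarrow> L1" "I (t/q) = ennreal L1"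
 using conv[of "t/q" "%i. Suc i" "%i. q*Suc i"] f1 t q q1 by (auto simp: field_simps)
 obtain L2 where L2: "L2 >= 0" "(%i. E (q*Suc i) (q*Suc i)) \<longlonglongrightarrow> L2" "I t = ennreal L2"
 using conv[of t "%i. q*Suc i" "%i. q*Suc i"] f2 t q by auto
 have h0: "(%i. t/real (q*Suc i)) \<longlonglongrightarrow> 0"
 proof -
 have "(%i. t/real q*(1/real (Suc i))) \<longlonglongrightarrow> t/real q*0" by (intro tendsto_mult tendsto_const) real_asymp
 then show ?thesis by (simp add: field_simps)
 qed
 have ev1: "\<forall>\<^sub>F i in sequentially. t/real (q*Suc i) < 1" using h0 by (rule order_tendstoD) simp
 have "(%i. t/real (q*Suc i)*G) \<longlonglongrightarrow> 0*G" using h0 by (intro tendsto_mult tendsto_const)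
 then have ev2: "\<forall>\<^sub>F i in sequentially. t/real (q*Suc i)*G < 1" by (rule order_tendstoD) simp
 have le: "\<forall>\<^sub>F i in sequentially. exp (- La*(t/q))*E (q*Suc i) (Suc i)
  <= exp (- La*t)*E (q*Suc i) (q*Suc i) + t*(C4*exp ((A + \<bar>La\<bar>)*t)) * sqrt (t/real (q*Suc i))"
 using ev1 ev2
 proof eventually_elim
 case (elim i)
 have e: "- La*(t/real (q*Suc i)) * real (Suc i) = - La*(t/q)"
 proof -
  have "t/(real q * s) * s = t/real q" if "s > 0" for s using that by simp
  from this[of "real (Suc i)"] show ?thesis unfolding of_nat_mult mult.assoc by simp
 qed
 from iter[OF q1 _ less_imp_le[OF elim(1)] less_imp_le[OF elim(2)]] show ?case using q unfolding e by simp
 qed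
 have "exp (- La*(t/q))*L1 <= exp (- La*t)*L2 + t*(C4*exp ((A + \<bar>La\<bar>)*t)) * sqrt 0"
 proof (rule tendsto_le[OF sequentially_bot _ _ le])
 show "(%i. exp (- La*t)*E (q*Suc i) (q*Suc i) + t*(C4*exp ((A + \<bar>La\<bar>)*t)) * sqrt (t/real (q*Suc i)))
  \<longlonglongrightarrow> exp (- La*t)*L2 + t*(C4*exp ((A + \<bar>La\<bar>)*t)) * sqrt 0"
  by (intro tendsto_add tendsto_mult tendsto_const tendsto_real_sqrt L2(2) h0)
 show "(%i. exp (- La*(t/q))*E (q*Suc i) (Suc i)) \<longlonglongrightarrow> exp (- La*(t/q))*L1"
  by (intro tendsto_mult tendsto_const L1(2))
 qed
 then have "exp (La*t)*(exp (- La*(t/q))*L1) <= exp (La*t)*(exp (- La*t)*L2)" by (intro mult_left_mono) auto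
 then have "exp (La*t + - La*(t/q))*L1 <= exp (La*t + - La*t)*L2" by (simp only: exp_add mult.assoc)
 then have "exp (La*(t - t/q))*L1 <= L2" by (simp add: algebra_simps)
 then show ?thesis
 using L1 L2 unfolding I_def[symmetric] by (simp add: ennreal_mult'[symmetric] ennreal_leI)
qed

subsection \<open>Upper bounds from supersolutions\<close>

text \<open>A smooth substitute for the absolute value with bounded derivatives \<open>chi1\<close>,
  \<open>chi2\<close>, \<open>chi3\<close>. It carries the linear growth of the rate at large
  distance.\<close>

definition chi :: "real => real" where "chi y = sqrt (1 + y\<^sup>2)"
definition chi1 :: "real => real" where "chi1 y = y/chi y"
definition chi2 :: "real => real" where "chi2 y = 1/chi y ^ 3"
definition chi3 :: "real => real" where "chi3 y = - 3*y/chi y ^ 5"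

lemma chi_ge: "chi y >= 1" "chi y >= \<bar>y\<bar>" "chi y > 0" "chi y ~= 0" "(chi y)\<^sup>2 = 1 + y\<^sup>2"
proof -
 show 1: "chi y >= 1" by (simp add: chi_def)
 show "chi y >= \<bar>y\<bar>" unfolding chi_def by (rule real_le_rsqrt) simp
 show "chi y > 0" "chi y ~= 0" using 1 by auto
 show "(chi y)\<^sup>2 = 1 + y\<^sup>2" unfolding chi_def by (simp add: add_nonneg_nonneg)
qed

lemma chi_le: "chi y <= 1 + \<bar>y\<bar>"
 unfolding chi_def by (rule real_le_lsqrt) (auto simp: power2_eq_square algebra_simps)

lemma chi_deriv: "(chi has_real_derivative chi1 y) (at y)"
proof -
 have p: "0 < 1 + y\<^sup>2" by (rule add_pos_nonneg) auto
 have "((%y. 1 + y\<^sup>2) has_real_derivative 2*y) (at y)" by (auto intro!: derivative_eq_intros)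
 from DERIV_chain2[OF DERIV_real_sqrt[OF p] this]
 have "((%y. sqrt (1 + y\<^sup>2)) has_real_derivative inverse (sqrt (1 + y\<^sup>2))/2*(2*y)) (at y)" .
 moreover have "inverse (sqrt (1 + y\<^sup>2))/2*(2*y) = chi1 y"
 unfolding chi1_def chi_def by (simp add: field_simps)
 ultimately show ?thesis unfolding chi_def[abs_def] by simp
qed

lemma chi1_deriv: "(chi1 has_real_derivative chi2 y) (at y)"
proof -
 have "((%y. y/chi y) has_real_derivative (1 * chi y - y * chi1 y)/(chi y * chi y)) (at y)"
 by (intro DERIV_divide DERIV_ident chi_deriv chi_ge)
 moreover have "(1 * chi y - y * chi1 y)/(chi y * chi y) = chi2 y"
 proof -
 have "chi y - y*(y/chi y) = ((chi y)\<^sup>2 - y\<^sup>2)/chi y"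
  using chi_ge(4)[of y] by (simp add: field_simps power2_eq_square)
 also have "... = 1/chi y" using chi_ge(5)[of y] by simp
 finally show ?thesis by (simp add: chi1_def chi2_def power3_eq_cube)
 qed
 ultimately show ?thesis by (simp add: chi1_def[abs_def])
qed

lemma chi2_deriv: "(chi2 has_real_derivative chi3 y) (at y)"
proof -
 have "((%y. 1/chi y ^ 3) has_real_derivative (0 * chi y ^ 3 - 1*(real 3*(chi1 y * chi y ^ (3 - Suc 0))))/(chi y ^ 3 * chi y ^ 3)) (at y)"
 by (intro DERIV_divide DERIV_const DERIV_power chi_deriv) (simp add: chi_ge)
 moreover have "(0 * chi y ^ 3 - 1*(real 3*(chi1 y * chi y ^ (3 - Suc 0))))/(chi y ^ 3 * chi y ^ 3) = chi3 y"
 using chi_ge(4)[of y] by (simp add: chi1_def chi3_def power2_eq_square power3_eq_cube numeral_eq_Suc)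
 ultimately show ?thesis by (simp add: chi2_def[abs_def])
qed

lemma chi_bounds: "\<bar>chi1 y\<bar> <= 1" "\<bar>chi2 y\<bar> <= 1" "\<bar>chi3 y\<bar> <= 3"
proof -
 note c = chi_ge[of y]
 show "\<bar>chi1 y\<bar> <= 1" using c by (simp add: chi1_def divide_le_eq)
 show "\<bar>chi2 y\<bar> <= 1" using c by (simp add: chi2_def power_le_one_iff one_le_power divide_le_eq)
 have "\<bar>y\<bar>*1 <= chi y * chi y ^ 4" using c by (intro mult_mono one_le_power) auto
 then have "\<bar>y\<bar> <= chi y ^ 5" by (simp add: numeral_eq_Suc)
 then show "\<bar>chi3 y\<bar> <= 3" using c by (simp add: chi3_def abs_mult divide_le_eq)
qed

lemma chi_cont: "continuous_on S chi"
 using chi_deriv by (meson DERIV_continuous continuous_at_imp_continuous_on)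

lemma chi_lipschitz: "\<bar>chi y - chi z\<bar> <= \<bar>y - z\<bar>"
proof -
 have "norm (chi y - chi z) <= 1*norm (y - z)"
 by (rule field_differentiable_bound[of UNIV chi chi1])
  (use chi_bounds(1) chi_deriv in \<open>auto intro: has_field_derivative_at_within\<close>)
 then show ?thesis by simp
qed

text \<open>Only the ratio of \<open>exp (f (y + e))\<close> to \<open>exp (f y)\<close> is
  expanded, so no bound on \<open>f\<close> itself is involved; the bounded slope of
  \<open>f\<close> accounts for the factor \<open>exp (K*|e|)\<close> in the remainder.\<close>

lemma exp_taylor_upper:
 fixes f f1 f2 f3 :: "real => real"
 assumes d: "\<And>x. (f has_real_derivative f1 x) (at x)" "\<And>x. (f1 has_real_derivative f2 x) (at x)"
 "\<And>x. (f2 has_real_derivative f3 x) (at x)"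
 and b: "\<And>x. \<bar>f1 x\<bar> <= K" "\<And>x. \<bar>f2 x\<bar> <= K" "\<And>x. \<bar>f3 x\<bar> <= K"
 shows "exp (f (y + e) - f y) <= 1 + f1 y*e + (f2 y + (f1 y)\<^sup>2)/2*e\<^sup>2 + (K + 3*K\<^sup>2 + K ^ 3)*(\<bar>e\<bar> ^ 3*exp (K * \<bar>e\<bar>))"
proof (cases "e = 0")
 case False
 have K: "K >= 0" using b(1)[of 0] by linarith
 \<comment> \<open>For \<open>n <= 3\<close> this is the n-th derivative in \<open>x\<close> of
   \<open>exp (f (y + x) - f y)\<close>.\<close>
 define u where "u n x = exp (f (y + x) - f y)*(if n = 0 then 1 else if n = 1 then f1 (y + x)
 else if n = 2 then f2 (y + x) + (f1 (y + x))\<^sup>2 else f3 (y + x) + 3*f1 (y + x)*f2 (y + x) + f1 (y + x) ^ 3)" for n :: nat and x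
 have sh: "((%x. g (y + x)) has_real_derivative g' (y + x)) (at x)" if "\<And>x. (g has_real_derivative g' x) (at x)" for g g' x
 using DERIV_shift[of g "g' (y + x)" x y] that[of "x + y"] by (simp add: add.commute)
 note D = sh[OF d(1)] sh[OF d(2)] sh[OF d(3)]
 have E: "((%x. exp (f (y + x) - f y)) has_real_derivative exp (f (y + x) - f y)*f1 (y + x)) (at x)" for x
 by (auto intro!: derivative_eq_intros D(1))
 have du: "(u n has_real_derivative u (Suc n) x) (at x)" if n3: "n < 3" for n x
 proof -
 consider "n = 0" | "n = 1" | "n = 2" using n3 by (fastforce simp: numeral_eq_Suc less_Suc_eq)
 then show ?thesis
 proof cases
  case 1 then show ?thesis using E[of x] by (simp add: u_def[abs_def])
 next
  case 2
  have "((%x. exp (f (y + x) - f y)*f1 (y + x)) has_real_derivative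
  exp (f (y + x) - f y)*f1 (y + x)*f1 (y + x) + f2 (y + x)*exp (f (y + x) - f y)) (at x)"
  by (rule DERIV_mult[OF E D(2)])
  then show ?thesis using 2 by (simp add: u_def[abs_def] power2_eq_square algebra_simps)
 next
  case 3
  have "((%x. f2 (y + x) + f1 (y + x)*f1 (y + x)) has_real_derivative
  f3 (y + x) + (f2 (y + x)*f1 (y + x) + f2 (y + x)*f1 (y + x))) (at x)"
  by (intro DERIV_add D(3) DERIV_mult D(2))
  from DERIV_mult[OF E this] show ?thesis using 3 by (simp add: u_def[abs_def] power2_eq_square power3_eq_cube algebra_simps)
 qed
 qed
 obtain t where t: "if e < 0 then e < t & t < 0 else 0 < t & t < e"
 "u 0 e = (\<Sum>m<3. u m 0/fact m*(e - 0) ^ m) + u 3 t/fact 3*(e - 0) ^ 3"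
 proof -
 have "- \<bar>e\<bar> <= e" "e <= \<bar>e\<bar>" by linarith+
 then show ?thesis using that Taylor[of 3 u "u 0" "- \<bar>e\<bar>" "\<bar>e\<bar>" 0 e] du False by auto
 qed
 have te: "\<bar>t\<bar> <= \<bar>e\<bar>" using t(1) by (auto split: if_splits)
 have "\<bar>f (y + t) - f y\<bar> <= K * \<bar>t\<bar>"
 using field_differentiable_bound[of UNIV f f1 K "y + t" y] d(1) b(1) by (auto intro: has_field_derivative_at_within)
 also have "... <= K * \<bar>e\<bar>" using te K by (intro mult_left_mono)
 finally have "exp (f (y + t) - f y) <= exp (K * \<bar>e\<bar>)" by simp
 moreover have "\<bar>f3 (y + t) + 3*f1 (y + t)*f2 (y + t) + f1 (y + t) ^ 3\<bar> <= K + 3*K\<^sup>2 + K ^ 3"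
 proof -
 have "\<bar>f1 (y + t)*f2 (y + t)\<bar> <= K*K" unfolding abs_mult using b K by (intro mult_mono) auto
 moreover have "\<bar>f1 (y + t) ^ 3\<bar> <= K ^ 3" unfolding power_abs using b by (intro power_mono) auto
 ultimately show ?thesis using b(3)[of "y + t"] by (simp add: power2_eq_square)
 qed
 ultimately have u3: "\<bar>u 3 t\<bar> <= exp (K * \<bar>e\<bar>)*(K + 3*K\<^sup>2 + K ^ 3)"
 unfolding u_def abs_mult by (intro mult_mono) auto
 have "u 3 t/fact 3*(e - 0) ^ 3 <= \<bar>u 3 t\<bar> * \<bar>e\<bar> ^ 3"
 proof -
 have "u 3 t/fact 3*(e - 0) ^ 3 <= \<bar>u 3 t/fact 3*e ^ 3\<bar>" by (simp only: diff_zero abs_ge_self)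
 also have "... = \<bar>u 3 t\<bar> * \<bar>e\<bar> ^ 3/6" by (simp add: abs_mult power_abs fact_numeral)
 also have "... <= \<bar>u 3 t\<bar> * \<bar>e\<bar> ^ 3" by simp
 finally show ?thesis .
 qed
 also have "... <= exp (K * \<bar>e\<bar>)*(K + 3*K\<^sup>2 + K ^ 3) * \<bar>e\<bar> ^ 3" by (intro mult_right_mono u3) auto
 finally have r: "u 3 t/fact 3*(e - 0) ^ 3 <= (K + 3*K\<^sup>2 + K ^ 3)*(\<bar>e\<bar> ^ 3*exp (K * \<bar>e\<bar>))"
 by (simp add: mult_ac)
 have "(\<Sum>m<3. u m 0/fact m*(e - 0) ^ m) = 1 + f1 y*e + (f2 y + (f1 y)\<^sup>2)/2*e\<^sup>2"
 by (simp add: numeral_eq_Suc u_def)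
 moreover have "u 0 e = exp (f (y + e) - f y)" by (simp add: u_def)
 ultimately show ?thesis using t(2) r by linarith
qed (simp add: power2_eq_square)

context kernel
begin

text \<open>By itself \<open>exp (conv h 0)\<close> is a supersolution only up to a rate growing
  like \<open>ka1*chi\<close>. The term \<open>ka*ta*chi y\<close> with \<open>ka = 2*ka1\<close>
  absorbs this growth: its increase in time supplies \<open>2*ka1*chi\<close>, one half for the
  growth and one half for the cross term of p with the derivative of \<open>chi\<close>, which
  \<open>ka2*T <= 1/2\<close> keeps below \<open>ka1*chi\<close> up to a constant. The shift by
  \<open>H\<close> makes \<open>F 0\<close> nonnegative, so that the terminal factor may be
  dropped.\<close>

lemma supersol_upper:
 assumes N: "prob_space N" and B: "brownian_motion N x B" and t: "0 < t" "t <= T"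
 and w: "continuous_on UNIV w" and p: "continuous_on UNIV p" "\<And>y. \<bar>p y\<bar> <= Pmax"
 and s: "supersol thh w (%y. La + ka1 * chi y) p" and ka1: "ka1 >= 0"
 and P0: "\<And>y. \<bar>p y\<bar> <= P0 + ka2 * chi y" "P0 >= 0" and ka2: "ka2 >= 0" "ka2*T <= 1/2"
 and h: "\<And>y. (h has_real_derivative p y) (at y)" "h 0 = 0" "\<And>y. h y >= - H"
 shows "(\<integral>\<^sup>+om. ennreal (exp (integral {0..t} (%s. thh*(- conv w 1 (B s om))))) \<partial>N)
 <= ennreal (exp (H + (\<bar>x\<bar> + 1)*(P0 + ka2*(\<bar>x\<bar> + 2)) + 2 * ka1*T*(\<bar>x\<bar> + 1)
  + (La + ka1 + ka1*T + 2 * ka1*T*(P0 + ka2) + 2*(ka1*T)\<^sup>2)*t))"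
proof -
 define ka where "ka = 2 * ka1"
 have ka: "ka >= 0" using ka1 by (simp add: ka_def)
 define c where "c = La + ka1 + ka*T/2 + ka*T*(P0 + ka2) + (ka*T)\<^sup>2/2"
 define v where "v y = thh*(- conv w 1 y)" for y
 define F where "F ta y = conv h 0 y + ka*ta * chi y + H" for ta y
 define F1 where "F1 ta y = conv p 0 y + ka*ta * chi1 y" for ta y
 define F2 where "F2 ta y = - conv p 1 y + ka*ta * chi2 y" for ta y
 define F3 where "F3 ta y = conv p 2 y + ka*ta * chi3 y" for ta y
 have T: "T >= 0" using t by simp
 have hc: "continuous_on UNIV h" using h(1) by (meson DERIV_continuous continuous_at_imp_continuous_on)
 have d1: "(F ta has_real_derivative F1 ta y) (at y)" for ta y
 unfolding F_def[abs_def] F1_def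
 using DERIV_add[OF DERIV_add[OF conv_deriv_C1[OF h(1) p(1)] DERIV_cmult[OF chi_deriv]] DERIV_const] by simp
 have d2: "(F1 ta has_real_derivative F2 ta y) (at y)" for ta y
 unfolding F1_def[abs_def] F2_def using conv_deriv[OF p(1), of 0 y]
 by (intro DERIV_add DERIV_cmult chi1_deriv) simp
 have d3: "(F2 ta has_real_derivative F3 ta y) (at y)" for ta y
 unfolding F2_def[abs_def] F3_def using DERIV_minus[OF conv_deriv[OF p(1), of 1 y]]
 by (intro DERIV_add DERIV_cmult chi2_deriv) (simp add: numeral_2_eq_2)
 obtain C0 where C0: "\<And>y B. (\<And>z. \<bar>p z\<bar> <= B) ==> \<bar>conv p 0 y\<bar> <= C0*B" "C0 >= 0" using conv_abs_bound[OF p(1)] by blast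
 obtain C1 where C1: "\<And>y B. (\<And>z. \<bar>p z\<bar> <= B) ==> \<bar>conv p 1 y\<bar> <= C1*B" "C1 >= 0" using conv_abs_bound[OF p(1)] by blast
 obtain C2 where C2: "\<And>y B. (\<And>z. \<bar>p z\<bar> <= B) ==> \<bar>conv p 2 y\<bar> <= C2*B" "C2 >= 0" using conv_abs_bound[OF p(1)] by blast
 define K where "K = (C0 + C1 + C2)*Pmax + 3*(ka*T)"
 have Pm: "Pmax >= 0" using p(2)[of 0] by linarith
 have pp: "C0*Pmax >= 0" "C1*Pmax >= 0" "C2*Pmax >= 0" "ka*T >= 0" using Pm C0 C1 C2 ka T by auto
 have kt: "\<bar>ka*ta*z\<bar> <= 3*(ka*T)" "\<bar>z\<bar> <= 1 ==> \<bar>ka*ta*z\<bar> <= ka*T" if "0 <= ta" "ta <= t" "\<bar>z\<bar> <= 3" for ta z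
 proof -
 have kk: "ka*ta <= ka*T" "0 <= ka*ta" using that t ka mult_left_mono[of ta T ka] by auto
 have "ka*ta * \<bar>z\<bar> <= ka*T*3" by (rule mult_mono[OF kk(1) that(3)]) (use pp in auto)
 moreover have az: "\<bar>ka*ta*z\<bar> = ka*ta * \<bar>z\<bar>"
  unfolding abs_mult[of "ka*ta" z] using kk(2) by (simp only: abs_of_nonneg)
 ultimately show "\<bar>ka*ta*z\<bar> <= 3*(ka*T)" by simp
 assume "\<bar>z\<bar> <= 1"
 then have "ka*ta * \<bar>z\<bar> <= ka*T*1" by (rule mult_mono[OF kk(1)]) (use pp in auto)
 then show "\<bar>ka*ta*z\<bar> <= ka*T" using az by simp
 qed
 have b1: "\<bar>F1 ta y\<bar> <= K" and b2: "\<bar>F2 ta y\<bar> <= K" and b3: "\<bar>F3 ta y\<bar> <= K" if "0 <= ta" "ta <= t" for ta y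
 proof -
 have z: "\<bar>chi1 y\<bar> <= 3" "\<bar>chi2 y\<bar> <= 3" "\<bar>chi3 y\<bar> <= 3" using chi_bounds[of y] by linarith+
 have "\<bar>F1 ta y\<bar> <= C0*Pmax + 3*(ka*T)" unfolding F1_def
  by (rule order.trans[OF abs_triangle_ineq add_mono[OF C0(1)[OF p(2)] kt(1)[OF that z(1)]]])
 moreover have "\<bar>- conv p 1 y\<bar> <= C1*Pmax" using C1(1)[OF p(2)] by simp
 then have "\<bar>F2 ta y\<bar> <= C1*Pmax + 3*(ka*T)" unfolding F2_def
  by (rule order.trans[OF abs_triangle_ineq add_mono[OF _ kt(1)[OF that z(2)]]])
 moreover have "\<bar>F3 ta y\<bar> <= C2*Pmax + 3*(ka*T)" unfolding F3_def
  by (rule order.trans[OF abs_triangle_ineq add_mono[OF C2(1)[OF p(2)] kt(1)[OF that z(3)]]])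
 moreover have "C0*Pmax + 3*(ka*T) <= K" "C1*Pmax + 3*(ka*T) <= K" "C2*Pmax + 3*(ka*T) <= K"
  using pp by (simp_all add: K_def distrib_right)
 ultimately show "\<bar>F1 ta y\<bar> <= K" "\<bar>F2 ta y\<bar> <= K" "\<bar>F3 ta y\<bar> <= K" by (blast intro: order.trans)+
 qed
 have K: "K >= 0" unfolding K_def using pp by (simp add: distrib_right)
 have pc: "\<bar>conv p 0 y\<bar> <= P0 + ka2 + ka2 * chi y" for y
 proof -
 have "\<bar>conv p 0 y - 0\<bar> <= P0 + ka2 + ka2 * chi y"
 proof (rule conv_bounds[OF p(1)])
  fix z assume z: "\<bar>z - y\<bar> <= ep"
  then have "chi z <= chi y + 1" using chi_lipschitz[of z y] eps by linarith
  then have "ka2 * chi z <= ka2*(chi y + 1)" using ka2 by (intro mult_left_mono)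
  then show "\<bar>p z - 0\<bar> <= P0 + ka2 + ka2 * chi y" using P0(1)[of z] by (simp add: distrib_left)
 qed
 then show ?thesis by simp
 qed
 have lc: "conv (%y. La + ka1 * chi y) 0 y <= La + ka1 + ka1 * chi y" for y
 proof -
 have "conv (%y. La + ka1 * chi y) 0 y <= conv (%_. La + ka1 + ka1 * chi y) 0 y"
 proof (rule conv_mono)
  fix z assume z: "\<bar>z - y\<bar> <= ep"
  then have "chi z <= chi y + 1" using chi_lipschitz[of z y] eps by linarith
  then have "ka1 * chi z <= ka1*(chi y + 1)" using ka1 by (intro mult_left_mono)
  then show "La + ka1 * chi z <= La + ka1 + ka1 * chi y" by (simp add: distrib_left)
 qed (intro continuous_on_add continuous_on_mult continuous_on_const chi_cont)+
 then show ?thesis by (simp add: conv_const)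
 qed
 have gen: "F ta y + h'*((F2 ta y + (F1 ta y)\<^sup>2)/2 + v y - c) <= F (ta + h') y"
 if "0 <= ta" "0 <= h'" "ta + h' <= t" for ta h' y
 proof -
 have ta: "0 <= ta" "ta <= t" using that by auto
 have "F1 ta y = conv p 0 y + ka*ta * chi1 y" by (simp add: F1_def)
 then have sq: "(F1 ta y)\<^sup>2 = (conv p 0 y)\<^sup>2 + 2*(conv p 0 y*(ka*ta * chi1 y)) + (ka*ta * chi1 y)\<^sup>2"
  by (simp add: power2_eq_square algebra_simps)
 have k1: "\<bar>ka*ta * chi1 y\<bar> <= ka*T" "\<bar>ka*ta * chi2 y\<bar> <= ka*T"
  using kt(2)[OF ta] chi_bounds[of y] by auto
 have q1: "(ka*ta * chi1 y)\<^sup>2 <= (ka*T)\<^sup>2" using k1(1) by (rule power2_le_iff_abs_le[THEN iffD2, rotated]) (use pp in simp)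
 have "conv p 0 y*(ka*ta * chi1 y) <= \<bar>conv p 0 y\<bar> * \<bar>ka*ta * chi1 y\<bar>" by (simp add: abs_mult[symmetric])
 also have "... <= (P0 + ka2 + ka2 * chi y)*(ka*T)" by (rule mult_mono[OF pc k1(1)]) (use P0(2) ka2 chi_ge(3)[of y] in auto)
 also have "... = ka*T*(P0 + ka2) + ka*((ka2*T) * chi y)" by (simp add: algebra_simps)
 also have "(ka2*T) * chi y <= 1/2 * chi y" using ka2 chi_ge[of y] by (intro mult_right_mono) auto
 then have "ka*((ka2*T) * chi y) <= ka*(1/2 * chi y)" using ka by (intro mult_left_mono) auto
 finally have q2: "conv p 0 y*(ka*ta * chi1 y) <= ka*T*(P0 + ka2) + ka1 * chi y" by (simp add: ka_def)
 have lamc: "continuous_on UNIV (%y. La + ka1 * chi y)" by (intro continuous_on_add continuous_on_mult continuous_on_const chi_cont)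
 have "- conv p 1 y/2 + (conv p 0 y)\<^sup>2/2 + v y <= La + ka1 + ka1 * chi y"
  unfolding v_def using supersol_conv[OF s w p(1) lamc, of y] lc[of y] by linarith
 then have "(F2 ta y + (F1 ta y)\<^sup>2)/2 + v y - c <= ka * chi y"
 proof -
  assume A: "- conv p 1 y/2 + (conv p 0 y)\<^sup>2/2 + v y <= La + ka1 + ka1 * chi y"
  have "ka * chi y = 2*(ka1 * chi y)" by (simp add: ka_def)
  moreover have "ka*ta * chi2 y <= ka*T" using k1(2) by linarith
  ultimately show ?thesis unfolding sq F2_def c_def using A q1 q2 by (simp only: add_divide_distrib)
 qed
 then have "h'*((F2 ta y + (F1 ta y)\<^sup>2)/2 + v y - c) <= h'*(ka * chi y)" using that by (intro mult_left_mono)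
 then show ?thesis unfolding F_def by (simp add: algebra_simps)
 qed
 have vc: "continuous_on UNIV v"
 proof -
 have "continuous_on UNIV (conv w 1)" using conv_deriv[OF w, of 1] by (meson DERIV_continuous continuous_at_imp_continuous_on)
 then show ?thesis unfolding v_def[abs_def] by (intro continuous_on_mult continuous_on_const continuous_on_minus)
 qed
 have Fc: "continuous_on UNIV (F ta)" for ta using d1 by (meson DERIV_continuous continuous_at_imp_continuous_on)
 have main: "(\<integral>\<^sup>+om. ennreal (exp (integral {0..t} (%s. v (B s om)) + F 0 (B t om))) \<partial>N) <= ennreal (exp (F t x + c*t))"
 proof (rule FK_upper[OF N B t(1) vc Fc K, where C = "K + 3*K\<^sup>2 + K ^ 3" and ?F1.0 = F1 and ?F2.0 = F2])
 show "exp (F ta (y + d) - F ta y) <= 1 + F1 ta y*d + (F2 ta y + (F1 ta y)\<^sup>2)/2*d\<^sup>2 + (K + 3*K\<^sup>2 + K ^ 3)*(\<bar>d\<bar> ^ 3*exp (K * \<bar>d\<bar>))"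
  if "0 <= ta" "ta <= t" for ta y d
  by (rule exp_taylor_upper[OF d1 d2 d3 b1[OF that] b2[OF that] b3[OF that]])
 qed (use K gen in auto)
 have hb: "conv h 0 y >= - H" for y
 using conv_mono[of "%_. - H" h y] h(3) hc by (simp add: conv_const)
 have hx: "conv h 0 x <= (\<bar>x\<bar> + 1)*(P0 + ka2*(\<bar>x\<bar> + 2))"
 proof -
 let ?M = "(\<bar>x\<bar> + 1)*(P0 + ka2*(\<bar>x\<bar> + 2))"
 have "conv h 0 x <= conv (%_. ?M) 0 x"
 proof (rule conv_mono[OF hc continuous_on_const])
  fix z assume "\<bar>z - x\<bar> <= ep"
  then have z: "\<bar>z\<bar> <= \<bar>x\<bar> + 1" using eps by linarith
  have "norm (h z - h 0) <= (P0 + ka2*(\<bar>x\<bar> + 2))*norm (z - 0)"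
  proof (rule field_differentiable_bound[of "{- (\<bar>x\<bar> + 1)..\<bar>x\<bar> + 1}" h p])
  fix r assume "r \<in> {- (\<bar>x\<bar> + 1)..\<bar>x\<bar> + 1}"
  then have "chi r <= \<bar>x\<bar> + 2" using chi_le[of r] by auto
  then have "ka2 * chi r <= ka2*(\<bar>x\<bar> + 2)" using ka2 by (intro mult_left_mono)
  then show "norm (p r) <= P0 + ka2*(\<bar>x\<bar> + 2)" using P0(1)[of r] by simp
  qed (use z h in \<open>auto intro: has_field_derivative_at_within\<close>)
  also have "... <= (P0 + ka2*(\<bar>x\<bar> + 2))*(\<bar>x\<bar> + 1)" using z P0(2) ka2 by (intro mult_left_mono) auto
  finally show "h z <= ?M" using h(2) by (simp add: mult.commute)
 qed
 then show ?thesis by (simp add: conv_const)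
 qed
 have "(\<integral>\<^sup>+om. ennreal (exp (integral {0..t} (%s. v (B s om)))) \<partial>N)
 <= (\<integral>\<^sup>+om. ennreal (exp (integral {0..t} (%s. v (B s om)) + F 0 (B t om))) \<partial>N)"
 proof (intro nn_integral_mono ennreal_leI)
 fix om
 have "0 <= H + conv h 0 (B t om)" using hb[of "B t om"] by linarith
 then show "exp (integral {0..t} (%s. v (B s om))) <= exp (integral {0..t} (%s. v (B s om)) + F 0 (B t om))"
  by (simp add: F_def)
 qed
 also have "... <= ennreal (exp (F t x + c*t))" by (rule main)
 also have "... <= ennreal (exp (H + (\<bar>x\<bar> + 1)*(P0 + ka2*(\<bar>x\<bar> + 2)) + 2 * ka1*T*(\<bar>x\<bar> + 1)
  + (La + ka1 + ka1*T + 2 * ka1*T*(P0 + ka2) + 2*(ka1*T)\<^sup>2)*t))"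
 proof -
 have "chi x <= \<bar>x\<bar> + 1" using chi_le[of x] by simp
 then have "ka*t * chi x <= ka*T*(\<bar>x\<bar> + 1)"
  by (rule mult_mono[OF mult_left_mono[OF t(2) ka]]) (use ka T chi_ge[of x] in auto)
 then have "F t x <= H + (\<bar>x\<bar> + 1)*(P0 + ka2*(\<bar>x\<bar> + 2)) + 2 * ka1*T*(\<bar>x\<bar> + 1)" unfolding F_def using hx by (simp add: ka_def)
 moreover have "c = La + ka1 + ka1*T + 2 * ka1*T*(P0 + ka2) + 2*(ka1*T)\<^sup>2"
  by (simp add: c_def ka_def power_mult_distrib)
 ultimately show ?thesis by (intro ennreal_leI) simp
 qed
 finally show ?thesis by (simp add: v_def)
qed

end

section \<open>Assembling the supersolution from node values along the mesh\<close>

lemma primitive_lower: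
 fixes e :: "nat => real"
 assumes b: "b > 0" and h: "\<And>y. y >= 0 ==> (h has_real_derivative p y) (at y)" "h 0 = 0"
 and p: "\<And>i y. real i*b <= y ==> y <= real (Suc i)*b ==> - e i <= p y"
 and e: "\<And>i. e i >= 0" "\<And>k. b*(\<Sum>i<k. e i) <= H" and y: "y >= 0"
 shows "- H <= h y"
proof -
 have cell: "h u - e k*(z - u) <= h z" if "real k*b <= u" "u <= z" "z <= real (Suc k)*b" for k u z
 proof -
 have u0: "0 <= u" using that b by (auto intro: order.trans[of 0 "real k*b"])
 have "h u + e k*u <= h z + e k*z"
 proof (rule DERIV_nonneg_imp_nondecreasing[OF that(2)])
  fix r assume r: "u <= r" "r <= z"
  have "((%y. h y + e k*y) has_real_derivative p r + e k*1) (at r)"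
  using r u0 by (intro DERIV_add DERIV_cmult DERIV_ident h(1)) auto
  moreover have "p r + e k*1 >= 0" using p[of k r] r that by auto
  ultimately show "\<exists>d. ((%y. h y + e k*y) has_real_derivative d) (at r) & 0 <= d" by blast
 qed
 then show ?thesis by (simp add: algebra_simps)
 qed
 have nodes: "- (b*(\<Sum>i<k. e i)) <= h (real k*b)" for k
 proof (induction k)
 case (Suc k)
 have "h (real k*b) - e k*(real (Suc k)*b - real k*b) <= h (real (Suc k)*b)"
  using b by (intro cell) (auto simp: algebra_simps)
 then show ?case using Suc by (simp add: algebra_simps)
 qed (simp add: h)
 define k where "k = nat \<lfloor>y/b\<rfloor>"
 have k: "real k*b <= y" "y <= real (Suc k)*b"
 using cell_exists[OF b, of y] y b by (auto simp: k_def algebra_simps)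
 have "e k*(y - real k*b) <= e k*b" using k e by (intro mult_left_mono) (auto simp: algebra_simps)
 then have "- (b*(\<Sum>i<Suc k. e i)) <= h y" using cell[of k "real k*b" y] k nodes[of k] by (simp add: algebra_simps)
 then show ?thesis using e(2)[of "Suc k"] by linarith
qed

text \<open>Half the coefficient produced by \<open>crude_cell\<close>: \<open>37/et\<close> comes
  from the slope of the node values and 4610 from the square of p.\<close>

definition c1 :: "real => real" where "c1 et = (37/et + 4610)/2"

text \<open>The amount by which p may be negative on a cell. It is nonzero only where the chain is
  below 1/2 and on the cell \<open>n\<close>, where the chain hands over to deterministic
  nodes.\<close>

definition bad :: "real => nat => (nat => real) => nat => real" where
 "bad m n rh i = (if i < n & rh i < 1/2 \<or> i = n then 2*m else 0)"

lemma sum_bad: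
 assumes "m >= 0"
 shows "(\<Sum>i<k. bad m n rh i) <= 2*m*(real (card {i. i < n & rh i < 1/2}) + 1)"
proof -
 let ?S = "insert n {i. i < n & rh i < 1/2}"
 have "(\<Sum>i<k. bad m n rh i) = (\<Sum>i\<in>{..<k} \<inter> ?S. 2*m)"
 proof -
 have "{i. i < n & rh i < 1/2 \<or> i = n} = ?S" by auto
 then show ?thesis unfolding bad_def by (simp only: sum.If_cases[OF finite_lessThan] sum.neutral_const add_0_right)
 qed
 also have "... <= (\<Sum>i\<in>?S. 2*m)" using assms by (intro sum_mono2) auto
 also have "... = 2*m*(real (card {i. i < n & rh i < 1/2}) + 1)" by simp
 finally show ?thesis .
qed

text \<open>The sequence r prescribes p at the mesh points. Up to index n it follows the chain;
 beyond n it is the deterministic choice that keeps p nonnegative.\<close>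

lemma chain_cell:
 fixes rh rh' m et b U d u :: real
 assumes m: "m > 0" and et: "0 < et" "sqrt et <= 1/110" and b: "b = et/m"
 and rh: "- 1 <= rh" "rh <= 1" and rh': "rh' = min 1 (rh + et*(1 - rh\<^sup>2) - d/m)"
 and d: "\<bar>d\<bar> <= 2*u" and u: "u <= 9 * sqrt et*m"
 shows "(m * rh' - m * rh + d)/b + (max \<bar>m * rh\<bar> \<bar>m * rh'\<bar> + 4*u)\<^sup>2 <= m\<^sup>2*(1 + 3135 * sqrt et)"
 "max \<bar>m * rh\<bar> \<bar>m * rh'\<bar> + 4*u <= 2*m" "m * rh - m/2 <= min (m * rh) (m * rh') - 4*u"
proof -
 have u0: "u >= 0" using d by linarith
 have sq: "et = sqrt et * sqrt et" using et by simp
 have s0: "sqrt et > 0" using et by simp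
 have "sqrt et * sqrt et <= sqrt et*(1/110)" using et s0 by (intro mult_left_mono) auto
 then have ets: "et <= sqrt et/110" using sq by simp
 have r2: "rh\<^sup>2 <= 1" using rh by (simp add: abs_square_le_1)
 have et1: "et*(1 - rh\<^sup>2) <= et" "0 <= et*(1 - rh\<^sup>2)" using r2 et by (auto intro: mult_left_le)
 have dm: "\<bar>d/m\<bar> <= 18 * sqrt et"
 proof -
 have "\<bar>d\<bar> <= 18 * sqrt et*m" using d u by linarith
 then show ?thesis using m by (simp add: divide_le_eq)
 qed
 have up: "rh' <= rh + et + 18 * sqrt et" "rh' >= rh - 18 * sqrt et"
 proof -
 have "- (18 * sqrt et) <= d/m" "d/m <= 18 * sqrt et" using dm by linarith+
 then show "rh' <= rh + et + 18 * sqrt et" "rh' >= rh - 18 * sqrt et"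
 proof -
  have "rh' <= rh + et*(1 - rh\<^sup>2) - d/m" "rh' = 1 \<or> rh' = rh + et*(1 - rh\<^sup>2) - d/m" unfolding rh' by (auto simp: min_def)
  moreover assume "- (18 * sqrt et) <= d/m" "d/m <= 18 * sqrt et"
  ultimately show "rh' <= rh + et + 18 * sqrt et" "rh' >= rh - 18 * sqrt et" using et1 rh s0 et by linarith+
 qed
 qed
 have diff: "\<bar>rh' - rh\<bar> <= 19 * sqrt et" using up ets s0 by (simp add: abs_le_iff)
 have ab: "max \<bar>rh\<bar> \<bar>rh'\<bar> <= \<bar>rh\<bar> + 19 * sqrt et" using diff s0 by (auto simp: max_def)
 \<comment> \<open>The constant 55 is 19 from the increment of \<open>rh\<close> plus
   \<open>4*9\<close> from \<open>4*u\<close>. Squaring it produces the coefficients 110 and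
   3025.\<close>
 have M: "max \<bar>m * rh\<bar> \<bar>m * rh'\<bar> + 4*u <= m*(\<bar>rh\<bar> + 55 * sqrt et)"
 proof -
 have "max \<bar>m * rh\<bar> \<bar>m * rh'\<bar> = m*max \<bar>rh\<bar> \<bar>rh'\<bar>" using m by (simp add: abs_mult max_mult_distrib_left)
 also have "... <= m*(\<bar>rh\<bar> + 19 * sqrt et)" using ab m by (intro mult_left_mono) auto
 finally have "max \<bar>m * rh\<bar> \<bar>m * rh'\<bar> <= m*(\<bar>rh\<bar> + 19 * sqrt et)" .
 moreover have "m*(\<bar>rh\<bar> + 19 * sqrt et) + 4*(9 * sqrt et*m) = m*(\<bar>rh\<bar> + 55 * sqrt et)" by (simp add: algebra_simps)
 ultimately show ?thesis using u by linarith
 qed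
 have "(m * rh' - m * rh + d)/b <= m\<^sup>2*(1 - rh\<^sup>2)"
 proof -
 have "m * rh' <= m*(rh + et*(1 - rh\<^sup>2) - d/m)" using rh' m by (intro mult_left_mono) auto
 also have "... = m * rh + m*(et*(1 - rh\<^sup>2)) - d" using m by (simp add: algebra_simps)
 finally have "(m * rh' - m * rh + d)/b <= m*(et*(1 - rh\<^sup>2))/b" using b m et by (intro divide_right_mono) auto
 also have "... = m\<^sup>2*(1 - rh\<^sup>2)" using b m et by (simp add: power2_eq_square)
 finally show ?thesis .
 qed
 moreover have "(max \<bar>m * rh\<bar> \<bar>m * rh'\<bar> + 4*u)\<^sup>2 <= (m*(\<bar>rh\<bar> + 55 * sqrt et))\<^sup>2" using M u0 by (intro power_mono) (auto simp: max_def)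
 moreover have "(m*(\<bar>rh\<bar> + 55 * sqrt et))\<^sup>2 = m\<^sup>2*(rh\<^sup>2 + 110 * sqrt et * \<bar>rh\<bar> + 3025*et)"
 using et by (simp add: power2_eq_square algebra_simps abs_mult_self_eq)
 moreover have "m\<^sup>2*(rh\<^sup>2 + 110 * sqrt et * \<bar>rh\<bar> + 3025*et) <= m\<^sup>2*(rh\<^sup>2 + 3135 * sqrt et)"
 proof (intro mult_left_mono)
 have "110 * sqrt et * \<bar>rh\<bar> <= 110 * sqrt et*1" using rh s0 by (intro mult_left_mono) auto
 then show "rh\<^sup>2 + 110 * sqrt et * \<bar>rh\<bar> + 3025*et <= rh\<^sup>2 + 3135 * sqrt et" using ets s0 by linarith
 qed simp
 ultimately have "(m * rh' - m * rh + d)/b + (max \<bar>m * rh\<bar> \<bar>m * rh'\<bar> + 4*u)\<^sup>2 <= m\<^sup>2*(1 - rh\<^sup>2) + m\<^sup>2*(rh\<^sup>2 + 3135 * sqrt et)" by linarith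
 then show "(m * rh' - m * rh + d)/b + (max \<bar>m * rh\<bar> \<bar>m * rh'\<bar> + 4*u)\<^sup>2 <= m\<^sup>2*(1 + 3135 * sqrt et)"
 by (simp add: algebra_simps)
 have "m*(\<bar>rh\<bar> + 55 * sqrt et) <= m*2" using m et rh by (intro mult_left_mono) auto
 then show "max \<bar>m * rh\<bar> \<bar>m * rh'\<bar> + 4*u <= 2*m" using M by linarith
 have "min rh rh' >= rh - 18 * sqrt et" using up s0 by (auto simp: min_def)
 then have "m*min rh rh' >= m*(rh - 18 * sqrt et)" using m by (intro mult_left_mono) auto
 then have "min (m * rh) (m * rh') >= m*(rh - 18 * sqrt et)" using m by (simp add: min_mult_distrib_left)
 moreover have "m*(54 * sqrt et) <= m*(1/2)" using m et by (intro mult_left_mono) auto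
 ultimately show "m * rh - m/2 <= min (m * rh) (m * rh') - 4*u" using u by (simp add: algebra_simps)
qed

text \<open>Without a chain the nodes are set to \<open>4*u\<close>, just enough for p to stay
  nonnegative after the deviation of the path from its chord is subtracted. The rate is worse by a
  constant depending on \<open>et\<close>, which is affordable beyond the radius and for auxiliary
  moments. The alternative \<open>|r| <= m\<close> covers the last node of the chain.\<close>

lemma crude_cell:
 fixes m et b U d u u' X r :: real
 assumes m: "m > 0" and et: "0 < et" "sqrt et <= 1/110" and b: "b = et/m"
 and r: "\<bar>r\<bar> <= m \<or> r = 4*u" and d: "\<bar>d\<bar> <= 2*u" and u: "0 <= u" "u <= u'"
 and u': "u' <= 6 * sqrt et*m * sqrt X" and X: "X >= 1"
 shows "(4*u' - r + d)/b + (max \<bar>r\<bar> \<bar>4*u'\<bar> + 4*u)\<^sup>2 <= 2*(c1 et*m\<^sup>2*X)"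
 "max \<bar>r\<bar> \<bar>4*u'\<bar> + 4*u <= m + m*X/2"
proof -
 have s0: "sqrt et > 0" using et by simp
 have sX: "sqrt X <= X" "sqrt X >= 1" "sqrt X * sqrt X = X"
 using X real_sqrt_le_mono[of X "X\<^sup>2"] by (auto simp: power2_eq_square)
 have sq: "sqrt et * sqrt et = et" using et by simp
 have et1: "et <= 1"
 proof -
 have s1: "sqrt et <= 1" using et(2) by linarith
 have "sqrt et * sqrt et <= 1*1" by (rule mult_mono[OF s1 s1]) (use s0 in auto)
 then show ?thesis unfolding sq by simp
 qed
 have ux: "u' <= 6 * sqrt et*m*X" using u' sX(1) m s0 by (smt (verit) mult_left_mono mult_nonneg_nonneg)
 have "6 * sqrt et*m*X <= 6*(1/110)*m*X" using et m X by (intro mult_right_mono mult_left_mono) auto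
 then have um: "u' <= m*X/18"
 proof -
 have "6*(1/110)*m*X = 6/110*(m*X)" "m*X/18 = 1/18*(m*X)" by simp_all
 moreover have "0 <= m*X" using m X by simp
 moreover assume "6 * sqrt et*m*X <= 6*(1/110)*m*X"
 ultimately show ?thesis using ux by linarith
 qed
 have mX: "m <= m*X" using m X by simp
 have "(4*u' - r + d)/b <= (37*(m*X))/b"
 proof (rule divide_right_mono)
 have "- r <= m" using r u m by auto
 then show "4*u' - r + d <= 37*(m*X)" using d u um mX m by linarith
 qed (use b m et in auto)
 also have "... = 37/et*m\<^sup>2*X" using b m et by (simp add: power2_eq_square)
 finally have 1: "(4*u' - r + d)/b <= 37/et*m\<^sup>2*X" .
 have mx: "max \<bar>r\<bar> \<bar>4*u'\<bar> + 4*u <= m + 8*u'" using r u m by (auto simp: max_def abs_le_iff)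
 have "(max \<bar>r\<bar> \<bar>4*u'\<bar> + 4*u)\<^sup>2 <= (m + 8*u')\<^sup>2" using mx u by (intro power_mono) (auto simp: max_def)
 also have "... <= 2*m\<^sup>2 + 128*u'\<^sup>2"
 using zero_le_power2[of "m - 8*u'"] by (simp add: power2_eq_square algebra_simps)
 also have "u'\<^sup>2 <= (6 * sqrt et*m * sqrt X)\<^sup>2" using u' u by (intro power_mono) auto
 also have "(6 * sqrt et*m * sqrt X)\<^sup>2 = 36*et*(m\<^sup>2*X)" using et X by (simp add: power_mult_distrib)
 also have "36*et*(m\<^sup>2*X) <= 36*1*(m\<^sup>2*X)" using et1 X by (intro mult_right_mono mult_left_mono) auto
 finally have "(max \<bar>r\<bar> \<bar>4*u'\<bar> + 4*u)\<^sup>2 <= 2*m\<^sup>2 + 4608*(m\<^sup>2*X)" by simp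
 moreover have "m\<^sup>2*1 <= m\<^sup>2*X" by (rule mult_left_mono[OF X]) simp
 ultimately have 2: "(max \<bar>r\<bar> \<bar>4*u'\<bar> + 4*u)\<^sup>2 <= 4610*(m\<^sup>2*X)" by linarith
 have "2*(c1 et*m\<^sup>2*X) = 37/et*m\<^sup>2*X + 4610*(m\<^sup>2*X)" by (simp add: c1_def algebra_simps)
 then show "(4*u' - r + d)/b + (max \<bar>r\<bar> \<bar>4*u'\<bar> + 4*u)\<^sup>2 <= 2*(c1 et*m\<^sup>2*X)" using 1 2 by linarith
 show "max \<bar>r\<bar> \<bar>4*u'\<bar> + 4*u <= m + m*X/2" using mx um mX m by linarith
qed

definition chain_ok :: "real => real => real => real => nat => (real => real) => (nat => real) => bool" where
 "chain_ok thh m et b n w rh \<longleftrightarrow> rh 0 = 0 & (\<forall>i\<le>n. - 1 <= rh i & rh i <= 1) &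
 (\<forall>i<n. rh (Suc i) = min 1 (rh i + et*(1 - (rh i)\<^sup>2) - 2*thh*(w (real (Suc i)*b) - w (real i*b))/m))"

text \<open>Two regimes share this statement: for \<open>n = 0\<close> every cell is treated
  crudely, while for \<open>n\<close> reaching the radius the cells before \<open>n\<close> have the
  sharp rate. An index \<open>I0\<close> with maximal oscillation provides the uniform bound
  \<open>Pmax\<close>.\<close>

lemma seq_supersol:
 fixes u :: "nat => real"
 assumes m: "m > 0" and et: "0 < et" "sqrt et <= 1/110" and b: "b = et/m" and thh: "thh > 0"
 and w: "continuous_on UNIV w" and osc: "osc_ok w b u" "osc_ok (%y. - w (- y)) b u"
 and u: "\<And>i. u i >= 0" "mono u" "\<And>i. thh*u i <= 6 * sqrt et*m * sqrt (1 + real i*b/R)" "\<And>i. u i <= u (I0::nat)"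
 and R: "R >= b" and nb: "real n*b <= R + b"
 and ch: "chain_ok thh m et b n w rhp" "chain_ok thh m et b n (%y. - w (- y)) rhm"
 and ka1: "ka1 >= 0" and La: "n = 0 \<or> m\<^sup>2*(1 + 3135 * sqrt et) <= 2*La"
 and c: "\<And>i. i >= n ==> c1 et*m\<^sup>2*(1 + real (Suc i)*b/R) <= La + ka1*max 1 (real i*b)"
 obtains p Pmax where "continuous_on UNIV p" "supersol thh w (%y. La + ka1 * chi y) p" "\<And>y. \<bar>p y\<bar> <= Pmax"
 "\<And>y. \<bar>p y\<bar> <= 2*m + m/R * chi y"
 "\<And>i y. real i*b <= y ==> y <= real (Suc i)*b ==> - bad m n rhp i <= p y"
 "\<And>i y. real i*b <= y ==> y <= real (Suc i)*b ==> - bad m n rhm i <= - p (- y)"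
proof -
 have b0: "b > 0" using m et b by simp
 have R0: "R > 0" using R b0 by linarith
 define rs where "rs rh i = (if i <= n then m * rh i else 4*(thh*u i))" for rh :: "nat => real" and i
 define L where "L i = (if i < n then m\<^sup>2*(1 + 3135 * sqrt et)/2 else c1 et*m\<^sup>2*(1 + real (Suc i)*b/R))" for i
 have s0: "sqrt et > 0" using et by simp
 \<comment> \<open>Before \<open>n\<close> one has \<open>i*b <= R\<close>, so the root is at most
   \<open>sqrt 2 <= 3/2\<close> and the factor 6 becomes 9.\<close>
 have ui: "thh*u i <= 9 * sqrt et*m" if "i < n" for i
 proof -
 have "real i*b <= real n*b - b" using that b0 by (simp add: algebra_simps) (metis Suc_leI mult.commute mult_le_cancel_left_pos of_nat_Suc of_nat_le_iff distrib_left mult.right_neutral)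
 then have "real i*b/R <= 1" using nb R0 by (simp add: divide_le_eq)
 have q94: "(3/2)\<^sup>2 = (9/4 :: real)" by (simp add: power2_eq_square)
 have "1 + real i*b/R <= (3/2)\<^sup>2" unfolding q94 using \<open>real i*b/R <= 1\<close> by linarith
 then have "sqrt (1 + real i*b/R) <= sqrt ((3/2)\<^sup>2)" by (rule real_sqrt_le_mono)
 then have "sqrt (1 + real i*b/R) <= 3/2" by simp
 then have "6 * sqrt et*m * sqrt (1 + real i*b/R) <= 6 * sqrt et*m*(3/2)" using m s0 by (intro mult_left_mono) auto
 then show ?thesis using u(3)[of i] by linarith
 qed
 have um: "thh*u i <= thh*u (Suc i)" "0 <= thh*u i" for i
 using thh u(1) monoD[OF u(2), of i "Suc i"] by (auto intro: mult_left_mono)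
 \<comment> \<open>one cell, on either half-line\<close>
 have cell: "(rs rh (Suc i) - rs rh i + 2*thh*(v (real (Suc i)*b) - v (real i*b)))/b
  + (max \<bar>rs rh i\<bar> \<bar>rs rh (Suc i)\<bar> + 4*thh*u i)\<^sup>2 <= 2*L i
 & max \<bar>rs rh i\<bar> \<bar>rs rh (Suc i)\<bar> + 4*thh*u i <= 2*m + m/R*(real i*b)
 & - bad m n rh i <= min (rs rh i) (rs rh (Suc i)) - 4*thh*u i"
 if v: "osc_ok v b u" "chain_ok thh m et b n v rh" for v rh i
 proof -
 have "real (Suc i)*b \<in> {real i*b..real i*b + b}" using b0 by (auto simp: algebra_simps)
 then have "\<bar>v (real (Suc i)*b) - v (real i*b)\<bar> <= u i" using v(1) unfolding osc_ok_def by blast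
 then have "2*thh * \<bar>v (real (Suc i)*b) - v (real i*b)\<bar> <= 2*thh*u i" using thh by (intro mult_left_mono) auto
 then have d: "\<bar>2*thh*(v (real (Suc i)*b) - v (real i*b))\<bar> <= 2*(thh*u i)" using thh by (simp add: abs_mult)
 have iR: "0 <= m/R*(real i*b)" using m R0 b0 by simp
 show ?thesis
 proof (cases "i < n")
  case True
  have rh: "-1 <= rh i" "rh i <= 1" "rh (Suc i) = min 1 (rh i + et*(1 - (rh i)\<^sup>2) - 2*thh*(v (real (Suc i)*b) - v (real i*b))/m)"
  using v(2) True unfolding chain_ok_def by auto
  note C = chain_cell[OF m et b rh(1-3) d ui[OF True]]
  have "- bad m n rh i <= m * rh i - m/2"
  proof (cases "rh i < 1/2")
  case True
  have "m*(-1) <= m * rh i" using rh m by (intro mult_left_mono) auto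
  then show ?thesis using True \<open>i < n\<close> m by (simp add: bad_def)
  next
  case False
  then have "m*(1/2) <= m * rh i" using m by (intro mult_left_mono) auto
  then show ?thesis using False \<open>i < n\<close> m by (simp add: bad_def)
  qed
  then show ?thesis using C True iR by (simp add: rs_def L_def mult.assoc)
 next
  case False
  have r: "\<bar>rs rh i\<bar> <= m \<or> rs rh i = 4*(thh*u i)"
  proof (cases "i = n")
  case True
  then have "\<bar>rh i\<bar> <= 1" using v(2) unfolding chain_ok_def by (auto simp: abs_le_iff)
  then have "m * \<bar>rh i\<bar> <= m*1" using m by (intro mult_left_mono) auto
  then show ?thesis using True m by (simp add: rs_def abs_mult)
  qed (use False in \<open>simp add: rs_def\<close>)
  have X: "1 + real (Suc i)*b/R >= 1" using b0 R0 by simp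
  have rS: "rs rh (Suc i) = 4*(thh*u (Suc i))" using False by (simp add: rs_def)
  note C = crude_cell[OF m et b r d um(2,1) u(3) X]
  have "m*(1 + real (Suc i)*b/R)/2 <= m + m/R*(real i*b)"
  proof -
  have "m*(b/R) <= m*1" using R R0 m by (intro mult_left_mono) auto
  moreover have "m*(1 + real (Suc i)*b/R)/2 = m/2 + m*(b/R)/2 + m/R*(real i*b)/2"
  using R0 by (simp add: field_simps)
  moreover have "m/2 + A/2 + Q/2 <= m + Q" if "A <= m*1" "0 <= Q" for A Q using that by linarith
  ultimately show ?thesis using iR by (simp only:)
  qed
  then have C2: "max \<bar>rs rh i\<bar> \<bar>rs rh (Suc i)\<bar> + 4*thh*u i <= 2*m + m/R*(real i*b)"
  proof -
  assume a: "m*(1 + real (Suc i)*b/R)/2 <= m + m/R*(real i*b)"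
  have "4*thh*u i = 4*(thh*u i)" by simp
  then show ?thesis using C(2) a unfolding rS by linarith
  qed
  have "- bad m n rh i <= min (rs rh i) (rs rh (Suc i)) - 4*thh*u i"
  proof (cases "i = n")
  case True
  have "\<bar>rs rh i\<bar> <= m"
  proof -
  have "\<bar>rh i\<bar> <= 1" using v(2) True unfolding chain_ok_def by (auto simp: abs_le_iff)
  then have "m * \<bar>rh i\<bar> <= m*1" using m by (intro mult_left_mono) auto
  then show ?thesis using True m by (simp add: rs_def abs_mult)
  qed
  moreover have "4*(thh*u i) <= m"
  proof -
  have "real i*b/R <= 2" using nb R True R0 by (simp add: divide_le_eq)
  then have "sqrt (1 + real i*b/R) <= sqrt (2\<^sup>2)" by (intro real_sqrt_le_mono) simp
  then have "6 * sqrt et*m * sqrt (1 + real i*b/R) <= 6*(1/110)*m*2"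
   using m s0 et R0 b0 by (intro mult_mono) auto
  then have "thh*u i <= 6*(1/110)*m*2" using u(3)[of i] by linarith
  then show ?thesis using m by simp
  qed
  moreover have "rs rh (Suc i) >= 0" unfolding rS using um(2) by simp
  ultimately show ?thesis using True m by (simp add: bad_def mult.assoc min_def abs_le_iff)
  next
  case ni: False
  then have "rs rh i = 4*(thh*u i)" using False by (simp add: rs_def)
  then show ?thesis using rS um(1)[of i] ni False by (simp add: bad_def mult.assoc min_def)
  qed
  then show ?thesis using C(1) C2 False unfolding rS by (simp add: L_def mult.assoc)
 qed
 qed
 note cp = cell[OF osc(1) ch(1)] and cm = cell[OF osc(2) ch(2)]
 have r0: "rs rhp 0 = 0" "rs rhm 0 = 0" using ch by (auto simp: rs_def chain_ok_def)
 have lamc: "continuous_on UNIV (%y. La + ka1 * chi y)" by (intro continuous_on_add continuous_on_mult continuous_on_const chi_cont)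
 have Ll: "L i <= La + ka1 * chi y" if "real i*b <= \<bar>y\<bar>" "\<bar>y\<bar> <= real (Suc i)*b" for i y
 proof (cases "i < n")
 case True
 then have "2*L i <= 2*La" using La by (simp add: L_def)
 moreover have "0 <= ka1 * chi y" using ka1 chi_ge[of y] by simp
 ultimately show ?thesis by linarith
 next
 case False
 have "max 1 (real i*b) <= chi y" using that chi_ge[of y] by simp
 then have "ka1*max 1 (real i*b) <= ka1 * chi y" using ka1 by (intro mult_left_mono)
 then show ?thesis using c[of i] False by (simp add: L_def)
 qed
 obtain p where p: "continuous_on UNIV p" "supersol thh w (%y. La + ka1 * chi y) p"
 "\<And>i y. real i*b <= y ==> y <= real (Suc i)*b ==> \<bar>p y\<bar> <= max \<bar>rs rhp i\<bar> \<bar>rs rhp (Suc i)\<bar> + 4*thh*u i & min (rs rhp i) (rs rhp (Suc i)) - 4*thh*u i <= p y"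
 "\<And>i y. real i*b <= y ==> y <= real (Suc i)*b ==> \<bar>p (- y)\<bar> <= max \<bar>rs rhm i\<bar> \<bar>rs rhm (Suc i)\<bar> + 4*thh*u i & min (rs rhm i) (rs rhm (Suc i)) - 4*thh*u i <= - p (- y)"
 using build_supersol[OF b0 thh w osc r0 conjunct1[OF cp] conjunct1[OF cm] lamc Ll] by blast
 have pb: "\<bar>p y\<bar> <= 2*m + m/R * chi y & \<bar>p y\<bar> <= m + 8*(thh*u I0)" for y
 proof -
 define i where "i = nat \<lfloor>\<bar>y\<bar>/b\<rfloor>"
 have i: "real i*b <= \<bar>y\<bar>" "\<bar>y\<bar> <= real (Suc i)*b"
  using cell_exists[OF b0, of "\<bar>y\<bar>"] b0 by (auto simp: i_def algebra_simps)
 have "m/R*(real i*b) <= m/R * chi y" using i chi_ge(2)[of y] m R0 by (intro mult_left_mono) auto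
 moreover have uI: "thh*u i <= thh*u I0" "thh*u (Suc i) <= thh*u I0" using u(4) thh by (auto intro: mult_left_mono)
 moreover have rb: "\<bar>rs rh k\<bar> <= m + 4*(thh*u I0)" if "chain_ok thh m et b n v rh" for v rh k
 proof (cases "k <= n")
  case True
  then have "\<bar>rh k\<bar> <= 1" using that unfolding chain_ok_def by (auto simp: abs_le_iff)
  then have "m * \<bar>rh k\<bar> <= m*1" using m by (intro mult_left_mono) auto
  moreover have "\<bar>rs rh k\<bar> = m * \<bar>rh k\<bar>" using True m by (simp add: rs_def abs_mult)
  ultimately show ?thesis using um(2)[of I0] by linarith
 next
  case False
  have "thh*u k <= thh*u I0" using u(4) thh by (auto intro: mult_left_mono)
  then show ?thesis using False um(2)[of k] m by (simp add: rs_def)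
 qed
 have mR: "m/R*(real i*b) <= m/R * chi y" by fact
 have fin: "\<bar>z\<bar> <= 2*m + m/R * chi y & \<bar>z\<bar> <= m + 8*(thh*u I0)"
  if 1: "\<bar>z\<bar> <= X + 4*thh*u i" and 2: "X + 4*thh*u i <= 2*m + m/R*(real i*b)"
  and 3: "X = max \<bar>rs rh i\<bar> \<bar>rs rh (Suc i)\<bar>" and 4: "chain_ok thh m et b n v rh" for z X v rh
 proof -
  have "X <= m + 4*(thh*u I0)" unfolding 3 using rb[OF 4, of i] rb[OF 4, of "Suc i"] by (rule max.boundedI)
  moreover have "4*thh*u i = 4*(thh*u i)" by simp
  ultimately show ?thesis using 1 2 mR uI(1) by linarith
 qed
 show ?thesis
 proof (cases "y >= 0")
  case True
  then have "real i*b <= y" "y <= real (Suc i)*b" using i by auto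
  from conjunct1[OF p(3)[OF this]] show ?thesis
  by (rule fin[OF _ _ refl ch(1)]) (use conjunct1[OF conjunct2[OF cp], of i] in \<open>simp add: mult.assoc\<close>)
 next
  case False
  then have "real i*b <= - y" "- y <= real (Suc i)*b" using i by auto
  from conjunct1[OF p(4)[OF this]] have "\<bar>y'\<bar> <= max \<bar>rs rhm i\<bar> \<bar>rs rhm (Suc i)\<bar> + 4*thh*u i" if "y' = p y" for y'
  using that by simp
  then have "\<bar>p y\<bar> <= max \<bar>rs rhm i\<bar> \<bar>rs rhm (Suc i)\<bar> + 4*thh*u i" by blast
  then show ?thesis
  by (rule fin[OF _ _ refl ch(2)]) (use conjunct1[OF conjunct2[OF cm], of i] in \<open>simp add: mult.assoc\<close>)
 qed
 qed
 show ?thesis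
 proof (rule that[OF p(1,2)])
 show "\<bar>p y\<bar> <= m + 8*(thh*u I0)" "\<bar>p y\<bar> <= 2*m + m/R * chi y" for y using pb by auto
 show "- bad m n rhp i <= p y" if "real i*b <= y" "y <= real (Suc i)*b" for i y
  using p(3)[OF that] conjunct2[OF conjunct2[OF cp], of i] by linarith
 show "- bad m n rhm i <= - p (- y)" if "real i*b <= y" "y <= real (Suc i)*b" for i y
  using p(4)[OF that] conjunct2[OF conjunct2[OF cm], of i] by linarith
 qed
qed

section \<open>Truncated paths and the upper bounds at a given scale\<close>

text \<open>Freezing the path beyond distance \<open>K\<close> makes p bounded, as
  \<open>supersol_upper\<close> requires, and leaves the path inside unchanged. A Brownian path on a
  bounded time interval stays inside for large \<open>K\<close>, so the truncation disappears in the
  limit.\<close>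

definition clamp :: "real => (real => real) => real => real" where
 "clamp K w y = w (max (- K) (min K y))"

lemma clamp_cont: "continuous_on UNIV w ==> continuous_on UNIV (clamp K w)"
 unfolding clamp_def[abs_def] by (rule continuous_on_compose2[of UNIV w UNIV "%y. max (- K) (min K y)"]) (auto intro!: continuous_intros)

lemma clamp_id: "\<bar>y\<bar> <= K ==> clamp K w y = w y"
proof -
 assume "\<bar>y\<bar> <= K"
 then have "max (- K) (min K y) = y" by linarith
 then show ?thesis by (simp add: clamp_def)
qed

lemma clamp_reflect: "K >= 0 ==> - clamp K w (- y) = clamp K (%y. - w (- y)) y"
proof -
 assume "K >= 0"
 then have "max (- K) (min K (- y)) = - max (- K) (min K y)" by (auto simp: min_def max_def)
 then show ?thesis by (simp add: clamp_def)
qed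

lemma osc_clamp:
 assumes b: "b > 0" and K: "K >= 0" and u: "\<And>i. u i >= 0" and o: "osc_ok w b u"
 shows "osc_ok (clamp K w) b (%i. u (min i (nat \<lceil>K/b\<rceil> + 1)))"
 unfolding osc_ok_def
proof (intro allI ballI)
 fix i y assume y: "y \<in> {real i*b..real i*b + b}"
 \<comment> \<open>Beyond the truncation radius the path is constant, so the index may be capped
   there; the thresholds become bounded.\<close>
 let ?j = "min i (nat \<lceil>K/b\<rceil> + 1)"
 have i0: "0 <= real i*b" using b by simp
 show "\<bar>clamp K w y - clamp K w (real i*b)\<bar> <= u ?j"
 proof (cases "real i*b <= K")
 case True
 then have "real i <= K/b" using b by (simp add: le_divide_eq)
 then have "?j = i" by linarith
 moreover have "clamp K w (real i*b) = w (real i*b)" using True i0 by (intro clamp_id) auto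
 moreover have "clamp K w y = w (min K y)"
 proof -
  have "real i*b <= y" using y by simp
  then have "y >= 0" using i0 by linarith
  then have "max (- K) (min K y) = min K y" using K by linarith
  then show ?thesis by (simp add: clamp_def)
 qed
 moreover have "min K y \<in> {real i*b..real i*b + b}" using y True by auto
 ultimately show ?thesis using o unfolding osc_ok_def by metis
 next
 case False
 then have "min K y = K" "min K (real i*b) = K" using y by auto
 then have "clamp K w y = w K" "clamp K w (real i*b) = w K" using K by (simp_all add: clamp_def)
 then show ?thesis using u by simp
 qed
qed

lemma chain_ok_clamp:
 assumes "chain_ok thh m et b n w rh" "b > 0" "real n*b <= K"
 shows "chain_ok thh m et b n (clamp K w) rh"
proof -
 have "clamp K w (real i*b) = w (real i*b)" if "i <= n" for i
 proof (rule clamp_id)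
 have "real i*b <= real n*b" using that assms by (intro mult_right_mono) auto
 moreover have "0 <= real i*b" using assms by simp
 ultimately show "\<bar>real i*b\<bar> <= K" using assms(3) by linarith
 qed
 then show ?thesis using assms(1) unfolding chain_ok_def by (metis Suc_leI less_imp_le)
qed

lemma (in kernel) upper_bound:
 assumes N: "prob_space N" and B: "brownian_motion N x B" and t: "0 < t" "t <= T"
 and m: "m >= 1" and et: "0 < et" "sqrt et <= 1/110" and b: "b = et/m" and thh: "thh > 0"
 and w: "continuous_on UNIV w" and osc: "osc_ok w b u" "osc_ok (%y. - w (- y)) b u"
 and u: "\<And>i. u i >= 0" "mono u" "\<And>i. thh*u i <= 6 * sqrt et*m * sqrt (1 + real i*b/R)"
 and T: "T >= 1" and K: "K >= 2" and R: "R = K*T*m" and nb: "real n*b <= R + b"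
 and ch: "chain_ok thh m et b n w rhp" "chain_ok thh m et b n (%y. - w (- y)) rhm"
 and cd: "real (card {i. i < n & rhp i < 1/2}) <= L" "real (card {i. i < n & rhm i < 1/2}) <= L"
 and ka1: "ka1 >= 0" and La: "n = 0 \<or> m\<^sup>2*(1 + 3135 * sqrt et) <= 2*La"
 and c: "\<And>i. i >= n ==> c1 et*m\<^sup>2*(1 + real (Suc i)*b/R) <= La + ka1*max 1 (real i*b)"
 and Kc: "Kc >= R + b"
 shows "(\<integral>\<^sup>+om. ennreal (exp (integral {0..t} (%s. thh*(- conv (clamp Kc w) 1 (B s om))))) \<partial>N)
 <= ennreal (exp (2*et*(L + 1) + (\<bar>x\<bar> + 1)*(\<bar>x\<bar> + 2 + 2*m) + 2 * ka1*T*(\<bar>x\<bar> + 1)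
  + (La + ka1 + ka1*T + 2 * ka1*T*(2*m + 1) + 2*(ka1*T)\<^sup>2)*t))"
proof -
 have m0: "m > 0" using m by simp
 have b0: "b > 0" using m et b by simp
 have sq1: "sqrt et <= 1" using et by linarith
 have et1: "et <= 1" using sq1 by simp
 have R2: "R >= 2*m" "R >= 2"
 proof -
 have "2*1 <= K*T" using K T by (intro mult_mono) auto
 then have "2*m <= K*T*m" using m by (intro mult_right_mono) auto
 then show "R >= 2*m" "R >= 2" using R m by linarith+
 qed
 have b1: "b <= 1" using b m et1 et by (simp add: divide_le_eq)
 have Rb: "R >= b" using R2 b1 by linarith
 have R0: "R > 0" using R2 by linarith
 have Kc0: "Kc >= 0" using Kc R0 b0 by linarith
 let ?v = "clamp Kc w"
 define I0 where "I0 = nat \<lceil>Kc/b\<rceil> + 1"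
 define u' where "u' i = u (min i I0)" for i
 have v: "continuous_on UNIV ?v" using w by (rule clamp_cont)
 have refl: "(%y. - ?v (- y)) = clamp Kc (%y. - w (- y))" using clamp_reflect[OF Kc0] by blast
 have osc': "osc_ok ?v b u'" "osc_ok (%y. - ?v (- y)) b u'"
 using osc_clamp[OF b0 Kc0 u(1) osc(1)] osc_clamp[OF b0 Kc0 u(1) osc(2)] unfolding refl u'_def I0_def by auto
 have nK: "real n*b <= Kc" using nb Kc by linarith
 have ch': "chain_ok thh m et b n ?v rhp" "chain_ok thh m et b n (%y. - ?v (- y)) rhm"
 unfolding refl using chain_ok_clamp[OF ch(1) b0 nK] chain_ok_clamp[OF ch(2) b0 nK] by auto
 have u'1: "u' i >= 0" "u' i <= u' I0" for i unfolding u'_def using u(1) monoD[OF u(2), of "min i I0" I0] by auto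
 have u'2: "mono u'" unfolding u'_def by (intro monoI monoD[OF u(2)]) auto
 have u'3: "thh*u' i <= 6 * sqrt et*m * sqrt (1 + real i*b/R)" for i
 proof -
 have "thh*u' i <= thh*u i" unfolding u'_def using thh by (intro mult_left_mono monoD[OF u(2)]) auto
 then show ?thesis using u(3)[of i] by linarith
 qed
 obtain p Pmax where p: "continuous_on UNIV p" "supersol thh ?v (%y. La + ka1 * chi y) p" "\<And>y. \<bar>p y\<bar> <= Pmax"
 "\<And>y. \<bar>p y\<bar> <= 2*m + m/R * chi y"
 "\<And>i y. real i*b <= y ==> y <= real (Suc i)*b ==> - bad m n rhp i <= p y"
 "\<And>i y. real i*b <= y ==> y <= real (Suc i)*b ==> - bad m n rhm i <= - p (- y)"
 using seq_supersol[OF m0 et b thh v osc' u'1(1) u'2 u'3 u'1(2) Rb nb ch' ka1 La c] by blast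
 obtain h0 where h0: "\<And>y. (h0 has_real_derivative p y) (at y)" using antideriv_exists[OF p(1)] by blast
 define h where "h y = h0 y - h0 0" for y
 have h: "(h has_real_derivative p y) (at y)" for y unfolding h_def[abs_def] using DERIV_diff[OF h0 DERIV_const] by simp
 have hz: "h 0 = 0" by (simp add: h_def)
 let ?H = "2*et*(L + 1)"
 have bad0: "bad m n rh i >= 0" for rh i using m by (simp add: bad_def)
 \<comment> \<open>A bad cell has length \<open>b = et/m\<close> and lets the primitive of p fall by
   at most \<open>2*m*b = 2*et\<close>.\<close>
 have Hb: "b*(\<Sum>i<k. bad m n rh i) <= ?H" if "real (card {i. i < n & rh i < 1/2}) <= L" for rh k
 proof -
 have "(\<Sum>i<k. bad m n rh i) <= 2*m*(real (card {i. i < n & rh i < 1/2}) + 1)" using m by (intro sum_bad) auto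
 also have "... <= 2*m*(L + 1)" using that m by (intro mult_left_mono) auto
 finally have "b*(\<Sum>i<k. bad m n rh i) <= b*(2*m*(L + 1))" using b0 by (intro mult_left_mono) auto
 also have "... = ?H" using m0 by (simp add: b)
 finally show ?thesis .
 qed
 have hl: "- ?H <= h y" for y
 proof (cases "y >= 0")
 case True
 show ?thesis by (rule primitive_lower[OF b0 h hz p(5) bad0 Hb[OF cd(1)] True])
 next
 case False
 have d: "((%y. h (- y)) has_real_derivative - p (- y)) (at y)" for y
  using DERIV_chain2[OF h[of "- y"] DERIV_minus[OF DERIV_ident]] by simp
 have "- ?H <= h (- (- y))"
  by (rule primitive_lower[where h = "%y. h (- y)" and y = "- y", OF b0 d _ p(6) bad0 Hb[OF cd(2)]]) (use hz False in auto)
 then show ?thesis by simp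
 qed
 \<comment> \<open>The growth rate of p is \<open>m/R\<close>. With \<open>R = K*T*m\<close> and
   \<open>K >= 2\<close> it satisfies the smallness condition \<open>ka2*T <= 1/2\<close> of
   \<open>supersol_upper\<close>.\<close>
 have mR: "m/R <= 1" "m/R >= 0" "m/R*T <= 1/2"
 proof -
 show "m/R <= 1" "m/R >= 0" using R2 m R0 by (auto simp: divide_le_eq)
 have "m/R*T = 1/K" using R K T m0 by simp
 then show "m/R*T <= 1/2" using K by (simp add: divide_le_eq)
 qed
 have P0: "2*m >= 0" using m by simp
 note S = supersol_upper[OF N B t v p(1,3,2) ka1 p(4) P0 mR(2,3) h hz hl]
 have k0: "0 <= ka1*T" using ka1 T by simp
 show ?thesis
 proof (rule order.trans[OF S], intro ennreal_leI, subst exp_le_cancel_iff, intro add_mono order.refl)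
 have "m/R*(\<bar>x\<bar> + 2) <= 1*(\<bar>x\<bar> + 2)" using mR by (intro mult_right_mono) auto
 then show "(\<bar>x\<bar> + 1)*(2*m + m/R*(\<bar>x\<bar> + 2)) <= (\<bar>x\<bar> + 1)*(\<bar>x\<bar> + 2 + 2*m)"
  by (intro mult_left_mono) auto
 have "2 * ka1*T*(2*m + m/R) <= 2 * ka1*T*(2*m + 1)"
 proof (rule mult_left_mono)
  show "0 <= 2 * ka1*T" using k0 by linarith
 qed (use mR in auto)
 then show "(La + ka1 + ka1*T + 2 * ka1*T*(2*m + m/R) + 2*(ka1*T)\<^sup>2)*t
  <= (La + ka1 + ka1*T + 2 * ka1*T*(2*m + 1) + 2*(ka1*T)\<^sup>2)*t"
  using t by (intro mult_right_mono) auto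
 qed
qed

text \<open>A frozen state stays frozen, so survival at step \<open>n\<close> entails survival at
  all earlier steps, where the chain obeys the plain capped recursion.\<close>

lemma rho_props:
 assumes ga: "0 < ga" and last: "- 1 + ga < rho w thh m b et ga n"
 shows "chain_ok thh m et b n w (rho w thh m b et ga)" "\<And>i. i <= n ==> - 1 + ga < rho w thh m b et ga i"
proof -
 let ?r = "rho w thh m b et ga"
 have S: "?r (Suc i) = kstep et ga i (?r i) (2*thh/m*(w (real (Suc i)*b) - w (real i*b)))" for i
 by (simp add: rho_def)
 have le1: "?r i <= 1" for i
 by (induction i) (simp add: rho_def, unfold S, auto simp: kstep_def)
 have bk: "- 1 + ga < ?r i" if "- 1 + ga < ?r (Suc i)" for i
 using that unfolding S kstep_def by (auto split: if_splits)
 have gt: "- 1 + ga < ?r (n - k)" for k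
 proof (induction k)
 case (Suc k)
 show ?case
 proof (cases "k < n")
  case True
  then have "n - k = Suc (n - Suc k)" by simp
  then show ?thesis using Suc bk[of "n - Suc k"] by simp
 qed (use Suc in simp)
 qed (use last in simp)
 show gt': "- 1 + ga < ?r i" if "i <= n" for i using gt[of "n - i"] that by simp
 show "chain_ok thh m et b n w ?r"
 unfolding chain_ok_def
 proof (intro conjI allI impI)
 show "?r 0 = 0" by (simp add: rho_def)
 show "- 1 <= ?r i" if "i <= n" for i using gt'[OF that] ga by linarith
 show "?r i <= 1" for i by (rule le1)
 show "?r (Suc i) = min 1 (?r i + et*(1 - (?r i)\<^sup>2) - 2*thh*(w (real (Suc i)*b) - w (real i*b))/m)" if "i < n" for i
  using gt'[of i] le1[of i] that unfolding S kstep_def by simp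
 qed
qed

lemma ou_props:
 assumes "thh > 0" "m > 0" "et > 0" "b > 0" "R > 0"
 shows "ou thh et m b R i >= 0" "mono (ou thh et m b R)" "thh * ou thh et m b R i = 3 * sqrt et*m * sqrt (1 + real i*b/R)"
proof -
 show "ou thh et m b R i >= 0" using assms by (simp add: ou_def)
 show "thh * ou thh et m b R i = 3 * sqrt et*m * sqrt (1 + real i*b/R)" using assms by (simp add: ou_def)
 show "mono (ou thh et m b R)"
 unfolding ou_def using assms by (intro monoI mult_left_mono real_sqrt_le_mono add_left_mono divide_right_mono mult_right_mono) auto
qed

context kernel
begin

context
 fixes N :: "'b measure" and B :: "real => 'b => real" and x thh de et ga de' :: real and j :: nat and w :: "real => real" and t Kc :: real
 assumes N: "prob_space N" and B: "brownian_motion N x B" and thh: "thh > 0" and ga: "0 < ga"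
 and et: "0 < et" "sqrt et <= 1/110" and de': "0 < de'" "de' <= 1"
 and m: "mm thh de j >= 1" and t: "0 < t" "t <= exp (real j)" and w: "continuous_on UNIV w"
 and up: "up_ok thh de et ga (c1 et/de') j w" "up_ok thh de et ga (c1 et/de') j (%y. - w (- y))"
 and Kc: "Kc >= c1 et/de'*exp (real j)*mm thh de j + 1"
begin

text \<open>The sharp bound follows the chain up to \<open>R\<close>. The crude one takes
  \<open>n = 0\<close>, doubles \<open>thh\<close> and admits both signs: the negative sign feeds
  the Cauchy-Schwarz step of the lower bound, the positive one gives the second moments for uniform
  integrability. The choice \<open>K = c1 et/de'\<close> makes the extra slope times
  \<open>T\<close> a multiple of \<open>de'*m\<close>, so that the remaining errors in the rate are
  multiples of \<open>de'*m^2\<close>.\<close>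

lemma upper_fine:
 "(\<integral>\<^sup>+om. ennreal (exp (integral {0..t} (%s. thh*(- conv (clamp Kc w) 1 (B s om))))) \<partial>N)
 <= ennreal (exp (2*et*(exp (31/32 * real j) + 1) + (\<bar>x\<bar> + 1)*(\<bar>x\<bar> + 2 + 2*mm thh de j) + 6*de'*mm thh de j*(\<bar>x\<bar> + 1)
  + (mm thh de j)\<^sup>2*(1/2 + 1568 * sqrt et + 42*de')*t))" (is ?fine)
 and upper_crude: "si \<in> {1, -1} ==> (\<integral>\<^sup>+om. ennreal (exp (integral {0..t} (%s. 2*thh * si*(- conv (clamp Kc w) 1 (B s om))))) \<partial>N)
 <= ennreal (exp (2*et + (\<bar>x\<bar> + 1)*(\<bar>x\<bar> + 2 + 2*mm thh de j) + 2*de'*mm thh de j*(\<bar>x\<bar> + 1)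
  + (mm thh de j)\<^sup>2*(2 * c1 et + 10*de')*t))"
proof -
 define m where "m = mm thh de j"
 define b where "b = et/m"
 define T where "T = exp (real j)"
 define K where "K = c1 et/de'"
 define R where "R = K*T*m"
 define n where "n = nat \<lceil>R/b\<rceil>"
 define u where "u = ou thh et m b R"
 have m1: "m >= 1" using \<open>mm thh de j >= 1\<close> by (simp add: m_def)
 have m0: "m > 0" using m1 by simp
 have b0: "b > 0" using m1 et by (simp add: b_def)
 have T: "T >= 1" by (simp add: T_def)
 have c1: "c1 et >= 2" "c1 et > 0" using et by (auto simp: c1_def add_pos_pos add_increasing)
 have K2: "K >= 2" unfolding K_def using c1 de' by (subst pos_le_divide_eq) linarith+
 have KT: "K*T*m > 0" using K2 T m0 by simp
 have R0: "R > 0" using KT by (simp add: R_def)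
 have sq1: "sqrt et <= 1" using et by linarith
 have b1: "b <= 1" using sq1 m1 et by (simp add: b_def divide_le_eq)
 have Rb: "R >= b"
 proof -
 have "2*1*1 <= K*T*m" using K2 T m1 by (intro mult_mono) auto
 then show ?thesis using b1 by (simp add: R_def)
 qed
 have o: "osc_ok w b u" "osc_ok (%y. - w (- y)) b u"
 and kr: "kr_ok w thh m b et ga n (exp (31/32 * real j))" "kr_ok (%y. - w (- y)) thh m b et ga n (exp (31/32 * real j))"
 using up unfolding up_ok_def Let_def by (auto simp: m_def b_def u_def R_def K_def T_def n_def)
 note uu = ou_props[OF thh m0 et(1) b0 R0, folded u_def]
 have X: "sqrt et*m * sqrt (1 + real i*b/R) >= 0" for i using et m0 b0 R0 by simp
 have Kc': "Kc >= R + b" using Kc b1 by (simp add: R_def K_def T_def m_def)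
 have mm2: "m <= m\<^sup>2" using m1 by (simp add: power2_eq_square)
 have d2: "de'\<^sup>2 <= de'" using de' by (simp add: power2_eq_square mult_left_le)
 have n1: "R <= real n*b" "real n*b <= R + b"
 proof -
 have "R/b <= real n" "real n <= R/b + 1"
  using divide_pos_pos[OF R0 b0] le_of_int_ceiling[of "R/b"] of_int_ceiling_le_add_one[of "R/b"] by (simp_all add: n_def)
 then show "R <= real n*b" "real n*b <= R + b" using b0 by (auto simp: field_simps)
 qed
 show ?fine
 proof -
 \<comment> \<open>The factor 3 arises because \<open>R + (i + 1)*b <= 3*(i*b)\<close> once
   \<open>i*b >= R\<close>. The resulting errors add up to \<open>3 + 3 + 12 + 6 + 18 = 42\<close>
   multiples of \<open>de'*m^2\<close>.\<close>
 define ka1 where "ka1 = 3 * c1 et*m\<^sup>2/R"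
 define La where "La = m\<^sup>2*(1 + 3135 * sqrt et)/2"
 have ka1: "ka1 >= 0" using c1 R0 by (simp add: ka1_def)
 have kT: "ka1*T = 3*de'*m"
  using c1 T m0 de' by (simp add: ka1_def R_def K_def power2_eq_square)
 have kk: "ka1 <= 3*de'*m" using mult_left_mono[OF T ka1] kT by simp
 have ch: "chain_ok thh m et b n w (rho w thh m b et ga)" "chain_ok thh m et b n (%y. - w (- y)) (rho (%y. - w (- y)) thh m b et ga)"
  using kr unfolding kr_ok_def by (auto intro!: rho_props(1)[OF ga])
 have cd: "real (card {i. i < n & rho v thh m b et ga i < 1/2}) <= exp (31/32 * real j)"
  if k: "kr_ok v thh m b et ga n (exp (31/32 * real j))" for v
 proof -
  have "{i. i < n & rho v thh m b et ga i < 1/2} = {i. i < n & - 1 + ga < rho v thh m b et ga i & rho v thh m b et ga i < 1/2}"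
  using rho_props(2)[OF ga, of v thh m b et n] k unfolding kr_ok_def by auto
  then show ?thesis using k unfolding kr_ok_def by simp
 qed
 have c: "c1 et*m\<^sup>2*(1 + real (Suc i)*b/R) <= La + ka1*max 1 (real i*b)" if "i >= n" for i
 proof -
  have ib: "R <= real i*b" using n1(1) that b0 by (meson mult_right_mono of_nat_mono order.trans less_imp_le)
  have "R + real (Suc i)*b <= 3*(real i*b)" using ib Rb by (simp add: algebra_simps)
  then have "(R + real (Suc i)*b)/R <= 3*(real i*b)/R" using R0 by (intro divide_right_mono) auto
  then have "1 + real (Suc i)*b/R <= 3*(real i*b)/R" using R0 by (simp add: add_divide_distrib)
  then have "c1 et*m\<^sup>2*(1 + real (Suc i)*b/R) <= c1 et*m\<^sup>2*(3*(real i*b)/R)" using c1 by (intro mult_left_mono) auto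
  also have "... = ka1*(real i*b)" by (simp add: ka1_def)
  also have "... <= ka1*max 1 (real i*b)" using ka1 by (intro mult_left_mono) auto
  also have "0 <= La" using et by (simp add: La_def)
  then have "ka1*max 1 (real i*b) <= La + ka1*max 1 (real i*b)" by simp
  finally show ?thesis .
 qed
 have u3: "thh*u i <= 6 * sqrt et*m * sqrt (1 + real i*b/R)" for i using uu(3)[of i] X[of i] by linarith
 have La2: "n = 0 \<or> m\<^sup>2*(1 + 3135 * sqrt et) <= 2*La" by (simp add: La_def)
 have "t <= T" using t by (simp add: T_def)
 note U = upper_bound[OF N B t(1) this m1 et b_def thh w o uu(1,2) u3 T K2 R_def n1(2) ch cd[OF kr(1)] cd[OF kr(2)] ka1 La2 c Kc']
 have "La + ka1 + ka1*T + 2 * ka1*T*(2*m + 1) + 2*(ka1*T)\<^sup>2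
  <= m\<^sup>2*(1/2 + 1568 * sqrt et + 42*de')"
 proof -
  have a1: "2 * ka1*T*(2*m + 1) = 6*de'*(2*m\<^sup>2 + m)"
  proof -
  have "2 * ka1*T*(2*m + 1) = 2*(ka1*T)*(2*m + 1)" by (simp only: mult.assoc)
  then show ?thesis unfolding kT by (simp add: power2_eq_square algebra_simps)
  qed
  have a2: "2*(ka1*T)\<^sup>2 = 18*(de'\<^sup>2*m\<^sup>2)" unfolding kT by (simp add: power2_eq_square)
  have a3: "de'*m <= de'*m\<^sup>2" using mm2 de' by (intro mult_left_mono) auto
  have a4: "de'\<^sup>2*m\<^sup>2 <= de'*m\<^sup>2" using d2 by (intro mult_right_mono) auto
  have a5: "6*de'*(2*m\<^sup>2 + m) = 12*(de'*m\<^sup>2) + 6*(de'*m)" by (simp add: algebra_simps)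
  have a6: "La = m\<^sup>2/2 + 3135/2*(m\<^sup>2 * sqrt et)" by (simp add: La_def algebra_simps)
  have a7: "m\<^sup>2*(1/2 + 1568 * sqrt et + 42*de') = m\<^sup>2/2 + 1568*(m\<^sup>2 * sqrt et) + 42*(de'*m\<^sup>2)" by (simp add: algebra_simps)
  have a8: "0 <= m\<^sup>2 * sqrt et" using et by simp
  show ?thesis unfolding a1 a2 a5 a7 a6 using kk kT a3 a4 a8 by linarith
 qed
 then have D1: "(La + ka1 + ka1*T + 2 * ka1*T*(2*m + 1) + 2*(ka1*T)\<^sup>2)*t <= m\<^sup>2*(1/2 + 1568 * sqrt et + 42*de')*t"
  using t by (intro mult_right_mono) auto
 moreover have C1: "2 * ka1*T*(\<bar>x\<bar> + 1) = 6*de'*m*(\<bar>x\<bar> + 1)" unfolding mult.assoc[of 2 ka1 T] kT by simp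
 show ?thesis
  unfolding m_def[symmetric] by (intro order.trans[OF U] ennreal_leI) (assumption | (unfold exp_le_cancel_iff, intro add_mono order_refl D1 eq_refl[OF C1]) | simp)+
 qed
 show "(\<integral>\<^sup>+om. ennreal (exp (integral {0..t} (%s. 2*thh * si*(- conv (clamp Kc w) 1 (B s om))))) \<partial>N)
 <= ennreal (exp (2*et + (\<bar>x\<bar> + 1)*(\<bar>x\<bar> + 2 + 2*mm thh de j) + 2*de'*mm thh de j*(\<bar>x\<bar> + 1)
  + (mm thh de j)\<^sup>2*(2 * c1 et + 10*de')*t))" if si: "si \<in> {1, -1}" for si
 proof -
 define ka1 where "ka1 = c1 et*m\<^sup>2/R"
 define La where "La = 2 * c1 et*m\<^sup>2"
 \<comment> \<open>Changing the sign of the path realises the sign \<open>si\<close>; the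
   oscillation conditions are symmetric.\<close>
 define w' where "w' y = si*w y" for y
 have w': "continuous_on UNIV w'" unfolding w'_def[abs_def] by (intro continuous_on_mult continuous_on_const w)
 have s1: "\<bar>si*z\<bar> = \<bar>z\<bar>" for z using si by auto
 have o': "osc_ok w' b u" "osc_ok (%y. - w' (- y)) b u"
 proof -
  have "w' y - w' z = si*(w y - w z)" "- w' (- y) - - w' (- z) = si*(- w (- y) - - w (- z))" for y z
  by (simp_all add: w'_def algebra_simps)
  then show "osc_ok w' b u" "osc_ok (%y. - w' (- y)) b u"
  using o unfolding osc_ok_def by (simp_all only: s1)
 qed
 have ka1: "ka1 >= 0" using c1 R0 by (simp add: ka1_def)
 have kT: "ka1*T = de'*m"
  using c1 T m0 de' by (simp add: ka1_def R_def K_def power2_eq_square)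
 have kk: "ka1 <= de'*m" using mult_left_mono[OF T ka1] kT by simp
 have ch: "chain_ok (2*thh) m et b 0 v (%_. 0)" for v by (simp add: chain_ok_def)
 have c: "c1 et*m\<^sup>2*(1 + real (Suc i)*b/R) <= La + ka1*max 1 (real i*b)" for i
 proof -
  have "b/R <= 1" using Rb R0 by (simp add: divide_le_eq)
  then have "c1 et*m\<^sup>2*(1 + b/R) <= c1 et*m\<^sup>2*2" using c1 by (intro mult_left_mono) auto
  moreover have "c1 et*m\<^sup>2*(1 + real (Suc i)*b/R) = c1 et*m\<^sup>2*(1 + b/R) + ka1*(real i*b)"
  using R0 by (simp add: ka1_def field_simps)
  moreover have "ka1*(real i*b) <= ka1*max 1 (real i*b)" using ka1 by (intro mult_left_mono) auto
  ultimately show ?thesis by (simp add: La_def)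
 qed
 have u3: "2*thh*u i <= 6 * sqrt et*m * sqrt (1 + real i*b/R)" for i using uu(3)[of i] by simp
 have "t <= T" using t by (simp add: T_def)
 have thh2: "2*thh > 0" using thh by simp
 have n0: "real (0::nat)*b <= R + b" using R0 b0 by simp
 have cd0: "real (card {i::nat. i < 0 & (0::real) < 1/2}) <= 0" by simp
 note U = upper_bound[OF N B t(1) \<open>t <= T\<close> m1 et b_def thh2 w' o' uu(1,2) u3 T K2 R_def n0 ch ch cd0 cd0 ka1 disjI1[OF refl] c Kc']
 have "La + ka1 + ka1*T + 2 * ka1*T*(2*m + 1) + 2*(ka1*T)\<^sup>2 <= m\<^sup>2*(2 * c1 et + 10*de')"
 proof -
  have a1: "2 * ka1*T*(2*m + 1) = 4*(de'*m\<^sup>2) + 2*(de'*m)"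
  proof -
  have "2 * ka1*T*(2*m + 1) = 2*(ka1*T)*(2*m + 1)" by (simp only: mult.assoc)
  then show ?thesis unfolding kT by (simp add: power2_eq_square algebra_simps)
  qed
  have a2: "2*(ka1*T)\<^sup>2 = 2*(de'\<^sup>2*m\<^sup>2)" unfolding kT by (simp add: power2_eq_square)
  have a3: "de'*m <= de'*m\<^sup>2" using mm2 de' by (intro mult_left_mono) auto
  have a4: "de'\<^sup>2*m\<^sup>2 <= de'*m\<^sup>2" using d2 by (intro mult_right_mono) auto
  have a7: "m\<^sup>2*(2 * c1 et + 10*de') = La + 10*(de'*m\<^sup>2)" by (simp add: La_def algebra_simps)
  show ?thesis unfolding a1 a2 a7 using kk kT a3 a4 by linarith
 qed
 then have D1: "(La + ka1 + ka1*T + 2 * ka1*T*(2*m + 1) + 2*(ka1*T)\<^sup>2)*t <= m\<^sup>2*(2 * c1 et + 10*de')*t"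
  using t by (intro mult_right_mono) auto
 moreover have C1: "2 * ka1*T*(\<bar>x\<bar> + 1) = 2*de'*m*(\<bar>x\<bar> + 1)" unfolding mult.assoc[of 2 ka1 T] kT by simp
 moreover have cw: "2*thh*(- conv (clamp Kc w') 1 y) = 2*thh * si*(- conv (clamp Kc w) 1 y)" for y
 proof -
  have "clamp Kc w' = (%y. si * clamp Kc w y)" by (simp add: clamp_def w'_def fun_eq_iff)
  then show ?thesis by (simp add: conv_cmult)
 qed
 show ?thesis
  unfolding m_def[symmetric] by (intro order.trans[OF U[unfolded cw]] ennreal_leI) (assumption | (unfold exp_le_cancel_iff, intro add_mono order_refl D1 eq_refl[OF C1]) | simp)+
 qed
qed

end

end

subsection \<open>Favourable stretches of the noise\<close>

text \<open>An antiderivative of sech^4, the energy density of the tanh profile; its total variation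
  over the line is 4/3.\<close>

definition tcube :: "real => real" where "tcube z = tanh z - tanh z ^ 3/3"

lemma tanh_deriv: "(tanh has_real_derivative 1 - (tanh z)\<^sup>2) (at z)" for z :: real
proof -
 have "((%x. tanh x) has_real_derivative (1 - (tanh z)\<^sup>2)*1) (at z)"
 by (rule has_field_derivative_tanh[where g = "%x. x"]) (use cosh_real_pos[of z] in auto)
 then show ?thesis by simp
qed

lemma tcube_deriv: "(tcube has_real_derivative (1 - (tanh z)\<^sup>2)\<^sup>2) (at z)"
proof -
 have "((%z. tanh z - tanh z ^ 3/3) has_real_derivative (1 - (tanh z)\<^sup>2) - (real 3*((1 - (tanh z)\<^sup>2)*tanh z ^ (3 - Suc 0)))/3) (at z)"
 by (intro DERIV_diff DERIV_cdivide DERIV_power tanh_deriv)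
 moreover have "(1 - (tanh z)\<^sup>2) - (real 3*((1 - (tanh z)\<^sup>2)*tanh z ^ (3 - Suc 0)))/3 = (1 - (tanh z)\<^sup>2)\<^sup>2"
 by (simp add: power2_eq_square field_simps)
 ultimately show ?thesis unfolding tcube_def[abs_def] by simp
qed

text \<open>The Cauchy-Schwarz inequality for the integral of sech^2 over the interval, obtained
  from monotonicity: with \<open>nu\<close> the mean slope,
  \<open>tcube x - 2*nu*tanh x + nu^2*x\<close> has the derivative \<open>(sech^2 x - nu)^2\<close>.
  It bounds the cost of discrete increments by the continuous energy.\<close>

lemma tanh_increment:
 fixes y z :: real
 assumes "y < z" shows "(tanh z - tanh y)\<^sup>2 <= (z - y)*(tcube z - tcube y)"
proof -
 define nu where "nu = (tanh z - tanh y)/(z - y)"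
 have "tcube y - 2*nu*tanh y + nu\<^sup>2*y <= tcube z - 2*nu*tanh z + nu\<^sup>2*z"
 proof (rule DERIV_nonneg_imp_nondecreasing[of y z "%x. tcube x - 2*nu*tanh x + nu\<^sup>2*x"])
 fix x
 have "((%x. tcube x - 2*nu*tanh x + nu\<^sup>2*x) has_real_derivative (1 - (tanh x)\<^sup>2)\<^sup>2 - 2*nu*(1 - (tanh x)\<^sup>2) + nu\<^sup>2*1) (at x)"
  by (intro DERIV_add DERIV_diff DERIV_cmult tcube_deriv tanh_deriv DERIV_ident)
 moreover have "(1 - (tanh x)\<^sup>2)\<^sup>2 - 2*nu*(1 - (tanh x)\<^sup>2) + nu\<^sup>2*1 = (1 - (tanh x)\<^sup>2 - nu)\<^sup>2"
  by (simp add: power2_eq_square algebra_simps)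
 ultimately show "\<exists>d. ((%x. tcube x - 2*nu*tanh x + nu\<^sup>2*x) has_real_derivative d) (at x) & 0 <= d"
  by (metis zero_le_power2)
 qed (use assms in simp)
 then have "2*nu*(tanh z - tanh y) - nu\<^sup>2*(z - y) <= tcube z - tcube y" by (simp add: algebra_simps)
 moreover have "tanh z - tanh y = nu*(z - y)" using assms by (simp add: nu_def)
 ultimately have "nu\<^sup>2*(z - y) <= tcube z - tcube y" by (simp add: power2_eq_square algebra_simps)
 then have "(z - y)*(nu\<^sup>2*(z - y)) <= (z - y)*(tcube z - tcube y)" using assms by (intro mult_left_mono) auto
 moreover have "(z - y)*(nu\<^sup>2*(z - y)) = (tanh z - tanh y)\<^sup>2"
 unfolding \<open>tanh z - tanh y = nu*(z - y)\<close> by (simp add: power2_eq_square algebra_simps)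
 ultimately show ?thesis by simp
qed

lemma tanh_mono_real: "y <= z ==> tanh y <= tanh z" for y z :: real
 by (cases "y = z") (auto intro: less_imp_le)

lemma abs_tanh_le: "\<bar>tanh z\<bar> <= 1" for z :: real
 using tanh_real_lt_1[of z] tanh_real_gt_neg1[of z] by (simp add: abs_le_iff)

lemma abs_tcube_le: "\<bar>tcube z\<bar> <= 2/3"
proof -
 have *: "t - t ^ 3/3 <= 2/3" if "\<bar>t\<bar> <= 1" for t :: real
 proof -
 have "0 <= (t - 1)\<^sup>2*(t + 2)" using that by (intro mult_nonneg_nonneg) auto
 then show ?thesis by (simp add: power2_eq_square power3_eq_cube algebra_simps)
 qed
 have "tcube z <= 2/3" using *[OF abs_tanh_le] by (simp add: tcube_def)
 moreover have "- tcube z <= 2/3" using *[of "- tanh z"] abs_tanh_le[of z] by (simp add: tcube_def)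
 ultimately show ?thesis by linarith
qed

lemma gauss_interval:
 assumes h: "h > 0" and e: "e >= 0"
 shows "measure (gauss h) {a - e..a + e} >= 2*e/sqrt (2*pi*h)*exp (- (\<bar>a\<bar> + e)\<^sup>2/(2*h))"
proof -
 interpret prob_space "gauss h" by (rule prob_space_gauss) fact
 let ?c = "1/sqrt (2*pi*h)*exp (- (\<bar>a\<bar> + e)\<^sup>2/(2*h))"
 have "ennreal (2*e * ?c) = ennreal ?c*emeasure lborel {a - e..a + e}" using e by (simp add: ennreal_mult'[symmetric] mult.commute)
 also have "... = (\<integral>\<^sup>+z. ennreal ?c*indicator {a - e..a + e} z \<partial>lborel)" by (simp add: nn_integral_cmult_indicator)
 also have "... <= (\<integral>\<^sup>+z. ennreal (normal_density 0 (sqrt h) z)*indicator {a - e..a + e} z \<partial>lborel)"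
 proof (rule nn_integral_mono)
 fix z
 have key: "?c <= normal_density 0 (sqrt h) z" if z: "a - e <= z" "z <= a + e"
 proof -
 have "\<bar>z\<bar> <= \<bar>a\<bar> + e" using z by linarith
 then have "z\<^sup>2 <= (\<bar>a\<bar> + e)\<^sup>2" using power_mono[of "\<bar>z\<bar>" "\<bar>a\<bar> + e" 2] by simp
 then have "- (\<bar>a\<bar> + e)\<^sup>2/(2*h) <= - z\<^sup>2/(2*h)" using h by (intro divide_right_mono) auto
 then have "?c <= 1/sqrt (2*pi*h)*exp (- z\<^sup>2/(2*h))" using h by (intro mult_left_mono) auto
 then show ?thesis using h by (simp add: normal_density_def)
 qed
 show "ennreal ?c*indicator {a - e..a + e} z <= ennreal (normal_density 0 (sqrt h) z)*indicator {a - e..a + e} z"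
  using key by (cases "z \<in> {a - e..a + e}") (auto simp: ennreal_leI simp del: times_divide_eq_left times_divide_eq_right)
 qed
 also have "... = emeasure (gauss h) {a - e..a + e}" unfolding gauss_def by (subst emeasure_density) auto
 finally have "ennreal (2*e * ?c) <= ennreal (measure (gauss h) {a - e..a + e})" by (simp add: emeasure_eq_measure)
 then show ?thesis by (subst (asm) ennreal_le_iff) (auto simp: mult.assoc)
qed

text \<open>The blocks use disjoint sets of increments and are therefore independent; each succeeds
  with probability at least \<open>p\<close>, so all fail with probability at most
  \<open>(1 - p)^J <= exp (- p*J)\<close>.\<close>

lemma no_good_block:
 fixes a :: "nat => real" and n J :: nat and e h p :: real
 assumes xi: "gaussian_incs M h (n*J) xi" and e: "e >= 0" and n: "n > 0" and J: "J > 0"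
 and p: "p <= (\<Prod>k<n. 2*e/sqrt (2*pi*h)*exp (- (\<bar>a k\<bar> + e)\<^sup>2/(2*h)))"
 shows "{om\<in>space M. \<forall>i<J. \<not> (\<forall>k<n. \<bar>xi (i*n + k) om - a k\<bar> <= e)} \<in> sets M"
 "measure M {om\<in>space M. \<forall>i<J. \<not> (\<forall>k<n. \<bar>xi (i*n + k) om - a k\<bar> <= e)} <= exp (- p*J)"
proof -
 interpret prob_space M using xi by (simp add: gaussian_incs_def)
 have h: "h > 0" using xi by (simp add: gaussian_incs_def)
 have ind: "indep_vars (%_. borel) xi {..<n*J}" using xi by (simp add: gaussian_incs_def)
 define Kb where "Kb i = {i*n..<i*n + n}" for i :: nat
 have sub: "Kb i \<subseteq> {..<n*J}" if "i < J" for i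
 proof -
 have "i*n + n <= J*n" using that by (metis Suc_leI add.commute mult_Suc mult_le_mono1)
 then show ?thesis by (auto simp: Kb_def mult.commute)
 qed
 have disj: "disjoint_family_on Kb {..<J}"
 unfolding disjoint_family_on_def Kb_def
 proof (intro ballI impI)
 fix i i' :: nat assume "i ~= i'"
 have "x div n = i" if "x \<in> {i*n..<i*n + n}" for x i :: nat
  using that n by (intro div_nat_eqI) (auto simp: algebra_simps)
 then show "{i*n..<i*n + n} \<inter> {i'*n..<i'*n + n} = {}" using \<open>i ~= i'\<close> by blast
 qed
 let ?I = "%k. {a k - e..a k + e}"
 define A where "A i = {f \<in> space (PiM (Kb i) (%_. borel :: real measure)). \<not> (\<forall>k<n. f (i*n + k) \<in> ?I k)}" for i
 have Am: "A i \<in> sets (PiM (Kb i) (%_. borel))" for i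
 proof -
 have "(%f. f (i*n + k)) \<in> PiM (Kb i) (%_. borel :: real measure) \<rightarrow>\<^sub>M borel" if "k < n" for k
  using that by (intro measurable_component_singleton) (auto simp: Kb_def)
 then have "{f \<in> space (PiM (Kb i) (%_. borel :: real measure)). \<forall>k\<in>{..<n}. f (i*n + k) \<in> ?I k} \<in> sets (PiM (Kb i) (%_. borel))"
  by (intro sets.sets_Collect_finite_All) (auto intro: measurable_sets_Collect)
 then have "space (PiM (Kb i) (%_. borel :: real measure)) - {f \<in> space (PiM (Kb i) (%_. borel :: real measure)). \<forall>k\<in>{..<n}. f (i*n + k) \<in> ?I k} \<in> sets (PiM (Kb i) (%_. borel))"
  by (rule sets.compl_sets)
 also have "space (PiM (Kb i) (%_. borel :: real measure)) - {f \<in> space (PiM (Kb i) (%_. borel :: real measure)). \<forall>k\<in>{..<n}. f (i*n + k) \<in> ?I k} = A i"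
  by (auto simp: A_def)
 finally show ?thesis .
 qed
 define Rr where "Rr i om = restrict (%k. xi k om) (Kb i)" for i om
 have iR: "indep_vars (%i. PiM (Kb i) (%_. borel)) Rr {..<J}"
 unfolding Rr_def by (rule indep_vars_restrict[OF ind sub disj]) auto
 have mem: "Rr i om \<in> A i \<longleftrightarrow> \<not> (\<forall>k<n. \<bar>xi (i*n + k) om - a k\<bar> <= e)" for i om
 proof -
 have "Rr i om (i*n + k) = xi (i*n + k) om" if "k < n" for k using that by (simp add: Rr_def Kb_def)
 moreover have "Rr i om \<in> space (PiM (Kb i) (%_. borel :: real measure))" by (simp add: Rr_def space_PiM)
 moreover have "z \<in> ?I k \<longleftrightarrow> \<bar>z - a k\<bar> <= e" for z k by (auto simp: abs_le_iff)
 ultimately show ?thesis unfolding A_def by auto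
 qed
 let ?E = "{om\<in>space M. \<forall>i<J. \<not> (\<forall>k<n. \<bar>xi (i*n + k) om - a k\<bar> <= e)}"
 have E: "?E = (\<Inter>i\<in>{..<J}. Rr i -` A i \<inter> space M)" using J unfolding mem[symmetric] by auto
 have Rm: "Rr i -` A i \<inter> space M \<in> sets M" if "i < J" for i
 proof (rule measurable_sets[OF _ Am])
 show "random_variable (PiM (Kb i) (%_. borel)) (Rr i)" using iR that unfolding indep_vars_def by auto
 qed
 show "?E \<in> sets M" unfolding E using Rm J by (intro sets.finite_INT) auto
 have p1: "prob (Rr i -` A i \<inter> space M) <= 1 - p" if i: "i < J" for i
 proof -
 have xm: "xi k \<in> borel_measurable M" if "k \<in> Kb i" for k using sub[OF i] that by (intro gaussian_incs_measurable[OF xi]) auto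
 have S: "space M - (Rr i -` A i \<inter> space M) = (\<Inter>l\<in>Kb i. xi l -` ?I (l - i*n) \<inter> space M)"
 proof -
  have X: "(\<forall>k<n. \<bar>xi (i*n + k) om - a k\<bar> <= e) \<longleftrightarrow> (\<forall>l\<in>Kb i. xi l om \<in> ?I (l - i*n))" for om
  proof
  assume H: "\<forall>k<n. \<bar>xi (i*n + k) om - a k\<bar> <= e"
  show "\<forall>l\<in>Kb i. xi l om \<in> ?I (l - i*n)"
  proof
  fix l assume "l \<in> Kb i"
  then have "l - i*n < n" "i*n + (l - i*n) = l" by (auto simp: Kb_def)
  then show "xi l om \<in> ?I (l - i*n)" using H by (metis abs_diff_le_iff atLeastAtMost_iff)
  qed
  next
  assume H: "\<forall>l\<in>Kb i. xi l om \<in> ?I (l - i*n)"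
  show "\<forall>k<n. \<bar>xi (i*n + k) om - a k\<bar> <= e"
  proof (intro allI impI)
  fix k assume "k < n"
  then have "i*n + k \<in> Kb i" by (simp add: Kb_def)
  then have "xi (i*n + k) om \<in> ?I k" using H by fastforce
  then show "\<bar>xi (i*n + k) om - a k\<bar> <= e" by (auto simp: abs_le_iff)
  qed
  qed
  have ne: "Kb i ~= {}" using n by (simp add: Kb_def)
  have "space M - (Rr i -` A i \<inter> space M) = {om \<in> space M. \<forall>k<n. \<bar>xi (i*n + k) om - a k\<bar> <= e}" by (auto simp: mem)
  also have "... = {om \<in> space M. \<forall>l\<in>Kb i. xi l om \<in> ?I (l - i*n)}" by (simp only: X)
  also have "... = (\<Inter>l\<in>Kb i. xi l -` ?I (l - i*n) \<inter> space M)" using ne by blast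
  finally show ?thesis .
 qed
 have "prob (\<Inter>l\<in>Kb i. xi l -` ?I (l - i*n) \<inter> space M) = (\<Prod>l\<in>Kb i. prob (xi l -` ?I (l - i*n) \<inter> space M))"
  using n sub[OF i] by (intro indep_varsD[OF ind]) (auto simp: Kb_def)
 also have "... = (\<Prod>l\<in>Kb i. measure (gauss h) (?I (l - i*n)))"
 proof (rule prod.cong[OF refl])
  fix l assume l: "l \<in> Kb i"
  have "measure (distr M borel (xi l)) (?I (l - i*n)) = prob (xi l -` ?I (l - i*n) \<inter> space M)"
  by (rule measure_distr[OF xm[OF l]]) simp
  then show "prob (xi l -` ?I (l - i*n) \<inter> space M) = measure (gauss h) (?I (l - i*n))"
  using gaussian_incs_distr[OF xi, of l] sub[OF i] l by auto
 qed
 also have "... = (\<Prod>k<n. measure (gauss h) (?I k))"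
  by (rule prod.reindex_bij_witness[where i = "%k. i*n + k" and j = "%l. l - i*n"]) (auto simp: Kb_def)
 also have "... >= (\<Prod>k<n. 2*e/sqrt (2*pi*h)*exp (- (\<bar>a k\<bar> + e)\<^sup>2/(2*h)))"
  using e h by (intro prod_mono conjI gauss_interval) auto
 finally have "p <= prob (space M - (Rr i -` A i \<inter> space M))" using p S by simp
 then show ?thesis using prob_compl[OF Rm[OF i]] by simp
 qed
 have "prob ?E = (\<Prod>i\<in>{..<J}. prob (Rr i -` A i \<inter> space M))"
 unfolding E using J Am by (intro indep_varsD[OF iR]) auto
 also have "... <= (\<Prod>i\<in>{..<J}. exp (- p))"
 proof (intro prod_mono conjI)
 fix i assume "i \<in> {..<J}"
 then show "prob (Rr i -` A i \<inter> space M) <= exp (- p)" using p1[of i] exp_ge_add_one_self[of "- p"] by simp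
 qed simp
 also have "... = exp (- p*J)" by (simp add: exp_of_nat_mult[symmetric] mult.commute)
 finally show "prob ?E <= exp (- p*J)" .
qed

text \<open>Enough cells for a block of length at least \<open>2*K0/mu\<close>. The number does not
  depend on \<open>j\<close>: the mesh is tied to \<open>mm thh de j\<close>, the profile to
  \<open>mm thh (- de) j\<close>, and their ratio is constant in \<open>j\<close>.\<close>

definition blk :: "real => real => real => nat" where
 "blk de et K0 = nat \<lceil>2*K0 * root 3 ((1 + de)/(1 - de))/et\<rceil>"

text \<open>The derivative times \<open>thh\<close> is the potential
  \<open>mu^2*sech^2(mu*y)\<close>. Half the second derivative plus this potential has the
  eigenfunction \<open>sech (mu*y)\<close> with eigenvalue \<open>mu^2/2\<close>.\<close>

definition target :: "real => real => real => real" where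
 "target thh mu y = mu/thh*tanh (mu*y)"

text \<open>Increments are prescribed instead of values, because increments are independent; the
  tolerance \<open>d*mu/n\<close> per cell adds up to \<open>d*mu\<close> over a block. The positive
  half-line alone offers enough blocks.\<close>

definition low_ok :: "real => real => real => real => real => nat => (real => real) => bool" where
 "low_ok thh de et K0 d j w \<longleftrightarrow>
 (let mu = mm thh (- de) j; b = et/mm thh de j; n = blk de et K0 in
  \<exists>i::nat. real ((i + 1)*n)*b <= exp (real j) &
  (\<forall>k<n. \<bar>(w (real (Suc (i*n + k))*b) - w (real (i*n + k)*b))
   - (target thh mu (real (Suc k)*b - real n*b/2) - target thh mu (real k*b - real n*b/2))\<bar> <= d*mu/real n))"

lemma mm_ratio:
 assumes "thh > 0" "0 < de" "de < 1" "j > 0"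
 shows "mm thh de j = root 3 ((1 + de)/(1 - de))*mm thh (- de) j"
proof -
 have "3/2*thh\<^sup>2*(1 + de)*j = (1 + de)/(1 - de)*(3/2*thh\<^sup>2*(1 + - de)*j)" using assms by simp
 then show ?thesis unfolding mm_def real_root_mult[symmetric] by (rule arg_cong)
qed

lemma blk_props:
 assumes "thh > 0" "0 < de" "de < 1" "j > 0" "et > 0" "et <= 1" "K0 > 0"
 defines "b \<equiv> et/mm thh de j" and "n \<equiv> blk de et K0" and "mu \<equiv> mm thh (- de) j"
 shows "2*K0 <= real n*b*mu" "real n*b*mu <= 2*K0 + 1" "n > 0"
proof -
 define r where "r = root 3 ((1 + de)/(1 - de))"
 have r: "r >= 1" unfolding r_def using assms by (intro real_root_ge_1_iff[THEN iffD2]) (auto simp: le_divide_eq)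
 have mu: "mu > 0" unfolding mu_def using assms by (intro mm_pos) auto
 have n: "2*K0 * r/et <= real n" "real n <= 2*K0 * r/et + 1"
 proof -
 have "0 <= 2*K0 * r/et" using assms r by simp
 then show "2*K0 * r/et <= real n" "real n <= 2*K0 * r/et + 1"
  using le_of_int_ceiling[of "2*K0 * r/et"] of_int_ceiling_le_add_one[of "2*K0 * r/et"]
  by (simp_all add: n_def blk_def r_def[symmetric])
 qed
 have bm: "b*mu = et/r" unfolding b_def mm_ratio[OF assms(1-4)] r_def[symmetric] using mu by (simp add: mu_def)
 have er: "et/r > 0" using assms r by simp
 have "2*K0 * r/et*(et/r) <= real n*(et/r)" using n er by (intro mult_right_mono) auto
 moreover have "2*K0 * r/et*(et/r) = 2*K0" using \<open>et > 0\<close> r by simp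
 ultimately show "2*K0 <= real n*b*mu" unfolding mult.assoc[of "real n"] bm by simp
 have "real n*(et/r) <= (2*K0 * r/et + 1)*(et/r)" using n er by (intro mult_right_mono) auto
 also have "... = 2*K0 + et/r" using \<open>et > 0\<close> r by (simp add: field_simps)
 also have "et/r <= 1" using assms r by (simp add: divide_le_eq)
 finally show "real n*b*mu <= 2*K0 + 1" unfolding mult.assoc[of "real n"] bm by simp
 have "0 < 2*K0 * r/et" using assms r by simp
 then show "n > 0" using n by linarith
qed

text \<open>The energy bound gives each block a success probability of at least
  \<open>exp (- (1 - de/2)*j)\<close>, and at least \<open>exp j\<close> blocks are available, so
  the probability that all fail is doubly exponentially small in \<open>j\<close>.\<close>

lemma low_ok_AE:
 assumes M: "prob_space M" and B: "brownian_motion_on M {0..} x B" and thh: "thh > 0"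
 and de: "0 < de" "de <= 1/2" and et: "0 < et" "et <= 1" and K0: "K0 > 0" and d: "d > 0"
 and small: "3/2*thh\<^sup>2*(d/(K0*thh) + d\<^sup>2/(4*K0)) <= de/2"
 shows "AE om in M. \<forall>\<^sub>F j in sequentially. low_ok thh de et K0 d j (%t. B t om)"
proof -
 define n where "n = blk de et K0"
 define cm where "cm = root 3 (3/2*thh\<^sup>2*(1 - de))"
 define cp where "cp = root 3 (3/2*thh\<^sup>2*(1 + de))"
 have cc: "cm > 0" "cp > 0" using thh de by (auto simp: cm_def cp_def)
 have mmj: "mm thh (- de) j = cm * root 3 j" "mm thh de j = cp * root 3 j" for j
 unfolding mm_def cm_def cp_def real_root_mult[symmetric] by simp_all
 have n0: "n > 0" unfolding n_def using blk_props(3)[of thh de 1 et K0] thh de et K0 by simp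
 have lim: "filterlim (%j. root 3 (real j)) at_top sequentially"
 by (rule filterlim_compose[OF _ filterlim_real_sequentially]) real_asymp
 \<comment> \<open>The condition \<open>root 3 j >= X\<close> secures three things:
   \<open>root 3 j >= 1\<close>, a Gaussian prefactor \<open>2*e/sqrt (2*pi*b)\<close> of at least
   1, and blocks no longer than 1/2.\<close>
 define X where "X = 1 + 2*pi*et*(real n)\<^sup>2/(4*d\<^sup>2 * cm\<^sup>2 * cp) + 2 * real n*et/cp"
 have "\<forall>\<^sub>F j in sequentially. root 3 (real j) >= X & j >= 1"
 using filterlim_at_top[THEN iffD1, OF lim, rule_format, of X] eventually_ge_at_top[of 1] by eventually_elim auto
 then obtain J0 where J0: "\<And>j. j >= J0 ==> root 3 (real j) >= X & j >= 1" unfolding eventually_sequentially by blast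
 show ?thesis
 proof (rule borel_cantelli_exp[OF M, where c = "de/2" and C = 1 and J = J0 and Q = "%_. True"])
 fix j assume jJ: "j >= J0"
 define mu where "mu = mm thh (- de) j"
 define m where "m = mm thh de j"
 define b where "b = et/m"
 define s where "s = root 3 (real j)"
 have j: "real j > 0" "j >= 1" and sX: "s >= X" using J0[OF jJ] by (auto simp: s_def)
 have X1: "X >= 1" "X >= 2*pi*et*(real n)\<^sup>2/(4*d\<^sup>2 * cm\<^sup>2 * cp)" "X >= 2 * real n*et/cp"
  using et cc d by (auto simp: X_def)
 have s1: "s >= 1" using sX X1 by linarith
 have mu: "mu > 0" "mu = cm * s" and m: "m > 0" "m = cp * s" using cc s1 by (auto simp: mu_def m_def mmj s_def)
 have b: "b > 0" using m et by (simp add: b_def)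
 note bp = blk_props[OF thh de(1) _ j(1) et K0, folded m_def mu_def n_def, folded b_def]
 have de1: "de < 1" using de by simp
 note bp = bp[OF de1]
 define e where "e = d*mu/real n"
 have e: "e > 0" using d mu n0 by (simp add: e_def)
 define z where "z k = mu*(real k*b - real n*b/2)" for k
 define a where "a k = target thh mu (real (Suc k)*b - real n*b/2) - target thh mu (real k*b - real n*b/2)" for k
 have az: "a k = mu/thh*(tanh (z (Suc k)) - tanh (z k))" for k by (simp add: a_def target_def z_def right_diff_distrib)
 have zz: "z (Suc k) - z k = mu*b" for k by (simp add: z_def algebra_simps)
 have a0: "a k >= 0" for k
 proof -
  have "0 < mu*b" using mu(1) b by (rule mult_pos_pos)
  then have "tanh (z k) <= tanh (z (Suc k))" using zz[of k] by (intro tanh_mono_real) linarith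
  then show ?thesis unfolding az using mu(1) thh by (intro mult_nonneg_nonneg) auto
 qed
 have mu3: "mu ^ 3 = 3/2*thh\<^sup>2*(1 - de)*j" by (simp add: mu_def mm_cube)
 have a2: "(a k)\<^sup>2/(2*b) <= mu ^ 3/(2*thh\<^sup>2)*(tcube (z (Suc k)) - tcube (z k))" for k
 proof -
  have "z k < z (Suc k)" using zz[of k] mu b by (smt (verit) mult_pos_pos)
  from tanh_increment[OF this] have "(tanh (z (Suc k)) - tanh (z k))\<^sup>2 <= mu*b*(tcube (z (Suc k)) - tcube (z k))" by (simp add: zz)
  then have "mu\<^sup>2/thh\<^sup>2/(2*b)*(tanh (z (Suc k)) - tanh (z k))\<^sup>2 <= mu\<^sup>2/thh\<^sup>2/(2*b)*(mu*b*(tcube (z (Suc k)) - tcube (z k)))"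
  using b by (intro mult_left_mono) auto
  moreover have "mu\<^sup>2/thh\<^sup>2/(2*b)*(mu*b*D) = mu ^ 3/(2*thh\<^sup>2)*D" for D
  using b by (simp add: power2_eq_square power3_eq_cube)
  moreover have "(a k)\<^sup>2/(2*b) = mu\<^sup>2/thh\<^sup>2/(2*b)*(tanh (z (Suc k)) - tanh (z k))\<^sup>2"
  unfolding az by (simp add: power_mult_distrib power_divide)
  ultimately show ?thesis by simp
 qed
 \<comment> \<open>The squares of the targets telescope to the energy and give
   \<open>(1 - de)*j\<close>; \<open>small\<close> makes the two terms with the tolerance at most
   \<open>de/2\<close> times that amount.\<close>
 have E: "(\<Sum>k<n. (\<bar>a k\<bar> + e)\<^sup>2/(2*b)) <= (1 - de/2)*j"
 proof -
  have "(\<bar>a k\<bar> + e)\<^sup>2/(2*b) = (a k)\<^sup>2/(2*b) + e/b*a k + e\<^sup>2/(2*b)" for k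
  using a0[of k] b by (simp add: power2_eq_square field_simps)
  then have "(\<Sum>k<n. (\<bar>a k\<bar> + e)\<^sup>2/(2*b)) = (\<Sum>k<n. (a k)\<^sup>2/(2*b)) + e/b*(\<Sum>k<n. a k) + real n*(e\<^sup>2/(2*b))"
  by (simp add: sum.distrib sum_distrib_left)
  moreover have "(\<Sum>k<n. (a k)\<^sup>2/(2*b)) <= mu ^ 3/(2*thh\<^sup>2)*(4/3)"
  proof -
  have "(\<Sum>k<n. (a k)\<^sup>2/(2*b)) <= (\<Sum>k<n. mu ^ 3/(2*thh\<^sup>2)*(tcube (z (Suc k)) - tcube (z k)))" by (intro sum_mono a2)
  also have "... = mu ^ 3/(2*thh\<^sup>2)*(tcube (z n) - tcube (z 0))"
  by (simp only: sum_distrib_left[symmetric] sum_lessThan_telescope[of "%k. tcube (z k)"])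
  also have "... <= mu ^ 3/(2*thh\<^sup>2)*(4/3)"
  using abs_tcube_le[of "z n"] abs_tcube_le[of "z 0"] mu by (intro mult_left_mono) auto
  finally show ?thesis .
  qed
  moreover have "e/b*(\<Sum>k<n. a k) <= mu ^ 3*(d/(K0*thh))"
  proof -
  have "(\<Sum>k<n. a k) = mu/thh*(tanh (z n) - tanh (z 0))"
  unfolding az by (simp only: sum_distrib_left[symmetric] sum_lessThan_telescope[of "%k. tanh (z k)"])
  also have "... <= mu/thh*2" using abs_tanh_le[of "z n"] abs_tanh_le[of "z 0"] mu thh by (intro mult_left_mono) auto
  finally have "e/b*(\<Sum>k<n. a k) <= e/b*(mu/thh*2)" using e b by (intro mult_left_mono) auto
  also have "... = 2*d*mu ^ 3/thh/(real n*b*mu)" using mu(1) n0 b thh by (simp add: e_def power3_eq_cube field_simps)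
  also have "... <= 2*d*mu ^ 3/thh/(2*K0)" using bp(1) K0 d mu thh by (intro divide_left_mono) auto
  finally show ?thesis by (simp add: mult_ac)
  qed
  moreover have "real n*(e\<^sup>2/(2*b)) <= mu ^ 3*(d\<^sup>2/(4*K0))"
  proof -
  have "real n*(e\<^sup>2/(2*b)) = d\<^sup>2*mu ^ 3/2/(real n*b*mu)"
  using mu(1) n0 b by (simp add: e_def power2_eq_square power3_eq_cube field_simps)
  also have "... <= d\<^sup>2*mu ^ 3/2/(2*K0)" using bp(1) K0 d mu by (intro divide_left_mono) auto
  finally show ?thesis by (simp add: mult_ac)
  qed
  ultimately have "(\<Sum>k<n. (\<bar>a k\<bar> + e)\<^sup>2/(2*b)) <= mu ^ 3/(2*thh\<^sup>2)*(4/3) + mu ^ 3*(d/(K0*thh) + d\<^sup>2/(4*K0))"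
  by (simp add: distrib_left)
  also have "mu ^ 3/(2*thh\<^sup>2)*(4/3) = (1 - de)*j" using thh by (simp add: mu3)
  also have "mu ^ 3*(d/(K0*thh) + d\<^sup>2/(4*K0)) = (1 - de)*j*(3/2*thh\<^sup>2*(d/(K0*thh) + d\<^sup>2/(4*K0)))" by (simp add: mu3 mult_ac)
  also have "... <= (1 - de)*j*(de/2)" using small de by (intro mult_left_mono) auto
  also have "(1 - de)*j + (1 - de)*j*(de/2) <= (1 - de/2)*j"
  proof -
  have "(1 - de) + (1 - de)*(de/2) <= 1 - de/2" using de zero_le_square[of de] by (simp add: field_simps)
  then have "((1 - de) + (1 - de)*(de/2))*j <= (1 - de/2)*j" by (intro mult_right_mono) auto
  then show ?thesis by (simp add: algebra_simps)
  qed
  finally show ?thesis by simp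
 qed
 define p where "p = exp (- (1 - de/2)*j)"
 have pre: "2*e/sqrt (2*pi*b) >= 1"
 proof -
  have s2: "s <= s ^ 3" using s1 self_le_power[of s 3] by simp
  have "2*pi*et*(real n)\<^sup>2/(4*d\<^sup>2 * cm\<^sup>2 * cp) <= s ^ 3" using X1(2) sX s2 by linarith
  moreover have Y: "0 < 4*d\<^sup>2 * cm\<^sup>2 * cp" using d cc by simp
  ultimately have "2*pi*et*(real n)\<^sup>2 <= s ^ 3*(4*d\<^sup>2 * cm\<^sup>2 * cp)" by (simp only: pos_divide_le_eq[OF Y])
  then have "2*pi*b <= (2*e)\<^sup>2"
  proof -
  assume A: "2*pi*et*(real n)\<^sup>2 <= s ^ 3*(4*d\<^sup>2 * cm\<^sup>2 * cp)"
  have "2*pi*b = 2*pi*et*(real n)\<^sup>2/(cp * s*(real n)\<^sup>2)" unfolding b_def m(2) using n0 by simp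
  also have "... <= s ^ 3*(4*d\<^sup>2 * cm\<^sup>2 * cp)/(cp * s*(real n)\<^sup>2)" using A cc s1 by (intro divide_right_mono) auto
  also have "... = (2*e)\<^sup>2" unfolding e_def mu(2) using n0 cc s1 by (simp add: power2_eq_square power3_eq_cube)
  finally show ?thesis .
  qed
  then have "sqrt (2*pi*b) <= 2*e" using e by (intro real_le_lsqrt) auto
  then show ?thesis using b by (simp add: le_divide_eq)
 qed
 have p: "p <= (\<Prod>k<n. 2*e/sqrt (2*pi*b)*exp (- (\<bar>a k\<bar> + e)\<^sup>2/(2*b)))"
 proof -
  have "(\<Sum>k<n. - (\<bar>a k\<bar> + e)\<^sup>2/(2*b)) = - (\<Sum>k<n. (\<bar>a k\<bar> + e)\<^sup>2/(2*b))" by (simp add: sum_negf)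
  then have "- (1 - de/2) * real j <= (\<Sum>k<n. - (\<bar>a k\<bar> + e)\<^sup>2/(2*b))" using E by linarith
  then have "p <= exp (\<Sum>k<n. - (\<bar>a k\<bar> + e)\<^sup>2/(2*b))" unfolding p_def by simp
  also have "... = (\<Prod>k<n. 1*exp (- (\<bar>a k\<bar> + e)\<^sup>2/(2*b)))" by (simp add: exp_sum)
  also have "... <= (\<Prod>k<n. 2*e/sqrt (2*pi*b)*exp (- (\<bar>a k\<bar> + e)\<^sup>2/(2*b)))"
  using pre by (intro prod_mono conjI mult_right_mono) auto
  finally show ?thesis .
 qed
 define T where "T = exp (real j)"
 have T1: "T >= 1" by (simp add: T_def)
 define J where "J = nat \<lfloor>T/(real n*b)\<rfloor>"
 have nb: "0 < real n*b" "real n*b <= 1/2"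
 proof -
  show "0 < real n*b" using n0 b by simp
  have "2 * real n*et/cp <= s" using X1(3) sX by linarith
  then have "2 * real n*et <= m" unfolding m(2) using cc by (simp add: divide_le_eq mult.commute)
  then show "real n*b <= 1/2" using m by (simp add: b_def divide_le_eq)
 qed
 \<comment> \<open>Blocks are at most 1/2 long, so more than \<open>2*T - 1 >= T\<close> of them fit
   into length \<open>T\<close>.\<close>
 have "T/(1/2) <= T/(real n*b)" using nb T1 by (intro divide_left_mono) auto
 then have J: "real J >= T" "real J <= T/(real n*b)" "J > 0"
  
 proof -
  have "0 <= T/(real n*b)" using nb T1 by simp
  then have "real J <= T/(real n*b)" "T/(real n*b) < real J + 1"
  unfolding J_def using of_int_floor_le[of "T/(real n*b)"] floor_correct[of "T/(real n*b)"] by simp_all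
  then show "real J >= T" "real J <= T/(real n*b)" "J > 0"
  using \<open>T/(1/2) <= T/(real n*b)\<close> T1 by (auto intro: gr0I)
 qed
 have inc: "gaussian_incs M b (n*J) (%i om. B (real (Suc i)*b) om - B (real i*b) om)"
  using brownian_gaussian_incs[OF M B b, of "n*J" 0] b by simp
 note G = no_good_block[OF inc less_imp_le[OF e] n0 J(3) p]
 let ?A = "{om \<in> space M. \<forall>i<J. \<not> (\<forall>k<n. \<bar>B (real (Suc (i*n + k))*b) om - B (real (i*n + k)*b) om - a k\<bar> <= e)}"
 have "exp (- p*J) <= exp (- (exp (de/2*j)))"
 proof -
  have "exp (de/2*j) = p*T" by (simp add: p_def T_def exp_add[symmetric] algebra_simps)
  also have "... <= p*J" using J by (intro mult_left_mono) (auto simp: p_def)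
  finally show ?thesis by simp
 qed
 also have "... <= exp (- (de/2*j))" unfolding exp_le_cancel_iff using exp_ge_add_one_self[of "de/2 * real j"] by linarith
 finally have pA: "exp (- p*J) <= exp (- (de/2)*j)" by simp
 interpret prob_space M by fact
 show "\<exists>A\<in>sets M. emeasure M A <= ennreal (1*exp (- (de/2) * real j)) &
  (\<forall>om\<in>space M - A. True --> low_ok thh de et K0 d j (%t. B t om))"
 proof (intro bexI[of _ ?A] conjI ballI impI)
  show "emeasure M ?A <= ennreal (1*exp (- (de/2) * real j))"
  unfolding emeasure_eq_measure mult_1 by (intro ennreal_leI order.trans[OF G(2) pA])
  show "?A \<in> sets M" by (rule G(1))
  fix om assume "om \<in> space M - ?A"
  then obtain i where i: "i < J" "\<forall>k<n. \<bar>B (real (Suc (i*n + k))*b) om - B (real (i*n + k)*b) om - a k\<bar> <= e" by auto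
  have "real ((i + 1)*n)*b = real (i + 1)*(real n*b)" by (simp add: algebra_simps)
  also have "... <= real J*(real n*b)" using i nb by (intro mult_right_mono) auto
  also have "... <= T" using J(2) nb by (simp add: le_divide_eq)
  finally have "real ((i + 1)*n)*b <= exp (real j)" by (simp only: T_def)
  with i(2) show "low_ok thh de et K0 d j (%t. B t om)"
  unfolding low_ok_def Let_def m_def[symmetric] mu_def[symmetric] n_def[symmetric] b_def[symmetric]
  unfolding a_def[symmetric] e_def[symmetric] by blast
 qed
 qed (use de in auto)
qed

subsection \<open>The lower bound\<close>

text \<open>Truncation at 0 only raises the right-hand side, so the kink is harmless. As the
  positivity set is bounded, the constants are uniform; for \<open>|d| >= 1\<close> the cubic term
  alone makes the left-hand side nonpositive.\<close>

lemma max_zero_taylor: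
 fixes f f1 f2 f3 :: "real => real"
 assumes d1: "\<And>y. (f has_real_derivative f1 y) (at y)" and d2: "\<And>y. (f1 has_real_derivative f2 y) (at y)"
 and d3: "\<And>y. (f2 has_real_derivative f3 y) (at y)" and c3: "continuous_on UNIV f3"
 and loc: "\<And>y. f y > 0 ==> \<bar>y - y0\<bar> <= r"
 obtains C where "C >= 0" "\<And>y d. f y > 0 ==> f y + f1 y*d + f2 y/2*d\<^sup>2 - C * \<bar>d\<bar> ^ 3 <= max 0 (f (y + d))"
proof -
 define I where "I = {y0 - r - 1..y0 + r + 1}"
 have bd: "\<exists>A\<ge>0. \<forall>y\<in>I. \<bar>g y\<bar> <= A" if "continuous_on UNIV g" for g :: "real => real"
 proof -
 have "continuous_on I g" using that by (rule continuous_on_subset) simp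
 then have "compact (g ` I)" unfolding I_def by (intro compact_continuous_image compact_Icc)
 then obtain A where "A > 0" "\<forall>z\<in>g ` I. norm z <= A" using compact_imp_bounded bounded_pos by metis
 then show ?thesis by (intro exI[of _ A]) auto
 qed
 have cc: "continuous_on UNIV f" "continuous_on UNIV f1" "continuous_on UNIV f2"
 using d1 d2 d3 by (meson DERIV_continuous continuous_at_imp_continuous_on)+
 obtain A0 where A0: "A0 >= 0" "\<And>y. y \<in> I ==> \<bar>f y\<bar> <= A0" using bd[OF cc(1)] by blast
 obtain A1 where A1: "A1 >= 0" "\<And>y. y \<in> I ==> \<bar>f1 y\<bar> <= A1" using bd[OF cc(2)] by blast
 obtain A2 where A2: "A2 >= 0" "\<And>y. y \<in> I ==> \<bar>f2 y\<bar> <= A2" using bd[OF cc(3)] by blast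
 obtain A3 where A3: "A3 >= 0" "\<And>y. y \<in> I ==> \<bar>f3 y\<bar> <= A3" using bd[OF c3] by blast
 show ?thesis
 proof (rule that[of "A0 + A1 + A2 + A3"])
 show "A0 + A1 + A2 + A3 >= 0" using A0 A1 A2 A3 by simp
 fix y d :: real assume "f y > 0"
 then have y: "\<bar>y - y0\<bar> <= r" by (rule loc)
 then have yI: "y \<in> I" by (auto simp: I_def abs_le_iff)
 define D where "D = \<bar>d\<bar> ^ 3"
 have D0: "D >= 0" by (simp add: D_def)
 show "f y + f1 y*d + f2 y/2*d\<^sup>2 - (A0 + A1 + A2 + A3) * \<bar>d\<bar> ^ 3 <= max 0 (f (y + d))"
 proof (cases "\<bar>d\<bar> <= 1")
  case True
  show ?thesis
  proof (cases "d = 0")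
  case False
  define df where "df m = (if m = 0 then f else if m = 1 then f1 else if m = 2 then f2 else f3)" for m :: nat
  have "\<exists>t. (if y + d < y then y + d < t & t < y else y < t & t < y + d) &
  f (y + d) = (\<Sum>m<3. df m y/fact m*(y + d - y) ^ m) + df 3 t/fact 3*(y + d - y) ^ 3"
  proof (rule Taylor[where a = "y - 1" and b = "y + 1"])
  show "\<forall>m t. m < 3 & y - 1 <= t & t <= y + 1 --> (df m has_real_derivative df (Suc m) t) (at t)"
  proof (intro allI impI)
   fix m :: nat and t assume "m < 3 & y - 1 <= t & t <= y + 1"
   then consider "m = 0" | "m = 1" | "m = 2" by linarith
   then show "(df m has_real_derivative df (Suc m) t) (at t)"
   by cases (simp_all add: df_def d1 d2 d3)
  qed
  qed (use True False in \<open>auto simp: df_def abs_le_iff\<close>)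
  then obtain t where t: "if d < 0 then y + d < t & t < y else y < t & t < y + d"
  and e: "f (y + d) = (\<Sum>m<3. df m y/fact m*d ^ m) + df 3 t/fact 3*d ^ 3" by auto
  have "t \<in> I" using t True y by (auto simp: I_def abs_le_iff split: if_splits)
  then have "\<bar>f3 t\<bar> <= A3" by (rule A3)
  then have "\<bar>f3 t\<bar>*D <= A3*D" using D0 by (intro mult_right_mono)
  moreover have "\<bar>f3 t/6*d ^ 3\<bar> = \<bar>f3 t\<bar>*D/6" by (simp add: abs_mult D_def power_abs)
  ultimately have "- (A3*D) <= f3 t/6*d ^ 3" using A3(1) D0 mult_nonneg_nonneg[OF A3(1) D0] by linarith
  moreover have "f (y + d) = f y + f1 y*d + f2 y/2*d\<^sup>2 + f3 t/6*d ^ 3"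
  unfolding e by (simp add: df_def eval_nat_numeral fact_numeral)
  moreover have "A3*D <= (A0 + A1 + A2 + A3)*D" using A0 A1 A2 D0 by (intro mult_right_mono) auto
  ultimately show ?thesis unfolding D_def[symmetric] by linarith
  qed simp
 next
  case False
  then have d1': "\<bar>d\<bar> >= 1" by simp
  have p: "1 <= D" "\<bar>d\<bar> <= D" "d\<^sup>2 <= D"
  unfolding D_def using d1' power_increasing[of 1 3 "\<bar>d\<bar>"] power_increasing[of 2 3 "\<bar>d\<bar>"] one_le_power[OF d1', of 3] by auto
  have "f y <= A0*D" using A0(2)[OF yI] mult_left_mono[OF p(1) A0(1)] by simp
  moreover have "f1 y*d <= A1*D"
  proof -
  have "f1 y*d <= \<bar>f1 y\<bar> * \<bar>d\<bar>" by (metis abs_ge_self abs_mult)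
  also have "... <= A1*D" using A1(1) A1(2)[OF yI] p(2) by (intro mult_mono) auto
  finally show ?thesis .
  qed
  moreover have "f2 y/2*d\<^sup>2 <= A2*D"
  proof -
  have "f2 y/2 <= A2" using A2(2)[OF yI] A2(1) by linarith
  then have "f2 y/2*d\<^sup>2 <= A2*d\<^sup>2" by (intro mult_right_mono) auto
  also have "... <= A2*D" using A2(1) p(3) by (intro mult_left_mono) auto
  finally show ?thesis .
  qed
  moreover have "0 <= A3*D" using A3(1) D0 by simp
  moreover have "(A0 + A1 + A2 + A3)*D = A0*D + A1*D + A2*D + A3*D" by (simp add: distrib_right)
  ultimately show ?thesis unfolding D_def[symmetric] by linarith
 qed
 qed
qed

text \<open>Paths are continuous only almost surely, so the integral itself may fail to be
  measurable; the limit of its Riemann sums is a measurable version.\<close>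

lemma AE_measurable_integral:
 assumes B: "brownian_motion N x B" and v: "continuous_on UNIV v" and t: "t >= 0"
 obtains X where "X \<in> borel_measurable N" "AE om in N. integral {0..t} (%s. v (B s om)) = (X om :: real)"
proof -
 define S where "S n om = (\<Sum>i<Suc n. t/real (Suc n) * v (B (real i*(t/real (Suc n))) om))" for n om
 have vm: "v \<in> borel_measurable borel" using v by (rule borel_measurable_continuous_onI)
 have Sm: "S n \<in> borel_measurable N" for n
 proof -
 have "B (real i*(t/real (Suc n))) \<in> borel_measurable N" for i using B t by (auto simp: brownian_motion_on_def)
 then have "(%om. v (B (real i*(t/real (Suc n))) om)) \<in> borel_measurable N" for i
  by (rule measurable_compose[OF _ vm])
 then show ?thesis unfolding S_def by (intro borel_measurable_sum borel_measurable_times borel_measurable_const) auto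
 qed
 have "AE om in N. continuous_on {0..} (%t. B t om)" using B by (simp add: brownian_motion_on_def)
 then have "AE om in N. integral {0..t} (%s. v (B s om)) = lim (%n. S n om)"
 proof (rule AE_mp, intro AE_I2 impI)
 fix om assume "continuous_on {0..} (%t. B t om)"
 then have "continuous_on {0..t} (%t. B t om)" by (rule continuous_on_subset) auto
 then have "continuous_on {0..t} (%s. v (B s om))" by (rule continuous_on_UNIV_comp[OF v])
 from riemann_sum_tendsto[OF t this] show "integral {0..t} (%s. v (B s om)) = lim (%n. S n om)"
  unfolding S_def by (rule limI[symmetric])
 qed
 then show ?thesis using Sm by (intro that[of "%om. lim (%n. S n om)"] borel_measurable_lim_metric)
qed

lemma brownian_hits_interval:
 assumes N: "prob_space N" and B: "brownian_motion N x B" and t: "t > 0" and e: "e >= 0"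
 shows "ennreal (2*e/sqrt (2*pi*t)*exp (- (\<bar>y - x\<bar> + e)\<^sup>2/(2*t)))
 <= (\<integral>\<^sup>+om. indicator {y - e..y + e} (B t om) \<partial>N)"
proof -
 interpret prob_space N by fact
 have inc: "gaussian_incs N t 1 (%i om. B (real (Suc i)*t) om - B (real i*t) om)"
 using brownian_gaussian_incs[OF N B t, of 1 0] t by simp
 have m: "B t \<in> borel_measurable N" "B 0 \<in> borel_measurable N" using B t by (auto simp: brownian_motion_on_def)
 have d: "distr N borel (%om. B t om - B 0 om) = gauss t" using gaussian_incs_distr[OF inc, of 0] by simp
 interpret g: prob_space "gauss t" by (rule prob_space_gauss[OF t])
 let ?I = "{(y - x) - e..(y - x) + e}"
 have "ennreal (2*e/sqrt (2*pi*t)*exp (- (\<bar>y - x\<bar> + e)\<^sup>2/(2*t))) <= emeasure (gauss t) ?I"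
 unfolding g.emeasure_eq_measure using gauss_interval[OF t e, of "y - x"] by (intro ennreal_leI) simp
 also have "... = (\<integral>\<^sup>+z. indicator ?I z \<partial>gauss t)" by simp
 also have "... = (\<integral>\<^sup>+om. indicator ?I (B t om - B 0 om) \<partial>N)"
 unfolding d[symmetric] using m by (subst nn_integral_distr) auto
 also have "... = (\<integral>\<^sup>+om. indicator {y - e..y + e} (B t om) \<partial>N)"
 proof (rule nn_integral_cong_AE)
 have "AE om in N. B 0 om = x" using B by (simp add: brownian_motion_on_def)
 then show "AE om in N. (indicator ?I (B t om - B 0 om) :: ennreal) = indicator {y - e..y + e} (B t om)"
  by (rule AE_mp) (auto split: split_indicator)
 qed
 finally show ?thesis .
qed

text \<open>Cauchy-Schwarz with \<open>f\<close> split into the roots of \<open>exp X*f\<close> and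
  \<open>exp (- X)*f\<close>. The second factor is controlled by
  \<open>exp (- X) <= 1 + exp (- 2*X)\<close>. The result bounds a weighted expectation from below
  by an unweighted one, that is, by a Gaussian hitting probability.\<close>

lemma exp_pairing_lower:
 assumes N: "prob_space N" and X: "X \<in> borel_measurable N" and f: "f \<in> borel_measurable N"
 and f0: "\<And>om. 0 <= f om" "\<And>om. f om <= P" and P: "P >= 0"
 and Q: "(\<integral>\<^sup>+om. ennreal (exp (- 2*X om)) \<partial>N) <= ennreal (exp Q)" "Q >= 0"
 shows "(\<integral>\<^sup>+om. ennreal (f om) \<partial>N)\<^sup>2 <= (\<integral>\<^sup>+om. ennreal (exp (X om)*f om) \<partial>N)*ennreal (P*(2*exp Q))"
proof -
 interpret prob_space N by fact
 note [measurable] = X f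
 have "(\<integral>\<^sup>+om. ennreal (f om) \<partial>N)\<^sup>2 = (\<integral>\<^sup>+om. ennreal (sqrt (exp (X om)*f om))*ennreal (sqrt (exp (- X om)*f om)) \<partial>N)\<^sup>2"
 proof -
 have "sqrt (exp (X om)*f om) * sqrt (exp (- X om)*f om) = f om" for om
 proof -
  have "sqrt (exp (X om)*f om) * sqrt (exp (- X om)*f om) = sqrt ((exp (X om)*exp (- X om))*(f om)\<^sup>2)"
  unfolding real_sqrt_mult[symmetric] by (simp add: power2_eq_square mult_ac)
  also have "exp (X om)*exp (- X om) = 1" by (simp add: exp_minus)
  finally show ?thesis using f0(1) by simp
 qed
 then show ?thesis using f0(1) by (subst ennreal_mult[symmetric]) auto
 qed
 also have "... <= (\<integral>\<^sup>+om. (ennreal (sqrt (exp (X om)*f om)))\<^sup>2 \<partial>N)*(\<integral>\<^sup>+om. (ennreal (sqrt (exp (- X om)*f om)))\<^sup>2 \<partial>N)"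
 by (rule Cauchy_Schwarz_nn_integral) measurable
 also have "... = (\<integral>\<^sup>+om. ennreal (exp (X om)*f om) \<partial>N)*(\<integral>\<^sup>+om. ennreal (exp (- X om)*f om) \<partial>N)"
 using f0(1) by (simp add: ennreal_power)
 also have "... <= (\<integral>\<^sup>+om. ennreal (exp (X om)*f om) \<partial>N)*ennreal (P*(2*exp Q))"
 proof (rule mult_left_mono)
 have "(\<integral>\<^sup>+om. ennreal (exp (- X om)*f om) \<partial>N) <= (\<integral>\<^sup>+om. ennreal P*(1 + ennreal (exp (- 2*X om))) \<partial>N)"
 proof (rule nn_integral_mono)
  fix om
  have e2: "exp (- 2*X om) = (exp (- X om))\<^sup>2" by (simp add: power2_eq_square exp_add[symmetric])
  have "0 <= (exp (- X om) - 1/2)\<^sup>2" by simp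
  then have "exp (- X om) <= 1 + exp (- 2*X om)" unfolding e2 by (simp add: power2_eq_square algebra_simps)
  then have "exp (- X om)*f om <= (1 + exp (- 2*X om))*P" using f0 P by (intro mult_mono) (auto intro: add_nonneg_nonneg)
  then have "ennreal (exp (- X om)*f om) <= ennreal (P*(1 + exp (- 2*X om)))" by (intro ennreal_leI) (simp add: mult.commute)
  also have "... = ennreal P*(1 + ennreal (exp (- 2*X om)))" using P by (simp add: ennreal_mult' ennreal_plus)
  finally show "ennreal (exp (- X om)*f om) <= ennreal P*(1 + ennreal (exp (- 2*X om)))" .
 qed
 also have "... = ennreal P*(1 + (\<integral>\<^sup>+om. ennreal (exp (- 2*X om)) \<partial>N))"
  by (subst nn_integral_cmult, measurable, subst nn_integral_add) (auto simp: emeasure_space_1)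
 also have "... <= ennreal P*(1 + ennreal (exp Q))" using Q by (intro mult_left_mono add_left_mono) auto
 also have "... = ennreal (P*(1 + exp Q))" using P by (simp add: ennreal_mult' ennreal_plus)
 also have "... <= ennreal (P*(2*exp Q))" using P Q(2) by (intro ennreal_leI mult_left_mono) auto
 finally show "(\<integral>\<^sup>+om. ennreal (exp (- X om)*f om) \<partial>N) <= ennreal (P*(2*exp Q))" .
 qed simp
 finally show ?thesis .
qed

text \<open>The test function is the positive part of \<open>exp (k y)*(S y - ta)\<close>.
  Subtracting \<open>ta\<close> from the ground state \<open>S\<close> confines the positivity set
  to the window of radius \<open>K0/mu\<close> on which the path is controlled, at the price of
  \<open>ta\<close> in the rate. The noise is not close to the target potential; only its primitive
  is. With \<open>k'\<close> equal to minus twice the deviation of the primitives,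
  \<open>k''/2\<close> cancels the difference of the potentials, and only the small
  \<open>k'\<close> is left.\<close>

lemma (in kernel) sech_lower:
 fixes q :: nat
 assumes N: "prob_space N" and B: "brownian_motion N x B" and t: "t > 0" and q: "q > 0"
 and g: "continuous_on UNIV g" "\<And>z. \<bar>g z\<bar> <= G" and mu: "mu > 0" and ta: "0 < ta" "ta <= 1/4"
 and K0: "1/cosh K0 <= ta" "K0 >= 1" and de2: "0 <= de2" "de2*K0 <= 1" "ta + de2 <= 1/2"
 and ap: "\<And>y. \<bar>y - y0\<bar> <= K0/mu ==> \<bar>thh*(conv g 0 y - c) - mu*tanh (mu*(y - y0))\<bar> <= de2*mu/2"
 and Q: "(\<integral>\<^sup>+om. ennreal (exp (integral {0..t/q} (%s. - 2*(thh*(- conv g 1 (B s om)))))) \<partial>N) <= ennreal (exp Q)" "Q >= 0"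
 shows "ennreal (exp (mu\<^sup>2*(1/2 - ta - de2)*(t - t/q) - 8 - Q)
  * (2*(1/mu)/sqrt (2*pi*(t/q))*exp (- (\<bar>y0 - x\<bar> + 1/mu)\<^sup>2/(2*(t/q))))\<^sup>2)
 <= (\<integral>\<^sup>+om. ennreal (exp (integral {0..t} (%s. thh*(- conv g 1 (B s om))))) \<partial>N)"
proof -
 interpret prob_space N by fact
 define v where "v y = thh*(- conv g 1 y)" for y
 define T where "T y = tanh (mu*(y - y0))" for y
 define S where "S y = inverse (cosh (mu*(y - y0)))" for y
 define s where "s y = S y - ta" for y
 define s1 where "s1 y = - mu*S y*T y" for y
 define s2 where "s2 y = mu\<^sup>2*S y*(2*(T y)\<^sup>2 - 1)" for y
 define s3 where "s3 y = mu ^ 3*S y*T y*(5 - 6*(T y)\<^sup>2)" for y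
 define k1 where "k1 y = - 2*(thh*(conv g 0 y - c) - mu*T y)" for y
 define k2 where "k2 y = - 2*(thh*(- conv g (Suc 0) y) - mu*(mu*(1 - (T y)\<^sup>2)))" for y
 define k3 where "k3 y = - 2*(thh * conv g (Suc (Suc 0)) y + mu*(mu*(2*T y*(mu*(1 - (T y)\<^sup>2)))))" for y
 have lin: "((%y. mu*(y - y0)) has_real_derivative mu) (at y)" for y
 by (rule DERIV_cong, (rule DERIV_cmult DERIV_diff DERIV_ident DERIV_const)+) simp
 have dT: "(T has_real_derivative mu*(1 - (T y)\<^sup>2)) (at y)" for y
 proof -
 have "((%y. tanh (mu*(y - y0))) has_real_derivative (1 - (tanh (mu*(y - y0)))\<^sup>2)*mu) (at y)"
  by (rule DERIV_chain2[OF tanh_deriv lin])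
 then show ?thesis unfolding T_def[abs_def] by (simp add: mult.commute)
 qed
 have dS: "(S has_real_derivative s1 y) (at y)" for y
 proof -
 have "((%y. cosh (mu*(y - y0))) has_real_derivative sinh (mu*(y - y0))*mu) (at y)"
  by (rule DERIV_chain2[OF _ lin]) (auto intro!: derivative_eq_intros)
 from DERIV_inverse'[OF this] have "((%y. inverse (cosh (mu*(y - y0)))) has_real_derivative
  - (inverse (cosh (mu*(y - y0)))*(sinh (mu*(y - y0))*mu)*inverse (cosh (mu*(y - y0))))) (at y)"
  using cosh_real_pos[of "mu*(y - y0)"] by simp
 then show ?thesis unfolding s1_def S_def[abs_def] T_def tanh_def by (simp add: field_simps)
 qed
 have ST: "(S y)\<^sup>2 = 1 - (T y)\<^sup>2" for y
 proof -
 define z where "z = mu*(y - y0)"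
 have "(cosh z)\<^sup>2 = (sinh z)\<^sup>2 + 1" by (rule cosh_square_eq)
 moreover have "(cosh z)\<^sup>2 > 0" using cosh_real_pos[of z] by simp
 ultimately show ?thesis unfolding S_def T_def z_def[symmetric] tanh_def
  by (simp add: power_divide power_inverse divide_simps)
 qed
 have S0: "0 < S y" "S y <= 1" for y
 using cosh_real_pos[of "mu*(y - y0)"] cosh_real_ge_1[of "mu*(y - y0)"] by (auto simp: S_def inverse_le_1_iff)
 have T1: "\<bar>T y\<bar> <= 1" for y by (simp add: T_def abs_tanh_le)
 have ds: "(s has_real_derivative s1 y) (at y)" for y
 unfolding s_def[abs_def] by (rule DERIV_cong, (rule DERIV_diff dS DERIV_const)+) simp
 have ds1: "(s1 has_real_derivative s2 y) (at y)" for y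
 unfolding s1_def[abs_def] by (rule DERIV_cong, (rule DERIV_mult DERIV_cmult dS dT)+) (simp add: s1_def s2_def power2_eq_square algebra_simps)
 have ds2: "(s2 has_real_derivative s3 y) (at y)" for y
 unfolding s2_def[abs_def] power2_eq_square
 by (rule DERIV_cong, (rule DERIV_mult DERIV_cmult DERIV_diff DERIV_const dS dT)+) (simp add: s1_def s3_def power2_eq_square power3_eq_cube algebra_simps)
 have dk1: "(k1 has_real_derivative k2 y) (at y)" for y
 unfolding k1_def[abs_def] by (rule DERIV_cong, (rule DERIV_cmult DERIV_diff DERIV_const conv_deriv[OF g(1)] dT)+) (simp add: k2_def)
 have dk2: "(k2 has_real_derivative k3 y) (at y)" for y
 unfolding k2_def[abs_def] power2_eq_square
 by (rule DERIV_cong, (rule DERIV_cmult DERIV_mult DERIV_diff DERIV_minus DERIV_const conv_deriv[OF g(1)] dT)+)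
  (simp add: k3_def power2_eq_square algebra_simps)
 have cont: "continuous_on UNIV f" if "\<And>y. (f has_real_derivative f' y) (at y)" for f f' :: "real => real"
 using that by (meson DERIV_continuous continuous_at_imp_continuous_on)
 obtain k0 where k0: "\<And>y. (k0 has_real_derivative k1 y) (at y)" using antideriv_exists[OF cont[OF dk1]] by blast
 define k where "k y = k0 y - k0 y0" for y
 have dk: "(k has_real_derivative k1 y) (at y)" for y
 unfolding k_def[abs_def] by (rule DERIV_cong, (rule DERIV_diff k0 DERIV_const)+) simp
 define E where "E y = exp (k y)" for y
 have dE: "(E has_real_derivative E y * k1 y) (at y)" for y
 unfolding E_def[abs_def] by (rule DERIV_fun_exp[OF dk])
 have E0: "E y > 0" for y by (simp add: E_def)
 define p where "p y = E y * s y" for y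
 define p1 where "p1 y = E y*(k1 y * s y + s1 y)" for y
 define p2 where "p2 y = E y*(k1 y*(k1 y * s y + s1 y) + (k2 y * s y + k1 y * s1 y + s2 y))" for y
 define p3 where "p3 y = E y*(k1 y*(k1 y*(k1 y * s y + s1 y) + (k2 y * s y + k1 y * s1 y + s2 y))
 + (k2 y*(k1 y * s y + s1 y) + k1 y*(k2 y * s y + k1 y * s1 y + s2 y)
  + (k3 y * s y + k2 y * s1 y + (k2 y * s1 y + k1 y * s2 y) + s3 y)))" for y
 have dp: "(p has_real_derivative p1 y) (at y)" for y
 unfolding p_def[abs_def] by (rule DERIV_cong, (rule DERIV_mult dE ds)+) (simp add: p1_def algebra_simps)
 have dp1: "(p1 has_real_derivative p2 y) (at y)" for y
 unfolding p1_def[abs_def] by (rule DERIV_cong, (rule DERIV_mult DERIV_add dE ds ds1 dk1)+) (simp add: p2_def algebra_simps)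
 have dp2: "(p2 has_real_derivative p3 y) (at y)" for y
 unfolding p2_def[abs_def] by (rule DERIV_cong, (rule DERIV_mult DERIV_add dE ds ds1 ds2 dk1 dk2)+) (simp add: p3_def algebra_simps)
 have cv: "continuous_on UNIV (conv g n)" for n by (rule cont[OF conv_deriv[OF g(1)]])
 have c3: "continuous_on UNIV p3"
 unfolding p3_def[abs_def] k3_def[abs_def] s3_def[abs_def]
 by (intro continuous_on_mult continuous_on_add continuous_on_diff continuous_on_power continuous_on_const
  cont[OF dE] cont[OF dk1] cont[OF dk2] cont[OF ds] cont[OF ds1] cont[OF ds2] cont[OF dT] cont[OF dS] cv)
 have loc: "\<bar>y - y0\<bar> <= K0/mu" if "p y > 0" for y
 proof -
 have "s y > 0" using that E0[of y] by (simp add: p_def zero_less_mult_iff)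
 then have "1/cosh K0 < 1/cosh (mu*(y - y0))" using K0 by (simp add: s_def S_def inverse_eq_divide)
 then have "cosh (mu*(y - y0)) < cosh K0"
  using cosh_real_pos[of "mu*(y - y0)"] cosh_real_pos[of K0] by (simp add: divide_less_cancel field_simps)
 then have "cosh \<bar>mu*(y - y0)\<bar> <= cosh K0" by (simp add: abs_if)
 then have "\<bar>mu*(y - y0)\<bar> <= K0" using K0(2) by (subst (asm) cosh_real_nonneg_le_iff) auto
 then show ?thesis using mu by (simp add: abs_mult le_divide_eq mult.commute)
 qed
 have kb: "\<bar>k1 y\<bar> <= de2*mu" if "\<bar>y - y0\<bar> <= K0/mu" for y
 using ap[OF that] unfolding k1_def T_def abs_mult by simp
 have kk: "\<bar>k y\<bar> <= 1" if y: "\<bar>y - y0\<bar> <= K0/mu" for y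
 proof -
 have D: "\<exists>z. \<bar>z - y0\<bar> <= K0/mu & k y = (y - y0) * k1 z"
 proof (cases y y0 rule: linorder_cases)
  case less
  from MVT2[OF less, of k k1] dk obtain z where "y < z" "z < y0" "k y0 - k y = (y0 - y) * k1 z" by blast
  then show ?thesis using y less by (intro exI[of _ z]) (auto simp: k_def algebra_simps)
 next
  case equal
  then show ?thesis using y by (intro exI[of _ y0]) (auto simp: k_def)
 next
  case greater
  from MVT2[OF greater, of k k1] dk obtain z where "y0 < z" "z < y" "k y - k y0 = (y - y0) * k1 z" by blast
  then show ?thesis using y greater by (intro exI[of _ z]) (auto simp: k_def algebra_simps)
 qed
 then obtain z where z: "\<bar>z - y0\<bar> <= K0/mu" "k y = (y - y0) * k1 z" by blast
 have "\<bar>k y\<bar> <= K0/mu*(de2*mu)" unfolding z(2) abs_mult using y kb[OF z(1)] K0 mu by (intro mult_mono) auto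
 then show ?thesis using mu de2 by (simp add: mult.commute)
 qed
 have e3: "exp 1 <= (3 :: real)" by (rule exp_le)
 define ph where "ph y = max 0 (p y)" for y
 have ph0: "0 <= ph y" for y by (simp add: ph_def)
 have ph3: "ph y <= 3" for y
 proof (cases "p y > 0")
 case True
 have "E y <= 3" using kk[OF loc[OF True]] e3 unfolding E_def by (intro order.trans[OF _ e3]) (simp add: abs_le_iff)
 moreover have "s y <= 1" using S0(2)[of y] ta by (simp add: s_def)
 ultimately have "E y * s y <= 3*1" using E0[of y] True by (intro mult_mono) (auto simp: p_def zero_less_mult_iff)
 then show ?thesis by (simp add: ph_def p_def)
 qed (simp add: ph_def)
 have phc: "continuous_on UNIV ph" unfolding ph_def[abs_def] by (intro continuous_on_max continuous_on_const cont[OF dp])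
 \<comment> \<open>The constant is \<open>1/3*(1/4)\<close>: \<open>exp k\<close> is at least
   \<open>exp (- 1) >= 1/3\<close>, while \<open>S\<close> is at least 1/2 on this interval and
   \<open>ta\<close> at most 1/4.\<close>
 have phl: "1/12 <= ph y" if "\<bar>y - y0\<bar> <= 1/mu" for y
 proof -
 have "1/mu <= K0/mu" using K0 mu by (intro divide_right_mono) auto
 then have "\<bar>k y\<bar> <= 1" using that by (intro kk) auto
 then have "exp (- 1) <= E y" unfolding E_def by simp
 moreover have "1/3 <= exp (- 1 :: real)" using e3 by (simp add: exp_minus divide_simps)
 ultimately have "1/3 <= E y" by linarith
 moreover have "1/4 <= s y"
 proof -
  have "\<bar>mu*(y - y0)\<bar> <= 1" using that mu by (simp add: abs_mult le_divide_eq mult.commute)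
  then have "cosh \<bar>mu*(y - y0)\<bar> <= cosh 1" by (subst cosh_real_nonneg_le_iff) auto
  also have "cosh 1 <= (2 :: real)"
  proof -
  have a: "exp (- 1 :: real) <= 1" by simp
  have "exp 1 + exp (- 1) <= (4 :: real)" using e3 a by linarith
  then show ?thesis by (simp add: cosh_def)
  qed
  finally have "cosh (mu*(y - y0)) <= 2" by (simp add: abs_if split: if_splits)
  then have "1/2 <= S y" using cosh_real_pos[of "mu*(y - y0)"] unfolding S_def by (simp add: field_simps)
  then show ?thesis using ta by (simp add: s_def)
 qed
 ultimately have "1/3*(1/4) <= E y * s y" by (intro mult_mono) auto
 then show ?thesis by (simp add: ph_def p_def)
 qed
 obtain C where C: "C >= 0" "\<And>y d. p y > 0 ==> p y + p1 y*d + p2 y/2*d\<^sup>2 - C * \<bar>d\<bar> ^ 3 <= max 0 (p (y + d))"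
 using max_zero_taylor[OF dp dp1 dp2 c3 loc] by blast
 define La where "La = mu\<^sup>2*(1/2 - ta - de2)"
 have gen: "La*ph y <= p2 y/2 + v y*ph y" if "ph y > 0" for y
 proof -
 have py: "p y > 0" using that by (simp add: ph_def less_max_iff_disj)
 have sy: "s y > 0" using py E0[of y] by (simp add: p_def zero_less_mult_iff)
 have "\<bar>s1 y\<bar> <= mu*S y" using T1[of y] S0[of y] mu mult_left_mono[OF T1[of y], of "mu*S y"] by (simp add: s1_def abs_mult)
 then have "\<bar>k1 y\<bar> * \<bar>s1 y\<bar> <= de2*mu*(mu*S y)" using kb[OF loc[OF py]] de2 mu by (intro mult_mono) auto
 then have a: "- (de2*mu\<^sup>2*S y) <= k1 y * s1 y" unfolding abs_mult[symmetric] by (simp add: power2_eq_square abs_le_iff mult_ac)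
 have S2: "(S y)\<^sup>2 <= S y" using S0[of y] by (simp add: power2_eq_square mult_left_le)
 have b: "ta*mu\<^sup>2*(S y)\<^sup>2 <= ta*mu\<^sup>2*S y" using S2 ta by (intro mult_left_mono) auto
 have c': "mu\<^sup>2*(1 - (T y)\<^sup>2) * s y + s2 y/2 = mu\<^sup>2*S y/2 - ta*mu\<^sup>2*(S y)\<^sup>2"
  unfolding ST by (simp add: s_def s2_def diff_divide_distrib add_divide_distrib algebra_simps)
 have d: "0 <= (k1 y)\<^sup>2 * s y" using sy by simp
 have e: "La * s y <= La*S y" unfolding La_def using ta de2 by (intro mult_left_mono) (auto simp: s_def)
 have f: "La*S y = mu\<^sup>2*S y/2 - ta*mu\<^sup>2*S y - de2*mu\<^sup>2*S y" by (simp add: La_def algebra_simps)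
 \<comment> \<open>Half of \<open>k2\<close> cancels \<open>v\<close> up to the target potential
   \<open>mu^2*(1 - T^2)\<close>, so the noise disappears from the right-hand side.\<close>
 have "(k1 y*(k1 y * s y + s1 y) + (k2 y * s y + k1 y * s1 y + s2 y))/2 + v y * s y
  = (k1 y)\<^sup>2 * s y/2 + k1 y * s1 y + (mu\<^sup>2*(1 - (T y)\<^sup>2) * s y + s2 y/2)"
  by (simp add: k2_def v_def power2_eq_square field_simps)
 then have "La * s y <= (k1 y*(k1 y * s y + s1 y) + (k2 y * s y + k1 y * s1 y + s2 y))/2 + v y * s y"
  using a b c' d e f by linarith
 then have "E y*(La * s y) <= E y*((k1 y*(k1 y * s y + s1 y) + (k2 y * s y + k1 y * s1 y + s2 y))/2 + v y * s y)"
  using E0[of y] by (intro mult_left_mono) auto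
 moreover have "ph y = E y * s y" using py by (simp add: ph_def p_def)
 ultimately show ?thesis by (simp add: p2_def algebra_simps)
 qed
 have vc: "continuous_on UNIV v" unfolding v_def[abs_def] by (intro continuous_on_mult continuous_on_const continuous_on_minus cv)
 obtain Cv where Cv: "\<And>y B. (\<And>z. \<bar>g z\<bar> <= B) ==> \<bar>conv g 1 y\<bar> <= Cv * B" using conv_abs_bound[OF g(1), where n = 1] by blast
 have vA: "\<bar>v y\<bar> <= \<bar>thh\<bar>*(Cv * G)" for y
 unfolding v_def abs_mult abs_minus_cancel by (rule mult_left_mono[OF Cv[OF g(2)]]) simp
 have tay: "ph y + p1 y*d + p2 y/2*d\<^sup>2 - C * \<bar>d\<bar> ^ 3 <= ph (y + d)" if "ph y > 0" for y d
 proof -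
 have "p y > 0" "ph y = p y" using that by (auto simp: ph_def)
 then show ?thesis using C(2)[of y d] by (simp add: ph_def)
 qed
 note F = FK_lower[OF N B t q vc vA phc ph0 ph3 C(1) tay gen]
 define t1 where "t1 = t/q"
 have t1: "t1 > 0" using t q by (simp add: t1_def)
 obtain X where X: "X \<in> borel_measurable N" "AE om in N. integral {0..t1} (%s. v (B s om)) = X om"
 using AE_measurable_integral[OF B vc less_imp_le[OF t1]] by blast
 have Bm: "B t1 \<in> borel_measurable N" using B t1 by (auto simp: brownian_motion_on_def)
 have fm: "(%om. ph (B t1 om)) \<in> borel_measurable N" by (rule measurable_compose[OF Bm borel_measurable_continuous_onI[OF phc]])
 define P where "P = 2*(1/mu)/sqrt (2*pi*t1)*exp (- (\<bar>y0 - x\<bar> + 1/mu)\<^sup>2/(2*t1))"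
 have P0: "P >= 0" using mu t1 by (simp add: P_def)
 define a where "a = (\<integral>\<^sup>+om. ennreal (exp (X om)*ph (B t1 om)) \<partial>N)"
 define Z where "Z = (\<integral>\<^sup>+om. ennreal (exp (integral {0..t} (%s. v (B s om)))) \<partial>N)"
 have "ennreal (1/12*P) <= (\<integral>\<^sup>+om. ennreal (ph (B t1 om)) \<partial>N)"
 proof -
 have "ennreal (1/12*P) = ennreal (1/12)*ennreal P" by (rule ennreal_mult') simp
 also have "... <= ennreal (1/12)*(\<integral>\<^sup>+om. indicator {y0 - 1/mu..y0 + 1/mu} (B t1 om) \<partial>N)"
  unfolding P_def using brownian_hits_interval[OF N B t1, of "1/mu" y0] mu by (intro mult_left_mono) auto
 also have "... = (\<integral>\<^sup>+om. ennreal (1/12)*indicator {y0 - 1/mu..y0 + 1/mu} (B t1 om) \<partial>N)"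
  using Bm by (intro nn_integral_cmult[symmetric]) measurable
 also have "... <= (\<integral>\<^sup>+om. ennreal (ph (B t1 om)) \<partial>N)"
 proof (rule nn_integral_mono)
  fix om
  have "\<bar>B t1 om - y0\<bar> <= 1/mu" if "B t1 om \<in> {y0 - 1/mu..y0 + 1/mu}" using that by (auto simp: abs_le_iff)
  then show "ennreal (1/12)*indicator {y0 - 1/mu..y0 + 1/mu} (B t1 om) <= ennreal (ph (B t1 om))"
  using phl by (cases "B t1 om \<in> {y0 - 1/mu..y0 + 1/mu}") (auto intro!: ennreal_leI)
 qed
 finally show ?thesis .
 qed
 then have "(ennreal (1/12*P))\<^sup>2 <= (\<integral>\<^sup>+om. ennreal (ph (B t1 om)) \<partial>N)\<^sup>2" by (intro power_mono) auto
 also have "... <= a*ennreal (3*(2*exp Q))"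
 unfolding a_def
 proof (rule exp_pairing_lower[OF N X(1) fm ph0 ph3 _ _ Q(2)])
 have "(\<integral>\<^sup>+om. ennreal (exp (- 2*X om)) \<partial>N) = (\<integral>\<^sup>+om. ennreal (exp (integral {0..t/q} (%s. - 2*(thh*(- conv g 1 (B s om)))))) \<partial>N)"
 proof (rule nn_integral_cong_AE, use X(2) in eventually_elim)
  fix om assume "integral {0..t1} (%s. v (B s om)) = X om"
  moreover have "integral {0..t1} (%s. - 2 * v (B s om)) = - 2*integral {0..t1} (%s. v (B s om))" by (rule integral_mult_right)
  ultimately show "ennreal (exp (- 2*X om)) = ennreal (exp (integral {0..t/q} (%s. - 2*(thh*(- conv g 1 (B s om))))))"
  by (simp only: v_def t1_def)
 qed
 then show "(\<integral>\<^sup>+om. ennreal (exp (- 2*X om)) \<partial>N) <= ennreal (exp Q)" using Q(1) by simp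
 qed simp
 finally have A: "(ennreal (1/12*P))\<^sup>2 <= a*ennreal (3*(2*exp Q))" .
 have Bb: "ennreal (exp (La*(t - t1)))*a <= ennreal 3*Z"
 proof -
 have "a = (\<integral>\<^sup>+om. ennreal (exp (integral {0..t1} (%s. v (B s om)))*ph (B t1 om)) \<partial>N)"
  unfolding a_def by (rule nn_integral_cong_AE, use X(2) in eventually_elim) simp
 then have "ennreal (exp (La*(t - t1)))*a <= (\<integral>\<^sup>+om. ennreal (exp (integral {0..t} (%s. v (B s om)))*ph (B t om)) \<partial>N)"
  using F unfolding t1_def by simp
 also have "... <= ennreal 3*Z"
 proof -
  obtain X' where X': "X' \<in> borel_measurable N" "AE om in N. integral {0..t} (%s. v (B s om)) = X' om"
  using AE_measurable_integral[OF B vc less_imp_le[OF t]] by blast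
  have "Z = (\<integral>\<^sup>+om. ennreal (exp (X' om)) \<partial>N)"
  unfolding Z_def by (rule nn_integral_cong_AE, use X'(2) in eventually_elim) simp
  moreover have "(\<integral>\<^sup>+om. ennreal (exp (integral {0..t} (%s. v (B s om)))*ph (B t om)) \<partial>N) <= (\<integral>\<^sup>+om. ennreal 3*ennreal (exp (X' om)) \<partial>N)"
  proof (rule nn_integral_mono_AE, use X'(2) in eventually_elim)
  fix om assume e: "integral {0..t} (%s. v (B s om)) = X' om"
  have "exp (X' om)*ph (B t om) <= exp (X' om)*3" using ph3 by (intro mult_left_mono) auto
  then show "ennreal (exp (integral {0..t} (%s. v (B s om)))*ph (B t om)) <= ennreal 3*ennreal (exp (X' om))"
  unfolding e by (subst ennreal_mult[symmetric]) (auto intro!: ennreal_leI simp: mult.commute)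
  qed
  moreover have "(\<integral>\<^sup>+om. ennreal 3*ennreal (exp (X' om)) \<partial>N) = ennreal 3*(\<integral>\<^sup>+om. ennreal (exp (X' om)) \<partial>N)"
  using X'(1) by (intro nn_integral_cmult) measurable
  ultimately show ?thesis by simp
 qed
 finally show ?thesis .
 qed
 have num: "exp (La*(t - t1) - 8 - Q)*P\<^sup>2 <= exp (La*(t - t1))*(1/12*P)\<^sup>2*(1/(18*exp Q))"
 proof -
 \<comment> \<open>The number is \<open>12^2*18\<close>: the lower bound 1/12 enters squared, and 18
   collects the bound 3 on \<open>ph\<close>, used twice, and the 2 from
   \<open>exp_pairing_lower\<close>.\<close>
 have "2592 <= exp (8 :: real)"
 proof -
  have "(1 + 1 + 1/2) ^ 1 <= exp (1 :: real)" using exp_lower_Taylor_quadratic[of 1] by simp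
  moreover have "exp 8 = (exp 1 :: real) ^ 8" by (simp add: exp_of_nat_mult[symmetric])
  moreover have e27: "exp 1 >= (2.7 :: real)"
  proof -
  have "1 + 1/8 + (1/8)\<^sup>2/2 <= exp (1/8 :: real)" using exp_lower_Taylor_quadratic[of "1/8"] by simp
  then have "(1 + 1/8 + (1/8)\<^sup>2/2) ^ 8 <= exp (1/8 :: real) ^ 8" by (intro power_mono) auto
  also have "exp (1/8 :: real) ^ 8 = exp 1" by (simp add: exp_of_nat_mult[symmetric])
  finally show ?thesis by (simp add: power2_eq_square eval_nat_numeral)
  qed
  ultimately show ?thesis using power_mono[OF e27, of 8] by (simp add: eval_nat_numeral)
 qed
 then have "1/exp 8 <= 1/(2592 :: real)" by (intro divide_left_mono) auto
 then have "exp (La*(t - t1))/exp Q*P\<^sup>2*(1/exp 8) <= exp (La*(t - t1))/exp Q*P\<^sup>2*(1/2592)" by (intro mult_left_mono) auto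
 moreover have "exp (La*(t - t1) - 8 - Q)*P\<^sup>2 = exp (La*(t - t1))/exp Q*P\<^sup>2*(1/exp 8)" by (simp add: exp_diff)
 moreover have "exp (La*(t - t1))*(1/12*P)\<^sup>2*(1/(18*exp Q)) = exp (La*(t - t1))/exp Q*P\<^sup>2*(1/2592)"
  by (simp add: power_divide power2_eq_square)
 ultimately show ?thesis by linarith
 qed
 have "ennreal (exp (La*(t - t1) - 8 - Q)*P\<^sup>2) <= ennreal (exp (La*(t - t1))*(1/12*P)\<^sup>2*(1/(18*exp Q)))"
 using num by (rule ennreal_leI)
 also have "... = ennreal (exp (La*(t - t1)))*(ennreal (1/12*P))\<^sup>2*ennreal (1/(18*exp Q))"
 proof -
 have h: "0 <= 1/12*P" "0 <= exp (La*(t - t1))*(1/12*P)\<^sup>2" "0 <= exp (La*(t - t1))" using P0 by simp_all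
 show ?thesis unfolding ennreal_power[OF h(1)] by (simp only: ennreal_mult'[OF h(2)] ennreal_mult'[OF h(3)])
 qed
 also have "... <= ennreal (exp (La*(t - t1)))*(a*ennreal (3*(2*exp Q)))*ennreal (1/(18*exp Q))"
 by (intro mult_right_mono mult_left_mono A) auto
 also have "... = (ennreal (exp (La*(t - t1)))*a)*(ennreal (3*(2*exp Q))*ennreal (1/(18*exp Q)))" by (simp only: mult.assoc)
 also have "... <= (ennreal 3*Z)*(ennreal (3*(2*exp Q))*ennreal (1/(18*exp Q)))" by (intro mult_right_mono Bb) simp
 also have "... = (ennreal 3*(ennreal (3*(2*exp Q))*ennreal (1/(18*exp Q))))*Z" by (simp only: mult_ac)
 also have "ennreal 3*(ennreal (3*(2*exp Q))*ennreal (1/(18*exp Q))) = ennreal (3*((3*(2*exp Q))*(1/(18*exp Q))))"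
 by (subst ennreal_mult[symmetric], simp, simp)+ simp
 also have "3*((3*(2*exp Q))*(1/(18*exp Q))) = 1" by simp
 finally show ?thesis unfolding Z_def v_def P_def La_def t1_def by simp
qed

section \<open>From a favourable block to a lower bound on the moment\<close>

lemma tanh_lipschitz: "\<bar>tanh y - tanh z\<bar> <= \<bar>y - z\<bar>" for y z :: real
proof -
 have *: "tanh b - tanh a <= b - a" if "a <= b" for a b :: real
 proof -
 have "a - tanh a <= b - tanh b"
 proof (rule DERIV_nonneg_imp_nondecreasing[OF that])
  fix u :: real
  have "((%u. u - tanh u) has_real_derivative 1 - (1 - (tanh u)\<^sup>2)) (at u)"
  by (rule DERIV_diff DERIV_ident tanh_deriv)+
  then show "\<exists>d. ((%u. u - tanh u) has_real_derivative d) (at u) & 0 <= d" by (intro exI conjI) auto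
 qed
 then show ?thesis by linarith
 qed
 show ?thesis
 proof (cases "y <= z")
 case True
 then show ?thesis using *[OF True] tanh_mono_real[OF True] by linarith
 next
 case False
 then have "z <= y" by simp
 then show ?thesis using *[of z y] tanh_mono_real[of z y] by linarith
 qed
qed

lemma target_lipschitz:
 assumes "thh > 0" "mu > 0" shows "\<bar>target thh mu y - target thh mu z\<bar> <= mu\<^sup>2/thh * \<bar>y - z\<bar>"
proof -
 have "target thh mu y - target thh mu z = mu/thh*(tanh (mu*y) - tanh (mu*z))"
 by (simp add: target_def right_diff_distrib)
 then have "\<bar>target thh mu y - target thh mu z\<bar> = mu/thh * \<bar>tanh (mu*y) - tanh (mu*z)\<bar>"
 using assms by (simp add: abs_mult)
 also have "... <= mu/thh * \<bar>mu*y - mu*z\<bar>" using assms by (intro mult_left_mono tanh_lipschitz) auto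
 also have "\<bar>mu*y - mu*z\<bar> = mu * \<bar>y - z\<bar>" using assms by (simp add: right_diff_distrib[symmetric] abs_mult)
 finally show ?thesis by (simp add: power2_eq_square)
qed

text \<open>Three errors are collected in the unit \<open>mu/thh\<close>: the tolerances telescope
  to \<open>d*thh\<close>, the oscillation within a cell gives \<open>10*sqrt et\<close>, and
  replacing a mesh point by \<open>z\<close> in the target costs \<open>et\<close>. The additive
  constant \<open>c\<close> is free, as only derivatives of the path matter.\<close>

lemma low_ok_block:
 assumes thh: "thh > 0" and de: "0 < de" "de <= 1/2" and et: "0 < et" "et <= 1" and K0: "K0 > 0" and d: "d >= 0" and j: "j > 0"
 and low: "low_ok thh de et K0 d j w" and R: "R >= exp (real j)"
 and osc: "osc_ok w (et/mm thh de j) (ou thh et (mm thh de j) (et/mm thh de j) R)"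
 defines "mu \<equiv> mm thh (- de) j"
 obtains y0 c where "0 <= y0" "y0 <= exp (real j)"
 "\<And>z. \<bar>z - y0\<bar> <= K0/mu ==> \<bar>z\<bar> <= exp (real j) & \<bar>w z - c - target thh mu (z - y0)\<bar> <= mu/thh*(10 * sqrt et + et + d*thh)"
proof -
 define m where "m = mm thh de j"
 define b where "b = et/m"
 define n where "n = blk de et K0"
 have jr: "real j > 0" using j by simp
 have mu: "mu > 0" unfolding mu_def using thh de j by (intro mm_pos) auto
 have m: "m > 0" unfolding m_def using thh de j by (intro mm_pos) auto
 have mmu: "mu <= m" "m <= 2*mu"
 proof -
 have "mu ^ 3 <= m ^ 3" unfolding mu_def m_def mm_cube using de jr by (intro mult_right_mono mult_left_mono) auto
 then show "mu <= m" using m by (meson power_le_imp_le_base power_mono_iff less_imp_le mu zero_less_numeral)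
 have "m ^ 3 <= (2*mu) ^ 3"
 proof -
  have "3/2*thh\<^sup>2*j*(1 + de) <= 3/2*thh\<^sup>2*j*(8*(1 - de))" using de jr by (intro mult_left_mono) auto
  then show ?thesis unfolding power_mult_distrib mu_def m_def mm_cube by (simp add: algebra_simps)
 qed
 then show "m <= 2*mu" using mu m by (meson power_mono_iff less_imp_le mult_pos_pos zero_less_numeral)
 qed
 have b: "b > 0" using m et by (simp add: b_def)
 have bmu: "b*mu <= et" unfolding b_def using mmu m et by (simp add: divide_le_eq mult_left_mono)
 have R0: "R > 0" using R exp_gt_zero[of "real j"] by linarith
 have de1: "de < 1" using de by simp
 note bp = blk_props[OF thh de(1) de1 jr et K0, folded m_def mu_def n_def, folded b_def]
 obtain i where i: "real ((i + 1)*n)*b <= exp (real j)"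
 and inc: "\<And>k. k < n ==> \<bar>(w (real (Suc (i*n + k))*b) - w (real (i*n + k)*b))
   - (target thh mu (real (Suc k)*b - real n*b/2) - target thh mu (real k*b - real n*b/2))\<bar> <= d*mu/real n"
 using low unfolding low_ok_def Let_def mu_def[symmetric] m_def[symmetric] n_def[symmetric] b_def[symmetric] by blast
 define a where "a = real (i*n)*b"
 have a0: "a >= 0" using b by (simp add: a_def)
 have an: "a + real n*b <= exp (real j)" using i by (simp add: a_def algebra_simps)
 define y0 where "y0 = a + real n*b/2"
 define c where "c = w a - target thh mu (- (real n*b/2))"
 have tel: "\<bar>(w (real (i*n + k)*b) - w a) - (target thh mu (real k*b - real n*b/2) - target thh mu (- (real n*b/2)))\<bar>
  <= real k*(d*mu/real n)" if "k <= n" for k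
 using that
 proof (induction k)
 case (Suc k)
 have "\<bar>(w (real (i*n + k)*b) - w a) - (target thh mu (real k*b - real n*b/2) - target thh mu (- (real n*b/2)))\<bar>
  <= real k*(d*mu/real n)" using Suc by simp
 moreover have "real (Suc k)*(d*mu/real n) = real k*(d*mu/real n) + d*mu/real n" by (simp add: distrib_right add_divide_distrib)
 moreover have "i*n + Suc k = Suc (i*n + k)" by simp
 ultimately show ?case using inc[of k] Suc.prems by (simp only:) linarith
 qed (simp add: a_def)
 show ?thesis
 proof (rule that[of y0 c])
 have nb: "0 <= real n*b" using b by simp
 show "0 <= y0" using a0 nb by (simp add: y0_def)
 show "y0 <= exp (real j)" using an nb by (simp add: y0_def)
 fix z assume z: "\<bar>z - y0\<bar> <= K0/mu"
 have "K0/mu <= real n*b/2" using bp(1) mu by (simp add: divide_le_eq)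
 then have z1: "a <= z" "z <= a + real n*b" using z unfolding y0_def by linarith+
 define k0 where "k0 = nat \<lfloor>(z - a)/b\<rfloor>"
 have k0: "real k0*b <= z - a" "z - a < real (Suc k0)*b"
 proof -
  have "0 <= (z - a)/b" using z1 b by simp
  then have "real k0 <= (z - a)/b" "(z - a)/b < real k0 + 1"
  unfolding k0_def using of_int_floor_le[of "(z - a)/b"] floor_correct[of "(z - a)/b"] by simp_all
  then show "real k0*b <= z - a" "z - a < real (Suc k0)*b"
  using b by (simp_all add: pos_le_divide_eq pos_divide_less_eq add.commute)
 qed
 \<comment> \<open>The right end point of the block would have index \<open>n\<close>; it is
   assigned to the last cell.\<close>
 define k where "k = min k0 (n - 1)"
 have kn: "k < n" "k <= n" using bp(3) by (auto simp: k_def)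
 have kz: "real k*b <= z - a" "z - a <= real k*b + b"
 proof -
  have "real k*b <= real k0*b" using b by (intro mult_right_mono) (auto simp: k_def)
  then show "real k*b <= z - a" using k0 by linarith
  show "z - a <= real k*b + b"
  proof (cases "k0 <= n - 1")
  case True
  then have "k = k0" by (simp add: k_def)
  then show ?thesis using k0(2) by (simp add: distrib_right)
  next
  case False
  then have "Suc k = n" using bp(3) by (simp add: k_def)
  then have "real n*b = real k*b + b" by (metis distrib_right mult_1 of_nat_Suc add.commute)
  then show ?thesis using z1 by linarith
  qed
 qed
 have ik: "real (i*n + k)*b = a + real k*b" by (simp add: a_def distrib_right)
 have o: "\<bar>w z - w (real (i*n + k)*b)\<bar> <= ou thh et m b R (i*n + k)"
 proof -
  have "z \<in> {real (i*n + k)*b..real (i*n + k)*b + b}" using kz by (simp only: ik atLeastAtMost_iff) linarith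
  then show ?thesis using osc unfolding osc_ok_def m_def[symmetric] b_def[symmetric] by blast
 qed
 have ou: "ou thh et m b R (i*n + k) <= mu/thh*(10 * sqrt et)"
 proof -
  have "real (i*n + k)*b <= R" using ik kz z1 an R by linarith
  then have "real (i*n + k)*b/R <= 1" using R0 by (simp add: divide_le_eq)
  then have "1 + real (i*n + k)*b/R <= (3/2)\<^sup>2" unfolding power2_eq_square by linarith
  then have "sqrt (1 + real (i*n + k)*b/R) <= sqrt ((3/2)\<^sup>2)" by (rule real_sqrt_le_mono)
  then have "3 * sqrt et*m/thh * sqrt (1 + real (i*n + k)*b/R) <= 3 * sqrt et*m/thh*(3/2)"
  using et m thh by (intro mult_left_mono) auto
  also have "... <= 3 * sqrt et*(2*mu)/thh*(3/2)"
  using mmu thh et by (intro mult_right_mono divide_right_mono mult_left_mono) auto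
  also have "... = 9*(mu/thh * sqrt et)" by simp
  also have "... <= 10*(mu/thh * sqrt et)" using mu thh et by (intro mult_right_mono) auto
  also have "... = mu/thh*(10 * sqrt et)" by simp
  finally show ?thesis by (simp add: ou_def)
 qed
 have t: "\<bar>target thh mu (real k*b - real n*b/2) - target thh mu (z - y0)\<bar> <= mu/thh*et"
 proof -
  have "\<bar>real k*b - real n*b/2 - (z - y0)\<bar> <= b" using kz unfolding y0_def by linarith
  then have "\<bar>target thh mu (real k*b - real n*b/2) - target thh mu (z - y0)\<bar> <= mu\<^sup>2/thh*b"
  using target_lipschitz[OF thh mu, of "real k*b - real n*b/2" "z - y0"] thh
  by (elim order.trans) (intro mult_left_mono, auto)
  also have "mu\<^sup>2/thh*b = mu/thh*(b*mu)" by (simp add: power2_eq_square)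
  also have "... <= mu/thh*et" using bmu mu thh by (intro mult_left_mono) auto
  finally show ?thesis .
 qed
 have "real k*(d*mu/real n) <= real n*(d*mu/real n)" using kn d mu by (intro mult_right_mono) auto
 moreover have "real n*(d*mu/real n) = mu/thh*(d*thh)" using bp(3) thh by (simp add: mult.commute)
 ultimately have tk: "real k*(d*mu/real n) <= mu/thh*(d*thh)" by (simp only:)
 have sp: "mu/thh*(10 * sqrt et + et + d*thh) = mu/thh*(10 * sqrt et) + mu/thh*et + mu/thh*(d*thh)" by (simp only: distrib_left)
 have "\<bar>w z - c - target thh mu (z - y0)\<bar> <= mu/thh*(10 * sqrt et + et + d*thh)"
  using o ou t tk tel[OF kn(2)] unfolding sp c_def by linarith
 moreover have "\<bar>z\<bar> <= exp (real j)" using z1 a0 an by linarith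
 ultimately show "\<bar>z\<bar> <= exp (real j) & \<bar>w z - c - target thh mu (z - y0)\<bar> <= mu/thh*(10 * sqrt et + et + d*thh)" by blast
 qed
qed

lemma cosh_ge_self: "z <= cosh z" if "z >= 0" for z :: real
proof -
 have "1 + z + z\<^sup>2/2 <= exp z" using exp_lower_Taylor_quadratic[OF that] .
 moreover have "1 - z <= exp (- z)" using exp_ge_add_one_self[of "- z"] by simp
 moreover have "0 <= (z - 2)\<^sup>2" by simp
 then have "4*z <= 4 + z\<^sup>2" by (simp add: power2_eq_square algebra_simps)
 ultimately have "2*z <= exp z + exp (- z)" by linarith
 then show ?thesis unfolding cosh_def by (simp add: scaleR_conv_of_real)
qed

lemma clamp_bounded:
 assumes "continuous_on UNIV w" "K >= 0" obtains G where "\<And>y. \<bar>clamp K w y\<bar> <= G"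
proof -
 have "compact (w ` {- K..K})" using assms(1) by (intro compact_continuous_image continuous_on_subset[OF assms(1)]) auto
 then obtain G where "\<forall>z\<in>w ` {- K..K}. norm z <= G" using compact_imp_bounded bounded_iff by metis
 moreover have "max (- K) (min K y) \<in> {- K..K}" for y using assms(2) by auto
 ultimately show ?thesis by (intro that[of G]) (auto simp: clamp_def)
qed

text \<open>The block is controlled on the radius \<open>(1/de + 1)/mu\<close>, one unit
  \<open>1/mu\<close> more than \<open>K0 = 1/de\<close> asks for, so that mollification at scale
  \<open>ep <= 1/mu\<close> stays inside. The cut-off level is \<open>de\<close> itself, since
  \<open>1/cosh (1/de) <= de\<close>.\<close>

lemma (in kernel) lower_fine:
 fixes q :: nat
 assumes N: "prob_space N" and B: "brownian_motion N x B" and thh: "thh > 0" and de: "0 < de" "de <= 1/8" and ga: "0 < ga"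
 and et: "0 < et" "sqrt et <= de/128" and j: "j > 0" and mu1: "mm thh (- de) j >= 1" and t: "0 < t" "t <= exp (real j)" and q: "q > 0"
 and w: "continuous_on UNIV w"
 and up: "up_ok thh de et ga (c1 et/de) j w" "up_ok thh de et ga (c1 et/de) j (%y. - w (- y))"
 and low: "low_ok thh de et (1/de + 1) (de/(6*thh)) j w"
 and Kc: "Kc >= c1 et/de*exp (real j)*mm thh de j + 1" and eps': "ep*mm thh (- de) j <= et"
 defines "Q \<equiv> 2*et + (\<bar>x\<bar> + 1)*(\<bar>x\<bar> + 2 + 2*mm thh de j) + 2*de*mm thh de j*(\<bar>x\<bar> + 1)
  + (mm thh de j)\<^sup>2*(2 * c1 et + 10*de)*(t/q)"
 shows "\<exists>y0. 0 <= y0 & y0 <= exp (real j) & ennreal (exp ((mm thh (- de) j)\<^sup>2*(1/2 - 2*de)*(t - t/q) - 8 - Q)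
  * (2*(1/mm thh (- de) j)/sqrt (2*pi*(t/q))*exp (- (\<bar>y0 - x\<bar> + 1/mm thh (- de) j)\<^sup>2/(2*(t/q))))\<^sup>2)
 <= (\<integral>\<^sup>+om. ennreal (exp (integral {0..t} (%s. thh*(- conv (clamp Kc w) 1 (B s om))))) \<partial>N)"
proof -
 define mu where "mu = mm thh (- de) j"
 define m where "m = mm thh de j"
 define K where "K = c1 et/de"
 have mu: "mu > 0" "mu >= 1" using mu1 by (auto simp: mu_def)
 have jr: "real j > 0" using j by simp
 have mmu: "mu <= m"
 unfolding mu_def m_def mm_def using de jr by (intro real_root_le_mono mult_right_mono mult_left_mono) auto
 have m1: "m >= 1" using mmu mu by linarith
 have c1: "c1 et >= 2" using et by (auto simp: c1_def add_increasing)
 have "de <= c1 et" using c1 de by linarith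
 then have K1: "K >= 1" using de by (simp add: K_def le_divide_eq)
 have et1: "et <= sqrt et" "et <= 1"
 proof -
 have s1: "sqrt et <= 1" using et(2) de by linarith
 then have "sqrt et * sqrt et <= 1 * sqrt et" using et(1) by (intro mult_right_mono) auto
 then show "et <= sqrt et" using et(1) by simp
 then show "et <= 1" using s1 by linarith
 qed
 have RT: "K*exp (real j)*m >= exp (real j)"
 proof -
 have "1*exp (real j)*1 <= K*exp (real j)*m" using K1 m1 by (intro mult_mono) auto
 then show ?thesis by simp
 qed
 have osc: "osc_ok w (et/m) (ou thh et m (et/m) (K*exp (real j)*m))"
 using up(1) unfolding up_ok_def Let_def m_def K_def by simp
 have K0: "1/de + 1 > 0" "1/de >= 1" using de by (auto simp: add_pos_pos le_divide_eq)
 have deh: "de <= 1/2" using de by simp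
 have dn: "de/(6*thh) >= 0" using de thh by simp
 obtain y0 c where y0: "0 <= y0" "y0 <= exp (real j)"
 and ap: "\<And>z. \<bar>z - y0\<bar> <= (1/de + 1)/mu ==> \<bar>z\<bar> <= exp (real j) & \<bar>w z - c - target thh mu (z - y0)\<bar> <= mu/thh*(10 * sqrt et + et + de/(6*thh)*thh)"
 using low_ok_block[OF thh de(1) deh et(1) et1(2) K0(1) dn j low RT[unfolded m_def] osc[unfolded m_def]] unfolding m_def mu_def by blast
 let ?g = "clamp Kc w"
 have gc: "continuous_on UNIV ?g" by (rule clamp_cont[OF w])
 have Kc1: "Kc >= exp (real j)" using Kc RT by (simp add: K_def m_def)
 then have Kc0: "Kc >= 0" by (rule order.trans[rotated]) simp
 obtain G where G: "\<And>y. \<bar>?g y\<bar> <= G" using clamp_bounded[OF w Kc0] by blast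
 define de2 where "de2 = 2*(10 * sqrt et + 2*et + de/6)"
 have de2: "0 <= de2" "de2 <= de"
 proof -
 have *: "0 <= 2*(10 * s + 2*et + de/6) & 2*(10 * s + 2*et + de/6) <= de" if "0 < et" "et <= s" "s <= de/128" for s
  using that by simp
 show "0 <= de2" "de2 <= de" unfolding de2_def using *[OF et(1) et1(1) et(2)] by blast+
 qed
 have ap2: "\<bar>thh*(conv ?g 0 y - c) - mu*tanh (mu*(y - y0))\<bar> <= de2*mu/2" if y: "\<bar>y - y0\<bar> <= 1/de/mu" for y
 proof -
 have "\<bar>conv ?g 0 y - (c + target thh mu (y - y0))\<bar> <= mu/thh*(10 * sqrt et + 2*et + de/6)"
 proof (rule conv_bounds[OF gc])
  fix z assume z: "\<bar>z - y\<bar> <= ep"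
  have e1: "ep <= 1/mu" using eps' et1 mu by (simp add: le_divide_eq mu_def)
  have "(1/de + 1)/mu = 1/de/mu + 1/mu" by (simp add: add_divide_distrib)
  then have "\<bar>z - y0\<bar> <= (1/de + 1)/mu" using z y e1 by linarith
  from ap[OF this] have z2: "\<bar>z\<bar> <= exp (real j)" and z3: "\<bar>w z - c - target thh mu (z - y0)\<bar> <= mu/thh*(10 * sqrt et + et + de/6)" using thh by auto
  have gz: "?g z = w z" using z2 Kc1 by (intro clamp_id) linarith
  have "\<bar>target thh mu (z - y0) - target thh mu (y - y0)\<bar> <= mu\<^sup>2/thh * \<bar>z - y\<bar>" using target_lipschitz[OF thh mu(1), of "z - y0" "y - y0"] by simp
  also have "... <= mu\<^sup>2/thh*ep" using z thh by (intro mult_left_mono) auto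
  also have "... = mu/thh*(ep*mu)" by (simp add: power2_eq_square)
  also have "... <= mu/thh*et" using eps' mu thh by (intro mult_left_mono) (auto simp: mu_def)
  finally have "\<bar>target thh mu (z - y0) - target thh mu (y - y0)\<bar> <= mu/thh*et" .
  moreover have "mu/thh*(10 * sqrt et + 2*et + de/6) = mu/thh*(10 * sqrt et + et + de/6) + mu/thh*et" by (simp only: distrib_left[symmetric]) simp
  ultimately show "\<bar>?g z - (c + target thh mu (y - y0))\<bar> <= mu/thh*(10 * sqrt et + 2*et + de/6)"
  unfolding gz using z3 by linarith
 qed
 then have "thh * \<bar>conv ?g 0 y - (c + target thh mu (y - y0))\<bar> <= thh*(mu/thh*(10 * sqrt et + 2*et + de/6))"
  using thh by (intro mult_left_mono) auto
 also have "... = de2*mu/2" using thh by (simp add: de2_def)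
 also have "thh * \<bar>conv ?g 0 y - (c + target thh mu (y - y0))\<bar> = \<bar>thh*(conv ?g 0 y - (c + target thh mu (y - y0)))\<bar>" using thh by (simp add: abs_mult)
 also have "thh*(conv ?g 0 y - (c + target thh mu (y - y0))) = thh*(conv ?g 0 y - c) - mu*tanh (mu*(y - y0))"
  using thh by (simp add: target_def algebra_simps)
 finally show ?thesis .
 qed
 have tq: "0 < t/q" "t/q <= exp (real j)"
 proof -
 show "0 < t/q" using t q by simp
 have "t/q <= t/1" using t q by (intro divide_left_mono) auto
 then show "t/q <= exp (real j)" using t by simp
 qed
 have sq: "sqrt et <= 1/110" using et de by linarith
 have de1: "de <= 1" using de by simp
 have Q1: "(\<integral>\<^sup>+om. ennreal (exp (integral {0..t/q} (%s. - 2*(thh*(- conv ?g 1 (B s om)))))) \<partial>N) <= ennreal (exp Q)"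
 proof -
 have e: "2*thh * - 1*(- z) = - 2*(thh*(- z))" for z by simp
 show ?thesis unfolding Q_def
  using upper_crude[OF N B thh ga et(1) sq de(1) de1 m1[unfolded m_def] tq w up Kc, of "-1"] by (simp only: e insert_iff simp_thms)
 qed
 have Q0: "Q >= 0" unfolding Q_def m_def[symmetric] using et m1 de c1 t by (intro add_nonneg_nonneg mult_nonneg_nonneg) auto
 have ta: "1/cosh (1/de) <= de"
 proof -
 have "1/de <= cosh (1/de)" using de by (intro cosh_ge_self) simp
 then show ?thesis using de cosh_real_pos[of "1/de"] by (simp add: field_simps)
 qed
 have de4: "de <= 1/4" "de2*(1/de) <= 1" "de + de2 <= 1/2" using de de2 by (auto simp: divide_le_eq)
 note L = sech_lower[OF N B t(1) q gc G mu(1) de(1) de4(1) ta K0(2) de2(1) de4(2,3) ap2 Q1 Q0]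
 have "exp (mu\<^sup>2*(1/2 - 2*de)*(t - t/q) - 8 - Q) <= exp (mu\<^sup>2*(1/2 - de - de2)*(t - t/q) - 8 - Q)"
 proof -
 have "t/q <= t/1" using t q by (intro divide_left_mono) auto
 then have "mu\<^sup>2*(1/2 - 2*de)*(t - t/q) <= mu\<^sup>2*(1/2 - de - de2)*(t - t/q)"
  using de2 by (intro mult_right_mono mult_left_mono) auto
 then show ?thesis by simp
 qed
 then have "ennreal (exp (mu\<^sup>2*(1/2 - 2*de)*(t - t/q) - 8 - Q)
  * (2*(1/mu)/sqrt (2*pi*(t/q))*exp (- (\<bar>y0 - x\<bar> + 1/mu)\<^sup>2/(2*(t/q))))\<^sup>2)
 <= ennreal (exp (mu\<^sup>2*(1/2 - de - de2)*(t - t/q) - 8 - Q)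
  * (2*(1/mu)/sqrt (2*pi*(t/q))*exp (- (\<bar>y0 - x\<bar> + 1/mu)\<^sup>2/(2*(t/q))))\<^sup>2)"
 by (intro ennreal_leI mult_right_mono) auto
 from order.trans[OF this L] y0 show ?thesis unfolding mu_def by blast
qed

subsection \<open>The smoothed noise as a convolution of the Brownian path\<close>

lemma brownian_increment_square:
 assumes M: "prob_space M" and W: "two_sided_brownian_motion M W"
 shows "integrable M (%om. (W b om - W a om)\<^sup>2)" "(LINT om|M. (W b om - W a om)\<^sup>2) = \<bar>b - a\<bar>"
proof -
 interpret prob_space M by fact
 have *: "integrable M (%om. (W b om - W a om)\<^sup>2) & (LINT om|M. (W b om - W a om)\<^sup>2) = b - a" if "a < b" for a b
 proof -
 have D: "distributed M lborel (%om. W b om - W a om) (normal_density 0 (sqrt (b - a)))"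
  using W that unfolding brownian_motion_on_def by blast
 have v: "fact (2*1)/((2/(sqrt (b - a))\<^sup>2) ^ 1*fact 1) = b - a" using that by (simp add: field_simps)
 have h: "has_bochner_integral lborel (%x. normal_density 0 (sqrt (b - a)) x*x\<^sup>2) (b - a)"
 proof -
  have "has_bochner_integral lborel (%x. normal_density 0 (sqrt (b - a)) x*(x - 0) ^ (2*1)) (b - a)"
  using normal_moment_even[of "sqrt (b - a)" 0 1] that unfolding v by (simp only: real_sqrt_gt_0_iff diff_gt_0_iff_gt)
  then show ?thesis by (simp only: diff_0_right mult_1_right)
 qed
 have "integrable M (%om. (W b om - W a om)\<^sup>2)"
  using distributed_integrable[OF D, of "%x. x\<^sup>2"] h by (simp add: has_bochner_integral_iff)
 moreover have "(LINT om|M. (W b om - W a om)\<^sup>2) = b - a"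
  using distributed_integral[OF D, of "%x. x\<^sup>2"] h by (simp add: has_bochner_integral_iff)
 ultimately show ?thesis by simp
 qed
 have "integrable M (%om. (W b om - W a om)\<^sup>2) & (LINT om|M. (W b om - W a om)\<^sup>2) = \<bar>b - a\<bar>"
 proof (cases a b rule: linorder_cases)
 case greater
 then show ?thesis using *[OF greater] by (simp add: power2_commute)
 qed (use *[of a b] in auto)
 then show "integrable M (%om. (W b om - W a om)\<^sup>2)" "(LINT om|M. (W b om - W a om)\<^sup>2) = \<bar>b - a\<bar>" by auto
qed

text \<open>By polarisation the product of two increments is half a signed sum of four squared
  increments. Overlapping intervals thus need no subdivision, and the variance of single increments
  suffices.\<close>

lemma brownian_increment_product:
 assumes M: "prob_space M" and W: "two_sided_brownian_motion M W" and ab: "a <= b" "c <= d"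
 shows "has_bochner_integral M (%om. (W b om - W a om)*(W d om - W c om)) (LINT x|lborel. indicator {a<..b} x*indicator {c<..d} x)"
 "integrable lborel (%x. indicator {a<..b} x*indicator {c<..d} x :: real)"
proof -
 have e: "(%x. indicator {a<..b} x*indicator {c<..d} x :: real) = indicator {max a c<..min b d}"
 by (auto simp: fun_eq_iff split: split_indicator)
 have f: "emeasure lborel {max a c<..min b d} < \<infinity>" by (cases "max a c <= min b d") (auto simp: ennreal_less_top)
 show "integrable lborel (%x. indicator {a<..b} x*indicator {c<..d} x :: real)" unfolding e using f by simp
 have i: "(LINT x|lborel. indicator {a<..b} x*indicator {c<..d} x) = (\<bar>b - c\<bar> + \<bar>a - d\<bar> - \<bar>b - d\<bar> - \<bar>a - c\<bar>)/2"
 proof (cases "max a c <= min b d")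
 case True
 then have v: "(LINT x|lborel. indicator {max a c<..min b d} x) = min b d - max a c" by simp
 have "c <= b" "a <= d" using True by simp_all
 then have "\<bar>b - c\<bar> = b - c" "\<bar>a - d\<bar> = d - a" by simp_all
 moreover have "min b d = (b + d - \<bar>b - d\<bar>)/2" "max a c = (a + c + \<bar>a - c\<bar>)/2" by (simp_all add: min_def max_def abs_if)
 ultimately show ?thesis unfolding e v by simp
 next
 case False
 then have E: "{max a c<..min b d} = {}" by auto
 have v: "(LINT x|lborel. indicator {max a c<..min b d} x) = (0 :: real)" unfolding E by simp
 have "\<bar>b - c\<bar> + \<bar>a - d\<bar> - \<bar>b - d\<bar> - \<bar>a - c\<bar> = 0"
 proof (cases "b < c")
  case True
  then have "a < c" "a < d" "b < d" using ab by linarith+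
  then show ?thesis using True by (simp add: abs_if)
 next
  case F: False
  then have "d < a" using False ab by auto
  then have "c < a" "c < b" "d < b" using ab by linarith+
  then show ?thesis using \<open>d < a\<close> by (simp add: abs_if)
 qed
 then show ?thesis unfolding e v by simp
 qed
 note q = brownian_increment_square[OF M W]
 have "has_bochner_integral M (%om. ((W b om - W c om)\<^sup>2 + (W a om - W d om)\<^sup>2 - (W b om - W d om)\<^sup>2 - (W a om - W c om)\<^sup>2)/2)
 ((\<bar>b - c\<bar> + \<bar>a - d\<bar> - \<bar>b - d\<bar> - \<bar>a - c\<bar>)/2)"
 using q by (intro has_bochner_integral_divide_zero has_bochner_integral_diff has_bochner_integral_add) (auto simp: has_bochner_integral_iff)
 moreover have "((W b om - W c om)\<^sup>2 + (W a om - W d om)\<^sup>2 - (W b om - W d om)\<^sup>2 - (W a om - W c om)\<^sup>2)/2 = (W b om - W a om)*(W d om - W c om)" for om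
 by (simp add: power2_eq_square field_simps)
 ultimately show "has_bochner_integral M (%om. (W b om - W a om)*(W d om - W c om)) (LINT x|lborel. indicator {a<..b} x*indicator {c<..d} x)"
 unfolding i by simp
qed

lemma ito_isometry:
 assumes M: "prob_space M" and W: "two_sided_brownian_motion M W" and S: "\<forall>(c, a, b)\<in>set S. a <= b"
 shows "(\<integral>\<^sup>+om. ennreal ((step_integral W S om)\<^sup>2) \<partial>M) = (\<integral>\<^sup>+x. ennreal ((step_fun S x)\<^sup>2) \<partial>lborel)"
proof -
 define n where "n = length S"
 define c where "c i = fst (S ! i)" for i
 define a where "a i = fst (snd (S ! i))" for i
 define b where "b i = snd (snd (S ! i))" for i
 have ab: "a i <= b i" if "i < n" for i
 using S that nth_mem[of i S] unfolding n_def a_def b_def by (auto split: prod.splits simp: case_prod_beta)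
 have I: "step_integral W S om = (\<Sum>i<n. c i*(W (b i) om - W (a i) om))" for om
 by (simp add: step_integral_def sum_list_sum_nth n_def case_prod_beta c_def a_def b_def atLeast0LessThan)
 have F: "step_fun S x = (\<Sum>i<n. c i*indicator {a i<..b i} x)" for x
 by (simp add: step_fun_def sum_list_sum_nth n_def case_prod_beta c_def a_def b_def atLeast0LessThan)
 have I2: "(step_integral W S om)\<^sup>2 = (\<Sum>i<n. \<Sum>k<n. c i * c k*((W (b i) om - W (a i) om)*(W (b k) om - W (a k) om)))" for om
 unfolding I power2_eq_square sum_product by (intro sum.cong refl) (simp add: mult_ac)
 have F2: "(step_fun S x)\<^sup>2 = (\<Sum>i<n. \<Sum>k<n. c i * c k*(indicator {a i<..b i} x*indicator {a k<..b k} x))" for x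
 unfolding F power2_eq_square sum_product by (intro sum.cong refl) (simp add: mult_ac)
 let ?q = "\<Sum>i<n. \<Sum>k<n. c i * c k*(LINT x|lborel. indicator {a i<..b i} x*indicator {a k<..b k} x)"
 have 1: "has_bochner_integral M (%om. (step_integral W S om)\<^sup>2) ?q"
 unfolding I2 by (intro has_bochner_integral_sum has_bochner_integral_mult_right brownian_increment_product(1)[OF M W] ab) auto
 have 2: "has_bochner_integral lborel (%x. (step_fun S x)\<^sup>2) ?q"
 unfolding F2
 by (intro has_bochner_integral_sum has_bochner_integral_mult_right has_bochner_integral_integrable brownian_increment_product(2)[OF M W] ab) auto
 show ?thesis using 1 2 by (simp add: nn_integral_eq_integral has_bochner_integral_iff)
qed

text \<open>The approximating sequence inside \<open>is_wiener_integral\<close> is arbitrary, so a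
  second one is brought in: right-endpoint step functions of \<open>f\<close>, whose integrals
  converge pathwise by summation by parts. The isometry shows that both sequences have the same mean
  square limit, and Fatou's lemma identifies it with the pathwise one.\<close>

lemma wiener_integral_smooth:
 assumes M: "prob_space M" and W: "two_sided_brownian_motion M W" and d: "\<And>u. (f has_real_derivative f1 u) (at u)"
 and d1: "\<And>u. (f1 has_real_derivative f2 u) (at u)" and c2: "continuous_on UNIV f2"
 and supp: "\<And>u. u <= a \<or> a + 2 <= u ==> f u = 0" and X: "is_wiener_integral M W f X"
 shows "AE om in M. X om = - integral {0..2} (%u. W (a + u) om*f1 (a + u))"
proof -
 interpret prob_space M by fact
 have Wm [measurable]: "W t \<in> borel_measurable M" for t using W by (simp add: brownian_motion_on_def)
 obtain S where Xm [measurable]: "X \<in> borel_measurable M" and S: "\<And>n. \<forall>(c, a, b)\<in>set (S n). a <= b"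
 and S1: "L2_tendsto lborel (%n. step_fun (S n)) f sequentially" and S2: "L2_tendsto M (%n. step_integral W (S n)) X sequentially"
 using X unfolding is_wiener_integral_def by blast
 have fc: "continuous_on UNIV f" "continuous_on UNIV f1" using d d1 by (meson DERIV_continuous continuous_at_imp_continuous_on)+
 have fm [measurable]: "f \<in> borel_measurable borel" using fc(1) by (rule borel_measurable_continuous_onI)
 have bd: "\<exists>A\<ge>0. \<forall>y\<in>{a..a + 2}. \<bar>g y\<bar> <= A" if "continuous_on UNIV g" for g :: "real => real"
 proof -
 have "continuous_on {a..a + 2} g" using that by (rule continuous_on_subset) simp
 then have "compact (g ` {a..a + 2})" by (intro compact_continuous_image compact_Icc)
 then obtain A where "A > 0" "\<forall>z\<in>g ` {a..a + 2}. norm z <= A" using compact_imp_bounded bounded_pos by metis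
 then show ?thesis by (intro exI[of _ A]) auto
 qed
 obtain L1 where L1: "L1 >= 0" "\<And>y. y \<in> {a..a + 2} ==> \<bar>f1 y\<bar> <= L1" using bd[OF fc(2)] by blast
 obtain L2 where L2: "L2 >= 0" "\<And>y. y \<in> {a..a + 2} ==> \<bar>f2 y\<bar> <= L2" using bd[OF c2] by blast
 have lip: "\<bar>f v - f u\<bar> <= L1*(v - u)" if "a <= u" "u <= v" "v <= a + 2" for u v
 proof (cases "u = v")
 case False
 then have "u < v" using that by simp
 from MVT2[OF this, of f f1] d obtain z where "u < z" "z < v" "f v - f u = (v - u)*f1 z" by blast
 then show ?thesis using L1(2)[of z] that by (simp add: abs_mult mult.commute[of L1] mult_left_mono)
 qed simp
 have lip1: "\<bar>f1 v - f1 u\<bar> <= L2*(v - u)" if "a <= u" "u <= v" "v <= a + 2" for u v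
 proof (cases "u = v")
 case False
 then have "u < v" using that by simp
 from MVT2[OF this, of f1 f2] d1 obtain z where "u < z" "z < v" "f1 v - f1 u = (v - u)*f2 z" by blast
 then show ?thesis using L2(2)[of z] that by (simp add: abs_mult mult.commute[of L2] mult_left_mono)
 qed simp
 define h where "h n = 2/real (Suc n)" for n
 have h0: "h n > 0" for n by (simp add: h_def)
 define p where "p n i = a + real i*h n" for n i
 have rn: "real (Suc n)*h n = 2" for n by (simp add: h_def del: of_nat_Suc)
 have pe: "p n (Suc n) = a + 2" "p n 0 = a" for n unfolding p_def rn by simp_all
 have pS: "p n (Suc i) = p n i + h n" for n i by (simp add: p_def algebra_simps)
 have pr: "a <= p n i" "p n i <= a + 2" if "i <= Suc n" for n i
 proof -
 show "a <= p n i" using h0[of n] by (simp add: p_def)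
 have "real i*h n <= real (Suc n)*h n" using that h0[of n] by (intro mult_right_mono) auto
 then show "p n i <= a + 2" unfolding p_def rn by simp
 qed
 define R where "R n = map (%i. (f (p n (Suc i)), p n i, p n (Suc i))) [0..<Suc n]" for n
 have Rl: "\<forall>(c, a, b)\<in>set (R n). a <= b" for n using h0[of n] by (auto simp: R_def pS)
 have Rf: "step_fun (R n) x = (\<Sum>i<Suc n. f (p n (Suc i))*indicator {p n i<..p n (Suc i)} x)" for n x
 unfolding step_fun_def R_def by (simp add: comp_def interv_sum_list_conv_sum_set_nat atLeast0LessThan del: upt_Suc)
 have Ri: "step_integral W (R n) om = (\<Sum>i<Suc n. f (p n (Suc i))*(W (p n (Suc i)) om - W (p n i) om))" for n om
 unfolding step_integral_def R_def by (simp add: comp_def interv_sum_list_conv_sum_set_nat atLeast0LessThan del: upt_Suc)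
 have app: "\<bar>step_fun (R n) x - f x\<bar> <= L1*h n*indicator {a<..a + 2} x" for n x
 proof -
 let ?i = "%i. indicator {p n i<..p n (Suc i)} x :: real"
 have "?i i = of_bool (x <= p n (Suc i)) - of_bool (x <= p n i)" for i using h0[of n] by (auto simp: pS)
 then have "(\<Sum>i<Suc n. ?i i) = of_bool (x <= p n (Suc n)) - of_bool (x <= p n 0)"
  by (simp only: sum_lessThan_telescope[of "%i. of_bool (x <= p n i) :: real"])
 also have "... = indicator {a<..a + 2} x" unfolding pe by (auto split: split_indicator)
 finally have s: "(\<Sum>i<Suc n. ?i i) = indicator {a<..a + 2} x" .
 have "f x = f x*indicator {a<..a + 2} x" using supp[of x] by (auto split: split_indicator)
 then have "step_fun (R n) x - f x = (\<Sum>i<Suc n. f (p n (Suc i)) * ?i i) - f x*(\<Sum>i<Suc n. ?i i)" unfolding Rf s by simp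
 also have "... = (\<Sum>i<Suc n. (f (p n (Suc i)) - f x) * ?i i)" unfolding sum_distrib_left sum_subtractf[symmetric] by (simp only: left_diff_distrib)
 finally have "\<bar>step_fun (R n) x - f x\<bar> <= (\<Sum>i<Suc n. \<bar>(f (p n (Suc i)) - f x) * ?i i\<bar>)" by (simp only: sum_abs)
 also have "... <= (\<Sum>i<Suc n. L1*h n * ?i i)"
 proof (rule sum_mono)
  fix i assume i: "i \<in> {..<Suc n}"
  show "\<bar>(f (p n (Suc i)) - f x) * ?i i\<bar> <= L1*h n * ?i i"
  proof (cases "x \<in> {p n i<..p n (Suc i)}")
  case True
  have "\<bar>f (p n (Suc i)) - f x\<bar> <= L1*(p n (Suc i) - x)" using True pr[of i n] pr[of "Suc i" n] i by (intro lip) auto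
  also have "... <= L1*h n" using True L1(1) by (intro mult_left_mono) (auto simp: pS)
  finally show ?thesis using True by simp
  qed simp
 qed
 also have "... = L1*h n*indicator {a<..a + 2} x" unfolding sum_distrib_left[symmetric] s ..
 finally show ?thesis .
 qed
 have sq2: "ennreal ((u + v)\<^sup>2) <= ennreal 2*ennreal (u\<^sup>2) + ennreal 2*ennreal (v\<^sup>2)" for u v :: real
 proof -
 have "0 <= (u - v)\<^sup>2" by simp
 then have "(u + v)\<^sup>2 <= 2*u\<^sup>2 + 2 * v\<^sup>2" by (simp add: power2_eq_square algebra_simps)
 then have "ennreal ((u + v)\<^sup>2) <= ennreal (2*u\<^sup>2 + 2 * v\<^sup>2)" by (rule ennreal_leI)
 then show ?thesis by (simp add: ennreal_plus ennreal_mult')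
 qed
 have stm [measurable]: "step_fun T \<in> borel_measurable borel" for T
 unfolding step_fun_def[abs_def] by (induction T) (auto simp: case_prod_beta)
 have sim [measurable]: "step_integral W T \<in> borel_measurable M" for T
 unfolding step_integral_def[abs_def] by (induction T) (auto simp: case_prod_beta)
 define e1 where "e1 n = (\<integral>\<^sup>+x. ennreal ((step_fun (R n) x - f x)\<^sup>2) \<partial>lborel)" for n
 define e2 where "e2 n = (\<integral>\<^sup>+x. ennreal ((step_fun (S n) x - f x)\<^sup>2) \<partial>lborel)" for n
 define e3 where "e3 n = (\<integral>\<^sup>+om. ennreal ((step_integral W (S n) om - X om)\<^sup>2) \<partial>M)" for n
 have e1: "e1 \<longlonglongrightarrow> 0"
 proof (rule tendsto_sandwich[OF _ _ tendsto_const])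
 show "\<forall>\<^sub>F n in sequentially. e1 n <= ennreal ((L1*h n)\<^sup>2*2)"
 proof (intro always_eventually allI)
  fix n
  have "e1 n <= (\<integral>\<^sup>+x. ennreal ((L1*h n)\<^sup>2)*indicator {a<..a + 2} x \<partial>lborel)"
  unfolding e1_def
  proof (rule nn_integral_mono)
  fix x
  have "\<bar>step_fun (R n) x - f x\<bar>\<^sup>2 <= (L1*h n*indicator {a<..a + 2} x)\<^sup>2" by (intro power_mono app) simp
  then show "ennreal ((step_fun (R n) x - f x)\<^sup>2) <= ennreal ((L1*h n)\<^sup>2)*indicator {a<..a + 2} x"
  by (cases "x \<in> {a<..a + 2}") (auto intro: ennreal_leI)
  qed
  also have "... = ennreal ((L1*h n)\<^sup>2)*ennreal 2" by (simp add: nn_integral_cmult_indicator)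
  also have "... = ennreal ((L1*h n)\<^sup>2*2)" by (rule ennreal_mult'[symmetric]) simp
  finally show "e1 n <= ennreal ((L1*h n)\<^sup>2*2)" .
 qed
 have "(%n. (L1*h n)\<^sup>2*2) \<longlonglongrightarrow> (L1*0)\<^sup>2*2"
 proof (intro tendsto_mult tendsto_power tendsto_const)
  show "h \<longlonglongrightarrow> 0" unfolding h_def[abs_def] by real_asymp
 qed
 then have "(%n. ennreal ((L1*h n)\<^sup>2*2)) \<longlonglongrightarrow> ennreal ((L1*0)\<^sup>2*2)" by (rule tendsto_ennrealI)
 then show "(%n. ennreal ((L1*h n)\<^sup>2*2)) \<longlonglongrightarrow> 0" by simp
 qed auto
 have e23: "e2 \<longlonglongrightarrow> 0" "e3 \<longlonglongrightarrow> 0" using S1 S2 by (simp_all add: L2_tendsto_def e2_def[abs_def] e3_def[abs_def])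
 have bound: "(\<integral>\<^sup>+om. ennreal ((step_integral W (R n) om - X om)\<^sup>2) \<partial>M) <= 2*(2*e1 n + 2*e2 n) + 2*e3 n" for n
 proof -
 \<comment> \<open>Concatenation with negated coefficients represents the difference of two step
   functions by one list, to which \<open>ito_isometry\<close> applies.\<close>
 define D where "D = R n @ map (%(c, a, b). (- c, a, b)) (S n)"
 have Dl: "\<forall>(c, a, b)\<in>set D. a <= b" using Rl[of n] S[of n] by (auto simp: D_def)
 have sneg: "step_fun (map (%(c, a, b). (- c, a, b)) T) x = - step_fun T x" "step_integral W (map (%(c, a, b). (- c, a, b)) T) om = - step_integral W T om" for T x om
  by (induction T) (auto simp: step_fun_def step_integral_def)
 have DD: "step_fun D x = step_fun (R n) x - step_fun (S n) x" "step_integral W D om = step_integral W (R n) om - step_integral W (S n) om" for x om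
  using sneg[of "S n"] by (simp_all add: D_def step_fun_def step_integral_def)
 have "(\<integral>\<^sup>+om. ennreal ((step_integral W D om)\<^sup>2) \<partial>M) <= (\<integral>\<^sup>+x. ennreal 2*ennreal ((step_fun (R n) x - f x)\<^sup>2) + ennreal 2*ennreal ((step_fun (S n) x - f x)\<^sup>2) \<partial>lborel)"
  unfolding ito_isometry[OF M W Dl]
 proof (rule nn_integral_mono)
  fix x
  show "ennreal ((step_fun D x)\<^sup>2) <= ennreal 2*ennreal ((step_fun (R n) x - f x)\<^sup>2) + ennreal 2*ennreal ((step_fun (S n) x - f x)\<^sup>2)"
  using sq2[of "step_fun (R n) x - f x" "f x - step_fun (S n) x"] unfolding DD power2_commute[of "f x" "step_fun (S n) x"] by simp
 qed
 also have "... = 2*e1 n + 2*e2 n"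
  unfolding e1_def e2_def by (subst nn_integral_add, measurable, subst (1 2) nn_integral_cmult) auto
 finally have i: "(\<integral>\<^sup>+om. ennreal ((step_integral W D om)\<^sup>2) \<partial>M) <= 2*e1 n + 2*e2 n" .
 have "(\<integral>\<^sup>+om. ennreal ((step_integral W (R n) om - X om)\<^sup>2) \<partial>M)
  <= (\<integral>\<^sup>+om. ennreal 2*ennreal ((step_integral W D om)\<^sup>2) + ennreal 2*ennreal ((step_integral W (S n) om - X om)\<^sup>2) \<partial>M)"
 proof (rule nn_integral_mono)
  fix om
  show "ennreal ((step_integral W (R n) om - X om)\<^sup>2) <= ennreal 2*ennreal ((step_integral W D om)\<^sup>2) + ennreal 2*ennreal ((step_integral W (S n) om - X om)\<^sup>2)"
  using sq2[of "step_integral W D om" "step_integral W (S n) om - X om"] unfolding DD by simp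
 qed
 also have "... = 2*(\<integral>\<^sup>+om. ennreal ((step_integral W D om)\<^sup>2) \<partial>M) + 2*e3 n"
  unfolding e3_def by (subst nn_integral_add, measurable, subst (1 2) nn_integral_cmult) auto
 also have "... <= 2*(2*e1 n + 2*e2 n) + 2*e3 n" by (intro add_right_mono mult_left_mono i) simp
 finally show ?thesis .
 qed
 have lim0: "(%n. 2*(2*e1 n + 2*e2 n) + 2*e3 n) \<longlonglongrightarrow> 0"
 proof -
 have "(%n. 2*(2*e1 n + 2*e2 n) + 2*e3 n) \<longlonglongrightarrow> 2*(2*0 + 2*0) + 2*0"
  by (intro tendsto_add ennreal_tendsto_cmult e1 e23) auto
 then show ?thesis by simp
 qed
 define Y where "Y om = - integral {0..2} (%u. W (a + u) om*f1 (a + u))" for om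
 have YT: "AE om in M. (%n. step_integral W (R n) om) \<longlonglongrightarrow> Y om"
 proof -
 have "AE om in M. continuous_on UNIV (%t. W t om)" using W by (simp add: brownian_motion_on_def)
 then show ?thesis
 proof (rule AE_mp, intro AE_I2 impI)
  fix om assume c: "continuous_on UNIV (%t. W t om)"
  define w where "w t = W t om" for t
  have wc: "continuous_on UNIV w" using c by (simp add: w_def[abs_def])
  obtain L0 where L0: "L0 >= 0" "\<And>y. y \<in> {a..a + 2} ==> \<bar>w y\<bar> <= L0" using bd[OF wc] by blast
  have "continuous_on {0..2} (%u. w (a + u)*f1 (a + u))"
  by (intro continuous_on_mult continuous_on_UNIV_comp[OF wc] continuous_on_UNIV_comp[OF fc(2)] continuous_on_add continuous_on_const continuous_on_id)
  from riemann_sum_tendsto[OF _ this]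
  have rs: "(%n. \<Sum>i<Suc n. h n*(w (p n i)*f1 (p n i))) \<longlonglongrightarrow> integral {0..2} (%u. w (a + u)*f1 (a + u))"
  by (simp add: h_def p_def del: sum.lessThan_Suc)
  have ab: "step_integral W (R n) om = - (\<Sum>i<Suc n. w (p n i)*(f (p n (Suc i)) - f (p n i)))" for n
  proof -
  have "step_integral W (R n) om + (\<Sum>i<Suc n. w (p n i)*(f (p n (Suc i)) - f (p n i)))
  = (\<Sum>i<Suc n. f (p n (Suc i))*w (p n (Suc i)) - f (p n i)*w (p n i))"
  unfolding Ri w_def[symmetric] sum.distrib[symmetric] by (intro sum.cong refl) (simp add: algebra_simps)
  also have "... = f (p n (Suc n))*w (p n (Suc n)) - f (p n 0)*w (p n 0)" by (rule sum_lessThan_telescope[of "%i. f (p n i)*w (p n i)"])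
  also have "... = 0" using supp[of "p n (Suc n)"] supp[of "p n 0"] unfolding pe by simp
  finally show ?thesis by linarith
  qed
  have er: "\<bar>(\<Sum>i<Suc n. w (p n i)*(f (p n (Suc i)) - f (p n i))) - (\<Sum>i<Suc n. h n*(w (p n i)*f1 (p n i)))\<bar> <= L0*L2*2*h n" for n
  proof -
  have "\<bar>(\<Sum>i<Suc n. w (p n i)*(f (p n (Suc i)) - f (p n i))) - (\<Sum>i<Suc n. h n*(w (p n i)*f1 (p n i)))\<bar>
  <= (\<Sum>i<Suc n. \<bar>w (p n i)*(f (p n (Suc i)) - f (p n i)) - h n*(w (p n i)*f1 (p n i))\<bar>)"
  unfolding sum_subtractf[symmetric] by (rule sum_abs)
  also have "... <= (\<Sum>i<Suc n. L0*(h n*(L2*h n)))"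
  proof (rule sum_mono)
  fix i assume i: "i \<in> {..<Suc n}"
  have lt: "p n i < p n (Suc i)" using h0[of n] by (simp add: pS)
  from MVT2[OF this, of f f1] d obtain z where z: "p n i < z" "z < p n (Suc i)" "f (p n (Suc i)) - f (p n i) = (p n (Suc i) - p n i)*f1 z" by blast
  have "\<bar>f1 z - f1 (p n i)\<bar> <= L2*(z - p n i)" using z i pr[of i n] pr[of "Suc i" n] by (intro lip1) auto
  also have "... <= L2*h n" using z L2(1) by (intro mult_left_mono) (auto simp: pS)
  finally have b: "\<bar>f1 z - f1 (p n i)\<bar> <= L2*h n" .
  have "w (p n i)*(f (p n (Suc i)) - f (p n i)) - h n*(w (p n i)*f1 (p n i)) = w (p n i)*(h n*(f1 z - f1 (p n i)))"
   unfolding z(3) by (simp add: pS algebra_simps)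
  then have "\<bar>w (p n i)*(f (p n (Suc i)) - f (p n i)) - h n*(w (p n i)*f1 (p n i))\<bar> = \<bar>w (p n i)\<bar>*(h n * \<bar>f1 z - f1 (p n i)\<bar>)"
   using h0[of n] by (simp add: abs_mult)
  also have "... <= L0*(h n*(L2*h n))"
  proof (rule mult_mono)
   show "\<bar>w (p n i)\<bar> <= L0" using pr[of i n] i by (intro L0(2)) auto
   show "h n * \<bar>f1 z - f1 (p n i)\<bar> <= h n*(L2*h n)" using b h0[of n] by (intro mult_left_mono) auto
  qed (use L0 h0[of n] in auto)
  finally show "\<bar>w (p n i)*(f (p n (Suc i)) - f (p n i)) - h n*(w (p n i)*f1 (p n i))\<bar> <= L0*(h n*(L2*h n))" .
  qed
  also have "... = L0*L2*2*h n"
  proof -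
  have "real (Suc n)*(L0*(h n*(L2*h n))) = L0*L2*(real (Suc n)*h n)*h n" by (simp only: mult_ac)
  also have "... = L0*L2*2*h n" unfolding rn ..
  finally show ?thesis by (simp del: of_nat_Suc)
  qed
  finally show ?thesis .
  qed
  have "(%n. (\<Sum>i<Suc n. w (p n i)*(f (p n (Suc i)) - f (p n i))) - (\<Sum>i<Suc n. h n*(w (p n i)*f1 (p n i)))) \<longlonglongrightarrow> 0"
  proof (rule Lim_null_comparison[OF always_eventually])
  show "\<forall>n. norm ((\<Sum>i<Suc n. w (p n i)*(f (p n (Suc i)) - f (p n i))) - (\<Sum>i<Suc n. h n*(w (p n i)*f1 (p n i)))) <= L0*L2*2*h n"
  using er by (simp del: sum.lessThan_Suc)
  show "(%n. L0*L2*2*h n) \<longlonglongrightarrow> 0" unfolding h_def by (rule tendsto_mult_right_zero) real_asymp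
  qed
  from tendsto_minus[OF tendsto_add[OF this rs]] show "(%n. step_integral W (R n) om) \<longlonglongrightarrow> Y om"
  unfolding ab Y_def w_def[symmetric] by (simp del: sum.lessThan_Suc)
 qed
 qed
 have "(\<integral>\<^sup>+om. liminf (%n. ennreal ((step_integral W (R n) om - X om)\<^sup>2)) \<partial>M) <= liminf (%n. \<integral>\<^sup>+om. ennreal ((step_integral W (R n) om - X om)\<^sup>2) \<partial>M)"
 by (rule nn_integral_liminf) measurable
 also have "... <= liminf (%n. 2*(2*e1 n + 2*e2 n) + 2*e3 n)" by (intro Liminf_mono always_eventually allI bound)
 also have "... = 0" using lim_imp_Liminf[OF _ lim0] by simp
 finally have "(\<integral>\<^sup>+om. liminf (%n. ennreal ((step_integral W (R n) om - X om)\<^sup>2)) \<partial>M) = 0" by simp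
 then have "AE om in M. liminf (%n. ennreal ((step_integral W (R n) om - X om)\<^sup>2)) = 0"
 by (subst (asm) nn_integral_0_iff_AE) auto
 then show ?thesis using YT
 proof eventually_elim
 case (elim om)
 have "(%n. ennreal ((step_integral W (R n) om - X om)\<^sup>2)) \<longlonglongrightarrow> ennreal ((Y om - X om)\<^sup>2)"
  by (intro tendsto_ennrealI tendsto_power tendsto_diff elim tendsto_const)
 from lim_imp_Liminf[OF _ this] elim(1) have "ennreal ((Y om - X om)\<^sup>2) = 0" by simp
 then have "(Y om - X om)\<^sup>2 = 0" by (simp add: ennreal_eq_0_iff power2_less_eq_zero_iff)
 then show ?case by (simp add: Y_def)
 qed
qed

section \<open>The mollifier as a kernel and regularity in the space variable\<close>

text \<open>The n-th derivative of \<open>rescale l ep\<close>; the chain rule adds one factor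
  \<open>1/ep\<close> per derivative.\<close>

definition mker :: "(real => real) => real => nat => real => real" where
 "mker l ep n x = (1/ep) ^ Suc n*(deriv ^^ n) l (x/ep)"

lemma mollifier_kernel:
 assumes l: "mollifier l" and ep: "0 < ep" "ep < 1"
 shows "kernel (mker l ep) ep"
proof
 show "0 < ep" "ep < 1" by fact+
 have fd: "((deriv ^^ n) l has_real_derivative (deriv ^^ Suc n) l z) (at z)" for n z
 using l field_differentiable_derivI[of "(deriv ^^ n) l" z] unfolding mollifier_def schwartz_def by simp
 show "(mker l ep n has_real_derivative mker l ep (Suc n) x) (at x)" for n x
 proof -
 have "((%x. x/ep) has_real_derivative 1/ep) (at x)" by (rule DERIV_cdivide[OF DERIV_ident])
 from DERIV_cmult[OF DERIV_chain2[OF fd this], of "(1/ep) ^ Suc n" n]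
 show ?thesis unfolding mker_def[abs_def] by (simp add: mult_ac)
 qed
 have z: "(deriv ^^ n) l x = 0" if "\<bar>x\<bar> > 1" for n x
 using that
 proof (induction n arbitrary: x)
 case 0
 have "x \<notin> {-1..1}" using 0 by auto
 then have "x \<notin> {x. l x ~= 0}" using l closure_subset[of "{x. l x ~= 0}"] unfolding mollifier_def by blast
 then show ?case by simp
 next
 case (Suc n)
 have o: "open {x :: real. 1 < \<bar>x\<bar>}" by (intro open_Collect_less continuous_intros)
 have "((deriv ^^ n) l has_real_derivative 0) (at x)"
  by (rule has_field_derivative_transform_within_open[OF DERIV_const o]) (use Suc in auto)
 then show ?case using DERIV_imp_deriv by simp
 qed
 show "mker l ep n x = 0" if "\<bar>x\<bar> > ep" for n x
 unfolding mker_def using z[of "x/ep" n] that ep by (simp add: less_divide_eq)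
 show nn: "mker l ep 0 x >= 0" for x using l ep by (simp add: mker_def mollifier_def)
 show "integral {-1..1} (mker l ep 0) = 1"
 proof -
 have i: "integrable lborel l" "integral\<^sup>L lborel l = 1" using l by (auto simp: mollifier_def has_bochner_integral_iff)
 have c: "1/ep ~= 0" using ep by simp
 have e: "mker l ep 0 x = 1/ep*l (0 + 1/ep*x)" for x by (simp add: mker_def)
 have g: "integrable lborel (mker l ep 0)"
  unfolding e[abs_def] by (intro integrable_mult_right lborel_integrable_real_affine[OF i(1) c])
 have "integral\<^sup>L lborel (mker l ep 0) = 1"
  using lborel_integral_real_affine[OF c, of l 0] i(2) ep unfolding e[abs_def] by simp
 with has_integral_integral_lborel[OF g] have "(mker l ep 0 has_integral 1) UNIV" by simp
 moreover have "mker l ep 0 = (%x. if x \<in> {-1..1} then mker l ep 0 x else 0)"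
 proof
  fix x show "mker l ep 0 x = (if x \<in> {-1..1} then mker l ep 0 x else 0)"
  using z[of "x/ep" 0] ep unfolding mker_def by (auto simp: less_divide_eq)
 qed
 ultimately have "(mker l ep 0 has_integral 1) {-1..1}" by (metis has_integral_restrict_UNIV)
 then show ?thesis by (rule integral_unique)
 qed
qed

lemma schwartz_compact_support:
 fixes F :: "nat => real => real"
 assumes d: "\<And>m u. (F m has_real_derivative F (Suc m) u) (at u)" and supp: "\<And>m u. \<bar>u\<bar> > r ==> F m u = 0"
 shows "(deriv ^^ m) (F 0) = F m" "F 0 \<in> schwartz"
proof -
 have D: "(deriv ^^ m) (F 0) = F m" for m
 proof (induction m)
 case (Suc m)
 have "deriv (F m) = F (Suc m)" by (rule ext) (rule DERIV_imp_deriv[OF d])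
 then show ?case using Suc by simp
 qed simp
 then show "(deriv ^^ m) (F 0) = F m" .
 have "F m field_differentiable at x" for m x using d unfolding field_differentiable_def by blast
 moreover have "bounded (range (%x. x ^ k*F m x))" for k m
 proof -
 have "continuous_on UNIV (F m)" using d by (meson DERIV_continuous continuous_at_imp_continuous_on)
 then have "continuous_on {- r..r} (%x. x ^ k*F m x)"
  by (intro continuous_on_mult continuous_on_power continuous_on_id) (rule continuous_on_subset, auto)
 then have "bounded ((%x. x ^ k*F m x) ` {- r..r})" by (intro compact_imp_bounded compact_continuous_image compact_Icc)
 then have "bounded (insert 0 ((%x. x ^ k*F m x) ` {- r..r}))" by simp
 moreover have "range (%x. x ^ k*F m x) \<subseteq> insert 0 ((%x. x ^ k*F m x) ` {- r..r})"
 proof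
  fix z assume "z \<in> range (%x. x ^ k*F m x)"
  then obtain x where x: "z = x ^ k*F m x" by blast
  show "z \<in> insert 0 ((%x. x ^ k*F m x) ` {- r..r})"
  proof (cases "\<bar>x\<bar> > r")
  case True
  then show ?thesis using supp[OF True, of m] x by simp
  next
  case False
  then have "x \<in> {- r..r}" by (auto simp: abs_le_iff not_less)
  then show ?thesis using x by blast
  qed
 qed
 ultimately show ?thesis by (rule bounded_subset)
 qed
 ultimately show "F 0 \<in> schwartz" unfolding schwartz_def by (simp add: D)
qed

context kernel
begin

lemma shift_deriv: "((%u. D m (u - y)) has_real_derivative D (Suc m) (u - y)) (at u)"
proof -
 have "((%u. u - y) has_real_derivative 1) (at u)" by (auto intro!: derivative_eq_intros)
 from DERIV_chain2[OF deriv this] show ?thesis by simp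
qed

lemma shift_schwartz: "(%u. D 0 (u - y)) \<in> schwartz"
 by (rule schwartz_compact_support(2)[of "%m u. D m (u - y)" "\<bar>y\<bar> + 1"]) (use eps in \<open>auto intro!: shift_deriv supp\<close>)

text \<open>A tempered distribution is bounded by finitely many seminorms, and for a compactly
  supported kernel each seminorm of the difference of two translates is locally Lipschitz in the
  shift.\<close>

lemma tempered_shift_cont:
 assumes T: "tempered_distribution T" shows "continuous_on UNIV (%y. T (%u. D 0 (u - y)))"
proof -
 obtain C n where C: "\<And>ph. ph \<in> schwartz ==> \<bar>T ph\<bar> <= C*(\<Sum>k\<le>n. \<Sum>m\<le>n. schwartz_seminorm k m ph)"
 and lin: "\<And>ph ps a b. ph \<in> schwartz ==> ps \<in> schwartz ==> T (%x. a*ph x + b*ps x) = a*T ph + b*T ps"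
 using T unfolding tempered_distribution_def by blast
 have "\<exists>A\<ge>0. \<forall>x. \<bar>D m x\<bar> <= A" for m
 proof -
 have "compact (D m ` {-1..1})" by (intro compact_continuous_image cont_D compact_Icc)
 then obtain A where A: "A > 0" "\<forall>z\<in>D m ` {-1..1}. norm z <= A" using compact_imp_bounded bounded_pos by metis
 have "\<bar>D m x\<bar> <= A" for x
 proof (cases "\<bar>x\<bar> > 1")
  case True
  then show ?thesis using A(1) eps supp[of x m] by simp
 next
  case False
  then have "x \<in> {-1..1}" by (auto simp: abs_le_iff not_less)
  then show ?thesis using A(2) by auto
 qed
 then show ?thesis using A(1) by (intro exI[of _ A]) auto
 qed
 then obtain L where L: "\<And>m. L m >= 0" "\<And>m x. \<bar>D m x\<bar> <= L m" by metis
 have lip: "\<bar>D m u - D m v\<bar> <= L (Suc m) * \<bar>u - v\<bar>" for m u v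
 proof -
 have *: "\<bar>D m b - D m a\<bar> <= L (Suc m)*(b - a)" if "a < b" for a b
 proof -
  from MVT2[OF that, of "D m" "D (Suc m)"] deriv obtain z where "D m b - D m a = (b - a)*D (Suc m) z" by blast
  then show ?thesis using L(2)[of "Suc m" z] that by (simp add: abs_mult mult.commute[of "L (Suc m)"] mult_left_mono)
 qed
 show ?thesis
  using *[of u v] *[of v u] by (cases u v rule: linorder_cases) (auto simp: abs_minus_commute)
 qed
 have "isCont (%y. T (%u. D 0 (u - y))) y" for y
 proof -
 define K where "K = \<bar>C\<bar>*(\<Sum>k\<le>n. \<Sum>m\<le>n. (\<bar>y\<bar> + 2) ^ k*L (Suc m))"
 have bd: "\<bar>T (%u. D 0 (u - z)) - T (%u. D 0 (u - y))\<bar> <= K * \<bar>z - y\<bar>" if z: "\<bar>z - y\<bar> <= 1" for z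
 proof -
  define F where "F m u = 1*D m (u - z) + (- 1)*D m (u - y)" for m u
  have Fd: "(F m has_real_derivative F (Suc m) u) (at u)" for m u
  unfolding F_def[abs_def] by (intro DERIV_add DERIV_cmult shift_deriv)
  have Fs: "F m u = 0" if "\<bar>u\<bar> > \<bar>y\<bar> + 2" for m u
  proof -
  have "\<bar>u - z\<bar> > ep" "\<bar>u - y\<bar> > ep" using that z eps by linarith+
  then show ?thesis by (simp add: F_def supp)
  qed
  have S1: "(deriv ^^ m) (F 0) = F m" for m by (rule schwartz_compact_support(1)[where r = "\<bar>y\<bar> + 2"]) (rule Fd, rule Fs)
  have S2: "F 0 \<in> schwartz" by (rule schwartz_compact_support(2)[where r = "\<bar>y\<bar> + 2"]) (rule Fd, rule Fs)
  have T1: "T (%u. D 0 (u - z)) - T (%u. D 0 (u - y)) = T (F 0)"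
  unfolding F_def[abs_def] by (subst lin[OF shift_schwartz shift_schwartz]) simp
  have pt: "\<bar>x ^ k*F m x\<bar> <= (\<bar>y\<bar> + 2) ^ k*L (Suc m) * \<bar>z - y\<bar>" for k m x
  proof (cases "\<bar>x\<bar> > \<bar>y\<bar> + 2")
  case True
  then show ?thesis using Fs[OF True, of m] L(1)[of "Suc m"] by simp
  next
  case False
  have "\<bar>F m x\<bar> <= L (Suc m) * \<bar>z - y\<bar>" using lip[of m "x - z" "x - y"] by (simp add: F_def abs_minus_commute)
  moreover have "\<bar>x\<bar> ^ k <= (\<bar>y\<bar> + 2) ^ k" using False by (intro power_mono) auto
  ultimately have "\<bar>x\<bar> ^ k * \<bar>F m x\<bar> <= (\<bar>y\<bar> + 2) ^ k*(L (Suc m) * \<bar>z - y\<bar>)" by (intro mult_mono) auto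
  then show ?thesis by (simp add: abs_mult power_abs mult.assoc)
  qed
  have se: "0 <= schwartz_seminorm k m (F 0)" "schwartz_seminorm k m (F 0) <= (\<bar>y\<bar> + 2) ^ k*L (Suc m) * \<bar>z - y\<bar>" for k m
  proof -
  have bdd: "bdd_above (range (%x. \<bar>x ^ k*F m x\<bar>))" by (rule bdd_aboveI2[OF pt])
  show "schwartz_seminorm k m (F 0) <= (\<bar>y\<bar> + 2) ^ k*L (Suc m) * \<bar>z - y\<bar>"
  unfolding schwartz_seminorm_def S1 by (rule cSUP_least) (auto intro: pt)
  show "0 <= schwartz_seminorm k m (F 0)"
  unfolding schwartz_seminorm_def S1 by (rule cSUP_upper2[OF bdd UNIV_I abs_ge_zero])
  qed
  have "\<bar>T (F 0)\<bar> <= C*(\<Sum>k\<le>n. \<Sum>m\<le>n. schwartz_seminorm k m (F 0))" by (rule C[OF S2])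
  also have "... <= \<bar>C\<bar>*(\<Sum>k\<le>n. \<Sum>m\<le>n. schwartz_seminorm k m (F 0))" using se by (intro mult_right_mono sum_nonneg) auto
  also have "... <= \<bar>C\<bar>*(\<Sum>k\<le>n. \<Sum>m\<le>n. (\<bar>y\<bar> + 2) ^ k*L (Suc m) * \<bar>z - y\<bar>)" using se by (intro mult_left_mono sum_mono) auto
  also have "... = K * \<bar>z - y\<bar>" unfolding K_def sum_distrib_right[symmetric] by (simp add: mult.assoc)
  finally show ?thesis unfolding T1 .
 qed
 have "((%z. T (%u. D 0 (u - z)) - T (%u. D 0 (u - y))) \<longlongrightarrow> 0) (at y)"
 proof (rule Lim_null_comparison)
  have "\<forall>\<^sub>F z in at y. dist z y < 1" by (rule eventually_at_ball'[THEN eventually_mono, of 1]) (auto simp: dist_commute)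
  then show "\<forall>\<^sub>F z in at y. norm (T (%u. D 0 (u - z)) - T (%u. D 0 (u - y))) <= K * \<bar>z - y\<bar>"
  by eventually_elim (use bd in \<open>auto simp: dist_real_def\<close>)
  have "((%z. K * \<bar>z - y\<bar>) \<longlongrightarrow> K * \<bar>y - y\<bar>) (at y)" by (intro tendsto_intros)
  then show "((%z. K * \<bar>z - y\<bar>) \<longlongrightarrow> 0) (at y)" by simp
 qed
 then show ?thesis unfolding isCont_def by (simp add: LIM_zero_iff)
 qed
 then show ?thesis by (simp add: continuous_at_imp_continuous_on)
qed

text \<open>For fixed \<open>y\<close> the identity holds off a null set depending on
  \<open>y\<close>. The rational \<open>y\<close> share one null set, and both sides are continuous
  in \<open>y\<close>: the left one by temperedness, the right one by smoothness of the
  mollification.\<close>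

lemma white_noise_conv:
 assumes M: "prob_space M" and W: "two_sided_brownian_motion M W" and V: "is_white_noise_of M W V"
 shows "AE om in M. \<forall>y. V (%u. D 0 (u - y)) om = - conv (%t. W t om) 1 y"
proof -
 have pw: "AE om in M. V (%u. D 0 (u - y)) om = - conv (%t. W t om) 1 y" for y
 proof -
 have X: "is_wiener_integral M W (%u. D 0 (u - y)) (V (%u. D 0 (u - y)))" using V shift_schwartz unfolding is_white_noise_of_def by blast
 have c2: "continuous_on UNIV (%u. D (Suc (Suc 0)) (u - y))" using shift_deriv by (meson DERIV_continuous continuous_at_imp_continuous_on)
 have s: "D 0 (u - y) = 0" if "u <= y - 1 \<or> y - 1 + 2 <= u" for u
 proof -
  have "\<bar>u - y\<bar> > ep" using that eps by linarith
  then show ?thesis by (rule supp)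
 qed
 have "AE om in M. V (%u. D 0 (u - y)) om = - integral {0..2} (%u. W (y - 1 + u) om*D (Suc 0) (y - 1 + u - y))"
  by (rule wiener_integral_smooth[OF M W shift_deriv shift_deriv c2 s X])
 moreover have "integral {0..2} (%u. W (y - 1 + u) om*D (Suc 0) (y - 1 + u - y)) = conv (%t. W t om) 1 y" for om
 proof -
  have "integral {0..2} ((%z. W (y + z) om*D 1 z) \<circ> (+) (-1)) = integral {0 + -1..2 + -1} (%z. W (y + z) om*D 1 z)"
  by (rule integral_shift_Icc_real)
  moreover have "((%z. W (y + z) om*D 1 z) \<circ> (+) (-1)) = (%u. W (y - 1 + u) om*D (Suc 0) (y - 1 + u - y))"
  by (auto simp: fun_eq_iff algebra_simps)
  ultimately show ?thesis by (simp add: conv_def)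
 qed
 ultimately show ?thesis by simp
 qed
 have "AE om in M. \<forall>r :: rat. V (%u. D 0 (u - of_rat r)) om = - conv (%t. W t om) 1 (of_rat r)"
 unfolding AE_all_countable using pw by blast
 moreover have "AE om in M. tempered_distribution (%ph. V ph om)" using V by (simp add: is_white_noise_of_def)
 moreover have "AE om in M. continuous_on UNIV (%t. W t om)" using W by (simp add: brownian_motion_on_def)
 ultimately show ?thesis
 proof eventually_elim
 case (elim om)
 let ?f = "%y. V (%u. D 0 (u - y)) om" and ?g = "%y. - conv (%t. W t om) 1 y"
 have fc: "continuous_on UNIV ?f" by (rule tempered_shift_cont[OF elim(2)])
 have "continuous_on UNIV (conv (%t. W t om) 1)" using conv_deriv[OF elim(3)] by (meson DERIV_continuous continuous_at_imp_continuous_on)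
 then have gc: "continuous_on UNIV ?g" by (rule continuous_on_minus)
 have op: "open {y. ?f y ~= ?g y}" by (rule open_Collect_neq[OF fc gc])
 show ?case
 proof (rule allI, rule ccontr)
  fix y assume "?f y ~= ?g y"
  then obtain e where e: "e > 0" "ball y e \<subseteq> {y. ?f y ~= ?g y}" using op openE by blast
  obtain r where r: "r \<in> \<rat>" "y < r" "r < y + e" using Rats_dense_in_real[of y "y + e"] e(1) by auto
  then have "r \<in> ball y e" by (simp add: dist_real_def)
  then have "?f r ~= ?g r" using e(2) by blast
  then show False using elim(1) r(1) unfolding Rats_def by auto
 qed
 qed
qed

end

lemma smooth_noise_conv:
 assumes M: "prob_space M" and W: "two_sided_brownian_motion M W" and V: "is_white_noise_of M W V" and l: "mollifier l"
 and ep: "0 < ep" "ep < 1"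
 shows "AE om in M. \<forall>y. smooth_noise V l ep y om = - kernel.conv (mker l ep) (%t. W t om) 1 y"
proof -
 interpret kernel "mker l ep" ep by (rule mollifier_kernel[OF l ep])
 have "rescale l ep (u - y) = mker l ep 0 (u - y)" for u y by (simp add: rescale_def mker_def divide_inverse mult.commute)
 then show ?thesis using white_noise_conv[OF M W V] by (simp add: smooth_noise_def)
qed

subsection \<open>Joint measurability\<close>

lemma measurable_integral_continuous:
 fixes F :: "real => 'a => real"
 assumes t: "t >= 0" and m: "\<And>s. 0 <= s ==> F s \<in> borel_measurable M" and c: "\<And>om. om \<in> space M ==> continuous_on {0..t} (%s. F s om)"
 shows "(%om. integral {0..t} (%s. F s om)) \<in> borel_measurable M"
proof (rule borel_measurable_LIMSEQ_real)
 fix om assume "om \<in> space M"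
 from riemann_sum_tendsto[OF t c[OF this]]
 show "(%n. \<Sum>i<Suc n. t/real (Suc n)*F (real i*(t/real (Suc n))) om) \<longlonglongrightarrow> integral {0..t} (%s. F s om)" .
next
 show "(%om. \<Sum>i<Suc n. t/real (Suc n)*F (real i*(t/real (Suc n))) om) \<in> borel_measurable M" for n
 using t by (intro borel_measurable_sum borel_measurable_times borel_measurable_const m) auto
qed

text \<open>Measurability in the outcome and continuity in the parameter give joint measurability:
  rounding the parameter to multiples of \<open>1/(k + 1)\<close> leaves countably many cases, and
  \<open>k\<close> tends to infinity.\<close>

lemma measurable_evaluation:
 fixes F :: "real => 'a => real"
 assumes F: "\<And>y. F y \<in> borel_measurable M" and c: "\<And>om. om \<in> space M ==> continuous_on UNIV (%y. F y om)"
 and g: "g \<in> borel_measurable P" and h: "h \<in> P \<rightarrow>\<^sub>M M"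
 shows "(%p. F (g p) (h p)) \<in> borel_measurable P"
proof (rule borel_measurable_LIMSEQ_real)
 show "(%p. F (real_of_int \<lfloor>real (Suc k)*g p\<rfloor>/real (Suc k)) (h p)) \<in> borel_measurable P" for k
 proof (rule measurable_compose_countable[where f = "%i p. F (real_of_int i/real (Suc k)) (h p)" and g = "%p. \<lfloor>real (Suc k)*g p\<rfloor>"])
 show "(%p. F (real_of_int i/real (Suc k)) (h p)) \<in> borel_measurable P" for i by (rule measurable_compose[OF h F])
 have "(%p. real (Suc k)*g p) \<in> borel_measurable P" using g by simp
 then show "(%p. \<lfloor>real (Suc k)*g p\<rfloor>) \<in> P \<rightarrow>\<^sub>M count_space UNIV" by (rule measurable_compose[OF _ measurable_real_floor])
 qed
next
 fix p assume "p \<in> space P"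
 then have "h p \<in> space M" using h by (rule measurable_space[rotated])
 then have ic: "isCont (%y. F y (h p)) (g p)" using c by (simp add: continuous_on_eq_continuous_at)
 have "(%k. real_of_int \<lfloor>real (Suc k)*g p\<rfloor>/real (Suc k)) \<longlonglongrightarrow> g p"
 proof (rule tendsto_sandwich)
 show "\<forall>\<^sub>F k in sequentially. g p - 1/real (Suc k) <= real_of_int \<lfloor>real (Suc k)*g p\<rfloor>/real (Suc k)"
 proof (intro always_eventually allI)
  fix k
  have "real (Suc k)*g p - 1 <= real_of_int \<lfloor>real (Suc k)*g p\<rfloor>" by linarith
  then have "(real (Suc k)*g p - 1)/real (Suc k) <= real_of_int \<lfloor>real (Suc k)*g p\<rfloor>/real (Suc k)" by (rule divide_right_mono) simp
  moreover have "(real (Suc k)*g p - 1)/real (Suc k) = g p - 1/real (Suc k)" by (simp add: diff_divide_distrib del: of_nat_Suc)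
  ultimately show "g p - 1/real (Suc k) <= real_of_int \<lfloor>real (Suc k)*g p\<rfloor>/real (Suc k)" by simp
 qed
 show "\<forall>\<^sub>F k in sequentially. real_of_int \<lfloor>real (Suc k)*g p\<rfloor>/real (Suc k) <= g p"
  by (intro always_eventually allI) (simp add: pos_divide_le_eq mult.commute del: of_nat_Suc)
 show "(%k. g p - 1/real (Suc k)) \<longlonglongrightarrow> g p" by real_asymp
 qed simp
 from isCont_tendsto_compose[OF ic this]
 show "(%k. F (real_of_int \<lfloor>real (Suc k)*g p\<rfloor>/real (Suc k)) (h p)) \<longlonglongrightarrow> F (g p) (h p)" .
qed

text \<open>Joint measurability asks for continuity at every outcome. Setting the process to 0 on a
  measurable null set provides it, with one null set for all times.\<close>

lemma continuous_modification:
 fixes B :: "real => 'a => real"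
 assumes m: "\<And>t. t \<in> T ==> B t \<in> borel_measurable M" and c: "AE om in M. continuous_on T (%t. B t om)"
 obtains B' where "\<And>t. t \<in> T ==> B' t \<in> borel_measurable M" "\<And>om. om \<in> space M ==> continuous_on T (%t. B' t om :: real)"
 "AE om in M. \<forall>t. B' t om = B t om"
proof -
 from c obtain Z where Z: "{om \<in> space M. \<not> continuous_on T (%t. B t om)} \<subseteq> Z" "emeasure M Z = 0" "Z \<in> sets M" by (rule AE_E)
 define B' where "B' t om = indicator (- Z) om*B t om" for t om
 show ?thesis
 proof (rule that[of B'])
 show "B' t \<in> borel_measurable M" if "t \<in> T" for t
 proof -
  have "(%om. (1 - indicator Z om)*B t om) \<in> borel_measurable M" using m[OF that] Z(3) by simp
  moreover have "B' t = (%om. (1 - indicator Z om)*B t om)" by (auto simp: B'_def fun_eq_iff split: split_indicator)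
  ultimately show ?thesis by simp
 qed
 show "continuous_on T (%t. B' t om)" if "om \<in> space M" for om
  using Z(1) that by (cases "om \<in> Z") (auto simp: B'_def)
 have "AE om in M. om \<notin> Z" using Z(2,3) by (intro AE_not_in) (auto simp: null_sets_def)
 then show "AE om in M. \<forall>t. B' t om = B t om" by eventually_elim (simp add: B'_def)
 qed
qed

text \<open>Mean square convergence on the product space gives almost sure convergence along a
  subsequence, and Fubini's theorem turns the product null set into nested ones. The subsequence
  depends on \<open>t\<close>, so only countably many times can be treated at once.\<close>

lemma path_integral_limit:
 assumes M: "prob_space M" and N: "prob_space N" and W: "two_sided_brownian_motion M W" and V: "is_white_noise_of M W V" and l: "mollifier l"
 and B: "brownian_motion N x B" and J: "is_noise_path_integral M N V l B J" and t: "t >= 0"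
 shows "\<exists>r :: nat => nat. strict_mono r & (AE om in M. AE om' in N.
 (%n. integral {0..t} (%s. - kernel.conv (mker l (1/real (r n + 2))) (%u. W u om) 1 (B s om'))) \<longlonglongrightarrow> J t (om, om'))"
proof -
 interpret M: prob_space M by fact
 interpret N: prob_space N by fact
 interpret P: pair_prob_space M N ..
 \<comment> \<open>The offset 2 keeps every scale strictly below 1, as \<open>kernel\<close>
   demands.\<close>
 define ep where "ep n = 1/real (n + 2)" for n
 have ep: "0 < ep n" "ep n < 1" for n by (auto simp: ep_def)
 have k: "kernel (mker l (ep n)) (ep n)" for n by (rule mollifier_kernel[OF l ep])
 have Wm: "W t \<in> borel_measurable M" for t using W by (simp add: brownian_motion_on_def)
 have Wc: "AE om in M. continuous_on UNIV (%t. W t om)" using W by (simp add: brownian_motion_on_def)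
 have Bm: "B t \<in> borel_measurable N" if "t \<in> {0..}" for t using B that by (simp add: brownian_motion_on_def)
 have Bc: "AE om in N. continuous_on {0..} (%t. B t om)" using B by (simp add: brownian_motion_on_def)
 obtain W' where W': "\<And>t. W' t \<in> borel_measurable M" "\<And>om. om \<in> space M ==> continuous_on UNIV (%t. W' t om)" "AE om in M. \<forall>t. W' t om = W t om"
 using continuous_modification[of UNIV W M, OF Wm Wc] by auto
 obtain B' where B': "\<And>t. t >= 0 ==> B' t \<in> borel_measurable N" "\<And>om. om \<in> space N ==> continuous_on {0..} (%t. B' t om)" "AE om in N. \<forall>t. B' t om = B t om"
 using continuous_modification[of "{0..}" B N, OF Bm Bc] by auto
 define c where "c n om y = kernel.conv (mker l (ep n)) (%u. W' u om) 1 y" for n om y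
 have cc: "continuous_on UNIV (c n om)" if "om \<in> space M" for n om
 unfolding c_def[abs_def] using kernel.conv_deriv[OF k W'(2)[OF that]] by (meson DERIV_continuous continuous_at_imp_continuous_on)
 have cm: "(%om. c n om y) \<in> borel_measurable M" for n y
 proof -
 let ?D = "mker l (ep n) 1"
 have Dc: "continuous_on UNIV ?D" by (rule kernel.cont_D[OF k])
 have "integral {0..2} ((%z. W' (y + z) om * ?D z) \<circ> (+) (-1)) = integral {0 + -1..2 + -1} (%z. W' (y + z) om * ?D z)" for om
  by (rule integral_shift_Icc_real)
 then have e: "c n om y = integral {0..2} (%s. W' (y + (-1 + s)) om * ?D (-1 + s))" for om
  by (simp add: c_def kernel.conv_def[OF k] comp_def)
 show ?thesis unfolding e
 proof (rule measurable_integral_continuous)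
  show "(%om. W' (y + (-1 + s)) om * ?D (-1 + s)) \<in> borel_measurable M" for s using W'(1) by simp
  show "continuous_on {0..2} (%s. W' (y + (-1 + s)) om * ?D (-1 + s))" if "om \<in> space M" for om
  by (intro continuous_on_mult continuous_on_UNIV_comp[OF W'(2)[OF that]] continuous_on_UNIV_comp[OF Dc] continuous_on_add continuous_on_const continuous_on_id)
 qed simp
 qed
 define X where "X n p = integral {0..t} (%s. - c n (fst p) (B' s (snd p)))" for n p
 have Xm: "X n \<in> borel_measurable (M \<Otimes>\<^sub>M N)" for n
 unfolding X_def[abs_def]
 proof (rule measurable_integral_continuous[OF t])
 show "(%p. - c n (fst p) (B' s (snd p))) \<in> borel_measurable (M \<Otimes>\<^sub>M N)" if "0 <= s" for s
  using measurable_evaluation[where F = "%y om. c n om y" and M = M and P = "M \<Otimes>\<^sub>M N" and g = "%p. B' s (snd p)" and h = fst,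
  OF cm cc measurable_compose[OF measurable_snd B'(1)[OF that]] measurable_fst] by simp
 fix p assume "p \<in> space (M \<Otimes>\<^sub>M N)"
 then have "fst p \<in> space M" "snd p \<in> space N" by (auto simp: space_pair_measure)
 then show "continuous_on {0..t} (%s. - c n (fst p) (B' s (snd p)))"
  by (intro continuous_on_minus continuous_on_UNIV_comp[OF cc] continuous_on_subset[OF B'(2)]) auto
 qed
 have Jm: "J t \<in> borel_measurable (M \<Otimes>\<^sub>M N)"
 and L2: "L2_tendsto (M \<Otimes>\<^sub>M N) (%ep (om, om'). LINT s:{0..t}|lborel. smooth_noise V l ep (B s om') om) (J t) (at_right 0)"
 using J t unfolding is_noise_path_integral_def by auto
 have A1: "AE om in M. (\<forall>n y. smooth_noise V l (ep n) y om = - kernel.conv (mker l (ep n)) (%t. W t om) 1 y) & (\<forall>t. W' t om = W t om)"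
 using smooth_noise_conv[OF M W V l ep] W'(3) by (simp add: AE_all_countable)
 have A2: "AE p in M \<Otimes>\<^sub>M N. (\<forall>n y. smooth_noise V l (ep n) y (fst p) = - kernel.conv (mker l (ep n)) (%t. W t (fst p)) 1 y) & (\<forall>t. W' t (fst p) = W t (fst p))"
 by (rule AE_distrD[OF measurable_fst]) (simp only: N.distr_pair_fst A1)
 have sm: "distr (M \<Otimes>\<^sub>M N) N snd = N"
 proof (rule measure_eqI)
 fix A assume A: "A \<in> sets (distr (M \<Otimes>\<^sub>M N) N snd)"
 then have "emeasure (distr (M \<Otimes>\<^sub>M N) N snd) A = emeasure (M \<Otimes>\<^sub>M N) (space M \<times> A)"
  by (auto simp add: emeasure_distr space_pair_measure dest: sets.sets_into_space intro!: arg_cong2[where f = emeasure])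
 with A show "emeasure (distr (M \<Otimes>\<^sub>M N) N snd) A = emeasure N A"
  by (simp add: N.emeasure_pair_measure_Times M.emeasure_space_1)
 qed simp
 have A3: "AE p in M \<Otimes>\<^sub>M N. \<forall>t. B' t (snd p) = B t (snd p)"
 by (rule AE_distrD[OF measurable_snd]) (simp only: sm B'(3))
 have eqX: "AE p in M \<Otimes>\<^sub>M N. \<forall>n. X n p = (LINT s:{0..t}|lborel. smooth_noise V l (ep n) (B s (snd p)) (fst p))
 & X n p = integral {0..t} (%s. - kernel.conv (mker l (ep n)) (%u. W u (fst p)) 1 (B s (snd p)))"
 using A2 A3 AE_space
 proof eventually_elim
 case (elim p)
 have sp: "fst p \<in> space M" "snd p \<in> space N" using elim(3) by (auto simp: space_pair_measure)
 have WW: "(%u. W' u (fst p)) = (%u. W u (fst p))" using elim(1) by auto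
 show ?case
 proof
  fix n
  have co: "continuous_on {0..t} (%s. - c n (fst p) (B' s (snd p)))"
  by (intro continuous_on_minus continuous_on_UNIV_comp[OF cc[OF sp(1)]] continuous_on_subset[OF B'(2)[OF sp(2)]]) auto
  have "(LINT s:{0..t}|lborel. smooth_noise V l (ep n) (B s (snd p)) (fst p)) = (LINT s:{0..t}|lborel. - c n (fst p) (B' s (snd p)))"
  using elim(1,2) by (simp add: c_def WW)
  also have "... = X n p" unfolding X_def by (rule set_borel_integral_eq_integral(2)[OF borel_integrable_atLeastAtMost'[OF co]])
  finally show "X n p = (LINT s:{0..t}|lborel. smooth_noise V l (ep n) (B s (snd p)) (fst p))
  & X n p = integral {0..t} (%s. - kernel.conv (mker l (ep n)) (%u. W u (fst p)) 1 (B s (snd p)))"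
  using elim(2) by (simp add: X_def c_def WW)
 qed
 qed
 have fl: "filterlim ep (at_right 0) sequentially" unfolding ep_def[abs_def] by real_asymp
 have lim: "(%n. \<integral>\<^sup>+p. ennreal ((X n p - J t p)\<^sup>2) \<partial>(M \<Otimes>\<^sub>M N)) \<longlonglongrightarrow> 0"
 proof -
 have "(%n. \<integral>\<^sup>+p. ennreal (((case p of (om, om') => LINT s:{0..t}|lborel. smooth_noise V l (ep n) (B s om') om) - J t p)\<^sup>2) \<partial>(M \<Otimes>\<^sub>M N)) \<longlonglongrightarrow> 0"
  using filterlim_compose[OF L2[unfolded L2_tendsto_def] fl] by (simp add: comp_def)
 moreover have "(\<integral>\<^sup>+p. ennreal (((case p of (om, om') => LINT s:{0..t}|lborel. smooth_noise V l (ep n) (B s om') om) - J t p)\<^sup>2) \<partial>(M \<Otimes>\<^sub>M N))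
  = (\<integral>\<^sup>+p. ennreal ((X n p - J t p)\<^sup>2) \<partial>(M \<Otimes>\<^sub>M N))" for n
  by (rule nn_integral_cong_AE, use eqX in eventually_elim) (simp add: case_prod_beta)
 ultimately show ?thesis by simp
 qed
 then have "\<forall>\<^sub>F n in sequentially. (\<integral>\<^sup>+p. ennreal ((X n p - J t p)\<^sup>2) \<partial>(M \<Otimes>\<^sub>M N)) < 1" by (rule order_tendstoD(2)) simp
 \<comment> \<open>The convergence leaves open whether early terms are finite; from
   \<open>n0\<close> on the squared differences are integrable.\<close>
 then obtain n0 where n0: "\<And>n. n >= n0 ==> (\<integral>\<^sup>+p. ennreal ((X n p - J t p)\<^sup>2) \<partial>(M \<Otimes>\<^sub>M N)) < 1" unfolding eventually_sequentially by blast
 define u where "u n p = (X (n + n0) p - J t p)\<^sup>2" for n p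
 have um: "u n \<in> borel_measurable (M \<Otimes>\<^sub>M N)" for n unfolding u_def[abs_def] using Xm Jm by simp
 have ui: "integrable (M \<Otimes>\<^sub>M N) (u n)" for n
 proof (rule integrableI_bounded[OF um])
 show "(\<integral>\<^sup>+p. ennreal (norm (u n p)) \<partial>(M \<Otimes>\<^sub>M N)) < \<infinity>" using n0[of "n + n0"] by (simp add: u_def order.strict_trans)
 qed
 have "(%n. \<integral>p. norm (u n p) \<partial>(M \<Otimes>\<^sub>M N)) \<longlonglongrightarrow> 0"
 proof -
 have "(\<integral>p. norm (u n p) \<partial>(M \<Otimes>\<^sub>M N)) = enn2real (\<integral>\<^sup>+p. ennreal ((X (n + n0) p - J t p)\<^sup>2) \<partial>(M \<Otimes>\<^sub>M N))" for n
  by (subst integral_eq_nn_integral) (use um[of n] in \<open>auto simp: u_def[abs_def]\<close>)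
 moreover have "(%n. enn2real (\<integral>\<^sup>+p. ennreal ((X (n + n0) p - J t p)\<^sup>2) \<partial>(M \<Otimes>\<^sub>M N))) \<longlonglongrightarrow> 0"
  using LIMSEQ_ignore_initial_segment[OF lim, of n0] by (intro tendsto_enn2real) auto
 ultimately show ?thesis by simp
 qed
 from tendsto_L1_AE_subseq[OF ui this] obtain r where r: "strict_mono r" "AE p in M \<Otimes>\<^sub>M N. (%n. u (r n) p) \<longlonglongrightarrow> 0" by blast
 have "AE p in M \<Otimes>\<^sub>M N. (%n. integral {0..t} (%s. - kernel.conv (mker l (ep (r n + n0))) (%u. W u (fst p)) 1 (B s (snd p)))) \<longlonglongrightarrow> J t p"
 using r(2) eqX
 proof eventually_elim
 case (elim p)
 have "(%n. sqrt (u (r n) p)) \<longlonglongrightarrow> sqrt 0" by (rule tendsto_real_sqrt[OF elim(1)])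
 then have "(%n. \<bar>X (r n + n0) p - J t p\<bar>) \<longlonglongrightarrow> 0" by (simp add: u_def)
 then have "(%n. X (r n + n0) p - J t p) \<longlonglongrightarrow> 0" by (rule tendsto_rabs_zero_cancel)
 then have "(%n. X (r n + n0) p) \<longlonglongrightarrow> J t p" by (simp add: LIM_zero_iff)
 moreover have "X n p = integral {0..t} (%s. - kernel.conv (mker l (ep n)) (%u. W u (fst p)) 1 (B s (snd p)))" for n using elim(2) by blast
 ultimately show ?case by (simp only:)
 qed
 from P.AE_pair[OF this] show ?thesis
 using r(1) unfolding ep_def by (intro exI[of _ "%n. r n + n0"]) (auto simp: strict_mono_def)
qed

section \<open>The two half-lines as one-sided Brownian motions\<close>

lemma two_sided_brownian_motionD:
 assumes W: "two_sided_brownian_motion M W"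
 shows "W t \<in> borel_measurable M" "AE om in M. W 0 om = 0"
 "u < v ==> distributed M lborel (%om. W v om - W u om) (normal_density 0 (sqrt (v - u)))"
 "(\<And>i. i < n ==> ta i < ta (Suc i)) ==> prob_space.indep_vars M (%_. borel) (%i om. W (ta (Suc i)) om - W (ta i) om) {..<n}"
 "AE om in M. continuous_on UNIV (%t. W t om)"
proof -
 note C = W[unfolded brownian_motion_on_def]
 show "W t \<in> borel_measurable M" by (rule conjunct1[OF C, rule_format]) simp
 show "AE om in M. W 0 om = 0" by (rule conjunct1[OF conjunct2[OF C]])
 show "distributed M lborel (%om. W v om - W u om) (normal_density 0 (sqrt (v - u)))" if "u < v"
 by (rule conjunct1[OF conjunct2[OF conjunct2[OF C]], rule_format]) (simp_all add: that)
 show "prob_space.indep_vars M (%_. borel) (%i om. W (ta (Suc i)) om - W (ta i) om) {..<n}" if "\<And>i. i < n ==> ta i < ta (Suc i)"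
 by (rule conjunct1[OF conjunct2[OF conjunct2[OF conjunct2[OF C]]], THEN spec[of _ n], THEN spec[of _ ta], THEN mp]) (simp add: that)
 show "AE om in M. continuous_on UNIV (%t. W t om)" by (rule conjunct2[OF conjunct2[OF conjunct2[OF conjunct2[OF C]]]])
qed

lemma brownian_restrict:
 assumes W: "two_sided_brownian_motion M W" shows "brownian_motion M 0 W"
 unfolding brownian_motion_on_def
proof (intro conjI ballI allI impI)
 show "AE om in M. continuous_on {0..} (%t. W t om)"
 using two_sided_brownian_motionD(5)[OF W] by eventually_elim (rule continuous_on_subset[OF _ subset_UNIV])
qed (rule two_sided_brownian_motionD[OF W]; blast)+

text \<open>Reflection reverses the order of the increments: the i-th increment of the new process
  is the increment of \<open>W\<close> with index \<open>n - Suc i\<close> on the reflected mesh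
  \<open>ta\<close>. Independence is carried over along this bijection of indices.\<close>

lemma brownian_reflect:
 assumes M: "prob_space M" and W: "two_sided_brownian_motion M W"
 shows "brownian_motion M 0 (%t om. - W (- t) om)"
 unfolding brownian_motion_on_def
proof (intro conjI ballI allI impI)
 interpret prob_space M by fact
 note WD = two_sided_brownian_motionD[OF W]
 have m: "W t \<in> borel_measurable M" for t by (rule WD)
 show "(%om. - W (- t) om) \<in> borel_measurable M" for t using m by simp
 show "AE om in M. - W (- 0) om = 0" using WD(2) by simp
 show "distributed M lborel (%om. - W (- t) om - - W (- s) om) (normal_density 0 (sqrt (t - s)))" if "s < t" for s t
 proof -
 from WD(3)[of "- t" "- s"] that
 have "distributed M lborel (%om. W (- s) om - W (- t) om) (normal_density 0 (sqrt (- s - - t)))" by simp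
 moreover have "(%om. - W (- t) om - - W (- s) om) = (%om. W (- s) om - W (- t) om)" by (simp add: fun_eq_iff)
 moreover have "- s - - t = t - s" by simp
 ultimately show ?thesis by (simp only:)
 qed
 show "AE om in M. continuous_on {0..} (%t. - W (- t) om)"
 proof -
 from WD(5) show ?thesis
 proof (rule AE_mp, intro AE_I2 impI)
  fix om assume "continuous_on UNIV (%t. W t om)"
  then show "continuous_on {0..} (%t. - W (- t) om)"
  by (rule continuous_on_minus[OF continuous_on_UNIV_comp[where f = "%t. - t"]]) (intro continuous_on_minus continuous_on_id)
 qed
 qed
 fix n :: nat and t :: "nat => real"
 assume t: "(\<forall>i\<le>n. t i \<in> {0..}) & (\<forall>i<n. t i < t (Suc i))"
 define ta where "ta i = - t (n - i)" for i
 have "ta i < ta (Suc i)" if "i < n" for i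
 proof -
 have "n - i = Suc (n - Suc i)" using that by simp
 moreover have "t (n - Suc i) < t (Suc (n - Suc i))" using t that by simp
 ultimately show ?thesis unfolding ta_def by simp
 qed
 then have ind: "indep_vars (%_. borel) (%i om. W (ta (Suc i)) om - W (ta i) om) {..<n}"
 by (rule WD(4))
 have eq: "W (ta (Suc (n - Suc i))) om - W (ta (n - Suc i)) om = - W (- t (Suc i)) om - - W (- t i) om" if "i < n" for i om
 proof -
 have "Suc (n - Suc i) = n - i" "n - (n - i) = i" "n - (n - Suc i) = Suc i" using that by auto
 then show ?thesis by (simp add: ta_def)
 qed
 show "indep_vars (%_. borel) (%i om. - W (- t (Suc i)) om - - W (- t i) om) {..<n}"
 proof (cases "n = 0")
 case False
 have rv: "W (ta (Suc i)) \<in> borel_measurable M" "W (ta i) \<in> borel_measurable M" for i by (rule m)+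
 have "indep_sets (%i. {(%om. W (ta (Suc i)) om - W (ta i) om) -` A \<inter> space M |A. A \<in> sets borel}) {..<n}"
  using ind unfolding indep_vars_def2 by simp
 have "indep_sets (%i. {(%om. - W (- t (Suc i)) om - - W (- t i) om) -` A \<inter> space M |A. A \<in> sets borel}) {..<n}"
 proof (rule indep_setsI)
  show "{(%om. - W (- t (Suc i)) om - - W (- t i) om) -` A \<inter> space M |A. A \<in> sets borel} \<subseteq> events" for i
  proof -
  have "(%om. - W (- t (Suc i)) om - - W (- t i) om) \<in> borel_measurable M" using m by simp
  then show ?thesis by (auto intro: measurable_sets)
  qed
  fix A J assume J: "J ~= {}" "J \<subseteq> {..<n}" "finite J"
  and A: "\<forall>j\<in>J. A j \<in> {(%om. - W (- t (Suc j)) om - - W (- t j) om) -` A \<inter> space M |A. A \<in> sets borel}"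
  let ?f = "%i. n - Suc i"
  have inj: "inj_on ?f J"
  proof (rule inj_onI)
  fix a b assume ab: "a \<in> J" "b \<in> J" "?f a = ?f b"
  then have "a < n" "b < n" using J(2) by auto
  then show "a = b" using ab(3) by linarith
  qed
  have ff: "?f (?f j) = j" if "j \<in> J" for j using that J(2) by auto
  have "prob (\<Inter>i\<in>?f ` J. A (?f i)) = (\<Prod>i\<in>?f ` J. prob (A (?f i)))"
  proof (rule indep_setsD)
  show "indep_sets (%i. {(%om. W (ta (Suc i)) om - W (ta i) om) -` A \<inter> space M |A. A \<in> sets borel}) {..<n}" by fact
  show "?f ` J \<subseteq> {..<n}" using J(2) by auto
  show "\<forall>i\<in>?f ` J. A (?f i) \<in> {(%om. W (ta (Suc i)) om - W (ta i) om) -` A \<inter> space M |A. A \<in> sets borel}"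
  proof
  fix i assume "i \<in> ?f ` J"
  then obtain j where j: "j \<in> J" "i = ?f j" by auto
  have jn: "j < n" using j J(2) by auto
  from A j obtain A' where "A' \<in> sets borel" "A j = (%om. - W (- t (Suc j)) om - - W (- t j) om) -` A' \<inter> space M" by blast
  then show "A (?f i) \<in> {(%om. W (ta (Suc i)) om - W (ta i) om) -` A \<inter> space M |A. A \<in> sets borel}"
   unfolding j(2) ff[OF j(1)] eq[OF jn] by blast
  qed
  qed (use J in auto)
  moreover have "(\<Inter>i\<in>?f ` J. A (?f i)) = (\<Inter>j\<in>J. A j)" using ff by auto
  moreover have "(\<Prod>i\<in>?f ` J. prob (A (?f i))) = (\<Prod>j\<in>J. prob (A j))"
  by (subst prod.reindex[OF inj]) (auto simp: ff intro!: prod.cong)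
  ultimately show "prob (\<Inter>j\<in>J. A j) = (\<Prod>j\<in>J. prob (A j))" by simp
 qed
 then show ?thesis unfolding indep_vars_def2 using m by auto
 next
 case True
 then show ?thesis by (simp add: indep_vars_def2 indep_sets_def)
 qed
qed


subsection \<open>Passing to the limit\<close>

lemma nn_limit_upper:
 fixes Y :: "nat => 'b => real"
 assumes Ym: "\<And>n. Y n \<in> borel_measurable N" and lim: "AE om in N. (%n. Y n om) \<longlonglongrightarrow> Y0 om"
 and ub: "\<And>n. (\<integral>\<^sup>+om. ennreal (Y n om) \<partial>N) <= ennreal (U n)" and U: "U \<longlonglongrightarrow> u"
 shows "(\<integral>\<^sup>+om. ennreal (Y0 om) \<partial>N) <= ennreal u"
proof -
 have "(\<integral>\<^sup>+om. ennreal (Y0 om) \<partial>N) = (\<integral>\<^sup>+om. liminf (%n. ennreal (Y n om)) \<partial>N)"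
 proof (rule nn_integral_cong_AE, use lim in eventually_elim)
 case (elim om)
 from lim_imp_Liminf[OF _ tendsto_ennrealI[OF elim]] show ?case by simp
 qed
 also have "... <= liminf (%n. \<integral>\<^sup>+om. ennreal (Y n om) \<partial>N)" using Ym by (intro nn_integral_liminf) measurable
 also have "... <= liminf (%n. ennreal (U n))" by (intro Liminf_mono always_eventually allI ub)
 also have "... = ennreal u" by (rule lim_imp_Liminf[OF _ tendsto_ennrealI[OF U]]) simp
 finally show ?thesis .
qed

text \<open>Fatou's lemma points the wrong way here. Truncation at level \<open>A\<close> admits
  dominated convergence, and the second moments bound the part above \<open>A\<close> by
  \<open>C/A\<close>.\<close>

lemma nn_limit_lower:
 fixes Y :: "nat => 'b => real"
 assumes N: "prob_space N" and Ym: "\<And>n. Y n \<in> borel_measurable N" and Y0m: "Y0 \<in> borel_measurable N"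
 and lim: "AE om in N. (%n. Y n om) \<longlonglongrightarrow> Y0 om" and nn: "\<And>n om. Y n om >= 0"
 and sq: "\<And>n. (\<integral>\<^sup>+om. ennreal ((Y n om)\<^sup>2) \<partial>N) <= ennreal C" and C: "C >= 0"
 and lb: "\<And>n. ennreal (L n) <= (\<integral>\<^sup>+om. ennreal (Y n om) \<partial>N)" and L: "L \<longlonglongrightarrow> u"
 shows "ennreal u <= (\<integral>\<^sup>+om. ennreal (Y0 om) \<partial>N)"
proof -
 interpret prob_space N by fact
 note [measurable] = Ym Y0m
 have key: "ennreal u <= (\<integral>\<^sup>+om. ennreal (Y0 om) \<partial>N) + ennreal (C/A)" if A: "A > 0" for A
 proof -
 have step: "ennreal (L n) <= (\<integral>\<^sup>+om. ennreal (min (Y n om) A) \<partial>N) + ennreal (C/A)" for n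
 proof -
  have "ennreal (L n) <= (\<integral>\<^sup>+om. ennreal (Y n om) \<partial>N)" by (rule lb)
  also have "... <= (\<integral>\<^sup>+om. ennreal (min (Y n om) A) + ennreal (1/A)*ennreal ((Y n om)\<^sup>2) \<partial>N)"
  proof (rule nn_integral_mono)
  fix om
  have "Y n om <= min (Y n om) A + 1/A*(Y n om)\<^sup>2"
  proof (cases "Y n om <= A")
  case False
  then have "A*Y n om <= Y n om*Y n om" using nn[of n om] by (intro mult_right_mono) auto
  then have "Y n om <= 1/A*(Y n om)\<^sup>2" using A by (simp add: power2_eq_square le_divide_eq mult.commute)
  then show ?thesis using nn[of n om] A by (simp add: min_def)
  qed (use A in simp)
  then have "ennreal (Y n om) <= ennreal (min (Y n om) A + 1/A*(Y n om)\<^sup>2)" by (rule ennreal_leI)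
  also have "... = ennreal (min (Y n om) A) + ennreal (1/A)*ennreal ((Y n om)\<^sup>2)"
  proof -
  have "0 <= min (Y n om) A" "0 <= 1/A*(Y n om)\<^sup>2" "0 <= 1/A" using nn[of n om] A by simp_all
  then show ?thesis by (simp only: ennreal_plus ennreal_mult')
  qed
  finally show "ennreal (Y n om) <= ennreal (min (Y n om) A) + ennreal (1/A)*ennreal ((Y n om)\<^sup>2)" .
  qed
  also have "... = (\<integral>\<^sup>+om. ennreal (min (Y n om) A) \<partial>N) + ennreal (1/A)*(\<integral>\<^sup>+om. ennreal ((Y n om)\<^sup>2) \<partial>N)"
  by (subst nn_integral_add, measurable, subst nn_integral_cmult) auto
  also have "... <= (\<integral>\<^sup>+om. ennreal (min (Y n om) A) \<partial>N) + ennreal (1/A)*ennreal C" by (intro add_left_mono mult_left_mono sq) simp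
  also have "ennreal (1/A)*ennreal C = ennreal (C/A)" using A C by (subst ennreal_mult[symmetric]) auto
  finally show ?thesis .
 qed
 have "(%n. \<integral>\<^sup>+om. ennreal (min (Y n om) A) \<partial>N) \<longlonglongrightarrow> (\<integral>\<^sup>+om. ennreal (min (Y0 om) A) \<partial>N)"
 proof (rule nn_integral_dominated_convergence[where w = "%_. ennreal A"])
  show "AE om in N. (%n. ennreal (min (Y n om) A)) \<longlonglongrightarrow> ennreal (min (Y0 om) A)"
  using lim by eventually_elim (intro tendsto_ennrealI tendsto_min tendsto_const)
 qed (auto simp: emeasure_space_1 intro!: AE_I2 ennreal_leI)
 then have "(%n. (\<integral>\<^sup>+om. ennreal (min (Y n om) A) \<partial>N) + ennreal (C/A)) \<longlonglongrightarrow> (\<integral>\<^sup>+om. ennreal (min (Y0 om) A) \<partial>N) + ennreal (C/A)"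
  by (intro tendsto_add tendsto_const)
 then have "ennreal u <= (\<integral>\<^sup>+om. ennreal (min (Y0 om) A) \<partial>N) + ennreal (C/A)"
  by (rule LIMSEQ_le[OF tendsto_ennrealI[OF L]]) (use step in auto)
 also have "... <= (\<integral>\<^sup>+om. ennreal (Y0 om) \<partial>N) + ennreal (C/A)" by (intro add_right_mono nn_integral_mono ennreal_leI) simp
 finally show ?thesis .
 qed
 have "(%k. (\<integral>\<^sup>+om. ennreal (Y0 om) \<partial>N) + ennreal (C/real (Suc k))) \<longlonglongrightarrow> (\<integral>\<^sup>+om. ennreal (Y0 om) \<partial>N) + ennreal 0"
 by (intro tendsto_add tendsto_const tendsto_ennrealI LIMSEQ_Suc lim_const_over_n)
 then have "ennreal u <= (\<integral>\<^sup>+om. ennreal (Y0 om) \<partial>N) + ennreal 0"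
 by (rule LIMSEQ_le_const) (intro exI allI impI key, simp)
 then show ?thesis by simp
qed

text \<open>Subsequential limits exist at countably many times only, so the bounds are proved at
  rational times and carried to \<open>t\<close> along rationals approaching it from above, by
  continuity of \<open>Jw\<close>, \<open>U\<close> and \<open>L\<close>. The truncation of
  \<open>w\<close> at radius \<open>n\<close> is eventually invisible, because a path on a bounded
  time interval is bounded.\<close>

lemma path_bounds:
 fixes Jw :: "real => 'b => real" and L U :: "real => real"
 assumes N: "prob_space N" and B: "brownian_motion N x B" and w: "continuous_on UNIV w"
 and Jm: "\<And>s. s >= 0 ==> Jw s \<in> borel_measurable N" and Jc: "AE om in N. continuous_on {0..} (%s. Jw s om)"
 and kern: "\<And>n. kernel (k n) (ep n)"
 and Jl: "\<And>q :: rat. 0 < q ==> \<exists>r :: nat => nat. strict_mono r &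
  (AE om in N. (%n. integral {0..of_rat q} (%s. - kernel.conv (k (r n)) w 1 (B s om))) \<longlonglongrightarrow> Jw (of_rat q) om)"
 and ub: "\<And>n s. n >= n0 ==> 0 < s ==> s < T ==>
  (\<integral>\<^sup>+om. ennreal (exp (integral {0..s} (%u. thh*(- kernel.conv (k n) (clamp (real n) w) 1 (B u om))))) \<partial>N) <= ennreal (U s)"
 and lb: "\<And>n s. n >= n0 ==> 0 < s ==> s < T ==>
  ennreal (L s) <= (\<integral>\<^sup>+om. ennreal (exp (integral {0..s} (%u. thh*(- kernel.conv (k n) (clamp (real n) w) 1 (B u om))))) \<partial>N)"
 and sq: "\<And>n s. n >= n0 ==> 0 < s ==> s < T ==>
  (\<integral>\<^sup>+om. ennreal (exp (integral {0..s} (%u. 2*thh*1*(- kernel.conv (k n) (clamp (real n) w) 1 (B u om))))) \<partial>N) <= ennreal C"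
 and C: "C >= 0" and cont: "\<And>s. s > 0 ==> isCont U s" "\<And>s. s > 0 ==> isCont L s" and t: "0 < t" "t < T"
 shows "(\<integral>\<^sup>+om. ennreal (exp (thh*Jw t om)) \<partial>N) <= ennreal (U t)" "ennreal (L t) <= (\<integral>\<^sup>+om. ennreal (exp (thh*Jw t om)) \<partial>N)"
proof -
 have Bc: "AE om in N. continuous_on {0..} (%t. B t om)" using B by (simp add: brownian_motion_on_def)
 have rat: "(\<integral>\<^sup>+om. ennreal (exp (thh*Jw (of_rat q) om)) \<partial>N) <= ennreal (U (of_rat q)) &
  ennreal (L (of_rat q)) <= (\<integral>\<^sup>+om. ennreal (exp (thh*Jw (of_rat q) om)) \<partial>N) &
  (\<integral>\<^sup>+om. ennreal ((exp (thh*Jw (of_rat q) om))\<^sup>2) \<partial>N) <= ennreal C" if q: "0 < q" "of_rat q < T" for q :: rat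
 proof -
 define s where "s = (of_rat q :: real)"
 have s: "0 < s" "s < T" using q by (auto simp: s_def)
 define v where "v n y = - kernel.conv (k n) (clamp (real n) w) 1 y" for n y
 have vc: "continuous_on UNIV (v n)" for n
 proof -
  have "continuous_on UNIV (kernel.conv (k n) (clamp (real n) w) 1)"
  using kernel.conv_deriv[OF kern clamp_cont[OF w]] by (meson DERIV_continuous continuous_at_imp_continuous_on)
  then show ?thesis unfolding v_def[abs_def] by (rule continuous_on_minus)
 qed
 have "\<exists>X. X \<in> borel_measurable N & (AE om in N. integral {0..s} (%u. v n (B u om)) = X om)" for n
  using AE_measurable_integral[OF B vc[of n], of s] s by (metis less_imp_le)
 then obtain X where X: "\<And>n. X n \<in> borel_measurable N" "\<And>n. AE om in N. integral {0..s} (%u. v n (B u om)) = X n om" by metis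
 have XA: "AE om in N. \<forall>n. integral {0..s} (%u. v n (B u om)) = X n om" using X(2) by (simp add: AE_all_countable)
 obtain r where r: "strict_mono r" and rl: "AE om in N. (%n. integral {0..s} (%u. - kernel.conv (k (r n)) w 1 (B u om))) \<longlonglongrightarrow> Jw s om"
  using Jl[OF q(1)] unfolding s_def by blast
 have Xl: "AE om in N. (%n. X (r n) om) \<longlonglongrightarrow> Jw s om"
  using Bc XA rl
 proof eventually_elim
  case (elim om)
  have c: "continuous_on {0..s} (%t. B t om)" using elim(1) by (rule continuous_on_subset) auto
  then have "compact ((%t. B t om) ` {0..s})" by (intro compact_continuous_image compact_Icc)
  then obtain A where A: "\<forall>z\<in>(%t. B t om) ` {0..s}. norm z <= A" using compact_imp_bounded bounded_iff by metis
  obtain n1 :: nat where n1: "A + 1 <= real n1" using real_arch_simple by blast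
  have "\<forall>\<^sub>F n in sequentially. integral {0..s} (%u. - kernel.conv (k (r n)) w 1 (B u om)) = X (r n) om"
  unfolding eventually_sequentially
  proof (intro exI allI impI)
  fix n assume n: "n >= n1"
  have rn: "real n1 <= real (r n)" using seq_suble[OF r, of n] n by simp
  have "v (r n) (B u om) = - kernel.conv (k (r n)) w 1 (B u om)" if u: "u \<in> {0..s}" for u
  proof -
  have "\<bar>B u om\<bar> <= A" using A u by auto
  then have E: "clamp (real (r n)) w (B u om + z) = w (B u om + z)" if "z \<in> {-1..1}" for z
   using that n1 rn by (intro clamp_id) (auto simp: abs_le_iff)
  show ?thesis unfolding v_def kernel.conv_def[OF kern] by (intro arg_cong[where f = uminus] integral_cong) (simp only: E)
  qed
  then have "integral {0..s} (%u. v (r n) (B u om)) = integral {0..s} (%u. - kernel.conv (k (r n)) w 1 (B u om))" by (rule integral_cong)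
  then show "integral {0..s} (%u. - kernel.conv (k (r n)) w 1 (B u om)) = X (r n) om" using elim(2) by simp
  qed
  with elim(3) show ?case by (rule Lim_transform_eventually)
 qed
 define Y where "Y n om = exp (thh*X (r (n + n0)) om)" for n om
 have Ym: "Y n \<in> borel_measurable N" "(%om. (Y n om)\<^sup>2) \<in> borel_measurable N" for n unfolding Y_def[abs_def] using X(1) by simp_all
 have Yl: "AE om in N. (%n. Y n om) \<longlonglongrightarrow> exp (thh*Jw s om)"
  using Xl
 proof eventually_elim
  case (elim om)
  from LIMSEQ_ignore_initial_segment[OF elim, of n0] show ?case unfolding Y_def by (intro tendsto_exp tendsto_mult tendsto_const)
 qed
 have Yl2: "AE om in N. (%n. (Y n om)\<^sup>2) \<longlonglongrightarrow> (exp (thh*Jw s om))\<^sup>2" using Yl by eventually_elim (rule tendsto_power)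
 have rn0: "r (n + n0) >= n0" for n using seq_suble[OF r, of "n + n0"] by simp
 have e1: "(\<integral>\<^sup>+om. ennreal (Y n om) \<partial>N) = (\<integral>\<^sup>+om. ennreal (exp (integral {0..s} (%u. thh*(- kernel.conv (k (r (n + n0))) (clamp (real (r (n + n0))) w) 1 (B u om))))) \<partial>N)" for n
 proof (rule nn_integral_cong_AE, use XA in eventually_elim)
  case (elim om)
  have "integral {0..s} (%u. thh * v (r (n + n0)) (B u om)) = thh*integral {0..s} (%u. v (r (n + n0)) (B u om))" by (rule integral_mult_right)
  then have "Y n om = exp (integral {0..s} (%u. thh * v (r (n + n0)) (B u om)))" using elim by (simp only: Y_def)
  then show ?case by (simp only: v_def)
 qed
 have e2: "(\<integral>\<^sup>+om. ennreal ((Y n om)\<^sup>2) \<partial>N) = (\<integral>\<^sup>+om. ennreal (exp (integral {0..s} (%u. 2*thh*1*(- kernel.conv (k (r (n + n0))) (clamp (real (r (n + n0))) w) 1 (B u om))))) \<partial>N)" for n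
 proof (rule nn_integral_cong_AE, use XA in eventually_elim)
  case (elim om)
  have "integral {0..s} (%u. 2*thh*1 * v (r (n + n0)) (B u om)) = 2*thh*1*integral {0..s} (%u. v (r (n + n0)) (B u om))" by (rule integral_mult_right)
  then have "exp (integral {0..s} (%u. 2*thh*1 * v (r (n + n0)) (B u om))) = exp (thh*X (r (n + n0)) om + thh*X (r (n + n0)) om)" using elim by simp
  also have "... = (Y n om)\<^sup>2" by (simp only: Y_def power2_eq_square exp_add)
  finally show ?case by (simp only: v_def)
 qed
 have J0: "(%om. exp (thh*Jw s om)) \<in> borel_measurable N" using Jm[of s] s by simp
 show ?thesis
  unfolding s_def[symmetric]
 proof (intro conjI)
  show "(\<integral>\<^sup>+om. ennreal (exp (thh*Jw s om)) \<partial>N) <= ennreal (U s)"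
  by (rule nn_limit_upper[OF Ym(1) Yl _ tendsto_const]) (unfold e1, rule ub[OF rn0 s])
  show "(\<integral>\<^sup>+om. ennreal ((exp (thh*Jw s om))\<^sup>2) \<partial>N) <= ennreal C"
  by (rule nn_limit_upper[OF Ym(2) Yl2 _ tendsto_const]) (unfold e2, rule sq[OF rn0 s])
  show "ennreal (L s) <= (\<integral>\<^sup>+om. ennreal (exp (thh*Jw s om)) \<partial>N)"
  proof (rule nn_limit_lower[OF N Ym(1) J0 Yl _ _ C _ tendsto_const])
  show "(\<integral>\<^sup>+om. ennreal ((Y n om)\<^sup>2) \<partial>N) <= ennreal C" for n unfolding e2 by (rule sq[OF rn0 s])
  show "ennreal (L s) <= (\<integral>\<^sup>+om. ennreal (Y n om) \<partial>N)" for n unfolding e1 by (rule lb[OF rn0 s])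
  qed (simp add: Y_def)
 qed
 qed
 have "\<exists>q :: rat. t < of_rat q & of_rat q < min T (t + 1/real (Suc n))" for n by (rule of_rat_dense) (use t in simp)
 then obtain q :: "nat => rat" where q: "\<And>n. t < of_rat (q n)" "\<And>n. of_rat (q n) < min T (t + 1/real (Suc n))" by metis
 have ql: "(%n. of_rat (q n) :: real) \<longlonglongrightarrow> t"
 proof (rule tendsto_sandwich[of "%_. t" _ _ "%n. t + 1/real (Suc n)"])
 show "(%n. t + 1/real (Suc n)) \<longlonglongrightarrow> t" by real_asymp
 show "\<forall>\<^sub>F n in sequentially. of_rat (q n) <= t + 1/real (Suc n)" using q(2) by (intro always_eventually allI) (simp add: less_imp_le)
 show "\<forall>\<^sub>F n in sequentially. t <= of_rat (q n)" using q(1) by (intro always_eventually allI less_imp_le)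
 qed simp
 have q0: "0 < q n" "of_rat (q n) < T" for n
 proof -
 have "0 < (of_rat (q n) :: real)" using q(1)[of n] t by linarith
 then show "0 < q n" by simp
 show "of_rat (q n) < T" using q(2)[of n] by simp
 qed
 define Y where "Y n om = exp (thh*Jw (of_rat (q n)) om)" for n om
 have Ym: "Y n \<in> borel_measurable N" for n unfolding Y_def[abs_def] using Jm[of "of_rat (q n)"] q0[of n] by simp
 have Yl: "AE om in N. (%n. Y n om) \<longlonglongrightarrow> exp (thh*Jw t om)"
 using Jc
 proof eventually_elim
 case (elim om)
 have "(%n. Jw (of_rat (q n)) om) \<longlonglongrightarrow> Jw t om"
  by (rule continuous_on_tendsto_compose[OF elim ql]) (use t q0 in \<open>auto intro!: always_eventually simp: less_imp_le\<close>)
 then show ?case unfolding Y_def by (intro tendsto_exp tendsto_mult tendsto_const)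
 qed
 have J0: "(%om. exp (thh*Jw t om)) \<in> borel_measurable N" using Jm[of t] t by simp
 note R = rat[OF q0]
 show "(\<integral>\<^sup>+om. ennreal (exp (thh*Jw t om)) \<partial>N) <= ennreal (U t)"
 by (rule nn_limit_upper[OF Ym Yl _ isCont_tendsto_compose[OF cont(1)[OF t(1)] ql]]) (use R in \<open>auto simp: Y_def\<close>)
 show "ennreal (L t) <= (\<integral>\<^sup>+om. ennreal (exp (thh*Jw t om)) \<partial>N)"
 by (rule nn_limit_lower[OF N Ym J0 Yl _ _ C _ isCont_tendsto_compose[OF cont(2)[OF t(1)] ql]]) (use R in \<open>auto simp: Y_def\<close>)
qed

text \<open>Trading the prefactors for exponentials of lower order makes the lower bound the
  exponential of one explicit function, continuous for \<open>t > 0\<close>.\<close>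

lemma (in kernel) lower_simple:
 fixes q :: nat
 assumes N: "prob_space N" and B: "brownian_motion N x B" and thh: "thh > 0" and de: "0 < de" "de <= 1/8" and ga: "0 < ga"
 and et: "0 < et" "sqrt et <= de/128" and j: "j > 0" and mu1: "mm thh (- de) j >= 1" and t: "0 < t" "t <= exp (real j)" and q: "q > 0"
 and w: "continuous_on UNIV w"
 and up: "up_ok thh de et ga (c1 et/de) j w" "up_ok thh de et ga (c1 et/de) j (%y. - w (- y))"
 and low: "low_ok thh de et (1/de + 1) (de/(6*thh)) j w"
 and Kc: "Kc >= c1 et/de*exp (real j)*mm thh de j + 1" and eps': "ep*mm thh (- de) j <= et"
 shows "ennreal (exp ((mm thh (- de) j)\<^sup>2*(1/2 - 2*de)*(t - t/q) - 8 -
  (2*et + (\<bar>x\<bar> + 1)*(\<bar>x\<bar> + 2 + 2*mm thh de j) + 2*de*mm thh de j*(\<bar>x\<bar> + 1) + (mm thh de j)\<^sup>2*(2 * c1 et + 10*de)*(t/q))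
  - 2*mm thh (- de) j - 8*t - q*(exp (real j) + \<bar>x\<bar> + 1)\<^sup>2/t))
 <= (\<integral>\<^sup>+om. ennreal (exp (integral {0..t} (%s. thh*(- conv (clamp Kc w) 1 (B s om))))) \<partial>N)"
proof -
 define mu where "mu = mm thh (- de) j"
 have mu: "mu >= 1" using mu1 by (simp add: mu_def)
 define Z where "Z = (mm thh (- de) j)\<^sup>2*(1/2 - 2*de)*(t - t/q) - 8 -
  (2*et + (\<bar>x\<bar> + 1)*(\<bar>x\<bar> + 2 + 2*mm thh de j) + 2*de*mm thh de j*(\<bar>x\<bar> + 1) + (mm thh de j)\<^sup>2*(2 * c1 et + 10*de)*(t/q))"
 obtain y0 where y0: "0 <= y0" "y0 <= exp (real j)" and F: "ennreal (exp Z
  * (2*(1/mu)/sqrt (2*pi*(t/q))*exp (- (\<bar>y0 - x\<bar> + 1/mu)\<^sup>2/(2*(t/q))))\<^sup>2)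
 <= (\<integral>\<^sup>+om. ennreal (exp (integral {0..t} (%s. thh*(- conv (clamp Kc w) 1 (B s om))))) \<partial>N)"
 using lower_fine[OF N B thh de ga et j mu1 t q w up low Kc eps'] unfolding Z_def mu_def by blast
 define s where "s = t/q"
 have s: "0 < s" "s <= t" using t q by (auto simp: s_def divide_le_eq)
 have a: "exp (- 2*mu) <= (2*(1/mu))\<^sup>2"
 proof -
 have "mu <= exp mu" using exp_ge_add_one_self[of mu] by linarith
 then have "1/exp mu <= 1/mu" using mu by (intro divide_left_mono) auto
 moreover have "0 <= 1/mu" using mu by simp
 ultimately have "exp (- mu) <= 2*(1/mu)" unfolding exp_minus inverse_eq_divide by linarith
 then have "(exp (- mu))\<^sup>2 <= (2*(1/mu))\<^sup>2" by (intro power_mono) auto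
 then show ?thesis by (simp add: power2_eq_square exp_add[symmetric])
 qed
 have b: "exp (- 8*t) <= 1/(sqrt (2*pi * s))\<^sup>2"
 proof -
 have p: "0 < 2*pi * s" using s pi_gt_zero by simp
 have "2*pi * s <= 8*t" using s pi_less_4 by (intro mult_mono) auto
 also have "... <= exp (8*t)" using exp_ge_add_one_self[of "8*t"] by linarith
 finally have "1/exp (8*t) <= 1/(2*pi * s)" using p by (intro divide_left_mono) auto
 then show ?thesis using p by (simp add: exp_minus divide_simps)
 qed
 have c: "exp (- (q*(exp (real j) + \<bar>x\<bar> + 1)\<^sup>2/t)) <= (exp (- (\<bar>y0 - x\<bar> + 1/mu)\<^sup>2/(2 * s)))\<^sup>2"
 proof -
 have "1/mu <= 1" using mu by simp
 then have "\<bar>y0 - x\<bar> + 1/mu <= exp (real j) + \<bar>x\<bar> + 1" using y0 by linarith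
 then have "(\<bar>y0 - x\<bar> + 1/mu)\<^sup>2 <= (exp (real j) + \<bar>x\<bar> + 1)\<^sup>2" using mu by (intro power_mono) auto
 then have "(\<bar>y0 - x\<bar> + 1/mu)\<^sup>2/s <= (exp (real j) + \<bar>x\<bar> + 1)\<^sup>2/s" using s by (intro divide_right_mono) auto
 moreover have "(exp (real j) + \<bar>x\<bar> + 1)\<^sup>2/s = q*(exp (real j) + \<bar>x\<bar> + 1)\<^sup>2/t" by (simp add: s_def)
 moreover have "(exp (- (\<bar>y0 - x\<bar> + 1/mu)\<^sup>2/(2 * s)))\<^sup>2 = exp (- ((\<bar>y0 - x\<bar> + 1/mu)\<^sup>2/s))"
  unfolding power2_eq_square[of "exp _"] exp_add[symmetric] by (simp add: field_simps)
 ultimately show ?thesis by simp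
 qed
 have "exp (Z - 2*mu - 8*t - q*(exp (real j) + \<bar>x\<bar> + 1)\<^sup>2/t)
 = exp Z*(exp (- 2*mu)*exp (- 8*t)*exp (- (q*(exp (real j) + \<bar>x\<bar> + 1)\<^sup>2/t)))"
 unfolding exp_add[symmetric] by simp
 also have "... <= exp Z*((2*(1/mu))\<^sup>2*(1/(sqrt (2*pi * s))\<^sup>2)*(exp (- (\<bar>y0 - x\<bar> + 1/mu)\<^sup>2/(2 * s)))\<^sup>2)"
 by (intro mult_left_mono mult_mono a b c) auto
 also have "... = exp Z*(2*(1/mu)/sqrt (2*pi * s)*exp (- (\<bar>y0 - x\<bar> + 1/mu)\<^sup>2/(2 * s)))\<^sup>2"
 by (simp only: power_mult_distrib power_divide times_divide_eq_right mult_1_right times_divide_eq_left)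
 finally have "ennreal (exp (Z - 2*mu - 8*t - q*(exp (real j) + \<bar>x\<bar> + 1)\<^sup>2/t)) <= ennreal (exp Z*(2*(1/mu)/sqrt (2*pi * s)*exp (- (\<bar>y0 - x\<bar> + 1/mu)\<^sup>2/(2 * s)))\<^sup>2)"
 by (rule ennreal_leI)
 from order.trans[OF this[unfolded s_def] F] show ?thesis unfolding Z_def mu_def .
qed

subsection \<open>Asymptotics\<close>

text \<open>All small parameters become functions of \<open>de\<close>. With
  \<open>ga = de/8\<close>, the value \<open>de^3/2048\<close> is the largest \<open>et\<close>
  allowed by \<open>32*et <= de*ga^2\<close>, and \<open>de <= 1/8\<close> is exactly what the bound
  on its square root requires.\<close>

lemma params:
 assumes "0 < de" "de <= (1/8 :: real)"
 shows "0 < de ^ 3/2048" "sqrt (de ^ 3/2048) <= de/128" "32*(de ^ 3/2048) <= de*(de/8)\<^sup>2" "(de/8)\<^sup>2 <= de/64"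
proof -
 show "0 < de ^ 3/2048" using assms by simp
 have d2: "0 <= de\<^sup>2" by simp
 have "de*de\<^sup>2 <= 1/8*de\<^sup>2" using assms d2 by (intro mult_right_mono)
 then have "de ^ 3/2048 <= (de/128)\<^sup>2" by (simp add: power_divide power3_eq_cube power2_eq_square)
 then show "sqrt (de ^ 3/2048) <= de/128" using assms by (intro real_le_lsqrt) auto
 show "32*(de ^ 3/2048) <= de*(de/8)\<^sup>2" by (simp add: power_divide power3_eq_cube power2_eq_square)
 have "de*de <= 1*de" using assms by (intro mult_right_mono) auto
 then show "(de/8)\<^sup>2 <= de/64" by (simp add: power_divide power2_eq_square)
qed

definition environment_ok :: "real => real => (real => real) => bool" where
 "environment_ok thh de w \<longleftrightarrow> (\<forall>\<^sub>F j in sequentially.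
 up_ok thh de (de ^ 3/2048) (de/8) (c1 (de ^ 3/2048)/de) j w &
 up_ok thh de (de ^ 3/2048) (de/8) (c1 (de ^ 3/2048)/de) j (%y. - w (- y)) &
 low_ok thh de (de ^ 3/2048) (1/de + 1) (de/(6*thh)) j w)"

lemma environment_ok_AE:
 assumes M: "prob_space M" and W: "two_sided_brownian_motion M W" and thh: "thh > 0" and de: "0 < de" "de <= 1/8"
 shows "AE om in M. environment_ok thh de (%y. W y om)"
proof -
 define et where "et = de ^ 3/2048"
 note P = params[OF de, folded et_def]
 have deh: "de <= 1/2" using de by simp
 have g: "0 < de/8" "de/8 <= 1/2" using de by auto
 have c: "c1 et/de > 0" using P(1) de by (auto simp: c1_def add_pos_pos)
 have "sqrt et <= 1" using P(2) de by linarith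
 then have et1: "et <= 1" by simp
 have K0: "1/de + 1 > 0" "1/de + 1 >= 1" using de by (auto simp: add_pos_pos)
 have d: "de/(6*thh) > 0" using de thh by simp
 have small: "3/2*thh\<^sup>2*(de/(6*thh)/((1/de + 1)*thh) + (de/(6*thh))\<^sup>2/(4*(1/de + 1))) <= de/2"
 proof -
 have "de/(6*thh)/((1/de + 1)*thh) <= de/(6*thh)/(1*thh)"
 proof (rule divide_left_mono)
  show "1*thh <= (1/de + 1)*thh" using K0(2) thh by (intro mult_right_mono) auto
  show "0 < (1/de + 1)*thh*(1*thh)" using thh by (intro mult_pos_pos K0(1)) auto
 qed (use d in simp)
 moreover have "(de/(6*thh))\<^sup>2/(4*(1/de + 1)) <= (de/(6*thh))\<^sup>2/(4*1)"
 proof (rule divide_left_mono)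
  show "4*1 <= 4*(1/de + 1)" using K0(2) by (intro mult_left_mono) auto
  show "0 < 4*(1/de + 1)*(4*1)" by (intro mult_pos_pos K0(1)) auto
 qed simp
 ultimately have "3/2*thh\<^sup>2*(de/(6*thh)/((1/de + 1)*thh) + (de/(6*thh))\<^sup>2/(4*(1/de + 1)))
  <= 3/2*thh\<^sup>2*(de/(6*thh)/(1*thh) + (de/(6*thh))\<^sup>2/(4*1))" by (intro mult_left_mono add_mono) auto
 also have "... = de/4 + de\<^sup>2/96" using thh by (simp add: power2_eq_square field_simps)
 also have "... <= de/2"
 proof -
  have "de\<^sup>2 <= 1*de" unfolding power2_eq_square using de by (intro mult_right_mono) auto
  then show ?thesis using de by simp
 qed
 finally show ?thesis .
 qed
 note W0 = brownian_restrict[OF W] and W1 = brownian_reflect[OF M W]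
 have "AE om in M. \<forall>\<^sub>F j in sequentially. up_ok thh de et (de/8) (c1 et/de) j (%t. W t om)"
 by (rule up_ok_AE[OF M W0 thh de(1) deh g P(4) P(1) P(3) c])
 moreover have "AE om in M. \<forall>\<^sub>F j in sequentially. up_ok thh de et (de/8) (c1 et/de) j (%t. - W (- t) om)"
 by (rule up_ok_AE[OF M W1 thh de(1) deh g P(4) P(1) P(3) c])
 moreover have "AE om in M. \<forall>\<^sub>F j in sequentially. low_ok thh de et (1/de + 1) (de/(6*thh)) j (%t. W t om)"
 by (rule low_ok_AE[OF M W0 thh de(1) deh P(1) et1 K0(1) d small])
 ultimately show ?thesis
 by eventually_elim (simp add: environment_ok_def et_def[symmetric] eventually_conj_iff)
qed

definition upper_exponent :: "real => real => real => nat => real => real" where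
 "upper_exponent thh de x j t = (let et = de ^ 3/2048; m = mm thh de j in
 2*et*(exp (31/32 * real j) + 1) + (\<bar>x\<bar> + 1)*(\<bar>x\<bar> + 2 + 2*m) + 6*de*m*(\<bar>x\<bar> + 1)
  + m\<^sup>2*(1/2 + 1568 * sqrt et + 42*de)*t)"

definition lower_exponent :: "real => real => real => nat => nat => real => real" where
 "lower_exponent thh de x q j t = (let et = de ^ 3/2048; m = mm thh de j; mu = mm thh (- de) j in
 mu\<^sup>2*(1/2 - 2*de)*(t - t/q) - 8 -
  (2*et + (\<bar>x\<bar> + 1)*(\<bar>x\<bar> + 2 + 2*m) + 2*de*m*(\<bar>x\<bar> + 1) + m\<^sup>2*(2 * c1 et + 10*de)*(t/q))
  - 2*mu - 8*t - q*(exp (real j) + \<bar>x\<bar> + 1)\<^sup>2/t)"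

lemma log_moment_bounds:
 fixes Jw :: "real => 'b => real" and q :: nat
 assumes N: "prob_space N" and B: "brownian_motion N x B" and w: "continuous_on UNIV w" and l: "mollifier l" and thh: "thh > 0"
 and de: "0 < de" "de <= 1/8" and env: "environment_ok thh de w" and q: "q > 0"
 and Jm: "\<And>s. s >= 0 ==> Jw s \<in> borel_measurable N" and Jc: "AE om in N. continuous_on {0..} (%s. Jw s om)"
 and Jl: "\<And>q :: rat. 0 < q ==> \<exists>r :: nat => nat. strict_mono r &
  (AE om in N. (%n. integral {0..of_rat q} (%s. - kernel.conv (mker l (1/real (r n + 2))) w 1 (B s om))) \<longlonglongrightarrow> Jw (of_rat q) om)"
 shows "\<forall>\<^sub>F j in sequentially. \<forall>t. 0 < t & t < exp (real j) -->
 lower_exponent thh de x q j t <= ln (LINT om|N. exp (thh*Jw t om)) & ln (LINT om|N. exp (thh*Jw t om)) <= upper_exponent thh de x j t"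
proof -
 define et where "et = de ^ 3/2048"
 note P = params[OF de, folded et_def]
 have sq: "sqrt et <= 1/110" using P(2) de by linarith
 have de1: "de <= 1" and g: "0 < de/8" using de by auto
 have "filterlim (%j. 3/2*thh\<^sup>2*(1 + - de) * real j) at_top sequentially"
 using thh de by (intro filterlim_tendsto_pos_mult_at_top[OF tendsto_const] filterlim_real_sequentially) auto
 from filterlim_at_top[THEN iffD1, OF this, rule_format, of 1]
 have ev1: "\<forall>\<^sub>F j in sequentially. mm thh (- de) (real j) >= 1" by eventually_elim (simp add: mm_def real_root_ge_1_iff)
 show ?thesis
 using ev1 env[unfolded environment_ok_def, folded et_def] eventually_gt_at_top[of 0]
 proof (eventually_elim, intro allI impI)
 fix j :: nat and t :: real
 assume mu1: "mm thh (- de) (real j) >= 1" and ok: "up_ok thh de et (de/8) (c1 et/de) j w & up_ok thh de et (de/8) (c1 et/de) j (%y. - w (- y)) & low_ok thh de et (1/de + 1) (de/(6*thh)) j w"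
  and j: "0 < j" and t: "0 < t & t < exp (real j)"
 note up = conjunct1[OF ok] conjunct1[OF conjunct2[OF ok]] and low = conjunct2[OF conjunct2[OF ok]]
 have m1: "mm thh de (real j) >= 1"
 proof -
  have "mm thh (- de) (real j) <= mm thh de (real j)" unfolding mm_def using de by (intro real_root_le_mono mult_right_mono mult_left_mono) auto
  then show ?thesis using mu1 by linarith
 qed
 define Kc where "Kc = c1 et/de*exp (real j)*mm thh de j + 1"
 \<comment> \<open>The index \<open>n\<close> is both the truncation radius and, through
   \<open>1/(n + 2)\<close>, the mollification scale; from \<open>n0\<close> on the radius exceeds
   \<open>Kc\<close> and the scale is at most \<open>et/mu\<close>.\<close>
 define n0 where "n0 = nat \<lceil>max Kc (mm thh (- de) j/et)\<rceil>"
 have n0: "Kc <= real n" "1/real (n + 2)*mm thh (- de) j <= et" if "n >= n0" for n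
 proof -
  have "max Kc (mm thh (- de) j/et) <= real n" using that unfolding n0_def by linarith
  then show "Kc <= real n" by simp
  have "mm thh (- de) j/et <= real (n + 2)" using \<open>max Kc (mm thh (- de) j/et) <= real n\<close> by simp
  then have "mm thh (- de) j <= real (n + 2)*et" using P(1) by (simp add: pos_divide_le_eq)
  then show "1/real (n + 2)*mm thh (- de) j <= et" by (simp add: divide_le_eq mult.commute del: of_nat_add)
 qed
 define k where "k n = mker l (1/real (n + 2))" for n
 have kern: "kernel (k n) (1/real (n + 2))" for n unfolding k_def by (rule mollifier_kernel[OF l]) auto
 define C where "C = exp (2*et + (\<bar>x\<bar> + 1)*(\<bar>x\<bar> + 2 + 2*mm thh de j) + 2*de*mm thh de j*(\<bar>x\<bar> + 1) + (mm thh de j)\<^sup>2*(2 * c1 et + 10*de)*exp (real j))"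
 have c1: "c1 et >= 0" using P(1) by (simp add: c1_def)
 have H: "(\<integral>\<^sup>+om. ennreal (exp (integral {0..s} (%u. thh*(- kernel.conv (k n) (clamp (real n) w) 1 (B u om))))) \<partial>N) <= ennreal (exp (upper_exponent thh de x j s)) &
  ennreal (exp (lower_exponent thh de x q j s)) <= (\<integral>\<^sup>+om. ennreal (exp (integral {0..s} (%u. thh*(- kernel.conv (k n) (clamp (real n) w) 1 (B u om))))) \<partial>N) &
  (\<integral>\<^sup>+om. ennreal (exp (integral {0..s} (%u. 2*thh*1*(- kernel.conv (k n) (clamp (real n) w) 1 (B u om))))) \<partial>N) <= ennreal C"
  if n: "n0 <= n" and s: "0 < s" "s < exp (real j)" for n s
 proof (intro conjI)
  have s': "s <= exp (real j)" using s by simp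
  note Kn = n0(1)[OF n, unfolded Kc_def] and en = n0(2)[OF n]
  show "(\<integral>\<^sup>+om. ennreal (exp (integral {0..s} (%u. thh*(- kernel.conv (k n) (clamp (real n) w) 1 (B u om))))) \<partial>N) <= ennreal (exp (upper_exponent thh de x j s))"
  using kernel.upper_fine[OF kern N B thh g P(1) sq de(1) de1 m1 s(1) s' w up Kn] unfolding upper_exponent_def Let_def et_def[symmetric] .
  show "ennreal (exp (lower_exponent thh de x q j s)) <= (\<integral>\<^sup>+om. ennreal (exp (integral {0..s} (%u. thh*(- kernel.conv (k n) (clamp (real n) w) 1 (B u om))))) \<partial>N)"
  using kernel.lower_simple[OF kern N B thh de g P(1,2) j mu1 s(1) s' q w up low Kn en] unfolding lower_exponent_def Let_def et_def[symmetric] .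
  have "(\<integral>\<^sup>+om. ennreal (exp (integral {0..s} (%u. 2*thh*1*(- kernel.conv (k n) (clamp (real n) w) 1 (B u om))))) \<partial>N)
  <= ennreal (exp (2*et + (\<bar>x\<bar> + 1)*(\<bar>x\<bar> + 2 + 2*mm thh de j) + 2*de*mm thh de j*(\<bar>x\<bar> + 1) + (mm thh de j)\<^sup>2*(2 * c1 et + 10*de) * s))"
  by (rule kernel.upper_crude[OF kern N B thh g P(1) sq de(1) de1 m1 s(1) s' w up Kn]) simp
  also have "... <= ennreal C" unfolding C_def using s' c1 de by (intro ennreal_leI) (simp add: mult_left_mono)
  finally show "(\<integral>\<^sup>+om. ennreal (exp (integral {0..s} (%u. 2*thh*1*(- kernel.conv (k n) (clamp (real n) w) 1 (B u om))))) \<partial>N) <= ennreal C" .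
 qed
 have cont: "isCont (%t. exp (upper_exponent thh de x j t)) s" "isCont (%t. exp (lower_exponent thh de x q j t)) s" if "s > 0" for s
  unfolding upper_exponent_def lower_exponent_def Let_def using q that by (auto intro!: continuous_intros)
 have C0: "C >= 0" by (simp add: C_def)
 note PB = path_bounds[OF N B w Jm Jc kern Jl[folded k_def] H[THEN conjunct1] H[THEN conjunct2, THEN conjunct1] H[THEN conjunct2, THEN conjunct2] C0 cont conjunct1[OF t] conjunct2[OF t]]
 have bounds: "(\<integral>\<^sup>+om. ennreal (exp (thh*Jw t om)) \<partial>N) <= ennreal (exp (upper_exponent thh de x j t))"
  "ennreal (exp (lower_exponent thh de x q j t)) <= (\<integral>\<^sup>+om. ennreal (exp (thh*Jw t om)) \<partial>N)"
  by (rule PB(1); assumption) (rule PB(2); assumption)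
 define I where "I = (\<integral>\<^sup>+om. ennreal (exp (thh*Jw t om)) \<partial>N)"
 have Jt: "Jw t \<in> borel_measurable N" using Jm t by simp
 have E: "(LINT om|N. exp (thh*Jw t om)) = enn2real I" unfolding I_def using Jt by (intro integral_eq_nn_integral) auto
 \<comment> \<open>Finiteness rules out that \<open>enn2real\<close> returns its default value 0 for
   an infinite moment.\<close>
 have "I < \<infinity>" using bounds(1) unfolding I_def by (rule le_less_trans) simp
 then obtain r where r: "r >= 0" "I = ennreal r" by (cases I) auto
 have r1: "exp (lower_exponent thh de x q j t) <= r" "r <= exp (upper_exponent thh de x j t)"
  using bounds unfolding I_def[symmetric] r(2) using r(1) by (simp_all add: ennreal_le_iff)
 have r0: "r > 0" using r1(1) by (rule less_le_trans[rotated]) simp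
 have "ln r <= ln (exp (upper_exponent thh de x j t))" using r0 r1(2) by (subst ln_le_cancel_iff) auto
 then show "lower_exponent thh de x q j t <= ln (LINT om|N. exp (thh*Jw t om)) & ln (LINT om|N. exp (thh*Jw t om)) <= upper_exponent thh de x j t"
  using r r0 r1(1) by (simp add: E ln_ge_iff)
 qed
qed

lemma mm_split: "mm thh si j = root 3 (3/2*thh\<^sup>2*(1 + si)) * root 3 j"
 by (simp only: mm_def real_root_mult)

text \<open>Choosing the integer just above \<open>ln t\<close> loses only constants:
  \<open>exp j\<close> is at most \<open>3*t\<close>, because \<open>exp 1 <= 3\<close>, and the
  cube roots of \<open>j\<close> and \<open>ln t\<close> are asymptotically equal.\<close>

lemma log_scale:
 assumes t: "t >= exp 1" defines "j \<equiv> nat \<lfloor>ln t\<rfloor> + 1"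
 shows "t < exp (real j)" "exp (real j) <= 3*t" "ln t <= real j" "real j <= ln t + 1"
 "(ln t) powr (1/3) <= root 3 (real j)" "root 3 (real j) <= (ln t + 1) powr (1/3)"
proof -
 have t0: "t > 0" using t exp_gt_zero[of "1::real"] by linarith
 have l1: "ln t >= 1" using t t0 by (simp add: ln_ge_iff)
 have jj: "ln t < real j" "real j <= ln t + 1"
 proof -
 have "real (nat \<lfloor>ln t\<rfloor>) = of_int \<lfloor>ln t\<rfloor>" using l1 by simp
 then have e: "real j = of_int \<lfloor>ln t\<rfloor> + 1" by (simp add: j_def)
 show "ln t < real j" using floor_correct[of "ln t"] e by linarith
 show "real j <= ln t + 1" using floor_correct[of "ln t"] e by linarith
 qed
 then show "ln t <= real j" "real j <= ln t + 1" by auto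
 have "exp (ln t) < exp (real j)" using jj by simp
 then show "t < exp (real j)" using t0 by simp
 have "exp (real j) <= exp (ln t + 1)" using jj by simp
 also have "... = t*exp 1" using t0 by (simp add: exp_add)
 also have "... <= t*3" using t0 exp_le by (intro mult_left_mono) auto
 finally show "exp (real j) <= 3*t" by simp
 have r: "root 3 z = z powr (1/3)" if "z > 0" for z :: real using root_powr_inverse[of 3 z] that by simp
 have j0: "real j > 0" using jj l1 by linarith
 show "(ln t) powr (1/3) <= root 3 (real j)" "root 3 (real j) <= (ln t + 1) powr (1/3)"
 unfolding r[OF j0] using jj l1 by (auto intro!: powr_mono2)
qed

text \<open>Here \<open>q\<close> stays fixed while \<open>t\<close> tends to infinity. The Gaussian
  cost \<open>q*(exp j + |x| + 1)^2/t\<close> of reaching the block is then of order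
  \<open>t\<close>, below \<open>t*(ln t)^(2/3)\<close>, and the bad cells contribute
  \<open>exp (31/32*j)\<close>, below \<open>t\<close>. Only terms of order \<open>t*j^(2/3)\<close>
  survive.\<close>

lemma exponent_asymptotics:
 fixes f :: "real => real" and q :: nat
 assumes thh: "thh > 0" and de: "0 < de" "de <= 1/8" and q: "q > 0"
 and b: "\<forall>\<^sub>F j in sequentially. \<forall>t. 0 < t & t < exp (real j) --> lower_exponent thh de x q j t <= f t & f t <= upper_exponent thh de x j t"
 defines "a \<equiv> root 3 (3/2*thh\<^sup>2*(1 + de))" and "a' \<equiv> root 3 (3/2*thh\<^sup>2*(1 + - de))" and "et \<equiv> de ^ 3/2048"
 shows "\<And>y. a\<^sup>2*(1/2 + 1568 * sqrt et + 42*de) < y ==> \<forall>\<^sub>F t in at_top. t powr (-1)*(ln t) powr (-2/3)*f t < y"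
 "\<And>y. y < a'\<^sup>2*(1/2 - 2*de)*(1 - 1/q) - a\<^sup>2*(2 * c1 et + 10*de)/q ==> \<forall>\<^sub>F t in at_top. y < t powr (-1)*(ln t) powr (-2/3)*f t"
proof -
 define ph where "ph t = t powr (-1)*(ln t) powr (-2/3)" for t :: real
 have ph0: "ph t >= 0" for t by (simp add: ph_def)
 define r where "r t = (ln t + 1) powr (1/3)" for t :: real
 define X where "X = \<bar>x\<bar>"
 have X0: "X >= 0" by (simp add: X_def)
 have a0: "a > 0" "a' > 0" "a' >= 0" "a >= 0" using thh de by (auto simp: a_def a'_def)
 have et0: "et > 0" using de by (simp add: et_def)
 have c0: "c1 et >= 0" using et0 by (simp add: c1_def)
 from b obtain j0 where j0: "\<And>j t. j >= j0 ==> 0 < t ==> t < exp (real j) ==> lower_exponent thh de x q j t <= f t & f t <= upper_exponent thh de x j t"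
 unfolding eventually_sequentially by blast
 define G where "G t = 2*et*exp (31/32*(ln t + 1)) + (2*et + (X + 1)*(X + 2)) + ((X + 1)*(2*a) + 6*de*a*(X + 1)) * r t
  + a\<^sup>2*(1/2 + 1568 * sqrt et + 42*de)*((r t)\<^sup>2*t)" for t :: real
 define H where "H t = a'\<^sup>2*(1/2 - 2*de)*(1 - 1/q)*(((ln t) powr (1/3))\<^sup>2*t) - (8 + 2*et + (X + 1)*(X + 2))
  - ((X + 1)*(2*a) + 2*de*a*(X + 1) + 2*a') * r t - a\<^sup>2*(2 * c1 et + 10*de)/q*((r t)\<^sup>2*t) - (8 + 16*q)*t" for t :: real
 have GH: "eventually (%t :: real. H t <= f t & f t <= G t) at_top"
 using eventually_ge_at_top[of "exp (real j0)"] eventually_ge_at_top[of "exp 1"] eventually_ge_at_top[of "X + 1"]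
 proof eventually_elim
 case (elim t)
 define j where "j = nat \<lfloor>ln t\<rfloor> + 1"
 note S = log_scale[OF elim(2), folded j_def]
 have t0: "t > 0" using elim(3) X0 by linarith
 have "real j0 <= ln t" using elim(1) t0 by (simp add: ln_ge_iff)
 then have "j0 <= j" using S(3) by linarith
 note F = j0[OF this t0 S(1)]
 define s where "s = root 3 (real j)"
 have s: "0 <= s" "s <= r t" "(ln t) powr (1/3) <= s" using S(5,6) by (auto simp: s_def r_def)
 have mj: "mm thh de (real j) = a * s" "mm thh (- de) (real j) = a' * s" by (simp_all only: mm_split a_def a'_def s_def)
 have s2: "s\<^sup>2*t <= (r t)\<^sup>2*t" "((ln t) powr (1/3))\<^sup>2*t <= s\<^sup>2*t" using s t0 by (auto intro!: mult_right_mono power_mono)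
 have "upper_exponent thh de x j t = 2*et*exp (31/32 * real j) + (2*et + (X + 1)*(X + 2)) + ((X + 1)*(2*a) + 6*de*a*(X + 1)) * s
  + a\<^sup>2*(1/2 + 1568 * sqrt et + 42*de)*(s\<^sup>2*t)"
  unfolding upper_exponent_def Let_def mj et_def[symmetric] X_def[symmetric] by (simp add: power_mult_distrib algebra_simps)
 also have "... <= G t"
  unfolding G_def using s s2 S(4) et0 X0 a0 de by (intro add_mono mult_left_mono order_refl) auto
 finally have up: "upper_exponent thh de x j t <= G t" .
 have e: "q*(exp (real j) + X + 1)\<^sup>2/t <= 16*q*t"
 proof -
  have "exp (real j) + X + 1 <= 4*t" using S(2) elim(3) by linarith
  then have "(exp (real j) + X + 1)\<^sup>2 <= (4*t)\<^sup>2" using X0 by (intro power_mono) (auto intro: add_nonneg_nonneg)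
  then have "q*(exp (real j) + X + 1)\<^sup>2/t <= q*(4*t)\<^sup>2/t" using t0 by (intro divide_right_mono mult_left_mono) auto
  also have "... = 16*q*t" using t0 by (simp add: power2_eq_square)
  finally show ?thesis .
 qed
 have q1: "0 <= 1 - 1/real q" using q by simp
 have c: "0 <= a'\<^sup>2*(1/2 - 2*de)*(1 - 1/q)" "0 <= (X + 1)*(2*a) + 2*de*a*(X + 1) + 2*a'" "0 <= a\<^sup>2*(2 * c1 et + 10*de)/q"
  using de q1 X0 a0 c0 by (auto intro!: mult_nonneg_nonneg add_nonneg_nonneg)
 have "lower_exponent thh de x q j t = a'\<^sup>2*(1/2 - 2*de)*(1 - 1/q)*(s\<^sup>2*t) - (8 + 2*et + (X + 1)*(X + 2))
  - ((X + 1)*(2*a) + 2*de*a*(X + 1) + 2*a') * s - a\<^sup>2*(2 * c1 et + 10*de)/q*(s\<^sup>2*t) - 8*t - q*(exp (real j) + X + 1)\<^sup>2/t"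
 proof -
  have "t - t/q = (1 - 1/q)*t" by (simp add: left_diff_distrib)
  then have 1: "(a' * s)\<^sup>2*(1/2 - 2*de)*(t - t/q) = a'\<^sup>2*(1/2 - 2*de)*(1 - 1/q)*(s\<^sup>2*t)" by (simp only: power_mult_distrib mult_ac)
  have 2: "(a * s)\<^sup>2*(2 * c1 et + 10*de)*(t/q) = a\<^sup>2*(2 * c1 et + 10*de)/q*(s\<^sup>2*t)" by (simp add: power_mult_distrib)
  have 3: "(X + 1)*(X + 2 + 2*(a * s)) + 2*de*(a * s)*(X + 1) + 2*(a' * s) = (X + 1)*(X + 2) + ((X + 1)*(2*a) + 2*de*a*(X + 1) + 2*a') * s"
  by (simp add: algebra_simps)
  show ?thesis unfolding lower_exponent_def Let_def mj et_def[symmetric] X_def[symmetric] 1 2 using 3 by linarith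
 qed
 moreover have "a'\<^sup>2*(1/2 - 2*de)*(1 - 1/q)*(((ln t) powr (1/3))\<^sup>2*t) <= a'\<^sup>2*(1/2 - 2*de)*(1 - 1/q)*(s\<^sup>2*t)"
  by (rule mult_left_mono[OF s2(2) c(1)])
 moreover have "((X + 1)*(2*a) + 2*de*a*(X + 1) + 2*a') * s <= ((X + 1)*(2*a) + 2*de*a*(X + 1) + 2*a') * r t"
  by (rule mult_left_mono[OF s(2) c(2)])
 moreover have "a\<^sup>2*(2 * c1 et + 10*de)/q*(s\<^sup>2*t) <= a\<^sup>2*(2 * c1 et + 10*de)/q*((r t)\<^sup>2*t)"
  by (rule mult_left_mono[OF s2(1) c(3)])
 moreover have "(8 + 16*q)*t = 8*t + 16*q*t" by (simp add: distrib_right)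
 ultimately have "H t <= lower_exponent thh de x q j t" unfolding H_def using e by linarith
 then show ?case using F up by linarith
 qed
 have T1: "((%t. ph t*exp (31/32*(ln t + 1))) \<longlongrightarrow> 0) at_top" unfolding ph_def by real_asymp
 have T2: "(ph \<longlongrightarrow> 0) at_top" unfolding ph_def[abs_def] by real_asymp
 have T3: "((%t. ph t * r t) \<longlongrightarrow> 0) at_top" unfolding ph_def r_def by real_asymp
 have T4: "((%t. ph t*((r t)\<^sup>2*t)) \<longlongrightarrow> 1) at_top" unfolding ph_def r_def by real_asymp
 have T5: "((%t. ph t*(((ln t) powr (1/3))\<^sup>2*t)) \<longlongrightarrow> 1) at_top" unfolding ph_def by real_asymp
 have T6: "((%t. ph t*t) \<longlongrightarrow> 0) at_top" unfolding ph_def by real_asymp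
 have Gl: "((%t. ph t*G t) \<longlongrightarrow> a\<^sup>2*(1/2 + 1568 * sqrt et + 42*de)) at_top"
 proof -
 have "((%t. 2*et*(ph t*exp (31/32*(ln t + 1))) + (2*et + (X + 1)*(X + 2))*ph t + ((X + 1)*(2*a) + 6*de*a*(X + 1))*(ph t * r t)
  + a\<^sup>2*(1/2 + 1568 * sqrt et + 42*de)*(ph t*((r t)\<^sup>2*t))) \<longlongrightarrow>
  2*et*0 + (2*et + (X + 1)*(X + 2))*0 + ((X + 1)*(2*a) + 6*de*a*(X + 1))*0 + a\<^sup>2*(1/2 + 1568 * sqrt et + 42*de)*1) at_top"
  by (intro tendsto_add tendsto_mult[OF tendsto_const] T1 T2 T3 T4)
 moreover have "A*(p*e) + b*p + C*(p*z) + D*(p * s) = p*(A*e + b + C*z + D * s)" for A b C D p e z s :: real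
  by (simp add: algebra_simps)
 ultimately show ?thesis unfolding G_def by (simp only: mult_zero_right add_0_left add_0_right mult_1_right)
 qed
 have Hl: "((%t. ph t*H t) \<longlongrightarrow> a'\<^sup>2*(1/2 - 2*de)*(1 - 1/q) - a\<^sup>2*(2 * c1 et + 10*de)/q) at_top"
 proof -
 have "((%t. a'\<^sup>2*(1/2 - 2*de)*(1 - 1/q)*(ph t*(((ln t) powr (1/3))\<^sup>2*t)) - (8 + 2*et + (X + 1)*(X + 2))*ph t
  - ((X + 1)*(2*a) + 2*de*a*(X + 1) + 2*a')*(ph t * r t) - a\<^sup>2*(2 * c1 et + 10*de)/q*(ph t*((r t)\<^sup>2*t)) - (8 + 16*q)*(ph t*t)) \<longlongrightarrow>
  a'\<^sup>2*(1/2 - 2*de)*(1 - 1/q)*1 - (8 + 2*et + (X + 1)*(X + 2))*0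
  - ((X + 1)*(2*a) + 2*de*a*(X + 1) + 2*a')*0 - a\<^sup>2*(2 * c1 et + 10*de)/q*1 - real (8 + 16*q)*0) at_top"
  by (intro tendsto_diff tendsto_mult[OF tendsto_const] T2 T3 T4 T5 T6)
 moreover have "a'\<^sup>2*(1/2 - 2*de)*(1 - 1/q)*(ph t*(((ln t) powr (1/3))\<^sup>2*t)) - (8 + 2*et + (X + 1)*(X + 2))*ph t
  - ((X + 1)*(2*a) + 2*de*a*(X + 1) + 2*a')*(ph t * r t) - a\<^sup>2*(2 * c1 et + 10*de)/q*(ph t*((r t)\<^sup>2*t)) - (8 + 16*q)*(ph t*t) = ph t*H t" for t
 proof -
  have "A*(p*e) - b*p - C*(p*z) - D*(p * s) - F*(p*u) = p*(A*e - b - C*z - D * s - F*u)" for A b C D F p e z s u :: real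
  by (simp add: algebra_simps)
  then show ?thesis unfolding H_def by blast
 qed
 ultimately show ?thesis by simp
 qed
 show "\<forall>\<^sub>F t in at_top. t powr (-1)*(ln t) powr (-2/3)*f t < y" if "a\<^sup>2*(1/2 + 1568 * sqrt et + 42*de) < y" for y
 using GH order_tendstoD(2)[OF Gl that]
 proof eventually_elim
 case (elim t)
 have "ph t*f t <= ph t*G t" using elim(1) ph0 by (intro mult_left_mono) auto
 then show ?case using elim(2) unfolding ph_def by linarith
 qed
 show "\<forall>\<^sub>F t in at_top. y < t powr (-1)*(ln t) powr (-2/3)*f t" if "y < a'\<^sup>2*(1/2 - 2*de)*(1 - 1/q) - a\<^sup>2*(2 * c1 et + 10*de)/q" for y
 using GH order_tendstoD(1)[OF Hl that]
 proof eventually_elim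
 case (elim t)
 have "ph t*H t <= ph t*f t" using elim(1) ph0 by (intro mult_left_mono) auto
 then show ?case using elim(2) unfolding ph_def by linarith
 qed
qed

lemma target_value:
 assumes "thh > 0" shows "(root 3 (3/2*thh\<^sup>2))\<^sup>2/2 = 1/2*(3/2) powr (2/3)*thh powr (4/3)"
proof -
 have p: "3/2*thh\<^sup>2 > 0" using assms by simp
 have "root 3 (3/2*thh\<^sup>2) = (3/2*thh\<^sup>2) powr (1/3)" using root_powr_inverse[of 3 "3/2*thh\<^sup>2"] p by simp
 then have "(root 3 (3/2*thh\<^sup>2))\<^sup>2 = (3/2*thh\<^sup>2) powr (1/3)*(3/2*thh\<^sup>2) powr (1/3)" by (simp only: power2_eq_square)
 also have "... = (3/2*thh\<^sup>2) powr (2/3)" by (simp add: powr_add[symmetric])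
 also have "... = (3/2) powr (2/3)*(thh\<^sup>2) powr (2/3)" by (rule powr_mult)
 also have "(thh\<^sup>2) powr (2/3) = thh powr (4/3)"
 proof -
 have "(thh powr 2) powr (2/3) = thh powr (4/3)" by (simp add: powr_powr)
 moreover have "thh powr 2 = thh\<^sup>2" using assms by simp
 ultimately show ?thesis by (simp only:)
 qed
 finally show ?thesis by simp
qed

theorem theorem1p4:
  fixes M :: "'a measure" and N :: "'b measure"
    and W :: "real \<Rightarrow> 'a \<Rightarrow> real" and B :: "real \<Rightarrow> 'b \<Rightarrow> real"
    and V :: "(real \<Rightarrow> real) \<Rightarrow> 'a \<Rightarrow> real" and l :: "real \<Rightarrow> real"
    and J :: "real \<Rightarrow> 'a \<times> 'b \<Rightarrow> real"
    and \<theta> x :: real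
  assumes "prob_space M" and "prob_space N"
    and "two_sided_brownian_motion M W"
    and "is_white_noise_of M W V"
    and "mollifier l"
    and "brownian_motion N x B"
    and "is_noise_path_integral M N V l B J"
    and "\<theta> > 0"
  shows "AE \<omega> in M.
    ((\<lambda>t. t powr (-1) * (ln t) powr (-2/3) * ln (LINT \<omega>'|N. exp (\<theta> * J t (\<omega>, \<omega>'))))
      \<longlongrightarrow> 1/2 * (3/2) powr (2/3) * \<theta> powr (4/3)) at_top"
proof -
 interpret M: prob_space M by fact
 interpret N: prob_space N by fact
 interpret P: pair_prob_space M N ..
 \<comment> \<open>Countably many parameter values suffice, so one null set serves them all; the
   offset 8 keeps them in the range of \<open>params\<close>.\<close>
 define \<delta> where "\<delta> i = 1/real (i + 8)" for i
 have \<delta>: "0 < \<delta> i" "\<delta> i <= 1/8" for i by (auto simp: \<delta>_def field_simps)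
 define \<eta> where "\<eta> i = \<delta> i ^ 3/2048" for i
 \<comment> \<open>Large enough for the initial fraction of time \<open>1/q\<close> and for the
   coefficient of the crude cost spent during it to be at most \<delta> each.\<close>
 define q where "q i = nat \<lceil>(2 * c1 (\<eta> i) + 10 * \<delta> i + 1) / \<delta> i\<rceil>" for i
 have \<eta>0: "\<eta> i > 0" for i using \<delta>[of i] by (simp add: \<eta>_def)
 have c0: "c1 (\<eta> i) >= 0" for i using \<eta>0[of i] by (simp add: c1_def)
 have q: "q i > 0" "1/real (q i) <= \<delta> i" "(2 * c1 (\<eta> i) + 10 * \<delta> i)/real (q i) <= \<delta> i" for i
 proof -
 define S where "S = 2 * c1 (\<eta> i) + 10 * \<delta> i"
 have S0: "S >= 0" using c0[of i] \<delta>[of i] by (simp add: S_def)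
 have "(S + 1) / \<delta> i <= real (q i)" unfolding q_def S_def by linarith
 then have S1: "S + 1 <= real (q i) * \<delta> i" using \<delta>[of i] by (simp add: pos_divide_le_eq)
 then show q0: "q i > 0" using S0 by (cases "q i") auto
 show "1/real (q i) <= \<delta> i" using S1 S0 q0 by (simp add: pos_divide_le_eq mult.commute)
 show "(2 * c1 (\<eta> i) + 10 * \<delta> i)/real (q i) <= \<delta> i" using S1 q0 unfolding S_def[symmetric] by (simp add: pos_divide_le_eq mult.commute)
 qed
 define u where "u i = (root 3 (3/2 * \<theta>\<^sup>2*(1 + \<delta> i)))\<^sup>2*(1/2 + 55 * \<delta> i)" for i
 define v where "v i = (root 3 (3/2 * \<theta>\<^sup>2*(1 + - \<delta> i)))\<^sup>2*(1/2 - 2 * \<delta> i)*(1 - \<delta> i) - (root 3 (3/2 * \<theta>\<^sup>2*(1 + \<delta> i)))\<^sup>2 * \<delta> i" for i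
 define target where "target = (root 3 (3/2 * \<theta>\<^sup>2))\<^sup>2/2"
 have \<delta>l: "\<delta> \<longlonglongrightarrow> 0" unfolding \<delta>_def[abs_def] by real_asymp
 have ul: "u \<longlonglongrightarrow> target"
 proof -
 have "u \<longlonglongrightarrow> (root 3 (3/2 * \<theta>\<^sup>2*(1 + 0)))\<^sup>2*(1/2 + 55*0)" unfolding u_def[abs_def] by (intro tendsto_intros \<delta>l)
 then show ?thesis by (simp add: target_def)
 qed
 have vl: "v \<longlonglongrightarrow> target"
 proof -
 have "v \<longlonglongrightarrow> (root 3 (3/2 * \<theta>\<^sup>2*(1 + - 0)))\<^sup>2*(1/2 - 2*0)*(1 - 0) - (root 3 (3/2 * \<theta>\<^sup>2*(1 + 0)))\<^sup>2*0"
  unfolding v_def[abs_def] by (intro tendsto_intros \<delta>l)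
 then show ?thesis by (simp add: target_def)
 qed
 have A1: "AE \<omega> in M. \<forall>i. environment_ok \<theta> (\<delta> i) (%y. W y \<omega>)"
 unfolding AE_all_countable by (intro allI environment_ok_AE assms \<delta>)
 have A2: "AE \<omega> in M. continuous_on UNIV (%y. W y \<omega>)" by (rule two_sided_brownian_motionD(5)[OF assms(3)])
 have A3: "AE \<omega> in M. \<forall>p :: rat. 0 < p --> (\<exists>r :: nat => nat. strict_mono r &
  (AE \<omega>' in N. (%n. integral {0..of_rat p} (%s. - kernel.conv (mker l (1/real (r n + 2))) (%u. W u \<omega>) 1 (B s \<omega>'))) \<longlonglongrightarrow> J (of_rat p) (\<omega>, \<omega>')))"
 unfolding AE_all_countable
 proof
 fix p :: rat
 show "AE \<omega> in M. 0 < p --> (\<exists>r :: nat => nat. strict_mono r &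
  (AE \<omega>' in N. (%n. integral {0..of_rat p} (%s. - kernel.conv (mker l (1/real (r n + 2))) (%u. W u \<omega>) 1 (B s \<omega>'))) \<longlonglongrightarrow> J (of_rat p) (\<omega>, \<omega>')))"
 proof (cases "0 < p")
  case True
  then have "(0 :: real) <= of_rat p" by simp
  from path_integral_limit[OF assms(1-7) this] obtain r :: "nat => nat" where r: "strict_mono r"
  "AE \<omega> in M. AE \<omega>' in N. (%n. integral {0..of_rat p} (%s. - kernel.conv (mker l (1/real (r n + 2))) (%u. W u \<omega>) 1 (B s \<omega>'))) \<longlonglongrightarrow> J (of_rat p) (\<omega>, \<omega>')"
  by blast
  from r(2) show ?thesis by eventually_elim (use r(1) in blast)
 qed simp
 qed
 have A4: "AE \<omega> in M. AE \<omega>' in N. continuous_on {0..} (%t. J t (\<omega>, \<omega>'))"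
 using assms(7) unfolding is_noise_path_integral_def by (intro P.AE_pair) simp
 have Jm: "J s \<in> borel_measurable (M \<Otimes>\<^sub>M N)" if "s >= 0" for s using assms(7) that unfolding is_noise_path_integral_def by blast
 show ?thesis
 unfolding target_value[OF assms(8), symmetric] target_def[symmetric]
 using A1 A2 A3 A4 AE_space
 proof eventually_elim
 case (elim \<omega>)
 define f where "f t = ln (LINT \<omega>'|N. exp (\<theta>*J t (\<omega>, \<omega>')))" for t
 have Jm': "(%\<omega>'. J s (\<omega>, \<omega>')) \<in> borel_measurable N" if "s >= 0" for s by (rule measurable_Pair2[OF Jm[OF that] elim(5)])
 have b: "\<forall>\<^sub>F j in sequentially. \<forall>t. 0 < t & t < exp (real j) -->
  lower_exponent \<theta> (\<delta> i) x (q i) j t <= f t & f t <= upper_exponent \<theta> (\<delta> i) x j t" for i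
  unfolding f_def
 proof (rule log_moment_bounds[OF assms(2,6) elim(2) assms(5,8) \<delta> _ q(1) Jm' elim(4)])
  show "environment_ok \<theta> (\<delta> i) (%y. W y \<omega>)" using elim(1) by blast
 qed (use elim(3) in blast)+
 note E = exponent_asymptotics[OF assms(8) \<delta> q(1) b, folded \<eta>_def]
 have "((%t. t powr (-1)*(ln t) powr (-2/3)*f t) \<longlongrightarrow> target) at_top"
 proof (rule order_tendstoI)
  fix y assume "y < target"
  then have "\<forall>\<^sub>F i in sequentially. y < v i" by (rule order_tendstoD(1)[OF vl])
  then obtain i where i: "y < v i" by (auto simp: eventually_sequentially)
  have "v i <= (root 3 (3/2 * \<theta>\<^sup>2*(1 + - \<delta> i)))\<^sup>2*(1/2 - 2 * \<delta> i)*(1 - 1/q i) - (root 3 (3/2 * \<theta>\<^sup>2*(1 + \<delta> i)))\<^sup>2*((2 * c1 (\<eta> i) + 10 * \<delta> i)/q i)"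
  unfolding v_def using q(2,3)[of i] \<delta>[of i] by (intro diff_mono mult_left_mono mult_nonneg_nonneg) auto
  then have "y < (root 3 (3/2 * \<theta>\<^sup>2*(1 + - \<delta> i)))\<^sup>2*(1/2 - 2 * \<delta> i)*(1 - 1/q i) - (root 3 (3/2 * \<theta>\<^sup>2*(1 + \<delta> i)))\<^sup>2*(2 * c1 (\<eta> i) + 10 * \<delta> i)/q i"
  using i unfolding times_divide_eq_right by linarith
  then show "\<forall>\<^sub>F t in at_top. y < t powr (-1)*(ln t) powr (-2/3)*f t" by (rule E(2))
 next
  fix y assume "target < y"
  then have "\<forall>\<^sub>F i in sequentially. u i < y" by (rule order_tendstoD(2)[OF ul])
  then obtain i where i: "u i < y" by (auto simp: eventually_sequentially)
  have "(root 3 (3/2 * \<theta>\<^sup>2*(1 + \<delta> i)))\<^sup>2*(1/2 + 1568 * sqrt (\<eta> i) + 42 * \<delta> i) <= u i"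
  unfolding u_def
  proof (rule mult_left_mono)
  \<comment> \<open>By \<open>params\<close> the first error is at most
    \<open>1568/128 = 12.25\<close> times \<delta>, and 12.25 + 42 is below 55.\<close>
  show "1/2 + 1568 * sqrt (\<eta> i) + 42 * \<delta> i <= 1/2 + 55 * \<delta> i" using params(2)[OF \<delta>, of i] \<delta>[of i] unfolding \<eta>_def by simp
  qed simp
  then have "(root 3 (3/2 * \<theta>\<^sup>2*(1 + \<delta> i)))\<^sup>2*(1/2 + 1568 * sqrt (\<eta> i) + 42 * \<delta> i) < y" using i by linarith
  then show "\<forall>\<^sub>F t in at_top. t powr (-1)*(ln t) powr (-2/3)*f t < y" by (rule E(1))
 qed
 then show ?case unfolding f_def .
 qed
qed

end
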